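(* Let $V$ be a positive integer divisible by $4$ and write $$\frac{V}{4}=2^{a}3^{b}\prod_{i=1}^{x}p_i^{k_i}\prod_{j=1}^{y}q_j^{\ell_j},$$ where $a,b,x,y\ge0$, the $p_i$ are distinct primes congruent to $1\pmod 3$, the $q_j$ are distinct primes greater than $2$ congruent to $2\pmod 3$, and $k_i\ge 0$, $\ell_j\ge0$. Let $\gamma(V)$ be the number of graph isomorphism classes of trihexes with $V$ vertices. Then: (1) If $a=0$ and all $\ell_j$ are even, $$\gamma(V)=\frac{3^{b+1}-1}{12}\prod_{i=1}^{x}\frac{p_i^{k_i+1}-1}{p_i-1}\prod_{j=1}^{y}\frac{q_j^{\ell_j+1}-1}{q_j-1}+\frac13\prod_{i=1}^{x}(k_i+1)+\frac{b+1}{2}\prod_{i=1}^{x}(k_i+1)\prod_{j=1}^{y}(\ell_j+1).$$ (2) If $a>0$, $a$ is even, and all $\ell_j$ are even, $$\gamma(V)=\frac{(2^{a+1}-1)(3^{b+1}-1)}{12}\prod_{i=1}^{x}\frac{p_i^{k_i+1}-1}{p_i-1}\prod_{j=1}^{y}\frac{q_j^{\ell_j+1}-1}{q_j-1}+\frac13\prod_{i=1}^{x}(k_i+1)+\frac{(2a-1)(b+1)}{2}\prod_{i=1}^{x}(k_i+1)\prod_{j=1}^{y}(\ell_j+1).$$ (3) If $a=0$ and some $\ell_j$ is odd, $$\gamma(V)=\frac{3^{b+1}-1}{12}\prod_{i=1}^{x}\frac{p_i^{k_i+1}-1}{p_i-1}\prod_{j=1}^{y}\frac{q_j^{\ell_j+1}-1}{q_j-1}+\frac{b+1}{2}\prod_{i=1}^{x}(k_i+1)\prod_{j=1}^{y}(\ell_j+1).$$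 (4) If $a>0$ and either $a$ is odd or some $\ell_j$ is odd, $$\gamma(V)=\frac{(2^{a+1}-1)(3^{b+1}-1)}{12}\prod_{i=1}^{x}\frac{p_i^{k_i+1}-1}{p_i-1}\prod_{j=1}^{y}\frac{q_j^{\ell_j+1}-1}{q_j-1}+\frac{(2a-1)(b+1)}{2}\prod_{i=1}^{x}(k_i+1)\prod_{j=1}^{y}(\ell_j+1).$$
   Context: A trihex is a 3-regular graph embedded in the plane (equivalently, in the sphere) all of whose faces, including the unbounded one, have exactly 3 or exactly 6 sides. Two trihexes are counted as the same trihex if they are isomorphic via an isomorphism induced by an orientation-preserving homeomorphism of the plane. A graph isomorphism class of trihexes is a class of trihexes that are isomorphic as abstract graphs; thus a chiral trihex and its mirror image lie in the same graph isomorphism class.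
   Formalization: Trihexes are taken to be connected; otherwise two disjoint copies of K4 (whose common face has 3+3=6 sides) would be a second class with V=8 vertices, where the formula gives 1. *)

theory Defs
  imports "HOL-Analysis.Analysis" "HOL-Computational_Algebra.Primes"
begin

text \<open>
  Plane graphs are actual drawings: the vertices are points of the plane and an edge is the
  point set of a simple arc, end points included. Graphs are simple; loops are excluded because
  an arc has two different end points.
\<close>

record plane_drawing =
  verts :: "complex set"
  edges :: "complex set set"

definition joins :: "complex set \<Rightarrow> complex \<Rightarrow> complex \<Rightarrow> bool" where
  "joins e u v \<longleftrightarrow>
     (\<exists>g. arc g \<and> path_image g = e \<and> pathstart g = u \<and> pathfinish g = v)"

definition plane_graph :: "plane_drawing \<Rightarrow> bool" where
  "plane_graph G \<longleftrightarrow>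
     finite (verts G) \<and> finite (edges G) \<and>
     (\<forall>e \<in> edges G. \<exists>u v. joins e u v \<and> e \<inter> verts G = {u, v}) \<and>
     (\<forall>e \<in> edges G. \<forall>f \<in> edges G. e \<noteq> f \<longrightarrow>
        e \<inter> f \<subseteq> verts G \<and> e \<inter> verts G \<noteq> f \<inter> verts G)"

definition adj :: "plane_drawing \<Rightarrow> complex \<Rightarrow> complex \<Rightarrow> bool" where
  "adj G u v \<longleftrightarrow> (\<exists>e \<in> edges G. e \<inter> verts G = {u, v})"

definition vertex_degree :: "plane_drawing \<Rightarrow> complex \<Rightarrow> nat" where
  "vertex_degree G v = card {e \<in> edges G. v \<in> e}"

definition connected_graph :: "plane_drawing \<Rightarrow> bool" where
  "connected_graph G \<longleftrightarrow> (\<forall>u \<in> verts G. \<forall>v \<in> verts G. (adj G)\<^sup>*\<^sup>* u v)"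

definition faces :: "plane_drawing \<Rightarrow> complex set set" where
  "faces G = components (- (verts G \<union> \<Union> (edges G)))"

text \<open>
  A side of a face is an edge on its boundary; an edge that has the same face on both sides
  (a bridge) contributes two sides to that face.
\<close>

definition sides :: "plane_drawing \<Rightarrow> complex set \<Rightarrow> nat" where
  "sides G F =
     (\<Sum>e \<in> {e \<in> edges G. e \<subseteq> frontier F}.
        if \<exists>F' \<in> faces G. F' \<noteq> F \<and> e \<subseteq> frontier F' then 1 else 2)"

definition trihex :: "plane_drawing \<Rightarrow> bool" where
  "trihex G \<longleftrightarrow>
     plane_graph G \<and> connected_graph G \<and>
     (\<forall>v \<in> verts G. vertex_degree G v = 3) \<and>
     (\<forall>F \<in> faces G. sides G F = 3 \<or> sides G F = 6)"

definition graph_iso :: "plane_drawing \<Rightarrow> plane_drawing \<Rightarrow> bool" where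
  "graph_iso G H \<longleftrightarrow>
     (\<exists>\<phi>. bij_betw \<phi> (verts G) (verts H) \<and>
          (\<forall>u \<in> verts G. \<forall>v \<in> verts G. adj G u v \<longleftrightarrow> adj H (\<phi> u) (\<phi> v)))"

definition trihexes :: "nat \<Rightarrow> plane_drawing set" where
  "trihexes n = {G. trihex G \<and> card (verts G) = n}"

definition trihex_gamma :: "nat \<Rightarrow> nat" where
  "trihex_gamma n =
     card (trihexes n // {(G, H). G \<in> trihexes n \<and> H \<in> trihexes n \<and> graph_iso G H})"

end

theory Submission
  imports Defs "HOL-Number_Theory.Residue_Primitive_Roots"
begin

text \<open>
  Since all faces have 3 or 6 sides, the flags of a trihex carry an action of the symmetry group of the
  honeycomb, whose relations say that 3 corners surround a vertex and that six steps lead around a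
  face. By Euler's formula there are at least 24 flags of triangles, each fixed by a half-turn about
  its face; this forces all vertex labels to be \<open>\<int>\<^sup>2\<close> modulo \<open>2L\<close>, where \<open>L\<close> is a sublattice of
  index \<open>n = V / 4\<close> consisting of the centres of half-turns. Conversely every such \<open>L\<close> is
  realised by drawing the honeycomb on the sphere that is the quotient of the plane by \<open>2L\<close>
  and these half-turns. The abstract graph determines \<open>L\<close> up to the linear symmetries of
  the honeycomb; modulo \<open>-1\<close>, which preserves every lattice, these form a group of order 6.
  Burnside's lemma expresses the number of orbits by the number of all sublattices of index \<open>n\<close>, of
  those invariant under a rotation of order 3 and of those invariant under a reflection. In Hermite
  normal form the last two are counted by the roots of \<open>r\<^sup>2 + r + 1\<close> and \<open>r\<^sup>2 - 1\<close> modulo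
  \<open>n / d\<^sup>2\<close>, and all three counts are multiplicative in \<open>n\<close>.
\<close>

section \<open>Arcs and components\<close>

text \<open>The classification is tight at one point: a lattice has at most 4 classes modulo its
  double and a triangle has 6 flags, so half-turns about faces fix at most 24 flags, exactly as many
  as Euler's formula guarantees. Bridges, which count as two sides of one face, must be excluded
  before flags make sense. An isomorphism of abstract graphs need not map faces to faces. It is
  controlled by colouring each edge with its direction (1,0), (0,1) or (1,1), the three nonzero
  classes modulo 2. Three consecutive edges of a hexagon keep distinct colours unless the target
  lattice contains a unit vector. In that exceptional case the lattice is, up to symmetry, generated
  by (1,0) and (0,D), hence determined by the number of vertices. In the realisation the half-turns
  exchange the two kinds of honeycomb vertices, so one set of labels names all vertices. The point
  at infinity is the centre of a triangle.\<close>

lemma joins_facts: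
  assumes "joins e u v"
  shows "compact e" "closed e" "connected e" "path_connected e" "u \<in> e" "v \<in> e" "u \<noteq> v"
    "connected (e - {u, v})" "e - {u, v} \<noteq> {}" "e \<subseteq> closure (e - {u, v})" "connected (- e)"
proof -
  obtain g where g: "arc g" "path_image g = e" "pathstart g = u" "pathfinish g = v"
    using assms by (auto simp: joins_def)
  have s: "simple_path g" using g(1) by (simp add: arc_imp_simple_path)
  show "compact e" "closed e" "connected e" "connected (- e)"
    using g compact_arc_image closed_arc_image connected_arc_image connected_arc_complement[of g] by auto
  show "path_connected e" using g arc_imp_path path_connected_path_image by blast
  show "u \<in> e" "v \<in> e" using g by auto
  show "u \<noteq> v" using g arc_distinct_ends by blast
  show "connected (e - {u, v})" "e - {u, v} \<noteq> {}"
    using connected_simple_path_endless[OF s] nonempty_simple_path_endless[OF s] g by auto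
  have e: "e - {u, v} = g ` {0<..<1}" using simple_path_endless[OF s] g by simp
  have "g ` closure {0<..<1::real} \<subseteq> closure (g ` {0<..<1})"
    by (rule image_closure_subset) (use g in \<open>auto simp: arc_def path_def closure_subset intro: continuous_on_subset\<close>)
  then show "e \<subseteq> closure (e - {u, v})"
    unfolding e using g(2) by (simp add: path_image_def)
qed

text \<open>A nonempty open part of the arc would embed into the real line by the inverse of the
  parametrisation, against invariance of dimension.\<close>

lemma interior_joins:
  assumes "joins e u v"
  shows "interior e = {}"
proof (rule ccontr)
  assume ne: "interior e \<noteq> {}"
  obtain g where g: "arc g" "path_image g = e"
    using assms by (auto simp: joins_def)
  obtain h where h: "homeomorphism {0..1} e g h"
    using homeomorphism_arc[OF g(1)] g(2) by metis
  have "continuous_on (interior e) h" "inj_on h (interior e)"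
    using h interior_subset[of e] unfolding homeomorphism_def
    by (blast intro: continuous_on_subset, metis (no_types, lifting) image_iff inj_onI subsetD)
  then show False using invariance_of_dimension[of "interior e" h] ne by simp
qed

lemma joins_sym: "joins e u v \<Longrightarrow> joins e v u"
  unfolding joins_def by (metis arc_reversepath path_image_reversepath pathfinish_reversepath pathstart_reversepath)

lemma joins_Un:
  assumes "joins e u v" "joins f v w" "e \<inter> f = {v}"
  shows "joins (e \<union> f) u w"
proof -
  obtain g where g: "arc g" "path_image g = e" "pathstart g = u" "pathfinish g = v"
    using assms by (auto simp: joins_def)
  obtain h where h: "arc h" "path_image h = f" "pathstart h = v" "pathfinish h = w"
    using assms by (auto simp: joins_def)
  show ?thesis unfolding joins_def
    by (rule exI[of _ "g +++ h"]) (use g h assms in \<open>auto intro!: arc_join simp: path_image_join\<close>)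
qed

text \<open>A criterion by pairs of points, the form in which Janiszewski's theorem supplies
  information.\<close>

lemma components_piece:
  assumes "X \<noteq> {}" "\<And>a b. a \<in> X \<Longrightarrow> b \<in> X \<Longrightarrow> connected_component S a b"
    "\<And>a b. a \<in> X \<Longrightarrow> connected_component S a b \<Longrightarrow> b \<in> X"
  shows "X \<in> components S"
proof -
  obtain a where a: "a \<in> X" using assms by auto
  have "X = connected_component_set S a" using assms a by blast
  moreover have "a \<in> S" using assms(2)[OF a a] by (simp add: connected_component_refl_eq)
  ultimately show ?thesis unfolding components_def by auto
qed

lemma same_component_iff:
  assumes "C \<in> components S" "a \<in> C"
  shows "connected_component S a b \<longleftrightarrow> b \<in> C"
  using assms by (metis componentsE connected_component_eq mem_Collect_eq)

text \<open>A component other than \<open>U\<close> avoids \<open>Z\<close>, so it stays connected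
  and maximal in the smaller set; everything new comes from \<open>U\<close>.\<close>

lemma components_Diff_eq:
  assumes U: "U \<in> components S" and Z: "Z \<inter> S \<subseteq> U" "P \<subseteq> components (S - Z)" "\<Union>P = U - Z"
  shows "components (S - Z) = components S - {U} \<union> P"
proof (intro equalityI subsetI)
  fix C assume C: "C \<in> components (S - Z)"
  show "C \<in> components S - {U} \<union> P"
  proof (cases "C \<inter> U = {}")
    case True
    obtain x where x: "x \<in> C" using C in_components_nonempty by blast
    then have xS: "x \<in> S" using C in_components_subset by blast
    define D where "D = connected_component_set S x"
    have D: "D \<in> components S" using xS by (simp add: D_def componentsI)
    have CD: "C \<subseteq> D" using components_maximal[OF D, of C] C x in_components_connected in_components_subset D_def
      by (metis Diff_subset IntI connected_component_refl_eq dual_order.trans empty_iff mem_Collect_eq xS)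
    have "D \<noteq> U" using True CD x by blast
    then have "D \<inter> U = {}" using D U components_nonoverlap by blast
    moreover have "D \<subseteq> S" using D in_components_subset by blast
    ultimately have "D \<subseteq> S - Z" using Z(1) by blast
    then have "D \<subseteq> C" using components_maximal[OF C, of D] D in_components_connected CD x by blast
    then show ?thesis using CD D \<open>D \<noteq> U\<close> by auto
  next
    case False
    then obtain x where x: "x \<in> C" "x \<in> U" by auto
    then have "x \<in> \<Union>P" using C Z in_components_subset by fastforce
    then obtain X where X: "X \<in> P" "x \<in> X" by blast
    then have "X = C" using x C Z components_eq by blast
    then show ?thesis using X by auto
  qed
next
  fix C assume "C \<in> components S - {U} \<union> P"
  then show "C \<in> components (S - Z)"
  proof
    assume C: "C \<in> components S - {U}"
    then have "C \<inter> U = {}" using U components_nonoverlap by blast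
    moreover have "C \<subseteq> S" using C in_components_subset by blast
    ultimately have "C \<subseteq> S - Z" using Z(1) by blast
    then show ?thesis using components_intermediate_subset C by blast
  qed (use Z in auto)
qed

lemma frontierI_arc:
  assumes e: "joins e u v" and "X \<inter> e = {}" "e - {u, v} \<subseteq> closure X"
  shows "e \<subseteq> frontier X"
proof -
  have "e \<subseteq> closure X"
    using joins_facts(10)[OF e] assms(3) by (meson closed_closure closure_minimal subset_trans)
  then show ?thesis using assms(2) interior_subset[of X] by (auto simp: frontier_def)
qed

text \<open>Janiszewski's theorem, applied to the continuum and a Jordan curve through the new arc,
  shows that two points on the same side of that curve are not separated.\<close>
lemma arc_splits_component:
  assumes K: "compact K" "path_connected K" and e: "joins e u v" "e \<inter> K = {u, v}"
  obtains U X Y where "U \<in> components (- K)" "e - {u, v} \<subseteq> U" "X \<noteq> Y" "X \<inter> Y = {}" "X \<union> Y = U - e"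
    "components (- (K \<union> e)) = components (- K) - {U} \<union> {X, Y}" "e \<subseteq> frontier X" "e \<subseteq> frontier Y"
proof -
  note f = joins_facts[OF e(1)]
  have uv: "u \<in> K" "v \<in> K" using e by auto
  obtain g where g: "arc g" "path_image g = e" "pathstart g = u" "pathfinish g = v"
    using e by (auto simp: joins_def)
  \<comment> \<open>The new arc is closed up inside \<open>K\<close>. The resulting Jordan curve
    \<open>C\<close> meets \<open>K\<close> in the connected set \<open>path_image h\<close>, as
    Janiszewski's theorem requires.\<close>
  obtain h where h: "arc h" "path_image h \<subseteq> K" "pathstart h = v" "pathfinish h = u"
    using K(2) uv f(7) unfolding path_connected_arcwise by metis
  define C where "C = path_image (g +++ h)"
  have Ceq: "C = e \<union> path_image h" using g h by (simp add: C_def path_image_join)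
  have sp: "simple_path (g +++ h)"
    by (rule simple_path_join_loop) (use g h e in auto)
  have lp: "pathfinish (g +++ h) = pathstart (g +++ h)" using g h by simp
  obtain P Q where PQ: "P \<noteq> {}" "open P" "connected P" "Q \<noteq> {}" "open Q" "connected Q"
    "P \<inter> Q = {}" "P \<union> Q = - C" "frontier P = C" "frontier Q = C"
    using Jordan_curve[OF sp lp] unfolding C_def by metis
  have closedC: "closed C" unfolding C_def using sp by (simp add: closed_simple_path_image)
  have oK: "open (- K)" using K by (simp add: compact_imp_closed open_Compl)
  obtain z where z: "z \<in> e - {u,v}" using f(9) by blast
  define U where "U = connected_component_set (- K) z"
  have zK: "z \<in> - K" using z e by auto
  have U: "U \<in> components (- K)" using zK by (simp add: U_def componentsI)
  have eU: "e - {u,v} \<subseteq> U" unfolding U_def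
    by (rule connected_component_maximal) (use z f e in auto)
  have oU: "open U" using oK U open_components by blast
  have Cint: "K \<inter> C = path_image h"
  proof -
    have "u \<in> path_image h" "v \<in> path_image h" using h by auto
    moreover have "K \<inter> C = (e \<inter> K) \<union> path_image h" unfolding Ceq using h(2) by blast
    ultimately show ?thesis unfolding e(2) by (simp add: insert_absorb)
  qed
  have KC: "K \<union> C = K \<union> e" using Ceq h by auto
  have main: "connected_component (- (K \<union> e)) a b \<longleftrightarrow> b \<in> U \<inter> J"
    if J: "J = P \<or> J = Q" and a: "a \<in> U \<inter> J" for J a b
  proof
    assume ab: "connected_component (- (K \<union> e)) a b"
    have "- (K \<union> e) \<subseteq> - K" "- (K \<union> e) \<subseteq> - C" using KC by blast+
    then have "connected_component (- K) a b" "connected_component (- C) a b"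
      using connected_component_of_subset[OF ab] by blast+
    moreover have "J \<in> components (- C)"
    proof (rule components_piece)
      show "J \<noteq> {}" using J PQ by auto
      have cJ: "connected J" "J \<subseteq> - C" using J PQ(3,6,8) by auto
      show "connected_component (- C) a b" if "a \<in> J" "b \<in> J" for a b
        using cJ that unfolding connected_component_def by blast
      fix a b assume "a \<in> J" "connected_component (- C) a b"
      then obtain T where T: "connected T" "T \<subseteq> P \<union> Q" "a \<in> T" "b \<in> T" "a \<in> J"
        using PQ(8) by (auto simp: connected_component_def)
      show "b \<in> J"
      proof (rule ccontr)
        assume "b \<notin> J"
        then have "P \<inter> T \<noteq> {} \<and> Q \<inter> T \<noteq> {}" using T J by auto
        then show False using T(1,2) PQ(2,5,7) connectedD[of T P Q] by blast
      qed
    qed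
    ultimately show "b \<in> U \<inter> J"
      using a same_component_iff[OF U, of a b] same_component_iff[of J "- C" a b] by blast
  next
    assume b: "b \<in> U \<inter> J"
    have "connected_component (- K) a b" using same_component_iff[OF U] a b by auto
    moreover have "connected_component (- C) a b" unfolding connected_component_def
      by (rule exI[of _ J]) (use J PQ(3,6,8) a b in auto)
    ultimately have "connected_component (- (K \<union> C)) a b"
      using Janiszewski[OF K(1) closedC] Cint connected_arc_image[OF h(1)] by simp
    then show "connected_component (- (K \<union> e)) a b" using KC by simp
  qed
  have cl: "e - {u, v} \<subseteq> closure (U \<inter> J)" if J: "J = P \<or> J = Q" for J
  proof
    fix y assume y: "y \<in> e - {u,v}"
    have "y \<in> U" using y eU by auto
    moreover have "y \<in> closure J" using J PQ(9,10) y Ceq unfolding frontier_def by blast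
    ultimately show "y \<in> closure (U \<inter> J)" using oU open_Int_closure_subset[of U J] by blast
  qed
  have ne: "U \<inter> J \<noteq> {}" if "J = P \<or> J = Q" for J using cl[OF that] z by (metis closure_empty empty_iff subsetD)
  have comp: "U \<inter> J \<in> components (- (K \<union> e))" if "J = P \<or> J = Q" for J
    by (rule components_piece) (use ne[OF that] main[OF that] in auto)
  have UPQ: "(U \<inter> P) \<union> (U \<inter> Q) = U - e"
  proof -
    have "U \<inter> C \<subseteq> e" using Ceq h U in_components_subset by blast
    then show ?thesis using PQ(8) Ceq by blast
  qed
  have cs: "components (- K - e) = components (- K) - {U} \<union> {U \<inter> P, U \<inter> Q}"
  proof (rule components_Diff_eq[OF U])
    show "e \<inter> - K \<subseteq> U" using e(2) eU by blast
    show "{U \<inter> P, U \<inter> Q} \<subseteq> components (- K - e)" using comp[of P] comp[of Q] by (simp add: Diff_eq)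
    show "\<Union>{U \<inter> P, U \<inter> Q} = U - e" using UPQ by simp
  qed
  have fr: "e \<subseteq> frontier (U \<inter> J)" if "J = P \<or> J = Q" for J
    by (rule frontierI_arc[OF e(1) _ cl[OF that]]) (use PQ(8) Ceq that in blast)
  show ?thesis
  proof (rule that[of U "U \<inter> P" "U \<inter> Q"])
    show "U \<inter> P \<noteq> U \<inter> Q" using ne[of P] PQ(7) by auto
    show "components (- (K \<union> e)) = components (- K) - {U} \<union> {U \<inter> P, U \<inter> Q}"
      using cs by (simp add: Diff_eq)
    show "U \<inter> P \<inter> (U \<inter> Q) = {}" using PQ(7) by auto
  qed (use U eU UPQ fr in simp_all)
qed

text \<open>\<open>K\<close> and the arc meet in one point, and neither of them separates two points
  of \<open>U - e\<close>; by Janiszewski's theorem their union does not either. The face is only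
  slit.\<close>

lemma pendant_arc_component:
  assumes K: "compact K" and e: "joins e u v" "e \<inter> K = {u}"
  obtains U where "U \<in> components (- K)" "e - {u} \<subseteq> U"
    "components (- (K \<union> e)) = components (- K) - {U} \<union> {U - e}" "e - {u} \<subseteq> closure (U - e)"
proof -
  note f = joins_facts[OF e(1)]
  have oK: "open (- K)" using K by (simp add: compact_imp_closed open_Compl)
  have vK: "v \<in> - K" using f(6,7) e(2) by (metis ComplI IntI singletonD)
  define U where "U = connected_component_set (- K) v"
  have U: "U \<in> components (- K)" using vK by (simp add: U_def componentsI)
  have conn: "connected (e - {u})"
    by (rule connected_intermediate_closure[OF f(8)]) (use f(10) in blast)+
  have eU: "e - {u} \<subseteq> U" unfolding U_def
  proof (rule connected_component_maximal[OF _ conn])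
    show "v \<in> e - {u}" using f(6,7) by auto
    show "e - {u} \<subseteq> - K" using e(2) by blast
  qed
  have oU: "open U" using oK U open_components by blast
  have int: "interior e = {}" by (rule interior_joins[OF e(1)])
  have cl: "U \<subseteq> closure (U - e)"
  proof
    fix x assume x: "x \<in> U"
    have "x \<in> closure (- e)" using int by (simp add: closure_complement)
    then have "x \<in> closure (U \<inter> - e)" using oU x open_Int_closure_subset[of U "- e"] by blast
    then show "x \<in> closure (U - e)" by (simp add: Diff_eq)
  qed
  have comp: "U - e \<in> components (- K - e)"
  proof (rule components_piece)
    show "U - e \<noteq> {}" using cl in_components_nonempty[OF U] closure_empty by (metis subset_empty)
    fix a b assume a: "a \<in> U - e"
    show "connected_component (- K - e) a b \<Longrightarrow> b \<in> U - e"
      using a same_component_iff[OF U, of a b] connected_component_of_subset[of "- K - e" a b "- K"]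
        connected_component_in[of "- K - e" a b] by auto
    assume b: "b \<in> U - e"
    have "connected_component (- K) a b" using same_component_iff[OF U] a b by auto
    moreover have "connected_component (- e) a b" using f(11) a b by (metis ComplI DiffD2 connected_iff_connected_component)
    moreover have "connected (K \<inter> e)" using e(2) by (simp add: Int_commute)
    ultimately have "connected_component (- (K \<union> e)) a b"
      using Janiszewski[OF K f(2)] by simp
    then show "connected_component (- K - e) a b" by (simp add: Diff_eq)
  qed
  have "components (- K - e) = components (- K) - {U} \<union> {U - e}"
  proof (rule components_Diff_eq[OF U])
    show "e \<inter> - K \<subseteq> U" using e(2) eU by blast
  qed (use comp in auto)
  then have "components (- (K \<union> e)) = components (- K) - {U} \<union> {U - e}" by (simp add: Diff_eq)
  moreover have "e - {u} \<subseteq> closure (U - e)" using cl eU by blast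
  ultimately show ?thesis using that[OF U eU] by blast
qed

section \<open>Plane graphs and the Euler formula\<close>

text \<open>The pieces that contain points reachable by a path from \<open>x\<close> and the
  remaining pieces form two disjoint closed sets, and a connected union does not split in this
  way.\<close>

lemma path_connected_finite_Union:
  fixes F :: "'a::real_normed_vector set set"
  assumes fin: "finite F" and F: "\<And>T. T \<in> F \<Longrightarrow> closed T \<and> path_connected T" and conn: "connected (\<Union>F)"
  shows "path_connected (\<Union>F)"
  unfolding path_connected_component
proof (intro ballI)
  fix x y assume x: "x \<in> \<Union>F" and y: "y \<in> \<Union>F"
  define P where "P = {z. path_component (\<Union>F) x z}"
  have sub: "T \<subseteq> P" if "T \<in> F" "z \<in> T" "z \<in> P" for T z
  proof
    fix t assume t: "t \<in> T"
    have "path_component T z t" using F[OF that(1)] that(2) t by (auto simp: path_connected_component)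
    then have "path_component (\<Union>F) z t" using path_component_of_subset that(1) by (metis Union_upper)
    then show "t \<in> P" using that(3) path_component_trans unfolding P_def by blast
  qed
  define P' where "P' = \<Union>{T \<in> F. T \<inter> P \<noteq> {}}"
  define N where "N = \<Union>{T \<in> F. T \<inter> P = {}}"
  have cl: "closed P'" "closed N" unfolding P'_def N_def using fin F by (auto intro!: closed_Union)
  have "P' \<subseteq> P" unfolding P'_def using sub by blast
  have dis: "P' \<inter> N = {}" using \<open>P' \<subseteq> P\<close> unfolding N_def by blast
  have un: "P' \<union> N = \<Union>F" unfolding P'_def N_def by blast
  have "x \<in> P" unfolding P_def using x by (simp add: path_component_refl)
  then have xP: "x \<in> P'" using x unfolding P'_def by blast
  have "N = {}"
  proof (rule ccontr)
    assume "N \<noteq> {}"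
    then show False using conn[unfolded connected_closed] cl dis un xP by (metis Int_Un_distrib2 IntI
        Un_Int_eq(1) Un_Int_eq(2) empty_iff inf_bot_right inf_commute order_refl)
  qed
  then show "path_component (\<Union>F) x y" using un y \<open>P' \<subseteq> P\<close> unfolding P_def by blast
qed

text \<open>Intersect the component around the arc outside \<open>A \<union> e\<close> with the one
  outside \<open>B\<close>. As \<open>A \<union> e\<close> and \<open>B\<close> meet only in
  \<open>v\<close>, Janiszewski's theorem makes this intersection a single component, which
  therefore lies on both sides of the arc.\<close>

lemma bridge_component:
  assumes A: "compact A" and B: "compact B" "connected B" and e: "joins e u v" "e \<inter> A = {u}" "e \<inter> B = {v}"
    and AB: "A \<inter> B = {}"
  obtains F where "F \<in> components (- (A \<union> e \<union> B))" "e \<subseteq> frontier F"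
    "\<And>F'. F' \<in> components (- (A \<union> e \<union> B)) \<Longrightarrow> F' \<noteq> F \<Longrightarrow> closure F' \<inter> (e - {u, v}) = {}"
proof -
  note f = joins_facts[OF e(1)]
  obtain UA where UA: "UA \<in> components (- A)" "e - {u} \<subseteq> UA"
    "components (- (A \<union> e)) = components (- A) - {UA} \<union> {UA - e}" "e - {u} \<subseteq> closure (UA - e)"
    using pendant_arc_component[OF A e(1,2)] by metis
  obtain UB where UB: "UB \<in> components (- B)" "e - {v} \<subseteq> UB"
    using pendant_arc_component[OF B(1) joins_sym[OF e(1)] e(3)] by metis
  have oA: "open UA" using UA(1) A by (metis compact_imp_closed open_Compl open_components)
  have oB: "open UB" using UB(1) B by (metis compact_imp_closed open_Compl open_components)
  have cAe: "compact (A \<union> e)" using A f(1) by (rule compact_Un)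
  have UAe: "UA - e \<in> components (- (A \<union> e))" using UA(3) by simp
  have int: "(A \<union> e) \<inter> B = {v}" using AB e(3) by blast
  let ?F = "(UA - e) \<inter> UB"
  have cl: "e - {u, v} \<subseteq> closure ?F"
  proof
    fix y assume y: "y \<in> e - {u, v}"
    then have "y \<in> UB \<inter> closure (UA - e)" using UB(2) UA(4) by auto
    then show "y \<in> closure ?F" using open_Int_closure_subset[OF oB, of "UA - e"] by (auto simp: Int_commute)
  qed
  have comp: "?F \<in> components (- (A \<union> e \<union> B))"
  proof (rule components_piece)
    show "?F \<noteq> {}" using cl f(9) closure_empty by (metis subset_empty)
    fix a b assume a: "a \<in> ?F"
    {
      assume b: "b \<in> ?F"
      have "connected_component (- (A \<union> e)) a b" using same_component_iff[OF UAe] a b by blast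
      moreover have "connected_component (- B) a b" using same_component_iff[OF UB(1)] a b by blast
      moreover have "connected ((A \<union> e) \<inter> B)" by (simp add: int)
      ultimately show "connected_component (- (A \<union> e \<union> B)) a b"
        using Janiszewski[OF cAe compact_imp_closed[OF B(1)]] by blast
    }
    assume ab: "connected_component (- (A \<union> e \<union> B)) a b"
    have "connected_component (- (A \<union> e)) a b" "connected_component (- B) a b"
      by (rule connected_component_of_subset[OF ab]; blast)+
    then show "b \<in> ?F" using same_component_iff[OF UAe, of a b] same_component_iff[OF UB(1), of a b] a by blast
  qed
  show ?thesis
  proof (rule that[OF comp])
    show "e \<subseteq> frontier ?F" by (rule frontierI_arc[OF e(1) _ cl]) blast
    fix F' assume F': "F' \<in> components (- (A \<union> e \<union> B))" "F' \<noteq> ?F"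
    have dis: "F' \<inter> ?F = {}" using F' comp components_nonoverlap by blast
    have "F' \<subseteq> - e" using in_components_subset[OF F'(1)] by blast
    then have "UA \<inter> UB \<inter> F' = {}" using dis by blast
    then have "UA \<inter> UB \<inter> closure F' = {}"
      using open_Int_closure_eq_empty[of "UA \<inter> UB" F'] oA oB by blast
    moreover have "e - {u, v} \<subseteq> UA \<inter> UB" using UA(2) UB(2) by blast
    ultimately show "closure F' \<inter> (e - {u, v}) = {}" by blast
  qed
qed

lemma component_avoids_arc:
  fixes S :: "complex set"
  assumes "open S" "U \<in> components S" "F \<in> components S" "F \<noteq> U" "e \<subseteq> U"
  shows "closure F \<inter> e = {}"
proof -
  have "U \<inter> F = {}" using components_nonoverlap[OF assms(2,3)] assms(4) by blast
  moreover have "open U" using open_components[OF assms(1,2)] .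
  ultimately have "U \<inter> closure F = {}" using open_Int_closure_eq_empty[of U F] by blast
  then show ?thesis using assms(5) by blast
qed

definition pts :: "complex set \<Rightarrow> complex set set \<Rightarrow> complex set" where
  "pts W A = W \<union> \<Union>A"

locale plane_gr =
  fixes G :: plane_drawing
  assumes pg: "plane_graph G"
begin

abbreviation "V \<equiv> verts G"
abbreviation "E \<equiv> edges G"

lemma fin: "finite V" "finite E" using pg by (auto simp: plane_graph_def)

lemma edge_ends: "e \<in> E \<Longrightarrow> \<exists>u v. joins e u v \<and> e \<inter> V = {u, v}"
  using pg by (auto simp: plane_graph_def)

lemma edge_endsE:
  assumes "e \<in> E"
  obtains u v where "joins e u v" "e \<inter> V = {u, v}" "u \<in> e" "v \<in> e" "u \<in> V" "v \<in> V" "u \<noteq> v"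
    "\<forall>x\<in>e. x \<in> V \<longrightarrow> x = u \<or> x = v"
proof -
  obtain u v where uv: "joins e u v" "e \<inter> V = {u, v}" using edge_ends[OF assms] by blast
  have "u \<in> e \<inter> V" "v \<in> e \<inter> V" unfolding uv(2) by auto
  moreover have "x = u \<or> x = v" if "x \<in> e" "x \<in> V" for x
  proof -
    have "x \<in> e \<inter> V" using that by simp
    then show ?thesis unfolding uv(2) by simp
  qed
  ultimately show ?thesis using that[OF uv] joins_facts(7)[OF uv(1)] by blast
qed

lemma edges_Int: "e \<in> E \<Longrightarrow> f \<in> E \<Longrightarrow> e \<noteq> f \<Longrightarrow> e \<inter> f \<subseteq> V"
  using pg unfolding plane_graph_def by blast

lemma edges_eqI: "e \<in> E \<Longrightarrow> f \<in> E \<Longrightarrow> e \<inter> V = f \<inter> V \<Longrightarrow> e = f"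
  using pg unfolding plane_graph_def by blast

lemma edge_facts:
  assumes "e \<in> E"
  shows "compact e" "closed e" "connected e" "path_connected e" "e \<noteq> {}" "e - V \<noteq> {}" "connected (e - V)"
    "e \<subseteq> closure (e - V)"
proof -
  obtain u v where uv: "joins e u v" "e \<inter> V = {u, v}" using edge_ends[OF assms] by blast
  have "e - V = e - {u, v}" using uv(2) by blast
  then show "compact e" "closed e" "connected e" "path_connected e" "e \<noteq> {}" "e - V \<noteq> {}" "connected (e - V)"
    "e \<subseteq> closure (e - V)" using joins_facts[OF uv(1)] by auto
qed

definition sub :: "complex set \<Rightarrow> complex set set \<Rightarrow> bool" where
  "sub W A \<longleftrightarrow> W \<subseteq> V \<and> A \<subseteq> E \<and> (\<forall>e\<in>A. e \<inter> V \<subseteq> W)"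

lemma sub_fin: "sub W A \<Longrightarrow> finite W \<and> finite A"
  unfolding sub_def by (meson fin finite_subset)

lemma sub_compact: "sub W A \<Longrightarrow> compact (pts W A)"
  using sub_fin[of W A] edge_facts(1) unfolding pts_def sub_def
  by (meson compact_Un compact_Union finite_imp_compact subsetD)

lemma sub_path_connected:
  assumes "sub W A" "connected (pts W A)"
  shows "path_connected (pts W A)"
proof -
  have eq: "pts W A = \<Union>((\<lambda>w. {w}) ` W \<union> A)" by (auto simp: pts_def)
  show ?thesis unfolding eq
    by (rule path_connected_finite_Union)
      (use assms sub_fin[OF assms(1)] eq edge_facts(2,4) in \<open>auto simp: sub_def\<close>)
qed

lemma sub_edge_Int:
  assumes "sub W A" "e \<in> E" "e \<notin> A"
  shows "e \<inter> pts W A = e \<inter> W"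
proof -
  have "e \<inter> f \<subseteq> W" if "f \<in> A" for f
    using edges_Int[of e f] that assms unfolding sub_def by blast
  then show ?thesis unfolding pts_def by blast
qed

lemma sub_V_Int: "sub W A \<Longrightarrow> V \<inter> pts W A = W"
  unfolding sub_def pts_def by blast

lemma sub_all: "sub V E" unfolding sub_def by blast

text \<open>The inequality bounds the number of faces from below, the direction from which triangles
  are counted.\<close>

definition euler_inv :: "complex set \<Rightarrow> complex set set \<Rightarrow> bool" where
  "euler_inv W A \<longleftrightarrow> sub W A \<and> connected (pts W A) \<and> finite (components (- pts W A)) \<and>
     card A + 2 \<le> card (components (- pts W A)) + card W"

text \<open>An edge with both ends in the subgraph splits a face in two; an edge with a new end adds
  one vertex and keeps the number of faces.\<close>

lemma euler_step:
  assumes inv: "euler_inv W A" and e: "e \<in> E" "e \<notin> A" "e \<inter> W \<noteq> {}"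
  shows "euler_inv (W \<union> (e \<inter> V)) (insert e A)"
proof -
  let ?K = "pts W A" and ?W = "W \<union> (e \<inter> V)"
  have s: "sub W A" and c: "connected ?K" and fc: "finite (components (- ?K))"
    and ca: "card A + 2 \<le> card (components (- ?K)) + card W"
    using inv unfolding euler_inv_def by auto
  have K: "compact ?K" using sub_compact[OF s] .
  have pK: "path_connected ?K" using sub_path_connected[OF s c] .
  have WV: "W \<subseteq> V" using s unfolding sub_def by blast
  obtain u v where uv: "joins e u v" "e \<inter> V = {u, v}" "u \<in> W" "u \<in> e" "v \<in> e" "v \<in> V"
    "\<forall>x\<in>e. x \<in> V \<longrightarrow> x = u \<or> x = v"
  proof -
    obtain u v where uv: "joins e u v" "e \<inter> V = {u, v}" "u \<in> e" "v \<in> e" "u \<in> V" "v \<in> V" "u \<noteq> v"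
      "\<forall>x\<in>e. x \<in> V \<longrightarrow> x = u \<or> x = v" by (rule edge_endsE[OF e(1)]) (rule that)
    obtain w where w: "w \<in> e" "w \<in> W" using e(3) by blast
    then have "w = u \<or> w = v" using uv(8) WV by blast
    then show ?thesis
    proof
      assume "w = u" then show ?thesis using that[OF uv(1,2) _ uv(3,4,6,8)] w by simp
    next
      assume "w = v"
      moreover have "e \<inter> V = {v, u}" using uv(2) by (simp add: insert_commute)
      moreover have "\<forall>x\<in>e. x \<in> V \<longrightarrow> x = v \<or> x = u" using uv(8) by blast
      ultimately show ?thesis using that[OF joins_sym[OF uv(1)] _ _ uv(4,3,5)] w by simp
    qed
  qed
  have s': "sub ?W (insert e A)" using s e(1) unfolding sub_def by blast
  have K': "pts ?W (insert e A) = ?K \<union> e" unfolding pts_def by blast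
  have i: "e \<inter> ?K = e \<inter> W" using sub_edge_Int[OF s e(1,2)] .
  have c': "connected (?K \<union> e)"
    by (rule connected_Un[OF c edge_facts(3)[OF e(1)]]) (use i e(3) in blast)
  have cA: "card (insert e A) = card A + 1" using e(2) sub_fin[OF s] by simp
  show ?thesis
  proof (cases "v \<in> W")
    case True
    have "e \<inter> W = {u, v}"
    proof (intro equalityI subsetI)
      fix x assume "x \<in> e \<inter> W" then show "x \<in> {u, v}" using uv(7) WV by blast
    qed (use uv True in blast)
    then have i2: "e \<inter> ?K = {u, v}" using i by simp
    obtain U X Y where r: "U \<in> components (- ?K)" "X \<noteq> Y" "X \<inter> Y = {}" "X \<union> Y = U - e"
      "components (- (?K \<union> e)) = components (- ?K) - {U} \<union> {X, Y}"
      using arc_splits_component[OF K pK uv(1) i2] by metis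
    have sub: "C = U" if "C \<in> components (- ?K)" "C \<in> {X, Y}" for C
    proof -
      have "C \<subseteq> U" using that(2) r(4) by blast
      then show ?thesis using in_components_nonempty[OF that(1)] components_nonoverlap[OF that(1) r(1)] by blast
    qed
    have "card (components (- (?K \<union> e))) = card (components (- ?K) - {U}) + card {X, Y}"
      unfolding r(5) by (rule card_Un_disjoint) (use fc sub in auto)
    also have "\<dots> = card (components (- ?K)) + 1"
      using r(1,2) fc by (simp add: card_gt_0_iff) (metis Suc_pred card_gt_0_iff empty_iff)
    finally have cc: "card (components (- (?K \<union> e))) = card (components (- ?K)) + 1" .
    have "?W = W" unfolding uv(2) using uv(3) True by blast
    moreover have "finite (components (- (?K \<union> e)))" using r(5) fc by simp
    ultimately show ?thesis unfolding euler_inv_def K' using s' c' cc ca cA by simp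
  next
    case False
    have "e \<inter> W = {u}"
    proof (intro equalityI subsetI)
      fix x assume "x \<in> e \<inter> W" then show "x \<in> {u}" using uv(7) WV False by blast
    qed (use uv in blast)
    then have i2: "e \<inter> ?K = {u}" using i by simp
    obtain U where r: "U \<in> components (- ?K)" "components (- (?K \<union> e)) = components (- ?K) - {U} \<union> {U - e}"
      using pendant_arc_component[OF K uv(1) i2] by metis
    have fin': "finite (components (- (?K \<union> e)))" using r(2) fc by simp
    have "U - e \<in> components (- (?K \<union> e))" using r(2) by blast
    then have ne: "U - e \<noteq> {}" using in_components_nonempty by blast
    have "U - e \<notin> components (- ?K) - {U}"
      using ne r(1) components_nonoverlap[of "U - e" "- ?K" U] by blast
    then have "card (components (- (?K \<union> e))) = card (components (- ?K) - {U}) + 1"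
      unfolding r(2) using fc by simp
    then have cc: "card (components (- (?K \<union> e))) = card (components (- ?K))"
      using r(1) fc by (metis Suc_eq_plus1 card.remove)
    have "?W = insert v W" unfolding uv(2) using uv(3) by blast
    then have "card ?W = card W + 1" using False sub_fin[OF s] by simp
    then show ?thesis unfolding euler_inv_def K' using s' c' cc ca cA fin' by simp
  qed
qed

lemma euler_start: "v \<in> V \<Longrightarrow> euler_inv {v} {}"
proof -
  assume v: "v \<in> V"
  have "connected (- {v})" by (simp add: connected_punctured_universe)
  moreover have "- {v} \<noteq> ({}::complex set)" by (metis Compl_empty_eq double_complement finite.emptyI
     finite_insert infinite_UNIV_char_0)
  ultimately have "components (- {v}) = {- {v}}" by (simp add: components_eq_sing_iff)
  then show ?thesis using v by (auto simp: euler_inv_def sub_def pts_def)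
qed

lemma euler:
  assumes c: "connected (pts V E)" and V: "V \<noteq> {}"
  shows "finite (faces G)" "card E + 2 \<le> card (faces G) + card V"
proof -
  \<comment> \<open>The growth process is replaced by a subgraph with the largest number of vertices
    and edges. Whatever it misses is closed and disjoint from it, against connectedness.\<close>
  define m where "m = (\<lambda>(W :: complex set, A :: complex set set). card W + card A)"
  define I where "I = {(W, A). euler_inv W A}"
  have "I \<subseteq> Pow V \<times> Pow E" unfolding I_def euler_inv_def sub_def by blast
  then have fI: "finite I" using fin by (meson finite_Pow_iff finite_SigmaI finite_subset)
  have neI: "I \<noteq> {}" using euler_start V unfolding I_def by blast
  have "Max (m ` I) \<in> m ` I" using fI neI by simp
  then obtain p where p: "p \<in> I" "m p = Max (m ` I)" by auto
  obtain W A where WA: "p = (W, A)" by force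
  have inv: "euler_inv W A" using p WA I_def by auto
  have s: "sub W A" using inv euler_inv_def by blast
  have stuck: "e \<inter> W = {}" if "e \<in> E" "e \<notin> A" for e
  proof (rule ccontr)
    assume "e \<inter> W \<noteq> {}"
    then have "(W \<union> (e \<inter> V), insert e A) \<in> I" using euler_step[OF inv that] I_def by blast
    then have "m (W \<union> (e \<inter> V), insert e A) \<le> m (W, A)" using p(2) fI WA by (metis Max_ge finite_imageI imageI)
    moreover have "card (insert e A) = card A + 1" using that(2) sub_fin[OF s] by simp
    moreover have "card W \<le> card (W \<union> (e \<inter> V))" using sub_fin[OF s] fin by (intro card_mono) auto
    ultimately show False unfolding m_def by simp
  qed
  define R where "R = pts (V - W) (E - A)"
  have cR: "closed R" unfolding R_def pts_def
    by (intro closed_Un closed_Union finite_imp_closed) (use fin edge_facts(2) in auto)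
  have cW: "closed (pts W A)" using sub_compact[OF s] compact_imp_closed by blast
  have dis: "R \<inter> pts W A = {}"
  proof -
    have "(V - W) \<inter> pts W A = {}" using sub_V_Int[OF s] by blast
    moreover have "e \<inter> pts W A = {}" if "e \<in> E - A" for e
      using sub_edge_Int[OF s] stuck[of e] that by blast
    ultimately show ?thesis unfolding R_def pts_def[of "V - W"] by blast
  qed
  have un: "R \<union> pts W A = pts V E" using s unfolding R_def pts_def sub_def by blast
  have ne: "pts W A \<noteq> {}"
  proof
    assume "pts W A = {}"
    then have "components (- pts W A) = components UNIV" "W = {}"
      by (simp only: Compl_empty_eq, simp add: pts_def)
    moreover have "components (UNIV :: complex set) = {UNIV}" by (simp add: components_eq_sing_iff)
    ultimately show False using inv unfolding euler_inv_def by simp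
  qed
  have "R \<inter> pts V E = {} \<or> pts W A \<inter> pts V E = {}"
    by (rule connected_closedD[OF c _ _ cR cW]) (simp_all add: dis un)
  then have R: "R = {}" using un ne by auto
  have "V = W" using R s unfolding R_def pts_def sub_def by auto
  moreover have "E = A"
  proof
    show "E \<subseteq> A"
    proof
      fix e assume e: "e \<in> E"
      show "e \<in> A" using R edge_facts(5)[OF e] e unfolding R_def pts_def by auto
    qed
  qed (use s in \<open>simp add: sub_def\<close>)
  moreover have "faces G = components (- pts V E)" by (simp add: faces_def pts_def)
  ultimately show "finite (faces G)" "card E + 2 \<le> card (faces G) + card V"
    using inv unfolding euler_inv_def by auto
qed

end

section \<open>Edges and the faces on their two sides\<close>

context plane_gr
begin

definition Fs :: "complex set \<Rightarrow> complex set set" where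
  "Fs e = {F \<in> faces G. e \<subseteq> frontier F}"

text \<open>Excludes a face that reaches an inner point of the edge without having the whole edge on
  its frontier.\<close>

definition touch_ok :: "complex set \<Rightarrow> bool" where
  "touch_ok e \<longleftrightarrow> (\<forall>F\<in>faces G. closure F \<inter> (e - V) \<noteq> {} \<longrightarrow> F \<in> Fs e)"

lemma faces_eq: "faces G = components (- pts V E)"
  by (simp add: faces_def pts_def)

lemma pts_insert: "pts W (insert e A) = pts W A \<union> e"
  unfolding pts_def by blast

lemma pts_remove: "e \<in> E \<Longrightarrow> pts V E = pts V (E - {e}) \<union> e"
  by (metis insert_Diff pts_insert)

text \<open>The rest of the drawing is connected, so the edge is an arc between two of its points
  and separates two faces.\<close>

lemma nonbridge_faces:
  assumes e: "e \<in> E" and c: "connected (pts V (E - {e}))"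
  shows "card (Fs e) = 2" "touch_ok e"
proof -
  let ?K = "pts V (E - {e})"
  have s: "sub V (E - {e})" unfolding sub_def by blast
  obtain u v where uv: "joins e u v" "e \<inter> V = {u, v}" using edge_ends[OF e] by blast
  have i: "e \<inter> ?K = {u, v}" using sub_edge_Int[OF s e] uv(2) by simp
  obtain U X Y where r: "U \<in> components (- ?K)" "e - {u, v} \<subseteq> U" "X \<noteq> Y" "X \<union> Y = U - e"
      "components (- (?K \<union> e)) = components (- ?K) - {U} \<union> {X, Y}" "e \<subseteq> frontier X" "e \<subseteq> frontier Y"
      using arc_splits_component[OF sub_compact[OF s] sub_path_connected[OF s c] uv(1) i] by metis
  have fe: "faces G = components (- ?K) - {U} \<union> {X, Y}" using r(5) pts_remove[OF e] faces_eq by simp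
  have oK: "open (- ?K)" using sub_compact[OF s] by (simp add: compact_imp_closed open_Compl)
  have eV: "e - V = e - {u, v}" using uv(2) by blast
  have av: "closure F \<inter> (e - V) = {}" if "F \<in> components (- ?K) - {U}" for F
    unfolding eV by (rule component_avoids_arc[OF oK r(1) _ _ r(2)]) (use that in auto)
  have tXY: "F = X \<or> F = Y" if F: "F \<in> faces G" "closure F \<inter> (e - V) \<noteq> {}" for F
    using F av[of F] fe by auto
  have XY: "X \<in> Fs e" "Y \<in> Fs e" using r(6,7) fe unfolding Fs_def by simp_all
  have tF: "closure F \<inter> (e - V) \<noteq> {}" if F: "F \<in> Fs e" for F
  proof -
    have "e \<subseteq> closure F" using F unfolding Fs_def frontier_def by blast
    then show ?thesis using edge_facts(6)[OF e] by blast
  qed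
  have "Fs e = {X, Y}"
  proof
    show "Fs e \<subseteq> {X, Y}"
    proof
      fix F assume "F \<in> Fs e"
      moreover from this have "F \<in> faces G" unfolding Fs_def by blast
      ultimately show "F \<in> {X, Y}" using tXY tF by blast
    qed
  qed (use XY in simp)
  then show "card (Fs e) = 2" using r(3) by simp
  show "touch_ok e" unfolding touch_ok_def
  proof (intro ballI impI)
    fix F assume "F \<in> faces G" "closure F \<inter> (e - V) \<noteq> {}"
    then have "F = X \<or> F = Y" using av[of F] fe by auto
    then show "F \<in> Fs e" using XY by auto
  qed
qed

definition stp :: "complex set set \<Rightarrow> complex \<Rightarrow> complex \<Rightarrow> bool" where
  "stp B a b \<longleftrightarrow> (\<exists>e\<in>B. e \<inter> V = {a, b})"

abbreviation reach :: "complex set set \<Rightarrow> complex \<Rightarrow> complex \<Rightarrow> bool" where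
  "reach B \<equiv> (stp B)\<^sup>*\<^sup>*"

lemma stp_sym: "stp B a b \<Longrightarrow> stp B b a"
  unfolding stp_def by (metis insert_commute)

lemma reach_sym: "reach B a b \<Longrightarrow> reach B b a"
  using sympD symp_rtranclp stp_sym by (metis sympI)

lemma stp_in: "stp B a b \<Longrightarrow> a \<in> V \<and> b \<in> V"
  unfolding stp_def by blast

lemma reach_in: "reach B a b \<Longrightarrow> a \<in> V \<Longrightarrow> b \<in> V"
  by (induction rule: rtranclp_induct) (use stp_in in blast)+

lemma reach_connected:
  assumes s: "sub W B" and w0: "w0 \<in> W" and r: "\<And>w. w \<in> W \<Longrightarrow> reach B w0 w"
  shows "connected (pts W B)"
proof -
  define C where "C = connected_component_set (pts W B) w0"
  have eC: "e \<subseteq> C" if "e \<in> B" "a \<in> e" "a \<in> C" for e a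
  proof -
    have "e \<in> E" using s that(1) unfolding sub_def by blast
    then have ce: "connected e" using edge_facts(3) by blast
    have "e \<subseteq> pts W B" unfolding pts_def using that(1) by blast
    then have "e \<subseteq> connected_component_set (pts W B) a" using connected_component_maximal ce that(2) by blast
    also have "\<dots> = C" using that(3) unfolding C_def using connected_component_eq[of a "pts W B" w0] by blast
    finally show ?thesis .
  qed
  have w0p: "w0 \<in> pts W B" using w0 unfolding pts_def by blast
  then have w0C: "w0 \<in> C" unfolding C_def by simp
  have rC: "w \<in> C" if "reach B w0 w" for w
    using that
  proof (induction rule: rtranclp_induct)
    case base show ?case using w0C .
  next
    case (step a b)
    obtain e where e: "e \<in> B" "e \<inter> V = {a, b}" using step(2) unfolding stp_def by blast
    have "a \<in> e" "b \<in> e" using e(2) by blast+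
    then show ?case using eC[OF e(1) _ step(3)] by blast
  qed
  have WC: "W \<subseteq> C" using r rC by blast
  have "e \<subseteq> C" if e: "e \<in> B" for e
  proof -
    have eE: "e \<in> E" "e \<inter> V \<subseteq> W" using s e unfolding sub_def by blast+
    obtain a where "a \<in> e" "a \<in> V" using edge_endsE[OF eE(1)] by metis
    then show ?thesis using eC[OF e] WC eE(2) by blast
  qed
  then have "pts W B \<subseteq> C" using WC unfolding pts_def by blast
  moreover have "C \<subseteq> pts W B" unfolding C_def by (rule connected_component_subset)
  ultimately have "pts W B = C" by blast
  then show ?thesis unfolding C_def by (metis connected_connected_component)
qed

definition inc :: "complex \<Rightarrow> complex set set" where
  "inc v = {e \<in> E. v \<in> e}"

lemma edge_at:
  assumes "e \<in> E" "v \<in> V" "v \<in> e"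
  obtains w where "joins e v w" "e \<inter> V = {v, w}" "w \<noteq> v" "w \<in> V" "w \<in> e"
proof -
  obtain a b where ab: "joins e a b" "e \<inter> V = {a, b}" "a \<in> e" "b \<in> e" "a \<in> V" "b \<in> V" "a \<noteq> b"
    "\<forall>x\<in>e. x \<in> V \<longrightarrow> x = a \<or> x = b" by (rule edge_endsE[OF assms(1)]) (rule that)
  have "v = a \<or> v = b" using ab(8) assms by blast
  then show ?thesis
  proof
    assume "v = a" then show ?thesis using that[of b] ab(1-7) by simp
  next
    assume "v = b" then show ?thesis using that[of a] ab(1-7) joins_sym[OF ab(1)] by (simp add: insert_commute)
  qed
qed

lemma edge_card: "e \<in> E \<Longrightarrow> card (e \<inter> V) = 2"
  by (metis card_2_iff edge_ends joins_facts(7))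

text \<open>Stated through walks only; \<open>bridge_faces\<close> and
  \<open>nonbridge_faces'\<close> link it to the weight 2 in \<open>sides\<close>.\<close>

definition bridge :: "complex set \<Rightarrow> bool" where
  "bridge e \<longleftrightarrow> (\<exists>u v. e \<inter> V = {u, v} \<and> \<not> reach (E - {e}) u v)"

lemma bridge_iff: "e \<inter> V = {u, v} \<Longrightarrow> bridge e \<longleftrightarrow> \<not> reach (E - {e}) u v"
  unfolding bridge_def by (metis doubleton_eq_iff reach_sym)

text \<open>A common face of two edges at a vertex: first add both edges as one arc, then the third edge,
  which can destroy only one of the two faces along that arc.\<close>
lemma corner:
  assumes v: "v \<in> V" and inc: "inc v = {e1, e2, e3}" and d: "e1 \<noteq> e2" "e1 \<noteq> e3" "e2 \<noteq> e3"
    and c: "connected (pts (V - {v}) (E - inc v))"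
  shows "\<exists>X \<in> faces G. e1 \<subseteq> frontier X \<and> e2 \<subseteq> frontier X \<and> closure X \<inter> (e3 - V) = {}"
proof -
  let ?K = "pts (V - {v}) (E - inc v)"
  have eE: "e1 \<in> E" "e2 \<in> E" "e3 \<in> E" "v \<in> e1" "v \<in> e2" "v \<in> e3" proof -
    have "e1 \<in> inc v" "e2 \<in> inc v" "e3 \<in> inc v" unfolding inc by simp_all
    then show "e1 \<in> E" "e2 \<in> E" "e3 \<in> E" "v \<in> e1" "v \<in> e2" "v \<in> e3" unfolding inc_def by simp_all
  qed
  obtain w1 where w1: "joins e1 v w1" "e1 \<inter> V = {v, w1}" "w1 \<noteq> v" "w1 \<in> V" by (rule edge_at[OF eE(1) v eE(4)])
  obtain w2 where w2: "joins e2 v w2" "e2 \<inter> V = {v, w2}" "w2 \<noteq> v" "w2 \<in> V" by (rule edge_at[OF eE(2) v eE(5)])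
  obtain w3 where w3: "joins e3 v w3" "e3 \<inter> V = {v, w3}" "w3 \<noteq> v" "w3 \<in> V" by (rule edge_at[OF eE(3) v eE(6)])
  have ne: "w1 \<noteq> w2" using edges_eqI[OF eE(1,2)] w1(2) w2(2) d(1) by metis
  have s: "sub (V - {v}) (E - inc v)" unfolding sub_def inc_def by blast
  have K: "compact ?K" "path_connected ?K" using sub_compact[OF s] sub_path_connected[OF s c] by auto
  have ei: "e \<inter> ?K = (e \<inter> V) - {v}" if "e \<in> inc v" for e
  proof -
    have "e \<inter> ?K = e \<inter> (V - {v})" by (rule sub_edge_Int[OF s]) (use that in \<open>auto simp: inc_def\<close>)
    then show ?thesis by blast
  qed
  have m: "e1 \<in> inc v" "e2 \<in> inc v" "e3 \<in> inc v" unfolding inc by simp_all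
  have i1: "e1 \<inter> ?K = {w1}"
  proof -
    have "e1 \<inter> ?K = {v, w1} - {v}" using ei[OF m(1)] w1(2) by simp
    also have "\<dots> = {w1}" using w1(3) by auto
    finally show ?thesis .
  qed
  have i2: "e2 \<inter> ?K = {w2}"
  proof -
    have "e2 \<inter> ?K = {v, w2} - {v}" using ei[OF m(2)] w2(2) by simp
    also have "\<dots> = {w2}" using w2(3) by auto
    finally show ?thesis .
  qed
  have i3: "e3 \<inter> ?K = {w3}"
  proof -
    have "e3 \<inter> ?K = {v, w3} - {v}" using ei[OF m(3)] w3(2) by simp
    also have "\<dots> = {w3}" using w3(3) by auto
    finally show ?thesis .
  qed
  have e12: "e1 \<inter> e2 = {v}"
  proof -
    have "e1 \<inter> e2 = (e1 \<inter> V) \<inter> (e2 \<inter> V)" using edges_Int[OF eE(1,2) d(1)] by blast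
    then show ?thesis unfolding w1(2) w2(2) using ne w1(3) w2(3) by auto
  qed
  have j: "joins (e1 \<union> e2) w1 w2" by (rule joins_Un[OF joins_sym[OF w1(1)] w2(1) e12])
  have i: "(e1 \<union> e2) \<inter> ?K = {w1, w2}" unfolding Int_Un_distrib2 i1 i2 by blast
  obtain U X Y where r: "X \<noteq> Y" "X \<union> Y = U - (e1 \<union> e2)" "U \<in> components (- ?K)"
    "components (- (?K \<union> (e1 \<union> e2))) = components (- ?K) - {U} \<union> {X, Y}"
    "e1 \<union> e2 \<subseteq> frontier X" "e1 \<union> e2 \<subseteq> frontier Y"
    using arc_splits_component[OF K j i] by metis
  let ?K1 = "?K \<union> (e1 \<union> e2)"
  have K1: "compact ?K1" using K(1) edge_facts(1)[OF eE(1)] edge_facts(1)[OF eE(2)] by (intro compact_Un)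
  have p1: "path_connected ?K1"
    by (rule path_connected_Un[OF K(2) joins_facts(4)[OF j]]) (use i in blast)
  have e13: "e3 \<inter> (e1 \<union> e2) \<subseteq> V" using edges_Int[OF eE(3,1)] edges_Int[OF eE(3,2)] d by blast
  have "e3 \<inter> ?K1 = {v, w3}"
  proof
    show "e3 \<inter> ?K1 \<subseteq> {v, w3}" using i3 e13 w3(2) by blast
    have "w3 \<in> ?K" using i3 by blast
    moreover have "w3 \<in> e3" using i3 by blast
    ultimately show "{v, w3} \<subseteq> e3 \<inter> ?K1" using eE by blast
  qed
  then obtain U' X' Y' where r': "U' \<in> components (- ?K1)" "e3 - {v, w3} \<subseteq> U'"
    "components (- (?K1 \<union> e3)) = components (- ?K1) - {U'} \<union> {X', Y'}"
    using arc_splits_component[OF K1 p1 w3(1)] by metis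
  have "pts V E = pts (V - {v}) (E - inc v) \<union> (e1 \<union> e2) \<union> e3"
  proof -
    have "inc v \<subseteq> E" unfolding inc_def by blast
    then have "\<Union>E = \<Union>(E - inc v) \<union> \<Union>(inc v)" by blast
    also have "\<Union>(inc v) = e1 \<union> e2 \<union> e3" unfolding inc by blast
    finally have "\<Union>E = \<Union>(E - inc v) \<union> (e1 \<union> e2 \<union> e3)" .
    then show ?thesis unfolding pts_def using v eE(4) by blast
  qed
  then have fe: "faces G = components (- ?K1) - {U'} \<union> {X', Y'}" using r'(3) faces_eq by simp
  \<comment> \<open>The inner points of the third edge lie in one component \<open>U'\<close>. Of
    the two faces along the joint arc, at least one differs from \<open>U'\<close> and is left
    untouched.\<close>
  define Z where "Z = (if U' = X then Y else X)"
  have Z: "Z \<in> components (- ?K1) - {U'}" using r(1,4) unfolding Z_def by auto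
  have oK: "open (- ?K1)" using compact_imp_closed[OF K1] by (rule open_Compl)
  have eV: "e3 - V = e3 - {v, w3}" using w3(2) by blast
  have "closure Z \<inter> (e3 - V) = {}" unfolding eV
    by (rule component_avoids_arc[OF oK r'(1) _ _ r'(2)]) (use Z in auto)
  moreover have "Z \<in> faces G" using fe Z by blast
  moreover have "e1 \<union> e2 \<subseteq> frontier Z" using r(5,6) unfolding Z_def by simp
  ultimately show ?thesis by blast
qed

end

section \<open>Trihexes: absence of bridges, and the three faces around a vertex\<close>

locale trihex_gr = plane_gr +
  assumes tri: "trihex G" and Vne: "verts G \<noteq> {}"
begin

lemma conn: "u \<in> V \<Longrightarrow> v \<in> V \<Longrightarrow> reach E u v"
proof -
  have "adj G = stp E" unfolding adj_def stp_def by (intro ext) blast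
  then show "u \<in> V \<Longrightarrow> v \<in> V \<Longrightarrow> reach E u v"
    using tri unfolding trihex_def connected_graph_def by simp
qed

lemma deg: "v \<in> V \<Longrightarrow> card (inc v) = 3"
  using tri unfolding trihex_def vertex_degree_def inc_def by blast

lemma face_sides: "F \<in> faces G \<Longrightarrow> sides G F = 3 \<or> sides G F = 6"
  using tri unfolding trihex_def by blast

lemma pts_connected: "connected (pts V E)"
proof -
  obtain w0 where "w0 \<in> V" using Vne by blast
  then show ?thesis using reach_connected[OF sub_all] conn by blast
qed

lemma finite_faces: "finite (faces G)"
  and euler_ge: "card E + 2 \<le> card (faces G) + card V"
  using euler[OF pts_connected Vne] by blast+

text \<open>Since the whole graph is connected, without the bridge every vertex is reached from
  exactly one of its ends. This prepares the hypotheses of \<open>bridge_component\<close>.\<close>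

lemma bridge_split:
  assumes e: "e \<in> E" "joins e u v" "e \<inter> V = {u, v}" and nr: "\<not> reach (E - {e}) u v"
    and A: "A = {w. reach (E - {e}) u w}" and B: "B = {w. reach (E - {e}) v w}"
    and EA: "EA = {f \<in> E - {e}. f \<inter> V \<subseteq> A}" and EB: "EB = {f \<in> E - {e}. f \<inter> V \<subseteq> B}"
  shows "A \<union> B = V" "A \<inter> B = {}" "u \<in> A" "v \<in> B" "sub A EA" "sub B EB" "EA \<union> EB = E - {e}" "EA \<inter> EB = {}"
    "connected (pts A EA)" "connected (pts B EB)" "pts A EA \<inter> pts B EB = {}"
    "e \<inter> pts A EA = {u}" "e \<inter> pts B EB = {v}" "pts V E = pts A EA \<union> e \<union> pts B EB"
proof -
  have uv: "u \<in> V" "v \<in> V" using e(3) by auto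
  show AB: "A \<inter> B = {}" using nr reach_sym rtranclp_trans[of "stp (E - {e})" u _ v] unfolding A B by blast
  show uA: "u \<in> A" and vB: "v \<in> B" unfolding A B by simp_all
  have AV: "A \<subseteq> V" "B \<subseteq> V" using reach_in uv unfolding A B by blast+
  have "w \<in> A \<union> B" if "reach E u w" for w
    using that
  proof (induction rule: rtranclp_induct)
    case base show ?case using uA by simp
  next
    case (step a b)
    obtain f where f: "f \<in> E" "f \<inter> V = {a, b}" using step(2) unfolding stp_def by blast
    show ?case
    proof (cases "f = e")
      case True
      then have "{a, b} = {u, v}" using f(2) e(3) by simp
      then have "b = u \<or> b = v" by (metis insert_iff singletonD)
      then show ?thesis using uA vB by blast
    next
      case False
      then have "stp (E - {e}) a b" unfolding stp_def using f by blast
      then show ?thesis using step(3) rtranclp.rtrancl_into_rtrancl[of "stp (E - {e})" _ a b] unfolding A B by blast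
    qed
  qed
  then show ABV: "A \<union> B = V" using conn[OF uv(1)] AV by blast
  have cl: "f \<inter> V \<subseteq> C" if f: "f \<in> E - {e}" "f \<inter> V \<inter> C \<noteq> {}" and C: "C = {w. reach (E - {e}) x w}" for f C x
  proof
    fix b assume b: "b \<in> f \<inter> V"
    obtain a where a: "a \<in> f" "a \<in> V" "a \<in> C" using f(2) by blast
    have fE: "f \<in> E" using f(1) by blast
    show "b \<in> C"
    proof (cases "a = b")
      case False
      obtain c where c: "f \<inter> V = {a, c}" by (rule edge_at[OF fE a(2,1)])
      then have "c = b" using b False by auto
      then have "stp (E - {e}) a b" unfolding stp_def using c f(1) by blast
      then show ?thesis using a(3) rtranclp.rtrancl_into_rtrancl[of "stp (E - {e})" x a b] unfolding C by blast
    qed (use a in simp)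
  qed
  show sA: "sub A EA" and sB: "sub B EB" unfolding sub_def EA EB using AV by blast+
  have ne: "f \<inter> V \<noteq> {}" if "f \<in> E" for f using edge_card[OF that] by (metis card.empty zero_neq_numeral)
  show "EA \<union> EB = E - {e}"
  proof
    show "E - {e} \<subseteq> EA \<union> EB"
    proof
      fix f assume f: "f \<in> E - {e}"
      then have "f \<inter> V \<inter> A \<noteq> {} \<or> f \<inter> V \<inter> B \<noteq> {}" using ne[of f] ABV by blast
      then show "f \<in> EA \<union> EB" using cl[OF f _ A] cl[OF f _ B] f unfolding EA EB by blast
    qed
  qed (auto simp: EA EB)
  note un = this
  show "EA \<inter> EB = {}" using ne AB unfolding EA EB by blast
  have reA: "reach EA u w" if "reach (E - {e}) u w" for w
    using that
  proof (induction rule: rtranclp_induct)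
    case (step a b)
    obtain f where f: "f \<in> E - {e}" "f \<inter> V = {a, b}" using step(2) unfolding stp_def by blast
    have "f \<inter> V \<subseteq> A" by (rule cl[OF f(1) _ A]) (use step(1) f(2) A in auto)
    then have "stp EA a b" using f unfolding stp_def EA by blast
    then show ?case using step(3) by (rule rtranclp.rtrancl_into_rtrancl[rotated])
  qed simp
  have reB: "reach EB v w" if "reach (E - {e}) v w" for w
    using that
  proof (induction rule: rtranclp_induct)
    case (step a b)
    obtain f where f: "f \<in> E - {e}" "f \<inter> V = {a, b}" using step(2) unfolding stp_def by blast
    have "f \<inter> V \<subseteq> B" by (rule cl[OF f(1) _ B]) (use step(1) f(2) B in auto)
    then have "stp EB a b" using f unfolding stp_def EB by blast
    then show ?case using step(3) by (rule rtranclp.rtrancl_into_rtrancl[rotated])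
  qed simp
  show "connected (pts A EA)" by (rule reach_connected[OF sA uA]) (use reA A in blast)
  show "connected (pts B EB)" by (rule reach_connected[OF sB vB]) (use reB B in blast)
  have eA: "e \<inter> pts A EA = e \<inter> A" by (rule sub_edge_Int[OF sA e(1)]) (simp add: EA)
  have eB: "e \<inter> pts B EB = e \<inter> B" by (rule sub_edge_Int[OF sB e(1)]) (simp add: EB)
  have "e \<inter> A = (e \<inter> V) \<inter> A" "e \<inter> B = (e \<inter> V) \<inter> B" using AV by blast+
  moreover have "v \<notin> A" "u \<notin> B" using AB uA vB by blast+
  ultimately show "e \<inter> pts A EA = {u}" "e \<inter> pts B EB = {v}" using uA vB unfolding eA eB e(3) by auto
  show "pts A EA \<inter> pts B EB = {}"
  proof -
    have 1: "f \<inter> pts B EB = {}" if "f \<in> EA" for f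
    proof -
      have "f \<in> E" "f \<notin> EB" using that \<open>EA \<inter> EB = {}\<close> unfolding EA by blast+
      then have "f \<inter> pts B EB = f \<inter> B" using sub_edge_Int[OF sB] by blast
      moreover have "f \<inter> B \<subseteq> A" using that AV unfolding EA by blast
      ultimately show ?thesis using AB by blast
    qed
    have 2: "A \<inter> pts B EB = {}" using sub_V_Int[OF sB] AV AB by blast
    have "x \<notin> pts B EB" if "x \<in> pts A EA" for x using that 1 2 unfolding pts_def[of A] by blast
    then show ?thesis by blast
  qed
  have "E = insert e (EA \<union> EB)" using un e(1) by blast
  then show "pts V E = pts A EA \<union> e \<union> pts B EB" unfolding pts_def using ABV by blast
qed

lemma frontier_face: "F \<in> faces G \<Longrightarrow> frontier F \<subseteq> pts V E" "F \<in> faces G \<Longrightarrow> connected (frontier F)"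
proof -
  assume F: "F \<in> faces G"
  have "closed (pts V E)" using sub_compact[OF sub_all] compact_imp_closed by blast
  moreover have "frontier F \<subseteq> frontier (- pts V E)"
    using F unfolding faces_eq by (rule frontier_of_components_subset)
  ultimately show "frontier F \<subseteq> pts V E" using frontier_subset_closed by (metis dual_order.trans frontier_complement)
  show "connected (frontier F)" using connected_frontier_component_complement[OF pts_connected] F faces_eq by blast
qed

lemma bridge_faces:
  assumes e: "e \<in> E" and b: "bridge e"
  shows "card (Fs e) = 1" "touch_ok e"
proof -
  obtain u v where uv: "joins e u v" "e \<inter> V = {u, v}" using edge_ends[OF e] by blast
  have nr: "\<not> reach (E - {e}) u v" using b bridge_iff[OF uv(2)] by blast
  note sp = bridge_split[OF e uv nr refl refl refl refl]
  let ?A = "pts {w. reach (E - {e}) u w} {f \<in> E - {e}. f \<inter> V \<subseteq> {w. reach (E - {e}) u w}}"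
  let ?B = "pts {w. reach (E - {e}) v w} {f \<in> E - {e}. f \<inter> V \<subseteq> {w. reach (E - {e}) v w}}"
  obtain F where F: "F \<in> components (- (?A \<union> e \<union> ?B))" "e \<subseteq> frontier F"
    "\<And>F'. F' \<in> components (- (?A \<union> e \<union> ?B)) \<Longrightarrow> F' \<noteq> F \<Longrightarrow> closure F' \<inter> (e - {u, v}) = {}"
    by (rule bridge_component[OF sub_compact[OF sp(5)] sub_compact[OF sp(6)] sp(10) uv(1) sp(12,13,11)]) (rule that)
  have fe: "faces G = components (- (?A \<union> e \<union> ?B))" using sp(14) faces_eq by simp
  have eV: "e - V = e - {u, v}" using uv(2) by blast
  have F1: "F \<in> Fs e" using F(1,2) fe unfolding Fs_def by simp
  have F2: "F' = F" if "F' \<in> faces G" "closure F' \<inter> (e - V) \<noteq> {}" for F'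
  proof (rule ccontr)
    assume "F' \<noteq> F"
    then have "closure F' \<inter> (e - {u, v}) = {}" using F(3)[of F'] that(1) fe by simp
    then show False using that(2) eV by simp
  qed
  have F3: "closure F \<inter> (e - V) \<noteq> {}" if F: "F \<in> Fs e" for F
  proof -
    have "e \<subseteq> closure F" using F unfolding Fs_def frontier_def by blast
    then show ?thesis using edge_facts(6)[OF e] by blast
  qed
  have "Fs e = {F}"
  proof
    show "Fs e \<subseteq> {F}"
    proof
      fix F' assume "F' \<in> Fs e"
      moreover from this have "F' \<in> faces G" unfolding Fs_def by blast
      ultimately show "F' \<in> {F}" using F2 F3 by blast
    qed
  qed (use F1 in simp)
  then show "card (Fs e) = 1" by simp
  show "touch_ok e" unfolding touch_ok_def using F1 F2 by blast
qed

lemma nonbridge_faces':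
  assumes e: "e \<in> E" and b: "\<not> bridge e"
  shows "card (Fs e) = 2" "touch_ok e"
proof -
  obtain u v where uv: "joins e u v" "e \<inter> V = {u, v}" "u \<in> e" "v \<in> e" "u \<in> V" "v \<in> V" "u \<noteq> v"
    "\<forall>x\<in>e. x \<in> V \<longrightarrow> x = u \<or> x = v" by (rule edge_endsE[OF e]) (rule that)
  have r: "reach (E - {e}) u v" using b bridge_iff[OF uv(2)] by blast
  have s: "sub V (E - {e})" unfolding sub_def by blast
  have "reach (E - {e}) u w" if "reach E u w" for w
    using that
  proof (induction rule: rtranclp_induct)
    case (step a b)
    obtain f where f: "f \<in> E" "f \<inter> V = {a, b}" using step(2) unfolding stp_def by blast
    show ?case
    proof (cases "f = e")
      case True
      then have "{a, b} = {u, v}" using f(2) uv(2) by simp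
      then have "b = u \<or> b = v" by (metis insert_iff singletonD)
      then show ?thesis using r by blast
    next
      case False
      then have "stp (E - {e}) a b" unfolding stp_def using f by blast
      then show ?thesis using step(3) by (rule rtranclp.rtrancl_into_rtrancl[rotated])
    qed
  qed simp
  then have "connected (pts V (E - {e}))" using reach_connected[OF s uv(5)] conn[OF uv(5)] by blast
  then show "card (Fs e) = 2" "touch_ok e" using nonbridge_faces[OF e] by blast+
qed

lemma touch: "e \<in> E \<Longrightarrow> F \<in> faces G \<Longrightarrow> closure F \<inter> (e - V) \<noteq> {} \<Longrightarrow> e \<subseteq> frontier F"
  using bridge_faces(2)[of e] nonbridge_faces'(2)[of e] unfolding touch_ok_def Fs_def by blast

lemma sides_eq: 
  assumes F: "F \<in> faces G"
  shows "sides G F = (\<Sum>e\<in>{e \<in> E. e \<subseteq> frontier F}. if bridge e then 2 else 1)"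
  unfolding sides_def
proof (rule sum.cong[OF refl])
  fix e assume "e \<in> {e \<in> E. e \<subseteq> frontier F}"
  then have e: "e \<in> E" "F \<in> Fs e" using F unfolding Fs_def by blast+
  have iff: "(\<exists>F'\<in>faces G. F' \<noteq> F \<and> e \<subseteq> frontier F') \<longleftrightarrow> Fs e \<noteq> {F}"
    using e(2) unfolding Fs_def by blast
  show "(if \<exists>F'\<in>faces G. F' \<noteq> F \<and> e \<subseteq> frontier F' then 1 else 2) = (if bridge e then 2 else (1::nat))"
  proof (cases "bridge e")
    case True
    then have "Fs e = {F}" using bridge_faces(1)[OF e(1)] e(2) by (metis card_1_singletonE singletonD)
    then show ?thesis using iff True by simp
  next
    case False
    then have "Fs e \<noteq> {F}" using nonbridge_faces'(1)[OF e(1)] by auto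
    then show ?thesis using iff False by simp
  qed
qed

text \<open>Cut a walk to \<open>v\<close> where it first arrives there: up to the preceding
  neighbour it uses no edge at \<open>v\<close>.\<close>

lemma reach_last:
  assumes v: "v \<in> V" and B: "B \<subseteq> E" and r: "reach B x v"
  shows "x = v \<or> (\<exists>f\<in>B \<inter> inc v. \<exists>w. f \<inter> V = {v, w} \<and> reach (E - inc v) x w)"
  using r
proof (induction rule: converse_rtranclp_induct)
  case (step x y)
  obtain f where f: "f \<in> B" "f \<inter> V = {x, y}" using step(1) unfolding stp_def by blast
  show ?case
  proof (cases "f \<in> inc v")
    case True
    then have "v \<in> f \<inter> V" using v unfolding inc_def by blast
    then have "v = x \<or> v = y" unfolding f(2) by blast
    moreover have "f \<inter> V = {v, x}" if "v = y" using f(2) that by (simp add: insert_commute)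
    ultimately show ?thesis using f(1) True by blast
  next
    case False
    have "y \<in> f" "f \<in> E" using f B by blast+
    then have yv: "y \<noteq> v" using False unfolding inc_def by blast
    have "stp (E - inc v) x y" unfolding stp_def using f False \<open>f \<in> E\<close> by blast
    then show ?thesis using step(3) yv converse_rtranclp_into_rtranclp[of "stp (E - inc v)" x y] by blast
  qed
qed simp

lemma inc3:
  assumes "v \<in> V"
  obtains e1 e2 e3 where "inc v = {e1, e2, e3}" "e1 \<noteq> e2" "e1 \<noteq> e3" "e2 \<noteq> e3"
  using deg[OF assms] card_3_iff[of "inc v"] by metis

text \<open>As no edge at \<open>v\<close> is a bridge, each of the three neighbours still reaches
  another one after the deletion of \<open>v\<close>. A symmetric and transitive relation with this
  property joins all three.\<close>

lemma star_connected:
  assumes v: "v \<in> V" and nb: "\<And>e. e \<in> inc v \<Longrightarrow> \<not> bridge e"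
  shows "connected (pts (V - {v}) (E - inc v))"
proof -
  obtain e1 e2 e3 where i: "inc v = {e1, e2, e3}" "e1 \<noteq> e2" "e1 \<noteq> e3" "e2 \<noteq> e3" by (rule inc3[OF v])
  let ?R = "reach (E - inc v)"
  have "e1 \<in> inc v" "e2 \<in> inc v" "e3 \<in> inc v" unfolding i by simp_all
  then have eE: "e1 \<in> E" "e2 \<in> E" "e3 \<in> E" "v \<in> e1" "v \<in> e2" "v \<in> e3" unfolding inc_def by simp_all
  obtain w1 where w1: "e1 \<inter> V = {v, w1}" "w1 \<noteq> v" "w1 \<in> V" by (rule edge_at[OF eE(1) v eE(4)])
  obtain w2 where w2: "e2 \<inter> V = {v, w2}" "w2 \<noteq> v" "w2 \<in> V" by (rule edge_at[OF eE(2) v eE(5)])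
  obtain w3 where w3: "e3 \<inter> V = {v, w3}" "w3 \<noteq> v" "w3 \<in> V" by (rule edge_at[OF eE(3) v eE(6)])
  have weq: "w = a" if "{v, w} = {v, a}" "a \<noteq> v" for w a using that by (metis doubleton_eq_iff)
  have w1': "w = w1" if "f = e1" "f \<inter> V = {v, w}" for f w
    by (rule weq[OF _ w1(2)]) (use that(2) w1(1) in \<open>simp only: that(1)\<close>)
  have w2': "w = w2" if "f = e2" "f \<inter> V = {v, w}" for f w
    by (rule weq[OF _ w2(2)]) (use that(2) w2(1) in \<open>simp only: that(1)\<close>)
  have w3': "w = w3" if "f = e3" "f \<inter> V = {v, w}" for f w
    by (rule weq[OF _ w3(2)]) (use that(2) w3(1) in \<open>simp only: that(1)\<close>)
  have f3: "f = e1 \<or> f = e2 \<or> f = e3" if "f \<in> inc v" for f using that unfolding i by simp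
  have w: "w \<in> {w1, w2, w3}" "f = e1 \<Longrightarrow> w = w1" "f = e2 \<Longrightarrow> w = w2" "f = e3 \<Longrightarrow> w = w3"
    if "f \<in> inc v" "f \<inter> V = {v, w}" for f w
    using f3[OF that(1)] w1'[OF _ that(2)] w2'[OF _ that(2)] w3'[OF _ that(2)] by blast+
  have any: "?R x w1 \<or> ?R x w2 \<or> ?R x w3" if x: "x \<in> V - {v}" for x
    using reach_last[OF v order_refl conn[of x v]] x v w(1) by blast
  have nbr: "reach (E - {e}) a v" if "e \<in> inc v" "e \<inter> V = {v, a}" for e a
    using nb[OF that(1)] bridge_iff[OF that(2)] reach_sym by blast
  have 1: "?R w1 w2 \<or> ?R w1 w3"
  proof -
    have "reach (E - {e1}) w1 v" by (rule nbr) (simp_all add: i w1)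
    then obtain f a where f: "f \<in> (E - {e1}) \<inter> inc v" "f \<inter> V = {v, a}" "?R w1 a"
      using reach_last[OF v, of "E - {e1}" w1] w1(2) by blast
    then have "f = e2 \<or> f = e3" using i by blast
    then show ?thesis using w(3,4)[of f a] f by blast
  qed
  have 2: "?R w2 w1 \<or> ?R w2 w3"
  proof -
    have "reach (E - {e2}) w2 v" by (rule nbr) (simp_all add: i w2)
    then obtain f a where f: "f \<in> (E - {e2}) \<inter> inc v" "f \<inter> V = {v, a}" "?R w2 a"
      using reach_last[OF v, of "E - {e2}" w2] w2(2) by blast
    then have "f = e1 \<or> f = e3" using i by blast
    then show ?thesis using w(2,4)[of f a] f by blast
  qed
  have 3: "?R w3 w1 \<or> ?R w3 w2"
  proof -
    have "reach (E - {e3}) w3 v" by (rule nbr) (simp_all add: i w3)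
    then obtain f a where f: "f \<in> (E - {e3}) \<inter> inc v" "f \<inter> V = {v, a}" "?R w3 a"
      using reach_last[OF v, of "E - {e3}" w3] w3(2) by blast
    then have "f = e1 \<or> f = e2" using i by blast
    then show ?thesis using w(2,3)[of f a] f by blast
  qed
  have tr: "?R a c" if "?R a b" "?R b c" for a b c using that by (rule rtranclp_trans)
  have w12: "?R w1 w2" using 1 2 3 tr reach_sym by meson
  have w13: "?R w1 w3" using 1 2 3 tr reach_sym by meson
  have s: "sub (V - {v}) (E - inc v)" unfolding sub_def inc_def by blast
  show ?thesis
  proof (rule reach_connected[OF s, of w1])
    show "w1 \<in> V - {v}" using w1 by blast
    fix x assume "x \<in> V - {v}"
    then show "?R w1 x" using any[of x] w12 w13 tr reach_sym by meson
  qed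
qed

text \<open>By \<open>corner\<close> each two of the edges share a face that avoids the third edge.
  An edge has only two faces, so these three faces are all there are.\<close>

lemma corners:
  assumes v: "v \<in> V" and nb: "\<And>e. e \<in> inc v \<Longrightarrow> \<not> bridge e"
    and i: "inc v = {e1, e2, e3}" "e1 \<noteq> e2" "e1 \<noteq> e3" "e2 \<noteq> e3"
  obtains X Y Z where "X \<noteq> Y" "X \<noteq> Z" "Y \<noteq> Z" "Fs e1 = {X, Y}" "Fs e2 = {X, Z}" "Fs e3 = {Y, Z}"
proof -
  note c = star_connected[OF v nb]
  have av: "X \<in> Fs a \<and> X \<in> Fs b \<and> X \<notin> Fs d"
    if "X \<in> faces G" "a \<subseteq> frontier X" "b \<subseteq> frontier X" "closure X \<inter> (d - V) = {}" "d \<in> E" for X a b d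
  proof -
    have "\<not> d \<subseteq> frontier X" using that(4) edge_facts(6)[OF that(5)] unfolding frontier_def by blast
    then show ?thesis using that unfolding Fs_def by blast
  qed
  have "e1 \<in> inc v" "e2 \<in> inc v" "e3 \<in> inc v" unfolding i by simp_all
  then have eE: "e1 \<in> E" "e2 \<in> E" "e3 \<in> E" and cd: "card (Fs e1) = 2" "card (Fs e2) = 2" "card (Fs e3) = 2"
    using nonbridge_faces'(1) nb unfolding inc_def by blast+
  have i2: "inc v = {e1, e3, e2}" "inc v = {e2, e3, e1}" using i(1) by auto
  obtain X where X: "X \<in> Fs e1" "X \<in> Fs e2" "X \<notin> Fs e3"
    using corner[OF v i c] av eE by meson
  obtain Y where Y: "Y \<in> Fs e1" "Y \<in> Fs e3" "Y \<notin> Fs e2"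
    using corner[OF v i2(1) _ _ _ c] i(2-4) av eE by metis
  obtain Z where Z: "Z \<in> Fs e2" "Z \<in> Fs e3" "Z \<notin> Fs e1"
    using corner[OF v i2(2) _ _ _ c] i(2-4) av eE by metis
  have d: "X \<noteq> Y" "X \<noteq> Z" "Y \<noteq> Z" using X Y Z by blast+
  have two: "S = {a, b}" if "card S = 2" "a \<in> S" "b \<in> S" "a \<noteq> b" for S :: "complex set set" and a b
    using that by (metis card_2_iff doubleton_eq_iff insertE singletonD)
  show ?thesis by (rule that[OF d]) (use two cd X Y Z d in blast)+
qed

lemma corner_two:
  assumes v: "v \<in> V" and nb: "\<And>e. e \<in> inc v \<Longrightarrow> \<not> bridge e" and e: "e \<in> inc v" "F \<in> Fs e"
  obtains f where "f \<in> inc v" "f \<noteq> e" "{g \<in> inc v. F \<in> Fs g} = {e, f}"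
proof -
  obtain e1 e2 e3 where i: "inc v = {e1, e2, e3}" "e1 \<noteq> e2" "e1 \<noteq> e3" "e2 \<noteq> e3" by (rule inc3[OF v])
  obtain X Y Z where x: "X \<noteq> Y" "X \<noteq> Z" "Y \<noteq> Z" "Fs e1 = {X, Y}" "Fs e2 = {X, Z}" "Fs e3 = {Y, Z}"
    by (rule corners[OF v nb i])
  have m: "F \<in> Fs e1 \<longleftrightarrow> F = X \<or> F = Y" "F \<in> Fs e2 \<longleftrightarrow> F = X \<or> F = Z" "F \<in> Fs e3 \<longleftrightarrow> F = Y \<or> F = Z"
    using x(4-6) by simp_all
  have mem: "g \<in> inc v \<longleftrightarrow> g = e1 \<or> g = e2 \<or> g = e3" for g unfolding i by simp
  have e': "e = e1 \<or> e = e2 \<or> e = e3" using e(1) mem by blast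
  obtain f where f: "f \<noteq> e" "\<And>g. g \<in> inc v \<and> F \<in> Fs g \<longleftrightarrow> g = e \<or> g = f"
  proof -
    consider "F = X" | "F = Y" | "F = Z" using e e' m by metis
    then show ?thesis
    proof cases
      case 1
      then have "g \<in> inc v \<and> F \<in> Fs g \<longleftrightarrow> g = e1 \<or> g = e2" for g using mem m x(1-3) by metis
      then show ?thesis using that[of e1] that[of e2] e i(2) by metis
    next
      case 2
      then have "g \<in> inc v \<and> F \<in> Fs g \<longleftrightarrow> g = e1 \<or> g = e3" for g using mem m x(1-3) by metis
      then show ?thesis using that[of e1] that[of e3] e i(3) by metis
    next
      case 3
      then have "g \<in> inc v \<and> F \<in> Fs g \<longleftrightarrow> g = e2 \<or> g = e3" for g using mem m x(1-3) by metis
      then show ?thesis using that[of e2] that[of e3] e i(4) by metis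
    qed
  qed
  have "{g \<in> inc v. F \<in> Fs g} = {e, f}" using f(2) by auto
  moreover have "f \<in> inc v" using f(2)[of f] by blast
  ultimately show ?thesis using that f(1) by blast
qed

end

context trihex_gr
begin

lemma handshake:
  assumes "W \<subseteq> V"
  shows "(\<Sum>x\<in>W. card (inc x)) = (\<Sum>f\<in>E. card (W \<inter> f))"
proof -
  have fW: "finite W" using assms fin finite_subset by blast
  have "(\<Sum>x\<in>W. card (inc x)) = (\<Sum>x\<in>W. \<Sum>f\<in>E. if x \<in> f then 1 else 0)"
    by (rule sum.cong[OF refl]) (simp add: inc_def fin sum.If_cases Int_def)
  also have "\<dots> = (\<Sum>f\<in>E. \<Sum>x\<in>W. if x \<in> f then 1 else 0)" by (rule sum.swap)
  also have "\<dots> = (\<Sum>f\<in>E. card (W \<inter> f))"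
    by (rule sum.cong[OF refl]) (simp add: fW sum.If_cases Int_def)
  finally show ?thesis .
qed

lemma faces_sum:
  assumes "B \<subseteq> E"
  shows "(\<Sum>F\<in>faces G. card {f \<in> B. f \<subseteq> frontier F}) = (\<Sum>f\<in>B. card (Fs f))"
proof -
  have fB: "finite B" using assms fin finite_subset by blast
  have "(\<Sum>F\<in>faces G. card {f \<in> B. f \<subseteq> frontier F}) = (\<Sum>F\<in>faces G. \<Sum>f\<in>B. if f \<subseteq> frontier F then 1 else 0)"
    by (rule sum.cong[OF refl]) (simp add: fB sum.If_cases Int_def)
  also have "\<dots> = (\<Sum>f\<in>B. \<Sum>F\<in>faces G. if f \<subseteq> frontier F then 1 else 0)" by (rule sum.swap)
  also have "\<dots> = (\<Sum>f\<in>B. card (Fs f))"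
    by (rule sum.cong[OF refl]) (simp add: finite_faces sum.If_cases Int_def Fs_def)
  finally show ?thesis .
qed

text \<open>The side of \<open>u\<close> is chosen smallest among all sides of bridges, so that it
  contains no further bridge.\<close>

lemma minimal_bridge:
  assumes "e0 \<in> E" "bridge e0"
  obtains e u v where "e \<in> E" "joins e u v" "e \<inter> V = {u, v}" "\<not> reach (E - {e}) u v"
    "\<And>e' u' v'. e' \<in> E \<Longrightarrow> e' \<inter> V = {u', v'} \<Longrightarrow> \<not> reach (E - {e'}) u' v' \<Longrightarrow>
      card {w. reach (E - {e}) u w} \<le> card {w. reach (E - {e'}) u' w}"
proof -
  define P where "P = (\<lambda>(e, u, v). e \<in> E \<and> e \<inter> V = {u, v} \<and> \<not> reach (E - {e}) u v)"
  obtain u0 v0 where "P (e0, u0, v0)" using assms unfolding bridge_def P_def by blast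
  then obtain t where t: "P t" "\<forall>y. P y \<longrightarrow> (\<lambda>(e, u, v). card {w. reach (E - {e}) u w}) t \<le> (\<lambda>(e, u, v). card {w. reach (E - {e}) u w}) y"
    using ex_has_least_nat[of P _ "\<lambda>(e, u, v). card {w. reach (E - {e}) u w}"] by blast
  obtain e u v where tt: "t = (e, u, v)" by (cases t) auto
  have e: "e \<in> E" "e \<inter> V = {u, v}" "\<not> reach (E - {e}) u v" using t(1) unfolding tt P_def by auto
  obtain a b where ab: "joins e a b" "e \<inter> V = {a, b}" using edge_ends[OF e(1)] by blast
  have "joins e u v"
  proof -
    have "{a, b} = {u, v}" using ab(2) e(2) by simp
    then have "a = u \<and> b = v \<or> a = v \<and> b = u" by (simp add: doubleton_eq_iff)
    then show ?thesis using ab(1) joins_sym by blast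
  qed
  moreover have "card {w. reach (E - {e}) u w} \<le> card {w. reach (E - {e'}) u' w}"
    if "e' \<in> E" "e' \<inter> V = {u', v'}" "\<not> reach (E - {e'}) u' v'" for e' u' v'
    using t(2)[rule_format, of "(e', u', v')"] that unfolding tt P_def by simp
  ultimately show ?thesis using that e by blast
qed

text \<open>Counted modulo 3, the edges of the smaller side of a bridge that lie on the face along the
  bridge number 2; these two edges would be parallel.\<close>
lemma no_bridge: "e0 \<in> E \<Longrightarrow> \<not> bridge e0"
proof
  assume e0: "e0 \<in> E" "bridge e0"
  obtain e u v where e: "e \<in> E" "joins e u v" "e \<inter> V = {u, v}" "\<not> reach (E - {e}) u v"
    and min: "\<And>e' u' v'. e' \<in> E \<Longrightarrow> e' \<inter> V = {u', v'} \<Longrightarrow> \<not> reach (E - {e'}) u' v' \<Longrightarrow>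
      card {w. reach (E - {e}) u w} \<le> card {w. reach (E - {e'}) u' w}"
    by (rule minimal_bridge[OF e0]) (rule that)
  define A where "A = {w. reach (E - {e}) u w}"
  define B where "B = {w. reach (E - {e}) v w}"
  define EA where "EA = {f \<in> E - {e}. f \<inter> V \<subseteq> A}"
  define EB where "EB = {f \<in> E - {e}. f \<inter> V \<subseteq> B}"
  note sp = bridge_split[OF e A_def B_def EA_def EB_def]
  have be: "bridge e" using bridge_iff[OF e(3)] e(4) by blast
  have AV: "A \<subseteq> V" "B \<subseteq> V" using sp(1) by blast+
  have fA: "finite A" using AV fin finite_subset by blast
  have uvd: "u \<noteq> v" using joins_facts(7)[OF e(2)] .
  have vA: "v \<notin> A" using sp(2,4) by blast
  have EAE: "EA \<subseteq> E" "EB \<subseteq> E" unfolding EA_def EB_def by blast+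
  have fEA: "finite EA" "finite EB" using EAE fin finite_subset by blast+
  have EAe: "e \<notin> EA" "e \<notin> EB" unfolding EA_def EB_def by blast+
  have nbA: "\<not> bridge f" if f: "f \<in> EA" for f
  proof
    assume b: "bridge f"
    have fE: "f \<in> E" "f \<noteq> e" "f \<inter> V \<subseteq> A" using f unfolding EA_def by blast+
    obtain x y where xy: "joins f x y" "f \<inter> V = {x, y}" using edge_ends[OF fE(1)] by blast
    have nr: "\<not> reach (E - {f}) x y" using b bridge_iff[OF xy(2)] by blast
    \<comment> \<open>Of the two ends of a bridge inside \<open>A\<close>, take the one that is cut
      off from \<open>u\<close>; its side is a proper subset of \<open>A\<close>.\<close>
    obtain z z' where z: "f \<inter> V = {z, z'}" "\<not> reach (E - {f}) z z'" "\<not> reach (E - {f}) z u"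
    proof (cases "reach (E - {f}) x u")
      case True
      have "\<not> reach (E - {f}) y u" using nr True reach_sym rtranclp_trans[of "stp (E - {f})" x u y] by blast
      moreover have "\<not> reach (E - {f}) y x" using nr reach_sym by blast
      moreover have "f \<inter> V = {y, x}" using xy(2) by (simp add: insert_commute)
      ultimately show ?thesis using that by blast
    qed (use that xy(2) nr in blast)
    have "z \<in> A" using z(1) fE(3) by blast
    have "w \<in> A" if "reach (E - {f}) z w" for w
      using that
    proof (induction rule: rtranclp_induct)
      case base show ?case by fact
    next
      case (step a b)
      obtain g where g: "g \<in> E - {f}" "g \<inter> V = {a, b}" using step(2) unfolding stp_def by blast
      show ?case
      proof (cases "g = e")
        case True
        then have "{a, b} = {u, v}" using g(2) e(3) by simp
        then have "a = u \<or> a = v" by (metis insert_iff singletonD)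
        then show ?thesis using step(1,3) z(3) vA by blast
      next
        case False
        then have "stp (E - {e}) a b" unfolding stp_def using g by blast
        then show ?thesis using step(3) rtranclp.rtrancl_into_rtrancl[of "stp (E - {e})" u a b] unfolding A_def by blast
      qed
    qed
    then have "{w. reach (E - {f}) z w} \<subset> A" using sp(3) z(3) by blast
    then have "card {w. reach (E - {f}) z w} < card A" using fA psubset_card_mono by blast
    then show False using min[OF fE(1) z(1,2)] A_def by simp
  qed
  have Eeq: "E = insert e (EA \<union> EB)" using sp(7) e(1) by blast
  have degsum: "3 * card A = 2 * card EA + 1"
  proof -
    have "(\<Sum>x\<in>A. card (inc x)) = (\<Sum>x\<in>A. 3)" by (rule sum.cong[OF refl]) (use deg AV in blast)
    then have "3 * card A = (\<Sum>f\<in>E. card (A \<inter> f))" using handshake[OF AV(1)] by simp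
    also have "\<dots> = card (A \<inter> e) + (\<Sum>f\<in>EA \<union> EB. card (A \<inter> f))"
      unfolding Eeq using EAe fEA by (subst sum.insert) auto
    also have "(\<Sum>f\<in>EA \<union> EB. card (A \<inter> f)) = (\<Sum>f\<in>EA. card (A \<inter> f)) + (\<Sum>f\<in>EB. card (A \<inter> f))"
      using fEA sp(8) by (rule sum.union_disjoint)
    also have "(\<Sum>f\<in>EA. card (A \<inter> f)) = (\<Sum>f\<in>EA. 2)"
    proof (rule sum.cong[OF refl])
      fix f assume f: "f \<in> EA"
      then have "A \<inter> f = f \<inter> V" using AV unfolding EA_def by blast
      then show "card (A \<inter> f) = 2" using edge_card f EAE by auto
    qed
    also have "(\<Sum>f\<in>EB. card (A \<inter> f)) = (\<Sum>f\<in>EB. 0)"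
    proof (rule sum.cong[OF refl])
      fix f assume f: "f \<in> EB"
      then have "f \<inter> V \<subseteq> B" unfolding EB_def by blast
      then have "A \<inter> f = {}" using AV sp(2) by blast
      then show "card (A \<inter> f) = 0" by simp
    qed
    also have "A \<inter> e = {u}"
    proof -
      have "A \<inter> e = A \<inter> (e \<inter> V)" using AV by blast
      then show ?thesis unfolding e(3) using vA sp(3) by auto
    qed
    finally show ?thesis by simp
  qed
  obtain F0 where F0: "Fs e = {F0}" using bridge_faces(1)[OF e(1) be] by (metis card_1_singletonE)
  have F0f: "F0 \<in> faces G" "e \<subseteq> frontier F0" using F0 unfolding Fs_def by blast+
  define n where "n = (\<lambda>F. card {f \<in> EA. f \<subseteq> frontier F})"
  \<comment> \<open>A face off the bridge has a connected frontier, which lies on one side of the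
    bridge. If it lies on the side \<open>A\<close>, all 3 or 6 sides of the face are counted once,
    since \<open>A\<close> has no bridges.\<close>
  have nmod: "3 dvd n F" if F: "F \<in> faces G" "F \<noteq> F0" for F
  proof -
    have nF: "F \<notin> Fs e" using F(2) F0 by blast
    then have ne: "\<not> e \<subseteq> frontier F" using F(1) unfolding Fs_def by blast
    then have "closure F \<inter> (e - V) = {}" using touch[OF e(1) F(1)] by blast
    moreover have "frontier F \<subseteq> closure F" unfolding frontier_def by blast
    ultimately have "frontier F \<inter> e \<subseteq> e \<inter> V" by blast
    then have fe: "frontier F \<inter> e \<subseteq> {u, v}" unfolding e(3) .
    have uvp: "u \<in> pts A EA" "v \<in> pts B EB" using sp(3,4) unfolding pts_def by blast+
    have sub: "frontier F \<subseteq> pts A EA \<union> pts B EB"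
      using frontier_face(1)[OF F(1)] fe uvp unfolding sp(14) by blast
    have "pts A EA \<inter> frontier F = {} \<or> pts B EB \<inter> frontier F = {}"
      by (rule connected_closedD[OF frontier_face(2)[OF F(1)] _ sub])
        (use sp(11) sub_compact[OF sp(5)] sub_compact[OF sp(6)] compact_imp_closed in auto)
    then show ?thesis
    proof
      assume a: "pts A EA \<inter> frontier F = {}"
      have "\<not> f \<subseteq> frontier F" if f: "f \<in> EA" for f
      proof -
        have "f \<subseteq> pts A EA" unfolding pts_def using f by blast
        moreover have "f \<noteq> {}" using edge_facts(5) f EAE by blast
        ultimately show ?thesis using a by blast
      qed
      then have 0: "{f \<in> EA. f \<subseteq> frontier F} = {}" by blast
      show ?thesis unfolding n_def 0 by simp
    next
      assume a: "pts B EB \<inter> frontier F = {}"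
      have "\<not> f \<subseteq> frontier F" if f: "f \<in> EB" for f
      proof -
        have "f \<subseteq> pts B EB" unfolding pts_def using f by blast
        moreover have "f \<noteq> {}" using edge_facts(5) f EAE by blast
        ultimately show ?thesis using a by blast
      qed
      then have eq: "{f \<in> E. f \<subseteq> frontier F} = {f \<in> EA. f \<subseteq> frontier F}"
        using Eeq ne by auto
      have "sides G F = (\<Sum>f\<in>{f \<in> EA. f \<subseteq> frontier F}. 1)"
        unfolding sides_eq[OF F(1)] eq by (rule sum.cong[OF refl]) (use nbA in auto)
      then have "sides G F = n F" unfolding n_def by simp
      then show ?thesis using face_sides[OF F(1)] by auto
    qed
  qed
  have "(\<Sum>F\<in>faces G. n F) = (\<Sum>f\<in>EA. card (Fs f))" unfolding n_def by (rule faces_sum[OF EAE(1)])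
  also have "\<dots> = (\<Sum>f\<in>EA. 2)"
    by (rule sum.cong[OF refl]) (use nonbridge_faces'(1) nbA EAE in blast)
  finally have "n F0 + (\<Sum>F\<in>faces G - {F0}. n F) = 2 * card EA"
    using sum.remove[OF finite_faces F0f(1), of n] by simp
  moreover have "3 dvd (\<Sum>F\<in>faces G - {F0}. n F)" by (rule dvd_sum) (use nmod in blast)
  \<comment> \<open>By \<open>degsum\<close>, twice the number of edges in \<open>EA\<close> is 2
    modulo 3.\<close>
  ultimately have n3: "n F0 mod 3 = 2" using degsum by presburger
  let ?S = "{f \<in> EA. f \<subseteq> frontier F0}"
  have "n F0 + 2 \<le> sides G F0"
  proof -
    have "(\<Sum>f\<in>insert e ?S. if bridge f then 2 else 1) \<le> sides G F0"
      unfolding sides_eq[OF F0f(1)] by (rule sum_mono2) (use fin EAE e(1) F0f(2) in auto)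
    also have "(\<Sum>f\<in>insert e ?S. if bridge f then 2 else 1) = 2 + (\<Sum>f\<in>?S. if bridge f then 2 else (1::nat))"
      using be EAe fEA by (subst sum.insert) auto
    also have "(\<Sum>f\<in>?S. if bridge f then 2 else (1::nat)) = (\<Sum>f\<in>?S. 1)"
      by (rule sum.cong[OF refl]) (use nbA in auto)
    finally show ?thesis unfolding n_def by simp
  qed
  \<comment> \<open>The bridge takes two of the at most six sides of \<open>F0\<close>; among 0 to 4
    only 2 has the right residue.\<close>
  then have "n F0 = 2" using n3 face_sides[OF F0f(1)] by presburger
  then obtain f g where fg: "?S = {f, g}" "f \<noteq> g" unfolding n_def by (meson card_2_iff)
  have fgS: "f \<in> ?S" "g \<in> ?S" unfolding fg(1) by simp_all
  \<comment> \<open>At an end other than \<open>u\<close> all edges belong to \<open>EA\<close>, so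
    the face \<open>F0\<close> can turn only from one of the two edges into the other.\<close>
  have other: "x \<in> k" if h: "h \<in> ?S" "x \<in> h" "x \<in> V" "x \<noteq> u" and k: "k \<in> {f, g}" "k \<noteq> h" for h k x
  proof -
    have hE: "h \<in> E" "h \<in> EA" "F0 \<in> Fs h" using h(1) EAE F0f(1) unfolding Fs_def by blast+
    have xA: "x \<in> A" using hE(2) h(2,3) unfolding EA_def by blast
    have ix: "inc x \<subseteq> EA"
    proof
      fix m assume m: "m \<in> inc x"
      then have mE: "m \<in> E" "x \<in> m" unfolding inc_def by blast+
      have "m \<noteq> e"
      proof
        assume "m = e"
        then have "x \<in> e \<inter> V" using mE h(3) by blast
        then show False unfolding e(3) using h(4) xA vA by blast
      qed
      moreover have "m \<notin> EB"
      proof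
        assume "m \<in> EB"
        then have "x \<in> B" using mE(2) h(3) unfolding EB_def by blast
        then show False using xA sp(2) by blast
      qed
      ultimately show "m \<in> EA" using mE(1) Eeq by blast
    qed
    have "h \<in> inc x" using hE(1) h(2) unfolding inc_def by blast
    then obtain f' where f': "f' \<in> inc x" "f' \<noteq> h" "{g \<in> inc x. F0 \<in> Fs g} = {h, f'}"
      using corner_two[OF h(3) _ _ hE(3)] nbA ix by blast
    have "F0 \<in> Fs f'" using f'(3) by blast
    then have "f' \<in> ?S" using f'(1) ix unfolding Fs_def by blast
    then have "f' = k" using k f'(2) h(1) unfolding fg(1) by blast
    then show ?thesis using f'(1) unfolding inc_def by blast
  qed
  have 1: "f \<inter> V - {u} = g \<inter> V - {u}"
    using other[OF fgS(1), of _ g] other[OF fgS(2), of _ f] fg(2) by blast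
  have fE: "f \<in> E" "g \<in> E" using fgS EAE by blast+
  have c: "card (f \<inter> V) = 2" "card (g \<inter> V) = 2" "finite (f \<inter> V)" "finite (g \<inter> V)"
    using edge_card fE fin by auto
  have "u \<in> f \<inter> V \<longleftrightarrow> u \<in> g \<inter> V"
    using 1 c by (metis Diff_empty Diff_insert0 card_Suc_Diff1 n_not_Suc_n)
  then have "f \<inter> V = g \<inter> V" using 1 by blast
  then show False using edges_eqI[OF fE] fg(2) by blast
qed

lemma card_Fs: "e \<in> E \<Longrightarrow> card (Fs e) = 2"
  using nonbridge_faces'(1) no_bridge by blast

lemma sides_card: "F \<in> faces G \<Longrightarrow> sides G F = card {e \<in> E. e \<subseteq> frontier F}"
proof -
  assume F: "F \<in> faces G"
  have "sides G F = (\<Sum>e\<in>{e \<in> E. e \<subseteq> frontier F}. 1)"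
    unfolding sides_eq[OF F] by (rule sum.cong[OF refl]) (use no_bridge in auto)
  then show ?thesis by simp
qed

lemma card_E: "2 * card E = 3 * card V"
proof -
  have "(\<Sum>x\<in>V. card (inc x)) = (\<Sum>x\<in>V. 3)" by (rule sum.cong[OF refl]) (use deg in blast)
  moreover have "(\<Sum>f\<in>E. card (V \<inter> f)) = (\<Sum>f\<in>E. 2)"
    by (rule sum.cong[OF refl]) (use edge_card in \<open>simp add: Int_commute\<close>)
  ultimately show ?thesis using handshake[OF order_refl] by simp
qed

text \<open>With T triangles and H hexagons, 2E = 3V and 3T + 6H = 2E turn E + 2 \<le> T + H + V
  into T \<ge> 4.\<close>

lemma four_triangles: "4 \<le> card {F \<in> faces G. sides G F = 3}"
proof -
  let ?T = "{F \<in> faces G. sides G F = 3}" and ?H = "{F \<in> faces G. sides G F \<noteq> 3}"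
  have u: "faces G = ?T \<union> ?H" "?T \<inter> ?H = {}" by blast+
  have f: "finite ?T" "finite ?H" using finite_faces by auto
  have cf: "card (faces G) = card ?T + card ?H" using card_Un_disjoint[OF f u(2)] u(1) by simp
  have "(\<Sum>F\<in>faces G. sides G F) = (\<Sum>F\<in>?T. sides G F) + (\<Sum>F\<in>?H. sides G F)"
    using sum.union_disjoint[OF f u(2), of "sides G"] u(1) by simp
  also have "(\<Sum>F\<in>?T. sides G F) = (\<Sum>F\<in>?T. 3)" by (rule sum.cong[OF refl]) blast
  also have "(\<Sum>F\<in>?H. sides G F) = (\<Sum>F\<in>?H. 6)" by (rule sum.cong[OF refl]) (use face_sides in blast)
  finally have "(\<Sum>F\<in>faces G. sides G F) = 3 * card ?T + 6 * card ?H" by simp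
  moreover have "(\<Sum>F\<in>faces G. sides G F) = 2 * card E"
    using faces_sum[OF order_refl] sides_card card_Fs by simp
  ultimately show ?thesis using euler_ge card_E cf by simp
qed

end

section \<open>Flags of a trihex\<close>

context trihex_gr
begin

definition flags :: "(complex \<times> complex set \<times> complex set) set" where
  "flags = {(v, e, F). v \<in> V \<and> e \<in> inc v \<and> F \<in> Fs e}"

lemma flag_iff: "(v, e, F) \<in> flags \<longleftrightarrow> v \<in> V \<and> e \<in> E \<and> v \<in> e \<and> F \<in> Fs e"
  unfolding flags_def inc_def by blast

lemma flag_struct:
  assumes "(v, e, F) \<in> flags"
  obtains f g F' H where "inc v = {e, f, g}" "e \<noteq> f" "e \<noteq> g" "f \<noteq> g"
    "Fs e = {F, F'}" "Fs f = {F, H}" "Fs g = {F', H}" "F \<noteq> F'" "F \<noteq> H" "F' \<noteq> H"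
proof -
  have v: "v \<in> V" "e \<in> inc v" "F \<in> Fs e" using assms unfolding flags_def by blast+
  obtain e1 e2 e3 where i: "inc v = {e1, e2, e3}" "e1 \<noteq> e2" "e1 \<noteq> e3" "e2 \<noteq> e3" by (rule inc3[OF v(1)])
  obtain f g where fg: "inc v = {e, f, g}" "e \<noteq> f" "e \<noteq> g" "f \<noteq> g"
  proof -
    consider "e = e1" | "e = e2" | "e = e3" using v(2) unfolding i by blast
    then show ?thesis
    proof cases
      case 1 then show ?thesis using that[of e2 e3] i by simp
    next
      case 2
      have "inc v = {e2, e1, e3}" using i(1) by (simp add: insert_commute)
      then show ?thesis using that[of e1 e3] i(2-4) 2 by simp
    next
      case 3
      have "inc v = {e3, e1, e2}" using i(1) by (simp add: insert_commute)
      then show ?thesis using that[of e1 e2] i(2-4) 3 by simp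
    qed
  qed
  have nb: "\<not> bridge d" if "d \<in> inc v" for d using no_bridge that unfolding inc_def by blast
  obtain X Y Z where x: "X \<noteq> Y" "X \<noteq> Z" "Y \<noteq> Z" "Fs e = {X, Y}" "Fs f = {X, Z}" "Fs g = {Y, Z}"
    by (rule corners[OF v(1) nb fg])
  consider "F = X" | "F = Y" using v(3) unfolding x by blast
  then show ?thesis
  proof cases
    case 1 then show ?thesis using that[of f g Y Z] fg x by simp
  next
    case 2
    have "inc v = {e, g, f}" "Fs e = {Y, X}" using fg(1) x(4) by (simp_all add: insert_commute)
    then show ?thesis using that[of g f X Z] fg(2-4) x(1-3,5,6) 2 by simp
  qed
qed

definition opp :: "complex \<Rightarrow> complex set \<Rightarrow> complex" where
  "opp v e = (THE w. e \<inter> V = {v, w})"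
definition nxt :: "complex \<Rightarrow> complex set \<Rightarrow> complex set \<Rightarrow> complex set" where
  "nxt v e F = (THE f. f \<in> inc v \<and> f \<noteq> e \<and> F \<in> Fs f)"
definition oth :: "complex set \<Rightarrow> complex set \<Rightarrow> complex set" where
  "oth e F = (THE F'. F' \<in> Fs e \<and> F' \<noteq> F)"

lemma opp_eq: "e \<inter> V = {v, w} \<Longrightarrow> opp v e = w"
  unfolding opp_def by (rule the_equality) (auto simp: doubleton_eq_iff)

lemma oth_eq: "Fs e = {F, F'} \<Longrightarrow> F \<noteq> F' \<Longrightarrow> oth e F = F'"
  unfolding oth_def by (rule the_equality) auto

lemma nxt_eq:
  assumes "inc v = {e, f, g}" "e \<noteq> f" "F \<in> Fs f" "F \<notin> Fs g"
  shows "nxt v e F = f"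
  unfolding nxt_def using assms by (intro the_equality) auto

text \<open>These three maps are the identity off the flags, so that their relations hold for all
  arguments.\<close>

definition r0 :: "complex \<times> complex set \<times> complex set \<Rightarrow> complex \<times> complex set \<times> complex set" where
  "r0 x = (if x \<in> flags then case x of (v, e, F) \<Rightarrow> (opp v e, e, F) else x)"
definition r1 :: "complex \<times> complex set \<times> complex set \<Rightarrow> complex \<times> complex set \<times> complex set" where
  "r1 x = (if x \<in> flags then case x of (v, e, F) \<Rightarrow> (v, nxt v e F, F) else x)"
definition r2 :: "complex \<times> complex set \<times> complex set \<Rightarrow> complex \<times> complex set \<times> complex set" where
  "r2 x = (if x \<in> flags then case x of (v, e, F) \<Rightarrow> (v, e, oth e F) else x)"

lemma r0_flag:
  assumes "(v, e, F) \<in> flags"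
  obtains w where "r0 (v, e, F) = (w, e, F)" "(w, e, F) \<in> flags" "r0 (w, e, F) = (v, e, F)" "w \<noteq> v"
    "e \<inter> V = {v, w}"
proof -
  have v: "v \<in> V" "e \<in> E" "v \<in> e" "F \<in> Fs e" using assms flag_iff by blast+
  obtain w where w: "e \<inter> V = {v, w}" "w \<noteq> v" "w \<in> V" "w \<in> e" by (rule edge_at[OF v(2,1,3)])
  have w': "(w, e, F) \<in> flags" using w v flag_iff by blast
  have "e \<inter> V = {w, v}" using w(1) by (simp add: insert_commute)
  then have "opp w e = v" "opp v e = w" using opp_eq w(1) by blast+
  then show ?thesis using that[of w] w w' assms unfolding r0_def by simp
qed

text \<open>All identities at a vertex are read off from one closed cycle of six flags in which
  \<open>r1\<close> and \<open>r2\<close> alternate.\<close>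

lemma flag_orbit:
  assumes x: "(v, e, F) \<in> flags"
  obtains f g F' H where "inc v = {e, f, g}" "e \<noteq> f" "e \<noteq> g" "f \<noteq> g"
    "Fs e = {F, F'}" "Fs f = {F, H}" "Fs g = {F', H}" "F \<noteq> F'" "F \<noteq> H" "F' \<noteq> H"
    "r2 (v, e, F) = (v, e, F')" "r1 (v, e, F) = (v, f, F)" "r2 (v, f, F) = (v, f, H)" "r1 (v, f, F) = (v, e, F)"
    "r1 (v, f, H) = (v, g, H)" "r2 (v, g, H) = (v, g, F')" "r1 (v, g, F') = (v, e, F')" "r2 (v, e, F') = (v, e, F)"
    "r1 (v, e, F') = (v, g, F')" "r2 (v, g, F') = (v, g, H)"
    "{(v, e, F), (v, e, F'), (v, f, F), (v, f, H), (v, g, F'), (v, g, H)} \<subseteq> flags"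
proof -
  obtain f g F' H where s: "inc v = {e, f, g}" "e \<noteq> f" "e \<noteq> g" "f \<noteq> g"
    "Fs e = {F, F'}" "Fs f = {F, H}" "Fs g = {F', H}" "F \<noteq> F'" "F \<noteq> H" "F' \<noteq> H"
    by (rule flag_struct[OF x])
  have V: "v \<in> V" using x flag_iff by blast
  have m: "e \<in> inc v" "f \<in> inc v" "g \<in> inc v" unfolding s(1) by simp_all
  have fl: "(v, d, K) \<in> flags \<longleftrightarrow> K \<in> Fs d" if "d \<in> inc v" for d K using that V unfolding flags_def by blast
  have flg: "(v, e, F) \<in> flags" "(v, e, F') \<in> flags" "(v, f, F) \<in> flags" "(v, f, H) \<in> flags"
    "(v, g, F') \<in> flags" "(v, g, H) \<in> flags"
    unfolding fl[OF m(1)] fl[OF m(2)] fl[OF m(3)] s(5-7) by simp_all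
  have i: "inc v = {e, g, f}" "inc v = {f, e, g}" "inc v = {f, g, e}" "inc v = {g, e, f}" "inc v = {g, f, e}"
    unfolding s(1) by (simp_all add: insert_commute)
  have Fe: "Fs e = {F', F}" "Fs f = {H, F}" "Fs g = {H, F'}" unfolding s(5-7) by (simp_all add: insert_commute)
  have n: "nxt v e F = f" "nxt v f F = e" "nxt v f H = g" "nxt v g F' = e" "nxt v e F' = g"
    using nxt_eq[OF s(1)] nxt_eq[OF i(1)] nxt_eq[OF i(2)] nxt_eq[OF i(3)] nxt_eq[OF i(4)] s(2-10) by auto
  have o: "oth e F = F'" "oth f F = H" "oth g H = F'" "oth e F' = F" "oth g F' = H"
    using oth_eq[OF s(5)] oth_eq[OF s(6)] oth_eq[OF s(7)] oth_eq[OF Fe(1)] oth_eq[OF Fe(3)] s(8-10) by auto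
  show ?thesis by (rule that[OF s]) (use flg in \<open>simp_all add: r1_def r2_def n o\<close>)
qed

lemma r_flags: "x \<in> flags \<Longrightarrow> r0 x \<in> flags" "x \<in> flags \<Longrightarrow> r1 x \<in> flags" "x \<in> flags \<Longrightarrow> r2 x \<in> flags"
proof -
  assume x: "x \<in> flags"
  obtain v e F where e: "x = (v, e, F)" by (cases x)
  show "r0 x \<in> flags" unfolding e by (rule r0_flag[OF x[unfolded e]]) simp
  show "r1 x \<in> flags" unfolding e by (rule flag_orbit[OF x[unfolded e]]) simp
  show "r2 x \<in> flags" unfolding e by (rule flag_orbit[OF x[unfolded e]]) simp
qed

lemma r_out: "x \<notin> flags \<Longrightarrow> r0 x = x" "x \<notin> flags \<Longrightarrow> r1 x = x" "x \<notin> flags \<Longrightarrow> r2 x = x"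
  unfolding r0_def r1_def r2_def by simp_all

lemma r_inv: "r0 (r0 x) = x" "r1 (r1 x) = x" "r2 (r2 x) = x"
proof -
  have "r0 (r0 x) = x \<and> r1 (r1 x) = x \<and> r2 (r2 x) = x"
  proof (cases "x \<in> flags")
    case True
    obtain v e F where e: "x = (v, e, F)" by (cases x)
    have "r0 (r0 x) = x" unfolding e by (rule r0_flag[OF True[unfolded e]]) simp
    moreover have "r1 (r1 x) = x \<and> r2 (r2 x) = x" unfolding e by (rule flag_orbit[OF True[unfolded e]]) simp
    ultimately show ?thesis by blast
  qed (simp add: r_out)
  then show "r0 (r0 x) = x" "r1 (r1 x) = x" "r2 (r2 x) = x" by blast+
qed

lemma r_comm: "r0 (r2 x) = r2 (r0 x)"
proof (cases "x \<in> flags")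
  case True
  obtain v e F where x: "x = (v, e, F)" by (cases x)
  obtain w where w: "r0 (v, e, F) = (w, e, F)" "(w, e, F) \<in> flags" "e \<inter> V = {v, w}"
    by (rule r0_flag[OF True[unfolded x]])
  have "r2 (v, e, F) = (v, e, oth e F)" "r2 (w, e, F) = (w, e, oth e F)"
    using w(2) True x unfolding r2_def by simp_all
  moreover have "(v, e, oth e F) \<in> flags" using r_flags(3)[OF True] calculation(1) x by simp
  then have "r0 (v, e, oth e F) = (w, e, oth e F)" unfolding r0_def using opp_eq[OF w(3)] by simp
  ultimately show ?thesis using w(1) x by simp
qed (simp add: r_out)

lemma r_vertex: "r2 (r1 (r2 (r1 (r2 (r1 x))))) = x"
proof (cases "x \<in> flags")
  case True
  obtain v e F where e: "x = (v, e, F)" by (cases x)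
  show ?thesis unfolding e by (rule flag_orbit[OF True[unfolded e]]) simp
qed (simp add: r_out)

lemma r_free: "x \<in> flags \<Longrightarrow> r0 x \<noteq> x" "x \<in> flags \<Longrightarrow> r1 x \<noteq> x" "x \<in> flags \<Longrightarrow> r0 (r2 x) \<noteq> x"
proof -
  assume x: "x \<in> flags"
  obtain v e F where e: "x = (v, e, F)" by (cases x)
  have *: "fst (r0 y) \<noteq> fst y" if "y \<in> flags" for y
  proof -
    obtain v e F where y: "y = (v, e, F)" by (cases y)
    show ?thesis unfolding y by (rule r0_flag[OF that[unfolded y]]) simp
  qed
  show "r0 x \<noteq> x" using *[OF x] by auto
  show "r1 x \<noteq> x" unfolding e by (rule flag_orbit[OF x[unfolded e]]) auto
  have "fst (r2 x) = fst x" unfolding r2_def by (simp split: prod.split)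
  then show "r0 (r2 x) \<noteq> x" using *[OF r_flags(3)[OF x]] by auto
qed

lemma fst_r: "fst (r1 x) = fst x" "fst (r2 x) = fst x"
  unfolding r1_def r2_def by (simp_all split: prod.split)

lemma same_vertex:
  assumes "x \<in> flags" "y \<in> flags" "fst x = fst y"
  shows "y \<in> {x, r2 x, r1 x, r2 (r1 x), r1 (r2 x), r2 (r1 (r2 x))}"
proof -
  obtain v e F where x: "x = (v, e, F)" by (cases x)
  obtain e' K where y: "y = (v, e', K)" using assms(3) x by (cases y) auto
  have y': "e' \<in> inc v" "K \<in> Fs e'" using assms(2) unfolding y flags_def by blast+
  obtain f g F' H where fo: "inc v = {e, f, g}" "Fs e = {F, F'}" "Fs f = {F, H}" "Fs g = {F', H}"
    "r2 (v, e, F) = (v, e, F')" "r1 (v, e, F) = (v, f, F)" "r2 (v, f, F) = (v, f, H)"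
    "r1 (v, e, F') = (v, g, F')" "r2 (v, g, F') = (v, g, H)"
    by (rule flag_orbit[OF assms(1)[unfolded x]])
  have "e' = e \<and> (K = F \<or> K = F') \<or> e' = f \<and> (K = F \<or> K = H) \<or> e' = g \<and> (K = F' \<or> K = H)"
  proof -
    have "e' = e \<or> e' = f \<or> e' = g" using y'(1) unfolding fo(1) by simp
    moreover have "K \<in> Fs e \<Longrightarrow> K = F \<or> K = F'" "K \<in> Fs f \<Longrightarrow> K = F \<or> K = H" "K \<in> Fs g \<Longrightarrow> K = F' \<or> K = H"
      unfolding fo(2-4) by simp_all
    ultimately show ?thesis using y'(2) by metis
  qed
  then show ?thesis unfolding x y by (elim disjE conjE) (simp_all add: fo(5-9))
qed

definition fstep where "fstep x y \<longleftrightarrow> y = r0 x \<or> y = r1 x \<or> y = r2 x"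

lemma same_vertex_reach: "x \<in> flags \<Longrightarrow> y \<in> flags \<Longrightarrow> fst x = fst y \<Longrightarrow> fstep\<^sup>*\<^sup>* x y"
proof -
  assume a: "x \<in> flags" "y \<in> flags" "fst x = fst y"
  have s: "fstep x (r1 x)" "fstep x (r2 x)" for x unfolding fstep_def by simp_all
  have "fstep\<^sup>*\<^sup>* x (r2 x)" "fstep\<^sup>*\<^sup>* x (r1 x)" "fstep\<^sup>*\<^sup>* x (r2 (r1 x))" "fstep\<^sup>*\<^sup>* x (r1 (r2 x))"
    "fstep\<^sup>*\<^sup>* x (r2 (r1 (r2 x)))" using s by (meson rtranclp.rtrancl_into_rtrancl rtranclp.rtrancl_refl)+
  then show ?thesis using same_vertex[OF a] by auto
qed

lemma Fs_ne: "e \<in> E \<Longrightarrow> \<exists>F. F \<in> Fs e"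
  using card_Fs[of e] by (metis card.empty equals0I zero_neq_numeral)

lemma flags_reach:
  assumes x: "x \<in> flags" and y: "y \<in> flags"
  shows "fstep\<^sup>*\<^sup>* x y"
proof -
  have "\<forall>y\<in>flags. fst y = w \<longrightarrow> fstep\<^sup>*\<^sup>* x y" if "reach E (fst x) w" for w
    using that
  proof (induction rule: rtranclp_induct)
    case base then show ?case using same_vertex_reach[OF x] by auto
  next
    case (step a b)
    obtain e where e: "e \<in> E" "e \<inter> V = {a, b}" using step(2) unfolding stp_def by blast
    obtain F where F: "F \<in> Fs e" using Fs_ne e(1) by blast
    have ab: "a \<in> V" "a \<in> e" using e(2) by blast+
    have fl: "(a, e, F) \<in> flags" using flag_iff e(1) F ab by blast
    have "r0 (a, e, F) = (b, e, F)" using fl opp_eq[OF e(2)] unfolding r0_def by simp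
    then have st: "fstep (a, e, F) (b, e, F)" unfolding fstep_def by simp
    have bf: "(b, e, F) \<in> flags" using r_flags(1)[OF fl] \<open>r0 (a, e, F) = (b, e, F)\<close> by simp
    have "fstep\<^sup>*\<^sup>* x (a, e, F)" using step(3) fl by simp
    then have xb: "fstep\<^sup>*\<^sup>* x (b, e, F)" using st by (rule rtranclp.rtrancl_into_rtrancl)
    show ?case
    proof (intro ballI impI)
      fix y assume "y \<in> flags" "fst y = b"
      then have "fstep\<^sup>*\<^sup>* (b, e, F) y" using same_vertex_reach[OF bf] by (metis fst_conv)
      then show "fstep\<^sup>*\<^sup>* x y" using xb by simp
    qed
  qed
  moreover have "fst x \<in> V" "fst y \<in> V" using x y unfolding flags_def by auto
  ultimately show ?thesis using conn y by blast
qed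

lemma finite_flags: "finite flags"
proof -
  have "flags \<subseteq> V \<times> E \<times> faces G" unfolding flags_def inc_def Fs_def by blast
  then show ?thesis using fin finite_faces by (meson finite_SigmaI finite_subset)
qed

definition face_flags where "face_flags F = {x \<in> flags. snd (snd x) = F}"

lemma card_face_flags:
  assumes F: "F \<in> faces G"
  shows "card (face_flags F) = 2 * sides G F"
proof -
  let ?EF = "{e \<in> E. e \<subseteq> frontier F}"
  have "face_flags F = (\<lambda>(e, v). (v, e, F)) ` (SIGMA e:?EF. e \<inter> V)"
    unfolding face_flags_def flags_def inc_def Fs_def using F by (auto simp: image_iff)
  moreover have "inj_on (\<lambda>(e, v). (v, e, F)) (SIGMA e:?EF. e \<inter> V)" by (auto intro: inj_onI)
  ultimately have "card (face_flags F) = card (SIGMA e:?EF. e \<inter> V)" by (simp add: card_image)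
  also have "\<dots> = (\<Sum>e\<in>?EF. card (e \<inter> V))" by (rule card_SigmaI) (use fin in auto)
  also have "\<dots> = (\<Sum>e\<in>?EF. 2)" by (rule sum.cong[OF refl]) (use edge_card in blast)
  finally show ?thesis using sides_card[OF F] by simp
qed

definition cstep where "cstep x y \<longleftrightarrow> y = r0 x \<or> y = r1 x"

lemma r01_face: "x \<in> flags \<Longrightarrow> snd (snd (r0 x)) = snd (snd x)" "snd (snd (r1 x)) = snd (snd x)"
  unfolding r0_def r1_def by (simp_all split: prod.split)

text \<open>The boundary of a face is connected, so one closed walk around the face uses all of its edges.\<close>
lemma face_walk:
  assumes x: "x \<in> face_flags F" and F: "F \<in> faces G" and y: "y \<in> face_flags F"
  shows "cstep\<^sup>*\<^sup>* x y"
proof -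
  have O: "z \<in> face_flags F" if "cstep\<^sup>*\<^sup>* x z" for z
    using that by (induction rule: rtranclp_induct)
      (use x r_flags r01_face in \<open>auto simp: cstep_def face_flags_def\<close>)
  let ?EF = "{e \<in> E. e \<subseteq> frontier F}"
  define P where "P = {e \<in> ?EF. \<exists>v. cstep\<^sup>*\<^sup>* x (v, e, F)}"
  define P1 where "P1 = \<Union>P"
  define Q where "Q = \<Union>(?EF - P) \<union> ((V \<inter> frontier F) - P1)"
  have cl: "closed P1" "closed Q" unfolding P1_def Q_def P_def
    by (intro closed_Un closed_Union finite_imp_closed; use fin edge_facts(2) in simp)+
  have st: "cstep\<^sup>*\<^sup>* x (r0 z)" "cstep\<^sup>*\<^sup>* x (r1 z)" if "cstep\<^sup>*\<^sup>* x z" for z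
    by (rule rtranclp.rtrancl_into_rtrancl[OF that], simp add: cstep_def)+
  have both: "cstep\<^sup>*\<^sup>* x (v, e, F)" if e: "e \<in> P" "v \<in> e" "v \<in> V" for e v
  proof -
    obtain w where w: "cstep\<^sup>*\<^sup>* x (w, e, F)" using e(1) unfolding P_def by blast
    have fl: "(w, e, F) \<in> flags" using O[OF w] unfolding face_flags_def by simp
    obtain w' where w': "r0 (w, e, F) = (w', e, F)" "e \<inter> V = {w, w'}" by (rule r0_flag[OF fl])
    have "v \<in> e \<inter> V" using e by simp
    then have "v = w \<or> v = w'" unfolding w'(2) by simp
    then show ?thesis using w st(1)[OF w] w'(1) by auto
  qed
  have dis: "P1 \<inter> Q = {}"
  proof (rule ccontr)
    assume "P1 \<inter> Q \<noteq> {}"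
    then obtain e f z where ef: "e \<in> P" "f \<in> ?EF - P" "z \<in> e" "z \<in> f" unfolding P1_def Q_def by blast
    have eE: "e \<in> E" "f \<in> E" "e \<noteq> f" using ef unfolding P_def by blast+
    have zV: "z \<in> V" using edges_Int[OF eE] ef(3,4) by blast
    have ze: "cstep\<^sup>*\<^sup>* x (z, e, F)" using both[OF ef(1,3) zV] .
    have fl: "(z, e, F) \<in> flags" using O[OF ze] unfolding face_flags_def by simp
    obtain f' g F' H where fo: "inc z = {e, f', g}" "Fs g = {F', H}" "F \<noteq> F'" "F \<noteq> H" "r1 (z, e, F) = (z, f', F)"
      by (rule flag_orbit[OF fl])
    have "f \<in> inc z" using eE(2) ef(4) unfolding inc_def by blast
    moreover have "F \<in> Fs f" using ef(2) F unfolding Fs_def by blast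
    ultimately have "f = f'" using fo eE(3) by auto
    then have "cstep\<^sup>*\<^sup>* x (z, f, F)" using st(2)[OF ze] fo(5) by simp
    then have "f \<in> P" using ef(2) unfolding P_def by blast
    then show False using ef(2) by blast
  qed
  have sub: "frontier F \<subseteq> P1 \<union> Q"
  proof
    fix z assume z: "z \<in> frontier F"
    then have "z \<in> pts V E" using frontier_face(1)[OF F] by blast
    show "z \<in> P1 \<union> Q"
    proof (cases "z \<in> V")
      case True then show ?thesis using z unfolding Q_def by blast
    next
      case False
      then obtain e where e: "e \<in> E" "z \<in> e" using \<open>z \<in> pts V E\<close> unfolding pts_def by blast
      have "closure F \<inter> (e - V) \<noteq> {}" using z False e unfolding frontier_def by blast
      then have "e \<in> ?EF" using touch[OF e(1) F] e(1) by blast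
      then show ?thesis using e(2) unfolding Q_def P1_def by blast
    qed
  qed
  obtain v e where xe: "x = (v, e, F)" using x unfolding face_flags_def by (cases x) auto
  have "e \<in> P" using x unfolding P_def xe face_flags_def flags_def inc_def Fs_def by auto
  then have Pe: "e \<subseteq> P1" "e \<subseteq> frontier F" "e \<noteq> {}" using edge_facts(5) unfolding P1_def P_def by blast+
  have "P1 \<inter> frontier F = {} \<or> Q \<inter> frontier F = {}"
    by (rule connected_closedD[OF frontier_face(2)[OF F] _ sub cl]) (use dis in blast)
  then have Q0: "Q \<inter> frontier F = {}" using Pe by blast
  obtain w d where yd: "y = (w, d, F)" using y unfolding face_flags_def by (cases y) auto
  have d: "d \<in> ?EF" "w \<in> d" "w \<in> V" using y unfolding yd face_flags_def flags_def inc_def Fs_def by auto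
  have "d \<in> P"
  proof (rule ccontr)
    assume "d \<notin> P"
    then have "d \<subseteq> Q" using d(1) unfolding Q_def by blast
    then show False using Q0 d(1,2) by blast
  qed
  then show ?thesis using both d yd by blast
qed

end

text \<open>The two involutions generate a dihedral group. As neither has a fixed point, no
  reflection agrees with a rotation at any point, so the orbit consists of two disjoint cycles of
  \<open>r0 \<circ> r1\<close> of equal length.\<close>

lemma dihedral_orbit:
  fixes r0 r1 :: "'f \<Rightarrow> 'f"
  assumes inv: "\<And>x. r0 (r0 x) = x" "\<And>x. r1 (r1 x) = x"
    and fO: "finite W" and xO: "x \<in> W" and cl: "\<And>y. y \<in> W \<Longrightarrow> r0 y \<in> W" "\<And>y. y \<in> W \<Longrightarrow> r1 y \<in> W"
    and free: "\<And>y. y \<in> W \<Longrightarrow> r0 y \<noteq> y" "\<And>y. y \<in> W \<Longrightarrow> r1 y \<noteq> y"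
    and reach: "\<And>y. y \<in> W \<Longrightarrow> (\<lambda>a b. b = r0 a \<or> b = r1 a)\<^sup>*\<^sup>* x y"
    and card: "card W = 2 * s"
  shows "((r0 \<circ> r1) ^^ s) x = x"
proof -
  define c where "c = r0 \<circ> r1"
  have c_in: "(c ^^ i) y \<in> W" if "y \<in> W" for i y
    by (induction i) (use that cl in \<open>auto simp: c_def\<close>)
  have injc: "inj c" unfolding c_def by (rule injI) (metis comp_apply inv)
  have injn: "inj (c ^^ i)" for i using injc by (rule inj_fn)
  have add: "(c ^^ (i + j)) y = (c ^^ i) ((c ^^ j) y)" for i j y by (simp add: funpow_add)
  have "\<not> inj_on (\<lambda>i. (c ^^ i) x) UNIV"
  proof
    assume "inj_on (\<lambda>i. (c ^^ i) x) UNIV"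
    then have "infinite (range (\<lambda>i. (c ^^ i) x))" using finite_imageD infinite_UNIV_nat by blast
    moreover have "range (\<lambda>i. (c ^^ i) x) \<subseteq> W" using c_in xO by blast
    ultimately show False using fO finite_subset by blast
  qed
  then obtain i j where "i < j" "(c ^^ i) x = (c ^^ j) x" unfolding inj_on_def by (metis nat_neq_iff UNIV_I)
  then have "(c ^^ i) x = (c ^^ i) ((c ^^ (j - i)) x)" using add[of i "j - i" x] by simp
  then have ex: "\<exists>n>0. (c ^^ n) x = x" using injn[of i] \<open>i < j\<close> by (metis injD zero_less_diff)
  define n where "n = (LEAST n. n > 0 \<and> (c ^^ n) x = x)"
  have n: "n > 0" "(c ^^ n) x = x" using LeastI_ex[OF ex[unfolded Bex_def]] unfolding n_def by blast+
  have nl: "(c ^^ m) x \<noteq> x" if "0 < m" "m < n" for m using not_less_Least[of m] that unfolding n_def by blast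
  have mult: "(c ^^ (k * n)) x = x" for k by (induction k) (simp_all add: add n(2))
  have red: "(c ^^ i) x = (c ^^ (i mod n)) x" for i
    using add[of "i mod n" "(i div n) * n" x] mult[of "i div n"] by simp
  have inj: "inj_on (\<lambda>i. (c ^^ i) x) {..<n}"
  proof (rule linorder_inj_onI')
    fix i j assume ij: "i \<in> {..<n}" "j \<in> {..<n}" "i < j"
    show "(c ^^ i) x \<noteq> (c ^^ j) x"
    proof
      assume "(c ^^ i) x = (c ^^ j) x"
      then have "(c ^^ i) x = (c ^^ i) ((c ^^ (j - i)) x)" using add[of i "j - i" x] ij(3) by simp
      then have "(c ^^ (j - i)) x = x" using injn[of i] by (metis injD)
      moreover have "j - i < n" using ij(2) by (simp add: less_imp_diff_less)
      ultimately show False using nl[of "j - i"] ij(3) by simp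
    qed
  qed
  define C where "C = (\<lambda>i. (c ^^ i) x) ` {..<n}"
  have Cm: "(c ^^ i) x \<in> C" for i unfolding C_def using red[of i] n(1) by (intro image_eqI[of _ _ "i mod n"]) auto
  have cC: "card C = n" unfolding C_def using card_image[OF inj] by simp
  \<comment> \<open>A coincidence for \<open>m\<close> at \<open>y\<close> gives one for
    \<open>m - 2\<close> at \<open>c y\<close>; the descent ends in a fixed point of
    \<open>r0\<close> or of \<open>r1\<close>.\<close>
  have ne: "r0 y \<noteq> (c ^^ m) y" if "y \<in> W" for m y
    using that
  proof (induction m arbitrary: y rule: nat_less_induct)
    case (1 m)
    consider "m = 0" | "m = 1" | k where "m = Suc (Suc k)" by (metis One_nat_def old.nat.exhaust)
    then show ?case
    proof cases
      case 1 then show ?thesis using free(1)[OF \<open>y \<in> W\<close>] by simp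
    next
      case 2
      have "r0 y \<noteq> r0 (r1 y)" using free(2)[OF \<open>y \<in> W\<close>] inv(1) by metis
      then show ?thesis using 2 by (simp add: c_def)
    next
      case (3 k)
      have cy: "c y \<in> W" using c_in[of y 1] \<open>y \<in> W\<close> by simp
      have "r0 (c y) \<noteq> (c ^^ k) (c y)" using 1 3 cy by (meson lessI less_SucI)
      moreover have "r0 (c y) = r1 y" by (simp add: c_def inv)
      moreover have "(c ^^ m) y = c ((c ^^ k) (c y))" using 3 by (simp add: funpow_swap1)
      ultimately show ?thesis using inv unfolding c_def by (metis comp_apply)
    qed
  qed
  have dis: "C \<inter> r0 ` C = {}"
  proof (rule ccontr)
    assume "C \<inter> r0 ` C \<noteq> {}"
    then obtain i j where ij: "(c ^^ i) x = r0 ((c ^^ j) x)" unfolding C_def by auto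
    have "(c ^^ (i + j * n - j)) ((c ^^ j) x) = (c ^^ (i + j * n)) x"
      using add[of "i + j * n - j" j x] n(1) by (simp add: trans_le_add2)
    also have "\<dots> = (c ^^ i) x" using add[of i "j * n" x] mult[of j] by simp
    finally show False using ij ne[OF c_in[OF xO], of j "i + j * n - j"] by simp
  qed
  have r1C: "r1 ((c ^^ i) x) \<in> r0 ` C" for i
  proof -
    have "r1 ((c ^^ i) x) = r0 ((c ^^ Suc i) x)" by (simp add: c_def inv)
    then show ?thesis using Cm by blast
  qed
  have r1C': "r1 (r0 ((c ^^ i) x)) \<in> C" for i
  proof -
    have "(c ^^ i) x = (c ^^ Suc (i + n - 1)) x" using add[of i n x] n by simp
    then have "r1 (r0 ((c ^^ i) x)) = (c ^^ (i + n - 1)) x" by (simp add: c_def inv)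
    then show ?thesis using Cm by simp
  qed
  have "y \<in> C \<union> r0 ` C" if "(\<lambda>a b. b = r0 a \<or> b = r1 a)\<^sup>*\<^sup>* x y" for y
    using that
  proof (induction rule: rtranclp_induct)
    case base show ?case using Cm[of 0] by simp
  next
    case (step a b)
    then obtain i where i: "a = (c ^^ i) x \<or> a = r0 ((c ^^ i) x)" unfolding C_def by blast
    then show ?case using step(2) Cm[of i] r1C[of i] r1C'[of i] inv(1) by (metis UnI1 UnI2 imageI)
  qed
  then have "W \<subseteq> C \<union> r0 ` C" using reach by blast
  moreover have "C \<union> r0 ` C \<subseteq> W" unfolding C_def using c_in xO cl(1) by blast
  ultimately have W: "W = C \<union> r0 ` C" by blast
  have fC: "finite C" unfolding C_def by simp
  have "card (r0 ` C) = n" using cC by (subst card_image) (auto intro: inj_on_inverseI inv(1))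
  then have "card W = n + n" unfolding W using card_Un_disjoint[OF fC _ dis] fC cC by simp
  then have "n = s" using card by simp
  then show ?thesis using n(2) unfolding c_def by simp
qed

context trihex_gr
begin

lemma face_cycle:
  assumes F: "F \<in> faces G" and x: "x \<in> face_flags F"
  shows "((r0 \<circ> r1) ^^ sides G F) x = x"
proof (rule dihedral_orbit[of r0 r1 "face_flags F"])
  show "finite (face_flags F)" unfolding face_flags_def using finite_flags by simp
  show "card (face_flags F) = 2 * sides G F" by (rule card_face_flags[OF F])
  fix y assume y: "y \<in> face_flags F"
  then have yf: "y \<in> flags" unfolding face_flags_def by blast
  show "r0 y \<in> face_flags F" "r1 y \<in> face_flags F"
    using y r_flags[OF yf] r01_face yf unfolding face_flags_def by auto
  show "r0 y \<noteq> y" "r1 y \<noteq> y" using r_free yf by blast+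
  show "(\<lambda>a b. b = r0 a \<or> b = r1 a)\<^sup>*\<^sup>* x y" using face_walk[OF x F y] unfolding cstep_def .
qed (use x r_inv in auto)

lemma flag_face: "x \<in> flags \<Longrightarrow> snd (snd x) \<in> faces G \<and> x \<in> face_flags (snd (snd x))"
  unfolding flags_def Fs_def face_flags_def by auto

text \<open>The rotation by one side has period 3 or 6, and both divide 6. Triangles thus satisfy
  the relations of the honeycomb and stay visible only through the third power.\<close>

lemma r_face6: "((r0 \<circ> r1) ^^ 6) x = x"
proof (cases "x \<in> flags")
  case True
  let ?F = "snd (snd x)"
  have F: "?F \<in> faces G" "x \<in> face_flags ?F" using flag_face[OF True] by blast+
  have c: "((r0 \<circ> r1) ^^ sides G ?F) x = x" using face_cycle[OF F] .
  show ?thesis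
  proof (cases "sides G ?F = 3")
    case True
    have "((r0 \<circ> r1) ^^ (3 + 3)) x = ((r0 \<circ> r1) ^^ 3) (((r0 \<circ> r1) ^^ 3) x)" by (simp only: funpow_add comp_apply)
    then show ?thesis using c True by simp
  next
    case False
    then have "sides G ?F = 6" using face_sides[OF F(1)] by blast
    then show ?thesis using c by simp
  qed
next
  case False
  have "((r0 \<circ> r1) ^^ n) x = x" for n by (induction n) (simp_all add: r_out False)
  then show ?thesis .
qed

lemma many_triangle_flags: "24 \<le> card {x \<in> flags. ((r0 \<circ> r1) ^^ 3) x = x}"
proof -
  let ?T = "{F \<in> faces G. sides G F = 3}"
  have sub: "(\<Union>F\<in>?T. face_flags F) \<subseteq> {x \<in> flags. ((r0 \<circ> r1) ^^ 3) x = x}"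
  proof
    fix x assume "x \<in> (\<Union>F\<in>?T. face_flags F)"
    then obtain F where F: "F \<in> faces G" "sides G F = 3" "x \<in> face_flags F" by blast
    have "((r0 \<circ> r1) ^^ 3) x = x" using face_cycle[OF F(1,3)] F(2) by simp
    then show "x \<in> {x \<in> flags. ((r0 \<circ> r1) ^^ 3) x = x}" using F(3) unfolding face_flags_def by blast
  qed
  have "card (\<Union>F\<in>?T. face_flags F) = (\<Sum>F\<in>?T. card (face_flags F))"
    by (rule card_UN_disjoint) (use finite_faces finite_flags in \<open>auto simp: face_flags_def\<close>)
  also have "\<dots> = (\<Sum>F\<in>?T. 6)" by (rule sum.cong[OF refl]) (simp add: card_face_flags)
  also have "\<dots> \<ge> 24" using four_triangles by simp
  finally have "24 \<le> card (\<Union>F\<in>?T. face_flags F)" by simp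
  also have "\<dots> \<le> card {x \<in> flags. ((r0 \<circ> r1) ^^ 3) x = x}" by (rule card_mono[OF _ sub]) (use finite_flags in simp)
  finally show ?thesis .
qed

lemma adj_flags: "adj G u w \<longleftrightarrow> (\<exists>x\<in>flags. fst x = u \<and> fst (r0 x) = w)"
proof
  assume "adj G u w"
  then obtain e where e: "e \<in> E" "e \<inter> V = {u, w}" unfolding adj_def by blast
  obtain F where F: "F \<in> Fs e" using Fs_ne e(1) by blast
  have "u \<in> e \<inter> V" unfolding e(2) by simp
  then have fl: "(u, e, F) \<in> flags" using flag_iff e(1) F by blast
  have "fst (r0 (u, e, F)) = w" using fl opp_eq[OF e(2)] unfolding r0_def by simp
  then show "\<exists>x\<in>flags. fst x = u \<and> fst (r0 x) = w" by (intro bexI[OF _ fl]) simp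
next
  assume "\<exists>x\<in>flags. fst x = u \<and> fst (r0 x) = w"
  then obtain x where x: "x \<in> flags" "fst x = u" "fst (r0 x) = w" by blast
  obtain e F where "x = (u, e, F)" using x(2) by (cases x) auto
  then have fl: "(u, e, F) \<in> flags" "fst (r0 (u, e, F)) = w" using x by simp_all
  obtain w' where "r0 (u, e, F) = (w', e, F)" "e \<inter> V = {u, w'}" by (rule r0_flag[OF fl(1)])
  then have "e \<inter> V = {u, w}" using fl(2) by simp
  moreover have "e \<in> E" using fl(1) flag_iff by blast
  ultimately show "adj G u w" unfolding adj_def by blast
qed

lemma vertex_flag: "v \<in> V \<Longrightarrow> \<exists>x\<in>flags. fst x = v"
proof -
  assume v: "v \<in> V"
  then obtain e where "e \<in> inc v" using inc3[OF v] by (metis insertI1)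
  moreover then obtain F where "F \<in> Fs e" using Fs_ne unfolding inc_def by blast
  ultimately have "(v, e, F) \<in> flags" using v unfolding flags_def by blast
  then show "\<exists>x\<in>flags. fst x = v" by force
qed

end

section \<open>Sublattices of the integer plane\<close>

text \<open>A subgroup of finite index; the last clause ensures full rank.\<close>

definition lat :: "(int \<times> int) set \<Rightarrow> bool" where
  "lat L \<longleftrightarrow> 0 \<in> L \<and> (\<forall>x\<in>L. \<forall>y\<in>L. x - y \<in> L) \<and> (\<exists>k>0. (k, 0) \<in> L \<and> (0, k) \<in> L)"

lemma lat_diff: "lat L \<Longrightarrow> x \<in> L \<Longrightarrow> y \<in> L \<Longrightarrow> x - y \<in> L"
  and lat_0: "lat L \<Longrightarrow> 0 \<in> L"
  unfolding lat_def by blast+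

lemma lat_uminus: "lat L \<Longrightarrow> x \<in> L \<Longrightarrow> - x \<in> L"
  using lat_diff[of L 0 x] lat_0[of L] by simp

lemma lat_add: "lat L \<Longrightarrow> x \<in> L \<Longrightarrow> y \<in> L \<Longrightarrow> x + y \<in> L"
  using lat_diff[of L x "- y"] lat_uminus[of L y] by simp

definition zmul :: "int \<Rightarrow> int \<times> int \<Rightarrow> int \<times> int" where
  "zmul k x = (k * fst x, k * snd x)"

lemma lat_zmul: "lat L \<Longrightarrow> x \<in> L \<Longrightarrow> zmul k x \<in> L"
proof (induction k rule: int_induct[where k = 0])
  case base then show ?case using lat_0 by (simp add: zmul_def zero_prod_def)
next
  case (step1 i)
  then have "zmul i x + x \<in> L" by (intro lat_add)
  then show ?case by (simp add: zmul_def plus_prod_def distrib_right)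
next
  case (step2 i)
  then have "zmul i x - x \<in> L" by (intro lat_diff)
  then show ?case by (simp add: zmul_def minus_prod_def left_diff_distrib)
qed

definition hnf :: "int \<Rightarrow> int \<Rightarrow> int \<Rightarrow> (int \<times> int) set" where
  "hnf A B D = {(i * A + j * B, j * D) | i j. True}"

lemma int_subgroup_generator:
  fixes S :: "int set"
  assumes "0 \<in> S" "\<And>x y. x \<in> S \<Longrightarrow> y \<in> S \<Longrightarrow> x - y \<in> S" "k \<in> S" "k > 0"
  obtains d where "d > 0" "d \<in> S" "\<And>x. x \<in> S \<Longrightarrow> d dvd x"
proof -
  define d where "d = int (LEAST n. n > 0 \<and> int n \<in> S)"
  have ex: "\<exists>n. n > 0 \<and> int n \<in> S" using assms(3,4) by (intro exI[of _ "nat k"]) auto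
  have d: "d > 0" "d \<in> S" using LeastI_ex[OF ex] unfolding d_def by auto
  have least: "x \<ge> d" if "x > 0" "x \<in> S" for x
    using Least_le[of "\<lambda>n. n > 0 \<and> int n \<in> S" "nat x"] that unfolding d_def by auto
  have mult: "int n * d \<in> S" for n
  proof (induction n)
    case (Suc n)
    have "0 - d \<in> S" using assms(1,2) d by blast
    then have "int n * d - (0 - d) \<in> S" using assms(2) Suc by blast
    then show ?case by (simp add: algebra_simps)
  qed (use assms in simp)
  have "d dvd x" if x: "x \<in> S" for x
  proof -
    have "x mod d \<in> S"
    proof (cases "x div d \<ge> 0")
      case True
      then have "x - int (nat (x div d)) * d \<in> S" using assms(2) x mult by blast
      then show ?thesis using True by (simp add: minus_div_mult_eq_mod)
    next
      case False
      have "0 - int (nat (- (x div d))) * d \<in> S" using assms(1,2) mult by blast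
      then have "x - (0 - int (nat (- (x div d))) * d) \<in> S" using assms(1,2) x by blast
      moreover have "x - (0 - int (nat (- (x div d))) * d) = x - (x div d) * d"
      proof -
        have n: "int (nat (- (x div d))) = - (x div d)" using False by simp
        show ?thesis unfolding n by simp
      qed
      ultimately show ?thesis by (simp add: minus_div_mult_eq_mod)
    qed
    then have "x mod d = 0" using least[of "x mod d"] d(1) by (smt (verit) pos_mod_bound pos_mod_sign)
    then show ?thesis by auto
  qed
  then show ?thesis using that d by blast
qed

text \<open>Hermite normal form: \<open>A\<close> generates the intersection with the first axis,
  \<open>D\<close> the projection to the second one, and \<open>B\<close> is reduced modulo
  \<open>A\<close>.\<close>

lemma lat_hnf:
  assumes L: "lat L"
  obtains A B D where "A > 0" "D > 0" "0 \<le> B" "B < A" "L = hnf A B D"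
proof -
  obtain k where k: "k > 0" "(k, 0) \<in> L" "(0, k) \<in> L" using L unfolding lat_def by blast
  obtain A where A: "A > 0" "(A, 0) \<in> L" "\<And>x. (x, 0) \<in> L \<Longrightarrow> A dvd x"
  proof (rule int_subgroup_generator[of "{x. (x, 0) \<in> L}" k])
    show "0 \<in> {x. (x, 0) \<in> L}" using lat_0[OF L] by (simp add: zero_prod_def)
    show "x - y \<in> {x. (x, 0) \<in> L}" if "x \<in> {x. (x, 0) \<in> L}" "y \<in> {x. (x, 0) \<in> L}" for x y
      using lat_diff[OF L, of "(x, 0)" "(y, 0)"] that by (simp add: minus_prod_def)
  qed (use k in auto)
  obtain D where D: "D > 0" "D \<in> snd ` L" "\<And>y. y \<in> snd ` L \<Longrightarrow> D dvd y"
  proof (rule int_subgroup_generator[of "snd ` L" k])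
    show "0 \<in> snd ` L" using lat_0[OF L] by force
    show "x - y \<in> snd ` L" if "x \<in> snd ` L" "y \<in> snd ` L" for x y
    proof -
      obtain p q where "p \<in> L" "q \<in> L" "x = snd p" "y = snd q" using \<open>x \<in> snd ` L\<close> \<open>y \<in> snd ` L\<close> by blast
      then show ?thesis using lat_diff[OF L, of p q] by (metis imageI snd_diff)
    qed
    show "k \<in> snd ` L" using k(3) by force
  qed (use k in auto)
  obtain B0 where B0: "(B0, D) \<in> L" using D(2) by (metis imageE prod.collapse)
  define B where "B = B0 mod A"
  have BL: "(B, D) \<in> L"
  proof -
    have "(B0, D) - zmul (B0 div A) (A, 0) \<in> L" using lat_diff lat_zmul L B0 A(2) by blast
    then show ?thesis unfolding B_def by (simp add: zmul_def minus_prod_def minus_div_mult_eq_mod)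
  qed
  have "L = hnf A B D"
  proof (intro equalityI subsetI)
    fix p assume p: "p \<in> L"
    obtain j where j: "snd p = D * j" using D(3) p by (meson dvdE imageI)
    have "p - zmul j (B, D) \<in> L" using lat_diff lat_zmul L p BL by blast
    moreover have "p - zmul j (B, D) = (fst p - j * B, 0)" using j by (simp add: zmul_def minus_prod_def)
    ultimately obtain i where i: "fst p - j * B = A * i" using A(3) by (metis dvdE)
    have "p = (i * A + j * B, j * D)" using i j by (simp add: prod_eq_iff algebra_simps)
    then show "p \<in> hnf A B D" unfolding hnf_def by blast
  next
    fix p assume "p \<in> hnf A B D"
    then obtain i j where "p = (i * A + j * B, j * D)" unfolding hnf_def by blast
    then have "p = zmul i (A, 0) + zmul j (B, D)" by (simp add: zmul_def plus_prod_def)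
    then show "p \<in> L" using lat_add lat_zmul L A(2) BL by simp
  qed
  moreover have "0 \<le> B" "B < A" unfolding B_def using A(1) by auto
  ultimately show ?thesis using that A(1) D(1) by blast
qed

lemma lat_mod2:
  assumes "lat L"
  obtains R where "R \<subseteq> L" "finite R" "card R \<le> 4" "0 \<in> R" "\<And>l. l \<in> L \<Longrightarrow> \<exists>r\<in>R. \<exists>m\<in>L. l = r + (m + m)"
proof -
  obtain A B D where L: "L = hnf A B D" using lat_hnf[OF assms] by metis
  define g where "g = (\<lambda>(i, j). (i * A + j * B, j * D))"
  define R where "R = g ` ({0, 1} \<times> {0, 1})"
  have gL: "g x \<in> L" for x unfolding L hnf_def g_def by (cases x) auto
  show ?thesis
  proof (rule that[of R])
    show "R \<subseteq> L" using gL unfolding R_def by blast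
    show "finite R" unfolding R_def by simp
    have "card R \<le> card ({0, 1::int} \<times> {0, 1::int})" unfolding R_def by (rule card_image_le) simp
    then show "card R \<le> 4" by simp
    show "0 \<in> R" unfolding R_def by (rule image_eqI[of _ _ "(0, 0)"]) (simp_all add: g_def zero_prod_def)
    fix l assume "l \<in> L"
    then obtain i j where l: "l = g (i, j)" unfolding L hnf_def g_def by auto
    define i1 i2 j1 j2 where "i1 = i mod 2" and "i2 = i div 2" and "j1 = j mod 2" and "j2 = j div 2"
    have ij: "i = i1 + 2 * i2" "j = j1 + 2 * j2" unfolding i1_def i2_def j1_def j2_def by simp_all
    have "l = g (i1, j1) + (g (i2, j2) + g (i2, j2))"
      unfolding l g_def plus_prod_def ij by (simp add: algebra_simps)
    then have "l = g (i mod 2, j mod 2) + (g (i2, j2) + g (i2, j2))" unfolding i1_def j1_def .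
    moreover have "g (i mod 2, j mod 2) \<in> R" unfolding R_def by (rule imageI) auto
    ultimately show "\<exists>r\<in>R. \<exists>m\<in>L. l = r + (m + m)" using gL by blast
  qed
qed

section \<open>The lattice of a flag system\<close>

text \<open>Integer powers of a bijection \<open>f\<close>, with \<open>g\<close> in the role of its
  inverse.\<close>

definition zp :: "('f \<Rightarrow> 'f) \<Rightarrow> ('f \<Rightarrow> 'f) \<Rightarrow> int \<Rightarrow> 'f \<Rightarrow> 'f" where
  "zp f g k = (if k \<ge> 0 then f ^^ nat k else g ^^ nat (- k))"

lemma zp_0 [simp]: "zp f g 0 x = x" by (simp add: zp_def)
lemma zp_1 [simp]: "zp f g 1 x = f x" by (simp add: zp_def)

lemma zp_Suc:
  assumes "\<And>x. f (g x) = x" "\<And>x. g (f x) = x"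
  shows "zp f g (k + 1) x = f (zp f g k x)" "zp f g (k - 1) x = g (zp f g k x)"
proof -
  show "zp f g (k + 1) x = f (zp f g k x)"
  proof (cases "k \<ge> 0")
    case True
    then show ?thesis by (simp add: zp_def nat_add_distrib)
  next
    case False
    define m where "m = nat (- k) - 1"
    have k: "k = - int (Suc m)" using False unfolding m_def by simp
    show ?thesis unfolding k by (simp add: zp_def assms nat_add_distrib del: of_nat_Suc) (simp add: assms)
  qed
  show "zp f g (k - 1) x = g (zp f g k x)"
  proof (cases "k \<ge> 1")
    case True
    define m where "m = nat k - 1"
    have k: "k = int (Suc m)" using True unfolding m_def by simp
    have "nat k = Suc m" "nat (k - 1) = m" "0 \<le> k" "0 \<le> k - 1" using k by simp_all
    then show ?thesis by (simp add: zp_def assms)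
  next
    case False
    then have "nat (- (k - 1)) = Suc (nat (- k))" by simp
    then show ?thesis using False by (cases "k = 0") (simp_all add: zp_def)
  qed
qed

lemma zp_conj:
  assumes fg: "\<And>x. f (g x) = x" "\<And>x. g (f x) = x" and K: "\<And>x. H 0 x = x"
    "\<And>k x. H (k + 1) x = H 1 (H k x)" "\<And>k x. H (k - 1) x = H (- 1) (H k x)"
    and h: "\<And>x. h (f x) = H (1::int) (h x)" and K1: "\<And>x. H (- 1) (H 1 x) = x"
  shows "h (zp f g k x) = H k (h x)"
proof (induction k rule: int_induct[where k = 0])
  case base then show ?case by (simp add: K)
next
  case (step1 i) then show ?case by (simp add: zp_Suc[OF fg] K(2) h)
next
  case (step2 i)
  have "h (g y) = H (- 1) (h y)" for y using h[of "g y"] fg K1 by metis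
  then show ?case using step2 by (simp add: zp_Suc[OF fg] K(3))
qed

text \<open>The relations are those of the triangle group (2,3,6) of the honeycomb. The geometry
  enters through \<open>afree\<close>, by which no half-turn about an edge fixes a flag, and through
  \<open>tri\<close>, the supply of flags fixed by a half-turn about a face.\<close>

locale flag_system =
  fixes X :: "'f set" and r0 r1 r2 :: "'f \<Rightarrow> 'f" and vt :: "'f \<Rightarrow> 'v"
  assumes finX: "finite X" and Xne: "X \<noteq> {}"
    and rX: "x \<in> X \<Longrightarrow> r0 x \<in> X" "x \<in> X \<Longrightarrow> r1 x \<in> X" "x \<in> X \<Longrightarrow> r2 x \<in> X"
    and rr: "r0 (r0 x) = x" "r1 (r1 x) = x" "r2 (r2 x) = x"
    and r02: "r0 (r2 x) = r2 (r0 x)"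
    and r12: "r2 (r1 (r2 (r1 (r2 (r1 x))))) = x"
    and r01: "((r0 \<circ> r1) ^^ 6) x = x"
    and afree: "x \<in> X \<Longrightarrow> r0 (r2 x) \<noteq> x"
    and reach: "x \<in> X \<Longrightarrow> y \<in> X \<Longrightarrow> (\<lambda>a b. b = r0 a \<or> b = r1 a \<or> b = r2 a)\<^sup>*\<^sup>* x y"
    and tri: "24 \<le> card {x \<in> X. ((r0 \<circ> r1) ^^ 3) x = x}"
    and vt_r: "vt (r1 x) = vt x" "vt (r2 x) = vt x"
    and vt_eq: "x \<in> X \<Longrightarrow> y \<in> X \<Longrightarrow> vt x = vt y \<Longrightarrow>
      y \<in> {x, r2 x, r1 x, r2 (r1 x), r1 (r2 x), r2 (r1 (r2 x))}"
begin

declare split_paired_Ex [simp del] split_paired_All [simp del]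

text \<open>In the honeycomb \<open>c\<close> is a sixth of a turn about a face with inverse
  \<open>ci\<close>, and \<open>a\<close> is the half-turn about an edge.\<close>

definition c where "c x = r0 (r1 x)"
definition ci where "ci x = r1 (r0 x)"
definition a where "a x = r0 (r2 x)"

lemma c_ci [simp]: "c (ci x) = x" "ci (c x) = x" unfolding c_def ci_def by (simp_all add: rr)
lemma aa [simp]: "a (a x) = x" unfolding a_def by (simp add: r02 rr)
lemma c6: "c (c (c (c (c (c x))))) = x"
  using r01[of x] by (simp add: numeral_eq_Suc c_def)
lemma c4 [simp]: "c (c (c (c x))) = ci (ci x)" using c6[of "ci (ci x)"] by simp
lemma ci3 [simp]: "ci (ci (ci x)) = c (c (c x))" using c4[of "ci x"] by simp
lemma ac: "a (c x) = r2 (r1 x)" unfolding a_def c_def by (simp add: r02 rr)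
lemma ac3: "a (c (a (c (a (c x))))) = x" unfolding ac using r12 .
lemma cac [simp]: "c (a (c x)) = a (ci (a x))"
proof -
  have "c (a (c (a (c x)))) = a x" using ac3[of x] by (metis aa)
  then have "a (c (a (c x))) = ci (a x)" by (metis c_ci(2))
  then show ?thesis by (metis aa)
qed
lemma ciaci [simp]: "ci (a (ci x)) = a (c (a x))"
  using cac[of "ci x"] by (metis aa c_ci cac)

text \<open>The product of the half-turns about a face and about an edge is a translation;
  \<open>t2\<close> is its conjugate by the face rotation.\<close>

definition t1 where "t1 x = c (c (c (a x)))"
definition t1i where "t1i x = a (c (c (c x)))"
definition t2 where "t2 x = c (t1 (ci x))"
definition t2i where "t2i x = c (t1i (ci x))"

lemma t_inv [simp]: "t1 (t1i x) = x" "t1i (t1 x) = x" "t2 (t2i x) = x" "t2i (t2 x) = x"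
  unfolding t1_def t1i_def t2_def t2i_def by simp_all

text \<open>Conjugating \<open>t2\<close> by \<open>c\<close> gives the difference of
  \<open>t2\<close> and \<open>t1\<close>, whether \<open>t1\<close> is cancelled on the left or on
  the right; comparing the two forms yields commutativity.\<close>

lemma t12: "t1 (c (t2 (ci x))) = t2 x" "c (t2 (ci (t1 x))) = t2 x"
  unfolding t1_def t2_def by simp_all

lemma t_comm: "t1 (t2 x) = t2 (t1 x)"
  using t12(1)[of "t1 x"] t12(2)[of x] by simp

lemma c_t: "c (t1 x) = t2 (c x)" "c (t2 x) = t2 (t1i (c x))"
  using t12(2)[of "t1i (c x)"] by (simp_all add: t2_def)

lemma r0_c: "r0 (c x) = ci (r0 x)" "r0 (ci x) = c (r0 x)" "r0 (a x) = a (r0 x)"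
  unfolding c_def ci_def a_def by (simp_all add: rr r02)

lemma r0_t: "r0 (t1 x) = t1 (r0 x)" "r0 (t2 x) = t1 (t2i (r0 x))"
  unfolding t1_def t2_def t2i_def t1i_def by (simp_all add: r0_c)

definition T :: "int \<times> int \<Rightarrow> 'f \<Rightarrow> 'f" where
  "T p x = zp t1 t1i (fst p) (zp t2 t2i (snd p) x)"

lemma t2_zp1: "t2 (zp t1 t1i k x) = zp t1 t1i k (t2 x)"
  by (rule zp_conj) (simp_all add: zp_Suc t_comm zp_def[of _ _ "-1"])

lemma zp12: "zp t1 t1i i (zp t2 t2i j x) = zp t2 t2i j (zp t1 t1i i x)"
proof (induction j rule: int_induct[where k = 0])
  case (step1 j) then show ?case by (simp add: zp_Suc flip: t2_zp1)
next
  case (step2 j)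
  have "t2i (zp t1 t1i k y) = zp t1 t1i k (t2i y)" for k y by (metis t2_zp1 t_inv(3,4))
  then show ?case using step2 by (simp only: zp_Suc[OF t_inv(3,4)]) metis
qed simp

lemma zp_add:
  assumes "\<And>x. f (g x) = x" "\<And>x. g (f x) = x"
  shows "zp f g (i + j) x = zp f g i (zp f g j x)"
proof (induction i rule: int_induct[where k = 0])
  case (step1 i)
  have "i + 1 + j = (i + j) + 1" by simp
  then show ?case using step1 by (simp only: zp_Suc[OF assms])
next
  case (step2 i)
  have "i - 1 + j = (i + j) - 1" by simp
  then show ?case using step2 by (simp only: zp_Suc[OF assms])
qed simp

lemma T_add: "T (p + q) x = T p (T q x)"
  unfolding T_def by (simp add: zp_add[OF t_inv(1,2)] zp_add[OF t_inv(3,4)] zp12)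

lemma T_0 [simp]: "T 0 x = x" unfolding T_def by simp

lemma T_inv [simp]: "T p (T (- p) x) = x" "T (- p) (T p x) = x"
  using T_add[of p "- p" x] T_add[of "- p" p x] by simp_all

lemma T_unit: "T (1, 0) x = t1 x" "T (0, 1) x = t2 x" "T (-1, 0) x = t1i x" "T (0, -1) x = t2i x"
  unfolding T_def by (simp_all add: zp_def)

text \<open>\<open>R\<close> and \<open>Q\<close> are the actions of \<open>c\<close> and
  \<open>r0\<close> on translations by conjugation.\<close>

definition R :: "int \<times> int \<Rightarrow> int \<times> int" where "R p = (- snd p, fst p + snd p)"
definition Q :: "int \<times> int \<Rightarrow> int \<times> int" where "Q p = (fst p + snd p, - snd p)"

lemma c_T: "c (T p x) = T (R p) (c x)"
proof -
  have 1: "c (zp t1 t1i i y) = T (0, i) (c y)" for i y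
    by (rule zp_conj) (simp_all add: T_unit c_t T_def zp_Suc zp_def[of _ _ "-1"])
  have 2: "c (zp t2 t2i j y) = T (- j, j) (c y)" for j y
  proof (rule zp_conj)
    fix k :: int and x :: 'f
    have "(- (k + 1), k + 1) = (- 1, 1) + (- k, k)" "(- (k - 1), k - 1) = (- (- 1), - 1) + (- k, k)" by (auto simp: prod_eq_iff)
    then show "T (- (k + 1), k + 1) x = T (- 1, 1) (T (- k, k) x)"
      "T (- (k - 1), k - 1) x = T (- (- 1), - 1) (T (- k, k) x)" by (metis T_add)+
  next
    fix x
    have "T (- 1, 1) z = T (0, 1) (T (-1, 0) z)" for z unfolding T_add[symmetric] by simp
    then show "c (t2 y) = T (- 1, 1) (c y)" for y by (simp only: T_unit c_t)
    show "T (- (- 1), - 1) (T (- 1, 1) x) = x" unfolding T_add[symmetric] by (simp flip: zero_prod_def)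
  qed (simp_all flip: zero_prod_def)
  have "c (T p x) = T (0, fst p) (T (- snd p, snd p) (c x))" unfolding T_def[of p] 1 2 ..
  also have "\<dots> = T (R p) (c x)" unfolding T_add[symmetric] by (simp add: R_def)
  finally show ?thesis .
qed

lemma r0_T: "r0 (T p x) = T (Q p) (r0 x)"
proof -
  have 1: "r0 (zp t1 t1i i y) = T (i, 0) (r0 y)" for i y
    by (rule zp_conj) (simp_all add: T_unit r0_t T_def zp_Suc zp_def[of _ _ "-1"])
  have 2: "r0 (zp t2 t2i j y) = T (j, - j) (r0 y)" for j y
  proof (rule zp_conj)
    fix k :: int and x :: 'f
    have "(k + 1, - (k + 1)) = (1, - 1) + (k, - k)" "(k - 1, - (k - 1)) = (- 1, - (- 1)) + (k, - k)" by (auto simp: prod_eq_iff)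
    then show "T (k + 1, - (k + 1)) x = T (1, - 1) (T (k, - k) x)"
      "T (k - 1, - (k - 1)) x = T (- 1, - (- 1)) (T (k, - k) x)" by (metis T_add)+
  next
    fix x
    have "T (1, - 1) z = T (1, 0) (T (0, -1) z)" for z unfolding T_add[symmetric] by simp
    then show "r0 (t2 y) = T (1, - 1) (r0 y)" for y by (simp only: T_unit r0_t)
    show "T (- 1, - (- 1)) (T (1, - 1) x) = x" unfolding T_add[symmetric] by (simp flip: zero_prod_def)
  qed (simp_all flip: zero_prod_def)
  have "r0 (T p x) = T (fst p, 0) (T (snd p, - snd p) (r0 x))" unfolding T_def[of p] 1 2 ..
  also have "\<dots> = T (Q p) (r0 x)" unfolding T_add[symmetric] by (simp add: Q_def)
  finally show ?thesis .
qed

text \<open>The half-turn about a face. It inverts translations, and in a trihex it fixes the flags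
  of triangles.\<close>

definition h where "h x = c (c (c x))"

lemma hh [simp]: "h (h x) = x" unfolding h_def by simp
lemma h_comm: "h (c x) = c (h x)" "h (r0 x) = r0 (h x)" unfolding h_def by (simp_all add: r0_c)
lemma h_T: "h (T p x) = T (- p) (h x)"
  unfolding h_def c_T by (simp add: R_def uminus_prod_def)
lemma a_h: "a x = T (- 1, 0) (h x)" unfolding T_unit t1i_def h_def by simp

lemma cX: "x \<in> X \<Longrightarrow> c x \<in> X" "x \<in> X \<Longrightarrow> ci x \<in> X" "x \<in> X \<Longrightarrow> a x \<in> X" "x \<in> X \<Longrightarrow> h x \<in> X"
  unfolding c_def ci_def a_def h_def by (simp_all add: rX)

lemma TX: "x \<in> X \<Longrightarrow> T p x \<in> X"
proof -
  have f: "(f ^^ n) x \<in> X" if "x \<in> X" "\<And>x. x \<in> X \<Longrightarrow> f x \<in> X" for f n x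
    by (induction n) (use that in auto)
  have "zp t1 t1i k x \<in> X" "zp t2 t2i k x \<in> X" if "x \<in> X" for k x
    unfolding zp_def using that
    by (auto intro!: f simp: t1_def t1i_def t2_def t2i_def cX)
  then show "x \<in> X \<Longrightarrow> T p x \<in> X" unfolding T_def by blast
qed


section \<open>A base flag in a triangle and the classes of flags modulo translations\<close>

definition base where "base = (SOME x. x \<in> X \<and> h x = x)"

lemma base: "base \<in> X" "h base = base"
proof -
  have "{x \<in> X. ((r0 \<circ> r1) ^^ 3) x = x} \<noteq> {}" using tri by (metis card.empty not_numeral_le_zero)
  then obtain x where "x \<in> X" "((r0 \<circ> r1) ^^ 3) x = x" by blast
  then have "x \<in> X \<and> h x = x" by (simp add: h_def c_def numeral_eq_Suc)
  then have "base \<in> X \<and> h base = base" unfolding base_def by (rule someI)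
  then show "base \<in> X" "h base = base" by blast+
qed

text \<open>The six flags of the triangle of \<open>base\<close>: \<open>k\<close> counts rotations,
  \<open>s\<close> tells whether a reflection precedes them.\<close>

definition dd :: "nat \<Rightarrow> bool \<Rightarrow> 'f" where
  "dd k s = (c ^^ k) (if s then r0 base else base)"

lemma h_pow: "h ((c ^^ k) x) = (c ^^ k) (h x)"
  by (induction k) (simp_all add: h_comm)

lemma h_dd: "h (dd k s) = dd k s"
  unfolding dd_def h_pow by (simp add: h_comm base)

lemma c_dd: "c (dd k s) = dd (Suc k) s" unfolding dd_def by simp

lemma dd_3: "dd (k + 3) s = dd k s"
proof -
  have "dd (k + 3) s = h (dd k s)" unfolding h_def c_dd by (simp add: numeral_eq_Suc)
  then show ?thesis using h_dd by simp
qed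

lemma dd_mod: "dd k s = dd (k mod 3) s"
proof -
  have "dd (m + 3 * n) s = dd m s" for m n
    by (induction n) (simp_all add: dd_3[of "m + 3 * _", symmetric] algebra_simps del: dd_3, metis add.commute add.left_commute dd_3)
  from this[of "k mod 3" "k div 3"] show ?thesis by simp
qed

definition cls where "cls k s = {T p (dd k s) | p. True}"

lemma cls_mod: "cls k s = cls (k mod 3) s"
  unfolding cls_def using dd_mod[of k s] by simp

lemma cls_T: "x \<in> cls k s \<Longrightarrow> T p x \<in> cls k s"
  unfolding cls_def by (auto simp flip: T_add)

lemma cls_c: "x \<in> cls k s \<Longrightarrow> c x \<in> cls (Suc k) s"
  unfolding cls_def by (auto simp: c_T c_dd)

lemma cls_h: "x \<in> cls k s \<Longrightarrow> h x \<in> cls k s"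
  unfolding cls_def by (auto simp: h_T h_dd)

lemma ci_dd: "ci (dd k s) = dd (k + 2) s"
proof -
  have "ci (dd k s) = ci (h (dd k s))" by (simp add: h_dd)
  also have "\<dots> = c (c (dd k s))" by (simp add: h_def)
  finally show ?thesis by (simp add: c_dd)
qed

lemma r0_dd: "r0 (dd k s) = dd (2 * k) (\<not> s)"
proof -
  have "r0 ((c ^^ k) x) = (ci ^^ k) (r0 x)" for x by (induction k) (simp_all add: r0_c)
  moreover have "(ci ^^ k) (dd 0 s) = dd (2 * k) s" for s
    by (induction k) (simp_all add: ci_dd)
  moreover have "r0 (dd k s) = (ci ^^ k) (dd 0 (\<not> s))"
    using calculation(1) by (cases s) (simp_all add: dd_def rr)
  ultimately show ?thesis by simp
qed

lemma cls_r0: "x \<in> cls k s \<Longrightarrow> r0 x \<in> cls (2 * k) (\<not> s)"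
  unfolding cls_def by (auto simp: r0_T r0_dd)

lemma r1_eq: "r1 x = r0 (c x)" and r2_eq: "r2 x = T (- 1, 0) (h (r0 x))"
proof -
  show "r1 x = r0 (c x)" unfolding c_def by (simp add: rr)
  have "r2 x = a (r0 x)" unfolding a_def by (simp add: r02 rr)
  then show "r2 x = T (- 1, 0) (h (r0 x))" by (simp add: a_h)
qed

lemma cls_r1: "x \<in> cls k s \<Longrightarrow> r1 x \<in> cls (2 * k + 2) (\<not> s)"
proof -
  assume "x \<in> cls k s"
  then have "r0 (c x) \<in> cls (2 * Suc k) (\<not> s)" by (rule cls_r0[OF cls_c])
  moreover have "2 * Suc k = 2 * k + 2" by simp
  ultimately show "r1 x \<in> cls (2 * k + 2) (\<not> s)" using r1_eq[of x] by metis
qed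

lemma cls_r2: "x \<in> cls k s \<Longrightarrow> r2 x \<in> cls (2 * k) (\<not> s)"
  by (subst r2_eq) (rule cls_T[OF cls_h[OF cls_r0]])

lemma base_cls: "T p base \<in> cls 0 False"
  unfolding cls_def dd_def by auto

text \<open>The six classes are permuted by \<open>r0\<close>, \<open>r1\<close> and
  \<open>r2\<close>, so their union contains everything reachable from \<open>base\<close>.\<close>

lemma X_cls:
  assumes "x \<in> X"
  obtains k s p where "k < 3" "x = T p (dd k s)"
proof -
  have "\<exists>k s. x \<in> cls k s"
    using reach[OF base(1) assms]
  proof (induction rule: rtranclp_induct)
    case base then show ?case using base_cls[of 0] by auto
  next
    case (step y z)
    then show ?case using cls_r0 cls_r1 cls_r2 by blast
  qed
  then obtain k s where "x \<in> cls (k mod 3) s" using cls_mod by blast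
  then show ?thesis using that[of "k mod 3"] unfolding cls_def by auto
qed

definition M where "M = {p. T p base = base}"

lemma M_sub: "0 \<in> M" "p \<in> M \<Longrightarrow> q \<in> M \<Longrightarrow> p - q \<in> M"
proof -
  show "0 \<in> M" unfolding M_def by simp
  assume "p \<in> M" "q \<in> M"
  then have "T p base = base" "T (- q) base = base" unfolding M_def using T_inv(2)[of q base] by auto
  then have "T (p + - q) base = base" unfolding T_add by simp
  then show "p - q \<in> M" unfolding M_def by simp
qed

lemma M_diff: "T p base = T q base \<longleftrightarrow> p - q \<in> M"
proof -
  have "T (p + - q) base = base \<longleftrightarrow> T p base = T q base"
    by (metis T_add T_inv(1) add.commute)
  then show ?thesis unfolding M_def by simp
qed

lemma M_period: "\<exists>k>0. (k, 0) \<in> M \<and> (0, k) \<in> M"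
proof -
  have *: "\<exists>k>0. zmul (int k) u \<in> M" for u
  proof -
    have "range (\<lambda>n::nat. T (zmul (int n) u) base) \<subseteq> X" using TX base by blast
    then have "finite (range (\<lambda>n::nat. T (zmul (int n) u) base))" using finX finite_subset by blast
    then have "\<not> inj (\<lambda>n::nat. T (zmul (int n) u) base)" using finite_imageD infinite_UNIV_nat by blast
    then obtain m n where mn: "m < n" "T (zmul (int n) u) base = T (zmul (int m) u) base"
      unfolding inj_on_def by (metis nat_neq_iff)
    have "zmul (int n) u - zmul (int m) u = zmul (int (n - m)) u"
      using mn(1) by (simp add: zmul_def minus_prod_def of_nat_diff left_diff_distrib)
    then have "zmul (int (n - m)) u \<in> M" using mn(2) M_diff by simp
    then show ?thesis using mn(1) by (intro exI[of _ "n - m"]) simp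
  qed
  obtain k l where kl: "k > 0" "zmul (int k) (1, 0) \<in> M" "l > 0" "zmul (int l) (0, 1) \<in> M" using * by metis
  have mult: "zmul (int j) p \<in> M" if "p \<in> M" for j p
  proof (induction j)
    case 0 then show ?case using M_sub(1) by (simp add: zmul_def zero_prod_def)
  next
    case (Suc j)
    have "0 - p \<in> M" using M_sub that by blast
    then have "zmul (int j) p - (0 - p) \<in> M" using M_sub(2) Suc by blast
    then show ?case by (simp add: zmul_def plus_prod_def algebra_simps)
  qed
  have "zmul (int l) (zmul (int k) (1, 0)) \<in> M" "zmul (int k) (zmul (int l) (0, 1)) \<in> M" using mult kl by blast+
  then have "(int (k * l), 0) \<in> M" "(0, int (k * l)) \<in> M" by (simp_all add: zmul_def mult.commute)
  then show ?thesis using kl by (intro exI[of _ "int (k * l)"]) simp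
qed

text \<open>A half-turn about an edge midpoint of the honeycomb is conjugate to the fixed-point-free
  involution that reverses an edge, hence it fixes no flag.\<close>
lemma half_turn_free:
  assumes y: "y \<in> X" and p: "odd (fst p)" "even (snd p)"
  shows "T p (h y) \<noteq> y"
proof
  assume eq: "T p (h y) = y"
  \<comment> \<open>\<open>q\<close> is half of \<open>p - (- 1, 0)\<close>. Since \<open>a\<close>
    is \<open>h\<close> followed by the translation (-1, 0), conjugation by \<open>T q\<close> turns
    the given half-turn into \<open>a\<close>.\<close>
  define q where "q = ((fst p + 1) div 2, snd p div 2)"
  have pq: "p = q + ((- 1, 0) + q)" using p unfolding q_def by (auto simp: prod_eq_iff elim!: oddE evenE)
  have "T (- q) y = T (- q) (T p (h y))" using eq by simp
  also have "\<dots> = T (- 1, 0) (T q (h y))" unfolding pq T_add by simp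
  also have "\<dots> = a (T (- q) y)" unfolding a_h h_T by simp
  finally have "a (T (- q) y) = T (- q) y" by simp
  then show False using afree[OF TX[OF y], of "- q"] unfolding a_def by blast
qed

text \<open>A period with an odd coordinate gives a half-turn that fixes \<open>base\<close>. Modulo
  2, \<open>R\<close> permutes the three nonzero classes cyclically, so applying \<open>c\<close> at
  most twice moves it to a half-turn excluded by \<open>half_turn_free\<close>.\<close>

lemma M_even: "p \<in> M \<Longrightarrow> even (fst p) \<and> even (snd p)"
proof (rule ccontr)
  assume p: "p \<in> M" and n: "\<not> (even (fst p) \<and> even (snd p))"
  have e: "T p (h base) = base" using p base unfolding M_def by simp
  have "c (T p (h base)) = c base" "c (c (T p (h base))) = c (c base)" unfolding e by (rule refl)+
  then have e1: "T (R p) (h (c base)) = c base" and e2: "T (R (R p)) (h (c (c base))) = c (c base)"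
    unfolding c_T h_comm(1) .
  consider "odd (fst p)" "even (snd p)" | "odd (fst p)" "odd (snd p)" | "even (fst p)" "odd (snd p)" using n by blast
  then show False
  proof cases
    case 1 then show ?thesis using half_turn_free[OF base(1)] e by blast
  next
    case 2
    then have "odd (fst (R p))" "even (snd (R p))" unfolding R_def by simp_all
    then show ?thesis using half_turn_free[OF cX(1)[OF base(1)]] e1 by blast
  next
    case 3
    then have "odd (fst (R (R p)))" "even (snd (R (R p)))" unfolding R_def by simp_all
    then show ?thesis using half_turn_free[OF cX(1)[OF cX(1)[OF base(1)]]] e2 by blast
  qed
qed

text \<open>The condition says that \<open>T p base\<close> is fixed by \<open>h\<close>, because
  \<open>h\<close> sends it to \<open>T (- p) base\<close>.\<close>

definition L where "L = {p. p + p \<in> M}"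

lemma M_L: "p \<in> M \<longleftrightarrow> (\<exists>l\<in>L. p = l + l)"
proof
  assume p: "p \<in> M"
  define l where "l = (fst p div 2, snd p div 2)"
  have "p = l + l" using M_even[OF p] unfolding l_def prod_eq_iff by simp
  then show "\<exists>l\<in>L. p = l + l" using p unfolding L_def by auto
next
  assume "\<exists>l\<in>L. p = l + l"
  then show "p \<in> M" unfolding L_def by blast
qed

lemma lat_L: "lat L"
proof -
  obtain k where k: "k > 0" "(k, 0) \<in> M" "(0, k) \<in> M" using M_period by blast
  have sub: "x - y \<in> L" if "x \<in> L" "y \<in> L" for x y
  proof -
    have "(x + x) - (y + y) \<in> M" using that M_sub(2) unfolding L_def by blast
    moreover have "(x + x) - (y + y) = (x - y) + (x - y)" by simp
    ultimately show ?thesis unfolding L_def by simp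
  qed
  have k2: "(k, 0) \<in> L" "(0, k) \<in> L"
  proof -
    have "p + p \<in> M" if "p \<in> M" for p
      using M_sub(2)[OF that M_sub(2)[OF M_sub(1) that]] by simp
    then show "(k, 0) \<in> L" "(0, k) \<in> L" using k unfolding L_def by blast+
  qed
  have "0 \<in> L" using M_sub(1) unfolding L_def by simp
  then show ?thesis unfolding lat_def using sub k(1) k2 by blast
qed

lemma pow_T: "\<exists>q. (c ^^ k) (T p x) = T q ((c ^^ k) x)" "\<exists>q. T p ((c ^^ k) x) = (c ^^ k) (T q x)"
proof -
  show "\<exists>q. (c ^^ k) (T p x) = T q ((c ^^ k) x)" by (induction k) (auto simp: c_T)
  have R: "\<exists>q. p = R q" for p by (rule exI[of _ "(fst p + snd p, - fst p)"]) (simp add: R_def)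
  show "\<exists>q. T p ((c ^^ k) x) = (c ^^ k) (T q x)"
  proof (induction k arbitrary: p)
    case (Suc k)
    obtain q where "p = R q" using R by blast
    then have "T p ((c ^^ Suc k) x) = c (T q ((c ^^ k) x))" by (simp add: c_T)
    then show ?case using Suc[of q] by auto
  qed auto
qed

text \<open>The translation is applied first: \<open>h\<close> commutes with the outer rotation and
  reflection, so being fixed by \<open>h\<close> depends on \<open>p\<close> alone.\<close>

definition gg :: "nat \<times> bool \<Rightarrow> int \<times> int \<Rightarrow> 'f" where
  "gg d p = (c ^^ fst d) (if snd d then r0 (T p base) else T p base)"

lemma T_gg: "\<exists>q. T p (dd k s) = gg (k, s) q"
proof -
  have r: "\<exists>q. T p (r0 x) = r0 (T q x)" for p x
    by (rule exI[of _ "Q p"]) (simp add: r0_T, simp add: Q_def)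
  obtain q where "T p (dd k s) = (c ^^ k) (T q (if s then r0 base else base))" using pow_T(2) unfolding dd_def by blast
  then show ?thesis using r[of q base] unfolding gg_def by (cases s) auto
qed

lemma gg_0: "gg (k, s) 0 = dd k s" unfolding gg_def dd_def by simp

lemma h_gg: "h (gg d p) = gg d p \<longleftrightarrow> p \<in> L"
proof -
  have inj: "(c ^^ k) x = (c ^^ k) y \<longleftrightarrow> x = y" for k x y
    by (induction k) (simp_all, metis c_ci(2))
  have "h (gg d p) = gg d p \<longleftrightarrow> T (- p) base = T p base"
    unfolding gg_def h_pow inj by (simp add: h_comm h_T base) (metis rr(1))
  also have "\<dots> \<longleftrightarrow> p - (- p) \<in> M" using M_diff by metis
  finally show ?thesis unfolding L_def by simp
qed

text \<open>All flags of triangles have the form \<open>gg d l\<close> with \<open>l\<close> running through \<open>L\<close> modulo \<open>2L\<close> and six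
  choices of \<open>d\<close>. As there are at least 24 of them, the parametrisation is injective.\<close>
lemma gg_inj:
  assumes d: "d \<in> {..<3::nat} \<times> (UNIV :: bool set)" "d' \<in> {..<3} \<times> UNIV" and l: "l \<in> L" and eq: "gg d 0 = gg d' l"
  shows "d = d'"
proof -
  obtain Rp where Rp: "Rp \<subseteq> L" "finite Rp" "card Rp \<le> 4" "0 \<in> Rp" "\<And>l. l \<in> L \<Longrightarrow> \<exists>r\<in>Rp. \<exists>m\<in>L. l = r + (m + m)"
    using lat_mod2[OF lat_L] by metis
  have red: "\<exists>r\<in>Rp. gg d l = gg d r" if l: "l \<in> L" for d l
  proof -
    obtain r m where rm: "r \<in> Rp" "m \<in> L" "l = r + (m + m)" using Rp(5)[OF l] by blast
    have "l - r \<in> M" using rm unfolding L_def by simp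
    then have "T l base = T r base" using M_diff by blast
    then show ?thesis using rm(1) unfolding gg_def by auto
  qed
  let ?D = "({..<3::nat} \<times> (UNIV :: bool set)) \<times> Rp" and ?f = "\<lambda>(d, p). gg d p"
  let ?Tr = "{x \<in> X. ((r0 \<circ> r1) ^^ 3) x = x}"
  have Tr: "x \<in> ?Tr \<longleftrightarrow> x \<in> X \<and> h x = x" for x by (simp add: h_def c_def numeral_eq_Suc)
  have "?Tr \<subseteq> ?f ` ?D"
  proof
    fix x assume x: "x \<in> ?Tr"
    then have xX: "x \<in> X" "h x = x" using Tr by blast+
    obtain k s p where k: "k < 3" "x = T p (dd k s)" by (rule X_cls[OF xX(1)])
    obtain q where q: "x = gg (k, s) q" using T_gg k(2) by metis
    have "q \<in> L" using xX(2) h_gg unfolding q by blast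
    then obtain r where r: "r \<in> Rp" "x = gg (k, s) r" using red q by metis
    show "x \<in> ?f ` ?D" by (rule image_eqI[of _ _ "((k, s), r)"]) (use r k in auto)
  qed
  then have "card ?Tr \<le> card (?f ` ?D)" using Rp(2) by (intro card_mono) auto
  then have ge: "24 \<le> card (?f ` ?D)" using tri by simp
  have fD: "finite ?D" using Rp(2) by simp
  have "card ?D = 6 * card Rp" by (simp add: card_cartesian_product)
  then have "card ?D \<le> 24" using Rp(3) by simp
  then have "card (?f ` ?D) = card ?D" using ge card_image_le[OF fD, of ?f] by simp
  then have inj: "inj_on ?f ?D" using eq_card_imp_inj_on[OF fD] by blast
  obtain r where r: "r \<in> Rp" "gg d' l = gg d' r" using red[OF l] by blast
  have "?f (d, 0) = ?f (d', r)" using eq r(2) by simp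
  moreover have "(d, 0) \<in> ?D" "(d', r) \<in> ?D" using d r(1) Rp(4) by blast+
  ultimately have "(d, 0) = (d', r)" by (rule inj_onD[OF inj])
  then show ?thesis by simp
qed

text \<open>Equate two representatives and move the translation to one side. Then
  \<open>dd k s\<close>, which is fixed by \<open>h\<close>, has two descriptions by
  \<open>gg\<close>, and \<open>gg_inj\<close> applies.\<close>

lemma cls_disjoint:
  assumes "x \<in> cls k s" "x \<in> cls k' s'"
  shows "k mod 3 = k' mod 3 \<and> s = s'"
proof -
  obtain p q where pq: "x = T p (dd (k mod 3) s)" "x = T q (dd (k' mod 3) s')"
  proof -
    have "x \<in> cls (k mod 3) s" "x \<in> cls (k' mod 3) s'" using assms cls_mod by auto
    then show ?thesis using that unfolding cls_def by blast
  qed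
  then have "T (- p) (T p (dd (k mod 3) s)) = T (- p) (T q (dd (k' mod 3) s'))" by simp
  then have e: "dd (k mod 3) s = T (- p + q) (dd (k' mod 3) s')" unfolding T_add by simp
  obtain l where l: "dd (k mod 3) s = gg (k' mod 3, s') l" using T_gg e by metis
  have "l \<in> L" using h_gg[of "(k' mod 3, s')" l] h_dd[of "k mod 3" s] unfolding l by blast
  moreover have "gg (k mod 3, s) 0 = gg (k' mod 3, s') l" using l gg_0 by simp
  ultimately have "(k mod 3, s) = (k' mod 3, s')" by (intro gg_inj) auto
  then show ?thesis by simp
qed

section \<open>Vertex labels and their adjacency\<close>

definition psi where "psi p = vt (T p base)"

lemma vt_base:
  assumes y: "y \<in> X" and v: "vt y = psi p"
  shows "y \<in> {T p base, r2 (T p base), r1 (T p base), r2 (r1 (T p base)), r1 (r2 (T p base)), r2 (r1 (r2 (T p base)))}"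
  using vt_eq[OF TX[OF base(1)] y] v unfolding psi_def by simp

text \<open>The six flags at a vertex lie in six different classes, so only one of them is a
  translate of \<open>base\<close>.\<close>

lemma psi_eq: "psi p = psi q \<longleftrightarrow> (\<exists>l\<in>L. p - q = l + l)"
proof
  assume eq: "psi p = psi q"
  let ?x = "T q base" and ?y = "T p base"
  have x: "?x \<in> cls 0 False" and y: "?y \<in> cls 0 False" using base_cls by blast+
  have "?y \<in> {?x, r2 ?x, r1 ?x, r2 (r1 ?x), r1 (r2 ?x), r2 (r1 (r2 ?x))}"
    by (rule vt_base[OF TX[OF base(1)]]) (use eq psi_def in simp)
  moreover have "r2 ?x \<in> cls 0 True" "r1 ?x \<in> cls 2 True" "r2 (r1 ?x) \<in> cls 4 False"
    "r1 (r2 ?x) \<in> cls 2 False" "r2 (r1 (r2 ?x)) \<in> cls 4 True"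
    using cls_r2[OF x] cls_r1[OF x] cls_r2[OF cls_r1[OF x]] cls_r1[OF cls_r2[OF x]] cls_r2[OF cls_r1[OF cls_r2[OF x]]]
    by (simp_all add: numeral_eq_Suc)
  then have "?y \<noteq> r2 ?x" "?y \<noteq> r1 ?x" "?y \<noteq> r2 (r1 ?x)" "?y \<noteq> r1 (r2 ?x)" "?y \<noteq> r2 (r1 (r2 ?x))"
    using cls_disjoint[OF y, of 0 True] cls_disjoint[OF y, of 2 True] cls_disjoint[OF y, of 4 False]
      cls_disjoint[OF y, of 2 False] cls_disjoint[OF y, of 4 True] by fastforce+
  ultimately have "?y = ?x" by blast
  then show "\<exists>l\<in>L. p - q = l + l" using M_diff M_L by blast
next
  assume "\<exists>l\<in>L. p - q = l + l"
  then have "T p base = T q base" using M_diff M_L by blast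
  then show "psi p = psi q" unfolding psi_def by simp
qed

lemma vt_a: "vt (a x) = vt (r0 x)" unfolding a_def r02 by (simp add: vt_r)

text \<open>Crossing an edge is a half-turn about its midpoint and acts on labels as a point
  reflection, with one constant for each of the three edges.\<close>

lemma psi_nb:
  "vt (r0 (T p base)) = psi ((- 1, 0) - p)"
  "vt (r0 (r1 (T p base))) = psi ((- 1, 1) - p)"
  "vt (r0 (r1 (r2 (T p base)))) = psi ((- 2, 1) - p)"
proof -
  have hT: "h (T p base) = T (- p) base" for p by (simp add: h_T base)
  have ciT: "ci (T p x) = T (fst p + snd p, - fst p) (ci x)" for p x
  proof -
    have "R (fst p + snd p, - fst p) = p" by (simp add: R_def)
    then have "c (T (fst p + snd p, - fst p) (ci x)) = T p x" by (simp add: c_T)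
    then show ?thesis by (metis c_ci(2))
  qed
  have h_ci: "h (ci x) = ci (h x)" for x by (simp add: h_def)
  have "a (T p base) = T ((- 1, 0) - p) base" unfolding a_h hT T_add[symmetric] by simp
  then show "vt (r0 (T p base)) = psi ((- 1, 0) - p)" using vt_a psi_def by metis
  have v1: "vt (ci (a x)) = vt (r1 (r2 x))" for x unfolding ci_def a_def by (simp add: rr)
  have "vt (r0 (r1 (T p base))) = vt (c (T p base))" unfolding c_def ..
  also have "\<dots> = vt (ci (a (c (T p base))))" unfolding v1 by (simp add: vt_r)
  also have "ci (a (c (T p base))) = ci (T (- 1, 0) (c (T (- p) base)))" unfolding a_h h_comm hT ..
  also have "\<dots> = T (- 1, 1) (T (- p) base)" unfolding ciT by simp
  also have "\<dots> = T ((- 1, 1) - p) base" unfolding T_add[symmetric] by simp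
  finally show "vt (r0 (r1 (T p base))) = psi ((- 1, 1) - p)" unfolding psi_def .
  have "r1 (r2 (r1 x)) = ci (a (r1 x))" for x unfolding ci_def a_def by (simp add: rr)
  have "vt (r0 (r1 (r2 (T p base)))) = vt (r1 (r2 (r1 (r0 (r1 (r2 (T p base)))))))" by (simp add: vt_r)
  also have "r1 (r2 (r1 (r0 (r1 (r2 (T p base)))))) = ci (a (ci (ci (a (T p base)))))"
    unfolding ci_def a_def by (simp add: rr)
  also have "\<dots> = ci (T (- 1, 0) (h (ci (ci (T (- 1, 0) (T (- p) base))))))" unfolding a_h hT ..
  also have "\<dots> = ci (T (- 1, 0) (c (T (- 1, 0) (T (- p) base))))" by (simp add: h_def)
  also have "\<dots> = T (- 1, 1) (T (- 1, 0) (T (- p) base))" unfolding ciT by simp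
  also have "\<dots> = T ((- 1, 1) + ((- 1, 0) + (- p))) base" unfolding T_add ..
  also have "(- 1, 1) + ((- 1, 0) + (- p)) = (- 2, 1) - p" by (simp add: prod_eq_iff)
  finally show "vt (r0 (r1 (r2 (T p base)))) = psi ((- 2, 1) - p)" unfolding psi_def .
qed

lemma psi_neighbours: "{vt (r0 y) | y. y \<in> X \<and> vt y = psi p} = (\<lambda>s. psi (s - p)) ` {(- 1, 0), (- 1, 1), (- 2, 1)}"
proof -
  have e: "vt (r0 (r2 x)) = vt (r0 x)" for x by (simp add: r02 vt_r)
  have e3: "vt (r0 (r2 (r1 (r2 x)))) = vt (r0 (r1 (r2 x)))" for x by (simp add: r02 vt_r)
  let ?x = "T p base"
  have x: "?x \<in> X" using TX base by blast
  have xs: "r1 ?x \<in> X" "r1 (r2 ?x) \<in> X" using x rX by blast+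
  have v: "vt ?x = psi p" "vt (r1 ?x) = psi p" "vt (r1 (r2 ?x)) = psi p" by (simp_all add: psi_def vt_r)
  show ?thesis
  proof (intro equalityI subsetI)
    fix w assume "w \<in> {vt (r0 y) | y. y \<in> X \<and> vt y = psi p}"
    then obtain y where y: "y \<in> X" "vt y = psi p" "w = vt (r0 y)" by blast
    have "w = vt (r0 ?x) \<or> w = vt (r0 (r1 ?x)) \<or> w = vt (r0 (r1 (r2 ?x)))"
      using vt_base[OF y(1,2)] y(3) by (auto simp: e)
    then show "w \<in> (\<lambda>s. psi (s - p)) ` {(- 1, 0), (- 1, 1), (- 2, 1)}" unfolding psi_nb by blast
  next
    fix w assume "w \<in> (\<lambda>s. psi (s - p)) ` {(- 1, 0), (- 1, 1), (- 2, 1)}"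
    then have "w = vt (r0 ?x) \<or> w = vt (r0 (r1 ?x)) \<or> w = vt (r0 (r1 (r2 ?x)))" unfolding psi_nb by blast
    then show "w \<in> {vt (r0 y) | y. y \<in> X \<and> vt y = psi p}" using x xs v by blast
  qed
qed

text \<open>On the unreflected classes, \<open>r1\<close> after \<open>r2\<close> and
  \<open>r2\<close> after \<open>r1\<close> shift \<open>k\<close> by 2 and by 1 modulo 3, so class
  0 occurs at every vertex.\<close>

lemma cls_vt:
  assumes x: "x \<in> cls k s"
  shows "\<exists>y. vt y = vt x \<and> y \<in> cls 0 False"
proof -
  have *: "\<exists>y. vt y = vt x \<and> y \<in> cls 0 False" if x: "x \<in> cls k False" for x k
  proof -
    have 1: "r1 (r2 x) \<in> cls (2 * (2 * k) + 2) False" using cls_r1[OF cls_r2[OF x]] by simp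
    have 2: "r2 (r1 x) \<in> cls (2 * (2 * k + 2)) False" using cls_r2[OF cls_r1[OF x]] by simp
    have "k mod 3 = 0 \<or> (2 * (2 * k) + 2) mod 3 = 0 \<or> (2 * (2 * k + 2)) mod 3 = 0" by presburger
    then show ?thesis
    proof (elim disjE)
      assume "k mod 3 = 0"
      then show ?thesis using x cls_mod[of k] by auto
    next
      assume "(2 * (2 * k) + 2) mod 3 = 0"
      then have "r1 (r2 x) \<in> cls 0 False" using 1 cls_mod[of "2 * (2 * k) + 2" False] by simp
      then show ?thesis by (intro exI[of _ "r1 (r2 x)"] conjI) (simp_all only: vt_r)
    next
      assume "2 * (2 * k + 2) mod 3 = 0"
      then have "r2 (r1 x) \<in> cls 0 False" using 2 cls_mod[of "2 * (2 * k + 2)" False] by simp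
      then show ?thesis by (intro exI[of _ "r2 (r1 x)"] conjI) (simp_all only: vt_r)
    qed
  qed
  show ?thesis
  proof (cases s)
    case True
    have "r2 x \<in> cls (2 * k) False" using cls_r2[OF x] True by simp
    then obtain y where "vt y = vt (r2 x)" "y \<in> cls 0 False" using * by blast
    then show ?thesis by (intro exI[of _ y]) (simp add: vt_r)
  next
    case False
    then show ?thesis using *[of x k] x by simp
  qed
qed

lemma psi_surj: "range psi = vt ` X"
proof
  show "range psi \<subseteq> vt ` X"
  proof
    fix w assume "w \<in> range psi"
    then obtain p where "w = vt (T p base)" unfolding psi_def by auto
    then show "w \<in> vt ` X" using TX[OF base(1)] by (intro image_eqI)
  qed
  show "vt ` X \<subseteq> range psi"
  proof
    fix w assume "w \<in> vt ` X"
    then obtain x where x: "w = vt x" "x \<in> X" by (rule imageE)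
    obtain k s p where "k < 3" "x = T p (dd k s)" by (rule X_cls[OF x(2)])
    then have "x \<in> cls k s" unfolding cls_def by auto
    then obtain y where y: "vt y = vt x" "y \<in> cls 0 False" using cls_vt by metis
    obtain p where "y = T p (dd 0 False)" using y(2) unfolding cls_def by auto
    then have "w = psi p" using x(1) y(1) unfolding psi_def dd_def by simp
    then show "w \<in> range psi" by (rule range_eqI)
  qed
qed

text \<open>The coordinates are changed so that the three translation vectors become the representatives
  (1,0), (0,1), (1,1) of the nonzero classes modulo 2.\<close>
lemma flag_model:
  "\<exists>L \<psi>. lat L \<and> range \<psi> = vt ` X \<and> (\<forall>p q. \<psi> p = \<psi> q \<longleftrightarrow> (\<exists>l\<in>L. p - q = l + l)) \<and>
    (\<forall>p. {vt (r0 y) | y. y \<in> X \<and> vt y = \<psi> p} = (\<lambda>s. \<psi> (s - p)) ` {(1, 0), (0, 1), (1, 1)})"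
proof -
  \<comment> \<open>Shifting the labels by v changes every constant in \<open>psi_neighbours\<close>
    by 2v. After v = (-1, 1) the constants are the images of (1,1), (1,0), (0,1) under
    \<open>N\<close>.\<close>
  define N :: "int \<times> int \<Rightarrow> int \<times> int" where "N p = (fst p, - fst p - snd p)" for p
  have NN: "N (N p) = p" for p by (simp add: N_def)
  have Nl: "N (p + q) = N p + N q" "N (p - q) = N p - N q" "N 0 = 0" for p q
    by (auto simp: N_def prod_eq_iff)
  define \<psi> where "\<psi> p = psi (N p + (- 1, 1))" for p
  define L' where "L' = N ` L"
  have "lat L'"
  proof -
    obtain k where k: "k > 0" "(k, 0) \<in> L" "(0, k) \<in> L" using lat_L unfolding lat_def by blast
    have "(k, 0) - (0, k) \<in> L" using lat_diff[OF lat_L] k by blast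
    then have "N ((k, 0) - (0, k)) \<in> L'" "N (0 - (0, k)) \<in> L'"
      unfolding L'_def using lat_diff[OF lat_L lat_0[OF lat_L] k(3)] by blast+
    moreover have "N ((k, 0) - (0, k)) = (k, 0)" "N (0 - (0, k)) = (0, k)"
      by (simp_all add: N_def zero_prod_def)
    ultimately have "(k, 0) \<in> L'" "(0, k) \<in> L'" by simp_all
    moreover have "0 \<in> L'" unfolding L'_def using lat_0[OF lat_L] Nl(3) by force
    moreover have "x - y \<in> L'" if "x \<in> L'" "y \<in> L'" for x y
    proof -
      obtain x' y' where xy: "x' \<in> L" "y' \<in> L" "x = N x'" "y = N y'" using \<open>x \<in> L'\<close> \<open>y \<in> L'\<close> unfolding L'_def by blast
      have "N (x' - y') \<in> L'" unfolding L'_def using lat_diff[OF lat_L xy(1,2)] by blast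
      then show ?thesis unfolding xy(3,4) Nl(2) .
    qed
    ultimately show ?thesis unfolding lat_def using k(1) by blast
  qed
  moreover have "range \<psi> = vt ` X"
  proof -
    have "range \<psi> \<subseteq> range psi" unfolding \<psi>_def by auto
    moreover have "range psi \<subseteq> range \<psi>"
    proof
      fix w assume "w \<in> range psi"
      then obtain p where "w = psi p" by blast
      then have "w = \<psi> (N (p - (- 1, 1)))" unfolding \<psi>_def NN by simp
      then show "w \<in> range \<psi>" by (rule range_eqI)
    qed
    ultimately show ?thesis using psi_surj by simp
  qed
  moreover have "\<psi> p = \<psi> q \<longleftrightarrow> (\<exists>l\<in>L'. p - q = l + l)" for p q
  proof -
    have "\<psi> p = \<psi> q \<longleftrightarrow> (\<exists>l\<in>L. N p - N q = l + l)" unfolding \<psi>_def psi_eq by simp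
    also have "\<dots> \<longleftrightarrow> (\<exists>l\<in>L. p - q = N l + N l)"
    proof -
      have "N (p - q) = l + l \<longleftrightarrow> p - q = N l + N l" for l
        using NN[of "p - q"] NN[of "l + l"] unfolding Nl(1)[symmetric] by metis
      then show ?thesis unfolding Nl(2) by simp
    qed
    finally show ?thesis unfolding L'_def by blast
  qed
  moreover have "{vt (r0 y) | y. y \<in> X \<and> vt y = \<psi> p} = (\<lambda>s. \<psi> (s - p)) ` {(1, 0), (0, 1), (1, 1)}" for p
  proof -
    have "(- 1, 0) - (N p + (- 1, 1)) = N ((1, 1) - p) + (- 1, 1)"
      "(- 1, 1) - (N p + (- 1, 1)) = N ((1, 0) - p) + (- 1, 1)"
      "(- 2, 1) - (N p + (- 1, 1)) = N ((0, 1) - p) + (- 1, 1)"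
      by (simp_all add: N_def prod_eq_iff)
    then have "psi ((- 1, 0) - (N p + (- 1, 1))) = \<psi> ((1, 1) - p)"
      "psi ((- 1, 1) - (N p + (- 1, 1))) = \<psi> ((1, 0) - p)"
      "psi ((- 2, 1) - (N p + (- 1, 1))) = \<psi> ((0, 1) - p)"
      unfolding \<psi>_def by simp_all
    then have "(\<lambda>s. psi (s - (N p + (- 1, 1)))) ` {(- 1, 0), (- 1, 1), (- 2, 1)} = (\<lambda>s. \<psi> (s - p)) ` {(1, 0), (0, 1), (1, 1)}"
      by auto
    moreover have "{vt (r0 y) | y. y \<in> X \<and> vt y = \<psi> p} = (\<lambda>s. psi (s - (N p + (- 1, 1)))) ` {(- 1, 0), (- 1, 1), (- 2, 1)}"
      unfolding \<psi>_def[of p] by (rule psi_neighbours)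
    ultimately show ?thesis by simp
  qed
  ultimately show ?thesis by (intro exI[of _ L'] exI[of _ \<psi>]) simp
qed

end

context trihex_gr begin

lemma flag_system: "flag_system flags r0 r1 r2 fst"
proof (rule flag_system.intro)
  show "finite flags" by (rule finite_flags)
  show "flags \<noteq> {}" using vertex_flag Vne by blast
  show "r0 x \<in> flags" "r1 x \<in> flags" "r2 x \<in> flags" if "x \<in> flags" for x using r_flags that by blast+
  show "r0 (r0 x) = x" "r1 (r1 x) = x" "r2 (r2 x) = x" for x by (rule r_inv)+
  show "r0 (r2 x) = r2 (r0 x)" for x by (rule r_comm)
  show "r2 (r1 (r2 (r1 (r2 (r1 x))))) = x" for x by (rule r_vertex)
  show "((r0 \<circ> r1) ^^ 6) x = x" for x by (rule r_face6)
  show "r0 (r2 x) \<noteq> x" if "x \<in> flags" for x using r_free(3)[OF that] .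
  show "(\<lambda>a b. b = r0 a \<or> b = r1 a \<or> b = r2 a)\<^sup>*\<^sup>* x y" if "x \<in> flags" "y \<in> flags" for x y
    using flags_reach[OF that] unfolding fstep_def[abs_def] .
  show "24 \<le> card {x \<in> flags. ((r0 \<circ> r1) ^^ 3) x = x}" by (rule many_triangle_flags)
  show "fst (r1 x) = fst x" "fst (r2 x) = fst x" for x by (rule fst_r)+
  show "y \<in> {x, r2 x, r1 x, r2 (r1 x), r1 (r2 x), r2 (r1 (r2 x))}" if "x \<in> flags" "y \<in> flags" "fst x = fst y" for x y
    using same_vertex[OF that] by blast
qed

lemma fst_flags: "fst ` flags = verts G"
proof
  show "fst ` flags \<subseteq> verts G"
  proof
    fix v assume "v \<in> fst ` flags"
    then obtain x where x: "x \<in> flags" "fst x = v" by blast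
    then have "adj G v (fst (r0 x))" unfolding adj_flags by blast
    then show "v \<in> verts G" unfolding adj_def by blast
  qed
  show "verts G \<subseteq> fst ` flags" using vertex_flag by force
qed

lemma lattice_model:
  "\<exists>L \<psi>. lat L \<and> range \<psi> = verts G \<and> (\<forall>p q. \<psi> p = \<psi> q \<longleftrightarrow> (\<exists>l\<in>L. p - q = l + l)) \<and>
    (\<forall>p q. adj G (\<psi> p) (\<psi> q) \<longleftrightarrow> (\<exists>s\<in>{(1, 0), (0, 1), (1, 1)}. \<psi> q = \<psi> (s - p)))"
proof -
  obtain L \<psi> where m: "lat L" "range \<psi> = fst ` flags" "\<forall>p q. \<psi> p = \<psi> q \<longleftrightarrow> (\<exists>l\<in>L. p - q = l + l)"
    "\<forall>p. {fst (r0 y) | y. y \<in> flags \<and> fst y = \<psi> p} = (\<lambda>s. \<psi> (s - p)) ` {(1, 0), (0, 1), (1, 1)}"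
    using flag_system.flag_model[OF flag_system] by (elim exE conjE) (rule that)
  have a: "adj G (\<psi> p) (\<psi> q) \<longleftrightarrow> (\<exists>s\<in>{(1, 0), (0, 1), (1, 1)}. \<psi> q = \<psi> (s - p))" for p q
  proof -
    have "adj G (\<psi> p) (\<psi> q) \<longleftrightarrow> \<psi> q \<in> {fst (r0 y) | y. y \<in> flags \<and> fst y = \<psi> p}"
      unfolding adj_flags mem_Collect_eq by metis
    also have "\<dots> \<longleftrightarrow> \<psi> q \<in> (\<lambda>s. \<psi> (s - p)) ` {(1, 0), (0, 1), (1, 1)}" unfolding m(4)[rule_format] ..
    also have "\<dots> \<longleftrightarrow> (\<exists>s\<in>{(1, 0), (0, 1), (1, 1)}. \<psi> q = \<psi> (s - p))" by (rule image_iff)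
    finally show ?thesis .
  qed
  show ?thesis
    by (rule exI[of _ L], rule exI[of _ \<psi>], intro conjI m(1) m(3) allI a) (use m(2) fst_flags in simp)
qed

end

lemma trihex_lattice:
  assumes "trihex G" "verts G \<noteq> {}"
  shows "\<exists>L \<psi>. lat L \<and> range \<psi> = verts G \<and> (\<forall>p q. \<psi> p = \<psi> q \<longleftrightarrow> (\<exists>l\<in>L. p - q = l + l)) \<and>
    (\<forall>p q. adj G (\<psi> p) (\<psi> q) \<longleftrightarrow> (\<exists>s\<in>{(1, 0), (0, 1), (1, 1)}. \<psi> q = \<psi> (s - p)))"
proof -
  interpret trihex_gr G by unfold_locales (use assms in \<open>simp_all add: trihex_def\<close>)
  show ?thesis by (rule lattice_model)
qed

section \<open>Graph isomorphisms and lattices\<close>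

definition cong2 :: "(int \<times> int) set \<Rightarrow> int \<times> int \<Rightarrow> int \<times> int \<Rightarrow> bool" where
  "cong2 L p q \<longleftrightarrow> (\<exists>l\<in>L. p - q = l + l)"

definition S3 :: "(int \<times> int) set" where "S3 = {(1, 0), (0, 1), (1, 1)}"

text \<open>The differences of distinct elements of \<open>S3\<close>, which are the displacements
  of walks of length 2.\<close>

definition unit6 :: "(int \<times> int) set" where
  "unit6 = {(1, 0), (-1, 0), (0, 1), (0, -1), (1, -1), (-1, 1)}"

definition lm :: "int \<times> int \<times> int \<times> int \<Rightarrow> int \<times> int \<Rightarrow> int \<times> int" where
  "lm = (\<lambda>(a, b, c, d) p. (a * fst p + b * snd p, c * fst p + d * snd p))"

text \<open>One matrix from each pair of opposite linear symmetries of the honeycomb; they permute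
  the three pairs of opposite vectors in \<open>unit6\<close>.\<close>

definition mats :: "(int \<times> int \<times> int \<times> int) set" where
  "mats = {(1, 0, 0, 1), (0, 1, 1, 0), (-1, -1, 1, 0), (0, 1, -1, -1), (1, 0, -1, -1), (-1, -1, 0, 1)}"

definition sym6 :: "(int \<times> int \<Rightarrow> int \<times> int) set" where
  "sym6 = lm ` mats"

definition mm :: "int \<times> int \<times> int \<times> int \<Rightarrow> int \<times> int \<times> int \<times> int \<Rightarrow> int \<times> int \<times> int \<times> int" where
  "mm = (\<lambda>(a, b, c, d) (a', b', c', d'). (a * a' + b * c', a * b' + b * d', c * a' + d * c', c * b' + d * d'))"

lemma lm_comp: "lm m \<circ> lm n = lm (mm m n)"
  unfolding lm_def mm_def by (cases m; cases n) (simp add: fun_eq_iff algebra_simps)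

lemma sym6_linear:
  assumes "d \<in> sym6"
  shows "d (p + q) = d p + d q" "d (p - q) = d p - d q"
proof -
  obtain a b c e where "d = lm (a, b, c, e)" using assms unfolding sym6_def by auto
  then show "d (p + q) = d p + d q" "d (p - q) = d p - d q"
    by (simp_all add: lm_def prod_eq_iff algebra_simps)
qed

lemma mats_group: "\<forall>m\<in>mats. \<forall>n\<in>mats. mm m n \<in> mats"
  "\<forall>m\<in>mats. \<exists>n\<in>mats. mm m n = (1, 0, 0, 1) \<and> mm n m = (1, 0, 0, 1)"
  by (simp_all add: mats_def mm_def)

lemma lm_id: "lm (1, 0, 0, 1) = id"
  by (simp add: lm_def fun_eq_iff)

lemma sym6_comp: "d \<in> sym6 \<Longrightarrow> e \<in> sym6 \<Longrightarrow> d \<circ> e \<in> sym6"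
  unfolding sym6_def using mats_group(1) lm_comp by (metis (no_types, lifting) image_iff)

lemma sym6_inv:
  assumes "d \<in> sym6"
  shows "\<exists>e\<in>sym6. e \<circ> d = id \<and> d \<circ> e = id"
proof -
  obtain m where m: "m \<in> mats" "d = lm m" using assms unfolding sym6_def by blast
  obtain n where n: "n \<in> mats" "mm m n = (1, 0, 0, 1)" "mm n m = (1, 0, 0, 1)" using mats_group(2) m(1) by blast
  show ?thesis unfolding sym6_def m(2) using n lm_comp lm_id by (intro bexI[of _ "lm n"]) auto
qed

lemma sym6_id: "id \<in> sym6"
  unfolding sym6_def lm_id[symmetric] by (rule imageI) (simp add: mats_def)

lemma sym6_image: "d \<circ> e = id \<Longrightarrow> d ` (e ` L) = L"
  by (simp add: image_comp)

lemma cong2_refl: "lat L \<Longrightarrow> cong2 L p p"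
  unfolding cong2_def using lat_0 by (intro bexI[of _ 0]) auto

lemma cong2_sym: "lat L \<Longrightarrow> cong2 L p q \<Longrightarrow> cong2 L q p"
proof -
  assume L: "lat L" and "cong2 L p q"
  then obtain l where l: "l \<in> L" "p - q = l + l" unfolding cong2_def by blast
  have "q - p = - l + - l" using l(2) by (simp add: prod_eq_iff)
  then show ?thesis unfolding cong2_def using lat_uminus[OF L l(1)] by blast
qed

lemma cong2_trans: "lat L \<Longrightarrow> cong2 L p q \<Longrightarrow> cong2 L q r \<Longrightarrow> cong2 L p r"
proof -
  assume L: "lat L" and "cong2 L p q" "cong2 L q r"
  then obtain l m where l: "l \<in> L" "p - q = l + l" "m \<in> L" "q - r = m + m" unfolding cong2_def by blast
  have "p - r = (p - q) + (q - r)" by simp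
  also have "\<dots> = (l + m) + (l + m)" unfolding l by (simp add: algebra_simps)
  finally show ?thesis unfolding cong2_def using lat_add[OF L l(1,3)] by blast
qed

lemma cong2_shift: "cong2 L (p + r) (q + r) \<longleftrightarrow> cong2 L p q" "cong2 L (r + p) (r + q) \<longleftrightarrow> cong2 L p q"
  unfolding cong2_def by simp_all

lemma cong2_flip: "lat L \<Longrightarrow> cong2 L (r - p) (r - q) \<longleftrightarrow> cong2 L p q"
proof -
  assume L: "lat L"
  have "cong2 L (r - p) (r - q) \<longleftrightarrow> cong2 L q p" unfolding cong2_def by simp
  then show ?thesis using cong2_sym[OF L] by blast
qed

lemma S3_odd:
  assumes "s \<in> S3" "t \<in> S3" "s - t = l + l"
  shows "s = t"
proof -
  obtain a b where l: "l = (a, b)" by (cases l)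
  show ?thesis using assms unfolding S3_def l by (auto simp: prod_eq_iff) presburger+
qed

lemma cong2_S3: "s \<in> S3 \<Longrightarrow> t \<in> S3 \<Longrightarrow> cong2 L s t \<Longrightarrow> s = t"
  unfolding cong2_def using S3_odd by blast

lemma S3_cases: "c \<in> S3 \<Longrightarrow> (c = (1, 0) \<Longrightarrow> P) \<Longrightarrow> (c = (0, 1) \<Longrightarrow> P) \<Longrightarrow> (c = (1, 1) \<Longrightarrow> P) \<Longrightarrow> P"
  unfolding S3_def by blast

lemma int_double:
  "(1::int) = a + a \<longleftrightarrow> False" "(-1::int) = a + a \<longleftrightarrow> False" "(3::int) = a + a \<longleftrightarrow> False"
  "(-3::int) = a + a \<longleftrightarrow> False" "(2::int) = a + a \<longleftrightarrow> a = 1" "(-2::int) = a + a \<longleftrightarrow> a = -1"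
  "(0::int) = a + a \<longleftrightarrow> a = 0"
  by presburger+

text \<open>Modulo 2 the three colours are the nonzero classes, so the equation forces
  \<open>c3 = c1\<close> and \<open>c4 = c2\<close>, and then \<open>l = c2 - c1\<close>.\<close>

lemma square_colours:
  assumes "c1 \<in> S3" "c2 \<in> S3" "c3 \<in> S3" "c4 \<in> S3" "c1 \<noteq> c2" "c2 \<noteq> c3" "c3 \<noteq> c4" "c4 \<noteq> c1"
    and "c4 - c3 + c2 - c1 = l + l"
  shows "l \<in> unit6"
proof -
  obtain a b where l: "l = (a, b)" by (cases l)
  show ?thesis
    by (rule S3_cases[OF assms(1)]; rule S3_cases[OF assms(2)];
        rule S3_cases[OF assms(3)]; rule S3_cases[OF assms(4)];
        use assms(5-9) in \<open>simp add: l int_double unit6_def\<close>)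
qed

text \<open>Parity forces the six colours to use every colour twice.\<close>
lemma hexagon_colours:
  assumes "c1 \<in> S3" "c2 \<in> S3" "c4 \<in> S3" "c5 \<in> S3" "c6 \<in> S3"
    and "c1 \<noteq> c2" "c1 \<noteq> c4" "c4 \<noteq> c5" "c5 \<noteq> c6" "c6 \<noteq> c1"
    and "c6 - c5 + c4 - c1 + c2 - c1 = l + l"
  shows "l \<in> unit6"
proof -
  obtain a b where l: "l = (a, b)" by (cases l)
  show ?thesis
    by (rule S3_cases[OF assms(1)]; rule S3_cases[OF assms(2)];
        rule S3_cases[OF assms(3)]; rule S3_cases[OF assms(4)]; rule S3_cases[OF assms(5)];
        use assms(6-11) in \<open>simp add: l int_double unit6_def\<close>)
qed

lemma S3_third: "a \<in> S3 \<Longrightarrow> b \<in> S3 \<Longrightarrow> c \<in> S3 \<Longrightarrow> d \<in> S3 \<Longrightarrow> a \<noteq> b \<Longrightarrow> c \<noteq> a \<Longrightarrow> c \<noteq> b \<Longrightarrow> d \<noteq> a \<Longrightarrow> d \<noteq> b \<Longrightarrow> c = d"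
  unfolding S3_def by auto

lemma cong2_double: "cong2 L (v + v) 0 \<longleftrightarrow> v \<in> L"
proof
  assume "cong2 L (v + v) 0"
  then obtain l where "l \<in> L" "v + v = l + l" unfolding cong2_def by auto
  moreover from this have "v = l" by (cases v; cases l) simp
  ultimately show "v \<in> L" by simp
next
  assume "v \<in> L"
  then show "cong2 L (v + v) 0" unfolding cong2_def by (intro bexI[of _ v]) simp_all
qed

text \<open>A lift of a graph isomorphism to the labels of the vertices.\<close>
locale label_map =
  fixes L L' :: "(int \<times> int) set" and f :: "int \<times> int \<Rightarrow> int \<times> int"
  assumes L: "lat L" and L': "lat L'"
    and f_cong: "cong2 L' (f p) (f q) \<longleftrightarrow> cong2 L p q"
    and f_adj: "s \<in> S3 \<Longrightarrow> \<exists>c\<in>S3. cong2 L' (f (s - p)) (c - f p)"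
begin

text \<open>The direction taken by the image of the edge that leaves \<open>p\<close> in direction
  \<open>s\<close>. It is unique because distinct elements of \<open>S3\<close> are incongruent
  modulo 2.\<close>

definition col :: "int \<times> int \<Rightarrow> int \<times> int \<Rightarrow> int \<times> int" where
  "col p s = (SOME c. c \<in> S3 \<and> cong2 L' (f (s - p)) (c - f p))"

lemma col: "s \<in> S3 \<Longrightarrow> col p s \<in> S3" "s \<in> S3 \<Longrightarrow> cong2 L' (f (s - p)) (col p s - f p)"
proof -
  assume "s \<in> S3"
  then have "\<exists>c. c \<in> S3 \<and> cong2 L' (f (s - p)) (c - f p)" using f_adj by blast
  then have "col p s \<in> S3 \<and> cong2 L' (f (s - p)) (col p s - f p)" unfolding col_def by (rule someI_ex)
  then show "col p s \<in> S3" "cong2 L' (f (s - p)) (col p s - f p)" by blast+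
qed

lemma tr: "cong2 L' a b \<Longrightarrow> cong2 L' b c \<Longrightarrow> cong2 L' a c" using cong2_trans[OF L'] .
lemma sy: "cong2 L' a b \<Longrightarrow> cong2 L' b a" using cong2_sym[OF L'] .

lemma col_unique: "s \<in> S3 \<Longrightarrow> c \<in> S3 \<Longrightarrow> cong2 L' (f (s - p)) (c - f p) \<Longrightarrow> col p s = c"
proof -
  assume a: "s \<in> S3" "c \<in> S3" "cong2 L' (f (s - p)) (c - f p)"
  have "cong2 L' (col p s - f p) (c - f p)" using tr[OF sy[OF col(2)[OF a(1)]] a(3)] .
  then have "cong2 L' (col p s) c" unfolding cong2_def by simp
  then show ?thesis using cong2_S3 col(1)[OF a(1)] a(2) by blast
qed

lemma col_inj: "s \<in> S3 \<Longrightarrow> t \<in> S3 \<Longrightarrow> col p s = col p t \<Longrightarrow> s = t"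
proof -
  assume a: "s \<in> S3" "t \<in> S3" "col p s = col p t"
  have "cong2 L' (f (s - p)) (col p t - f p)" using col(2)[OF a(1), of p] unfolding a(3) .
  then have "cong2 L' (f (s - p)) (f (t - p))" using tr sy[OF col(2)[OF a(2), of p]] by blast
  then have "cong2 L (s - p) (t - p)" using f_cong by blast
  then have "cong2 L s t" unfolding cong2_def by simp
  then show "s = t" using cong2_S3 a by blast
qed

text \<open>The condition that defines a colour is symmetric in the two ends \<open>p\<close> and
  \<open>s - p\<close> of the edge.\<close>

lemma col_flip: "s \<in> S3 \<Longrightarrow> col (s - p) s = col p s"
proof -
  assume s: "s \<in> S3"
  obtain l where l: "l \<in> L'" "f (s - p) - (col p s - f p) = l + l" using col(2)[OF s, of p] unfolding cong2_def by blast
  have "f (s - (s - p)) - (col p s - f (s - p)) = l + l" using l(2) by (simp add: algebra_simps)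
  then have "cong2 L' (f (s - (s - p))) (col p s - f (s - p))" unfolding cong2_def using l(1) by blast
  then show ?thesis using col_unique[OF s col(1)[OF s]] by blast
qed

lemma walk2:
  assumes "s \<in> S3" "t \<in> S3"
  shows "cong2 L' (f (t - (s - p))) (col (s - p) t - col p s + f p)"
proof -
  have "cong2 L' (col (s - p) t - f (s - p)) (col (s - p) t - (col p s - f p))"
    using col(2)[OF assms(1), of p] by (simp only: cong2_flip[OF L'])
  moreover have "col (s - p) t - (col p s - f p) = col (s - p) t - col p s + f p" by simp
  ultimately show ?thesis using tr[OF col(2)[OF assms(2), of "s - p"]] by metis
qed

text \<open>A vector \<open>u = t - s\<close> in \<open>L\<close> closes the walk with directions
  \<open>s, t, s, t\<close>. Its image is a closed walk of length 4 whose cyclically consecutive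
  colours are distinct.\<close>

lemma unit_transfer:
  assumes u: "u \<in> unit6" "u \<in> L"
  shows "\<exists>u\<in>unit6. u \<in> L'"
proof -
  obtain s t where st: "s \<in> S3" "t \<in> S3" "s \<noteq> t" "u = t - s"
  proof -
    have "\<exists>s\<in>S3. \<exists>t\<in>S3. s \<noteq> t \<and> u = t - s" using u(1) unfolding unit6_def S3_def by auto
    then show ?thesis using that by blast
  qed
  let ?p = "0 :: int \<times> int"
  define c1 c2 c3 c4 where "c1 = col ?p s" and "c2 = col (s - ?p) t" and "c3 = col (t - (s - ?p)) s"
    and "c4 = col (s - (t - (s - ?p))) t"
  note cd = c1_def c2_def c3_def c4_def
  have c: "c1 \<in> S3" "c2 \<in> S3" "c3 \<in> S3" "c4 \<in> S3" unfolding cd using col(1) st by blast+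
  have w1: "cong2 L' (f (t - (s - ?p))) (c2 - c1 + f ?p)" unfolding cd by (rule walk2[OF st(1,2)])
  have w2: "cong2 L' (f (t - (s - (t - (s - ?p))))) (c4 - c3 + f (t - (s - ?p)))" unfolding cd by (rule walk2[OF st(1,2)])
  have "cong2 L' (c4 - c3 + f (t - (s - ?p))) (c4 - c3 + (c2 - c1 + f ?p))" using w1 cong2_shift by blast
  then have w3: "cong2 L' (f (t - (s - (t - (s - ?p))))) (c4 - c3 + (c2 - c1 + f ?p))" using tr w2 by blast
  have "(t - (s - (t - (s - ?p)))) - ?p = u + u" unfolding st(4) by (simp add: algebra_simps)
  then have "cong2 L (t - (s - (t - (s - ?p)))) ?p" unfolding cong2_def using u(2) by blast
  then have "cong2 L' (f (t - (s - (t - (s - ?p))))) (f ?p)" using f_cong by blast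
  then have "cong2 L' (c4 - c3 + (c2 - c1 + f ?p)) (f ?p)" using sy[OF w3] tr by blast
  then obtain l where l: "l \<in> L'" "c4 - c3 + (c2 - c1 + f ?p) - f ?p = l + l" unfolding cong2_def by blast
  have e: "c4 - c3 + c2 - c1 = l + l" unfolding l(2)[symmetric] by (simp add: algebra_simps)
  have "c1 \<noteq> c2" using col_inj[OF st(1,2), of "s - ?p"] col_flip[OF st(1), of ?p] st(3) unfolding cd by metis
  moreover have "c2 \<noteq> c3" using col_inj[OF st(2,1), of "t - (s - ?p)"] col_flip[OF st(2), of "s - ?p"] st(3) unfolding cd by metis
  moreover have "c3 \<noteq> c4" using col_inj[OF st(1,2), of "s - (t - (s - ?p))"] col_flip[OF st(1), of "t - (s - ?p)"] st(3) unfolding cd by metis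
  \<comment> \<open>Equal first and last colours would identify the vertices after one and after
    three steps, which makes \<open>s\<close> and \<open>t\<close> congruent.\<close>
  moreover have "c4 \<noteq> c1"
  proof
    assume eq: "c4 = c1"
    have "cong2 L' (f (t - (s - (t - (s - ?p))))) (c4 - f (s - (t - (s - ?p))))" unfolding cd by (rule col(2)[OF st(2)])
    then have "cong2 L' (f ?p) (c4 - f (s - (t - (s - ?p))))"
      using \<open>cong2 L' (f (t - (s - (t - (s - ?p))))) (f ?p)\<close> sy tr by blast
    then obtain l where l: "l \<in> L'" "f ?p - (c4 - f (s - (t - (s - ?p)))) = l + l" unfolding cong2_def by blast
    obtain m where m: "m \<in> L'" "f (s - ?p) - (c1 - f ?p) = m + m" using col(2)[OF st(1), of ?p] unfolding cong2_def cd by blast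
    have "f (s - (t - (s - ?p))) - f (s - ?p) = (l + l) - (m + m)" unfolding l(2)[symmetric] m(2)[symmetric] eq by (simp add: algebra_simps)
    also have "\<dots> = (l - m) + (l - m)" by (simp add: algebra_simps)
    finally have "cong2 L' (f (s - (t - (s - ?p)))) (f (s - ?p))" unfolding cong2_def using lat_diff[OF L' l(1) m(1)] by blast
    then have "cong2 L (s - (t - (s - ?p))) (s - ?p)" using f_cong by blast
    then have "cong2 L s t" unfolding cong2_def by (simp add: algebra_simps)
    then show False using cong2_S3 st by blast
  qed
  ultimately have "l \<in> unit6" using square_colours[OF c _ _ _ _ e] by blast
  then show ?thesis using l(1) by blast
qed

context
  assumes nou: "\<And>u. u \<in> unit6 \<Longrightarrow> u \<notin> L'"
begin

text \<open>The directions \<open>i, j, k, i, j, k\<close> run around a hexagon back to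
  \<open>p\<close>. If the third colour repeated the first, \<open>hexagon_colours\<close> would
  give a unit vector in \<open>L'\<close>.\<close>

lemma rainbow:
  assumes ijk: "i \<in> S3" "j \<in> S3" "k \<in> S3" "i \<noteq> j" "j \<noteq> k" "i \<noteq> k"
  shows "col (j - (i - p)) k \<noteq> col p i"
proof
  assume eq: "col (j - (i - p)) k = col p i"
  define p1 p2 p3 p4 p5 where "p1 = i - p" and "p2 = j - p1" and "p3 = k - p2" and "p4 = i - p3" and "p5 = j - p4"
  have p6: "k - p5 = p" unfolding p1_def p2_def p3_def p4_def p5_def by (simp add: algebra_simps)
  define c1 c2 c3 c4 c5 c6 where "c1 = col p i" and "c2 = col p1 j" and "c3 = col p2 k"
    and "c4 = col p3 i" and "c5 = col p4 j" and "c6 = col p5 k"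
  note cd = c1_def c2_def c3_def c4_def c5_def c6_def
  have e31: "c3 = c1" using eq unfolding cd p2_def p1_def .
  have c: "c1 \<in> S3" "c2 \<in> S3" "c4 \<in> S3" "c5 \<in> S3" "c6 \<in> S3" unfolding cd using col(1) ijk by blast+
  have w1: "cong2 L' (f p2) (c2 - c1 + f p)" unfolding cd p2_def p1_def by (rule walk2[OF ijk(1,2)])
  have w2: "cong2 L' (f p4) (c4 - c3 + f p2)" unfolding cd p4_def p3_def by (rule walk2[OF ijk(3,1)])
  have w3: "cong2 L' (f p) (c6 - c5 + f p4)" using walk2[OF ijk(2,3), of p4] unfolding cd p5_def[symmetric] p6 by (simp add: p5_def)
  obtain l1 where l1: "l1 \<in> L'" "f p2 - (c2 - c1 + f p) = l1 + l1" using w1 unfolding cong2_def by blast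
  obtain l2 where l2: "l2 \<in> L'" "f p4 - (c4 - c3 + f p2) = l2 + l2" using w2 unfolding cong2_def by blast
  obtain l3 where l3: "l3 \<in> L'" "f p - (c6 - c5 + f p4) = l3 + l3" using w3 unfolding cong2_def by blast
  have "c6 - c5 + c4 - c1 + c2 - c1 = - (l1 + l1) - (l2 + l2) - (l3 + l3)"
    unfolding l1(2)[symmetric] l2(2)[symmetric] l3(2)[symmetric] e31 by (simp add: algebra_simps)
  also have "\<dots> = (0 - l1 - l2 - l3) + (0 - l1 - l2 - l3)" by (simp add: algebra_simps)
  finally have e: "c6 - c5 + c4 - c1 + c2 - c1 = (0 - l1 - l2 - l3) + (0 - l1 - l2 - l3)" .
  have lL: "0 - l1 - l2 - l3 \<in> L'" using l1(1) l2(1) l3(1) lat_diff[OF L'] lat_0[OF L'] by blast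
  have d: "c1 \<noteq> c2" "c1 \<noteq> c4" "c4 \<noteq> c5" "c5 \<noteq> c6" "c6 \<noteq> c1"
  proof -
    show "c1 \<noteq> c2" using col_inj[OF ijk(1,2), of p1] col_flip[OF ijk(1), of p] ijk(4) unfolding cd p1_def by metis
    show "c1 \<noteq> c4" using col_inj[OF ijk(3,1), of p3] col_flip[OF ijk(3), of p2] ijk(6) unfolding e31[symmetric] cd p3_def by metis
    show "c4 \<noteq> c5" using col_inj[OF ijk(1,2), of p4] col_flip[OF ijk(1), of p3] ijk(4) unfolding cd p4_def by metis
    show "c5 \<noteq> c6" using col_inj[OF ijk(2,3), of p5] col_flip[OF ijk(2), of p4] ijk(5) unfolding cd p5_def by metis
    have "col p5 k = col p k" using col_flip[OF ijk(3), of p5] unfolding p6 by simp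
    then show "c6 \<noteq> c1" using col_inj[OF ijk(3,1), of p] ijk(6) unfolding cd by metis
  qed
  have "0 - l1 - l2 - l3 \<in> unit6" by (rule hexagon_colours[OF c d e])
  then show False using nou lL by blast
qed

text \<open>At the far end of an edge of direction \<open>j\<close>, direction \<open>k\<close>
  avoids the colour of \<open>i\<close> by \<open>rainbow\<close> and the colour of \<open>j\<close>
  by injectivity; only its old colour remains.\<close>

lemma col_step:
  assumes j: "j \<in> S3" and s: "s \<in> S3"
  shows "col (j - q) s = col q s"
proof -
  have *: "col (j - q) k = col q k" if ijk: "i \<in> S3" "k \<in> S3" "i \<noteq> j" "j \<noteq> k" "i \<noteq> k" for i k
  proof -
    have q: "i - (i - q) = q" by simp
    have "col (j - q) k \<noteq> col (i - q) i" using rainbow[OF ijk(1) j ijk(2,3,4,5), of "i - q"] unfolding q .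
    then have 1: "col (j - q) k \<noteq> col q i" using col_flip[OF ijk(1), of q] by simp
    have "col (j - q) k \<noteq> col (j - q) j" using col_inj[OF ijk(2) j] ijk(4) by blast
    then have 2: "col (j - q) k \<noteq> col q j" using col_flip[OF j, of q] by simp
    have 3: "col q k \<noteq> col q i" "col q k \<noteq> col q j" "col q i \<noteq> col q j"
      using col_inj[OF ijk(2,1)] col_inj[OF ijk(2) j] col_inj[OF ijk(1) j] ijk by blast+
    show ?thesis
      by (rule S3_third[OF col(1)[OF ijk(1)] col(1)[OF j] col(1)[OF ijk(2)] col(1)[OF ijk(2)] 3(3) 1 2 3(1,2)])
  qed
  show ?thesis
  proof (cases "s = j")
    case True then show ?thesis using col_flip[OF j] by simp
  next
    case False
    have "\<exists>i\<in>S3. i \<noteq> j \<and> i \<noteq> s" using j s False unfolding S3_def by auto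
    then show ?thesis using *[of _ s] s False by metis
  qed
qed

lemma int2_induct:
  assumes z: "P (0 :: int \<times> int)" and "\<And>p. P p \<longleftrightarrow> P (p + (1, 0))" "\<And>p. P p \<longleftrightarrow> P (p + (0, 1))"
  shows "P p"
proof -
  have 1: "P (i, 0)" for i
  proof (induction i rule: int_induct[where k = 0])
    case (step1 i) then show ?case using assms(2)[of "(i, 0)"] by simp
  next
    case (step2 i) then show ?case using assms(2)[of "(i - 1, 0)"] by simp
  qed (use z in \<open>simp add: zero_prod_def\<close>)
  have "P (i, j)" for i j
  proof (induction j rule: int_induct[where k = 0])
    case base show ?case using 1 .
  next
    case (step1 j) then show ?case using assms(3)[of "(i, j)"] by simp
  next
    case (step2 j) then show ?case using assms(3)[of "(i, j - 1)"] by simp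
  qed
  then show ?thesis by (cases p) simp
qed

lemma col_const: "s \<in> S3 \<Longrightarrow> col p s = col 0 s"
proof -
  assume s: "s \<in> S3"
  have st: "col (p + (t - t')) s = col p s" if "t \<in> S3" "t' \<in> S3" for p t t'
  proof -
    have eq: "p + (t - t') = t - (t' - p)" by simp
    show ?thesis unfolding eq using col_step[OF that(1) s, of "t' - p"] col_step[OF that(2) s, of p] by (rule trans)
  qed
  have "(1, 0) = (1, 1) - (0 :: int, 1 :: int)" "(0, 1) = (1, 1) - (1 :: int, 0 :: int)" "(1, 1) \<in> S3" "(0, 1) \<in> S3" "(1, 0) \<in> S3"
    by (simp_all add: S3_def)
  then have e: "col (p + (1, 0)) s = col p s" "col (p + (0, 1)) s = col p s" for p using st by metis+
  show "col p s = col 0 s" by (rule int2_induct[where P = "\<lambda>p. col p s = col 0 s"]) (simp_all add: e)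
qed

text \<open>With constant colours every walk of length 2 adds a fixed difference of colours, so
  \<open>f\<close> is affine modulo \<open>2L'\<close>. Its linear part is read off from (1,0) =
  (1,1) - (0,1) and (0,1) = (1,1) - (1,0).\<close>

lemma label_linear: "\<exists>d\<in>sym6. L' = d ` L"
proof -
  define g where "g s = col 0 s" for s
  have gS: "g (1, 0) \<in> S3" "g (0, 1) \<in> S3" "g (1, 1) \<in> S3" unfolding g_def by (rule col(1); simp add: S3_def)+
  have gi: "g (1, 0) \<noteq> g (0, 1)" "g (1, 0) \<noteq> g (1, 1)" "g (0, 1) \<noteq> g (1, 1)"
  proof -
    have "g s \<noteq> g t" if "s \<in> S3" "t \<in> S3" "s \<noteq> t" for s t using col_inj that unfolding g_def by blast
    then show "g (1, 0) \<noteq> g (0, 1)" "g (1, 0) \<noteq> g (1, 1)" "g (0, 1) \<noteq> g (1, 1)" by (simp_all add: S3_def)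
  qed
  have "\<exists>d\<in>sym6. d (1, 0) = g (1, 1) - g (0, 1) \<and> d (0, 1) = g (1, 1) - g (1, 0)"
    by (rule S3_cases[OF gS(1)]; rule S3_cases[OF gS(2)]; rule S3_cases[OF gS(3)];
        use gi in \<open>simp add: sym6_def mats_def lm_def\<close>)
  then obtain d where d: "d \<in> sym6" "d (1, 0) = g (1, 1) - g (0, 1)" "d (0, 1) = g (1, 1) - g (1, 0)" by blast
  have dl: "d (p + q) = d p + d q" "d (p - q) = d p - d q" for p q using sym6_linear[OF d(1)] by blast+
  have d0: "d 0 = 0" using dl(2)[of 0 0] by simp
  have st: "cong2 L' (f (p + (t - s))) (g t - g s + f p)" if "s \<in> S3" "t \<in> S3" for p s t
  proof -
    have "p + (t - s) = t - (s - p)" by simp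
    then show ?thesis using walk2[OF that, of p] col_const[OF that(2)] col_const[OF that(1)] unfolding g_def by metis
  qed
  have e: "(1, 0) = (1, 1) - (0 :: int, 1 :: int)" "(0, 1) = (1, 1) - (1 :: int, 0 :: int)" "(1, 1) \<in> S3" "(0, 1) \<in> S3" "(1, 0) \<in> S3"
    by (simp_all add: S3_def)
  have s1: "cong2 L' (f (p + (1, 0))) (d (1, 0) + f p)" for p using st[OF e(4,3), of p] unfolding d(2) by simp
  have s2: "cong2 L' (f (p + (0, 1))) (d (0, 1) + f p)" for p using st[OF e(5,3), of p] unfolding d(3) by simp
  have key: "cong2 L' (f v) (d v + f 0)" for v
  proof (rule int2_induct[where P = "\<lambda>v. cong2 L' (f v) (d v + f 0)"])
    show "cong2 L' (f 0) (d 0 + f 0)" using d0 cong2_refl[OF L'] by simp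
    fix p
    have 1: "cong2 L' (f p) (d p + f 0) \<longleftrightarrow> cong2 L' (f (p + w)) (d (p + w) + f 0)"
      if "cong2 L' (f (p + w)) (d w + f p)" for w
    proof -
      have "cong2 L' (f p) (d p + f 0) \<longleftrightarrow> cong2 L' (d w + f p) (d w + (d p + f 0))" unfolding cong2_shift ..
      also have "\<dots> \<longleftrightarrow> cong2 L' (f (p + w)) (d w + (d p + f 0))" using that sy tr by blast
      finally show ?thesis unfolding dl by (simp add: algebra_simps)
    qed
    show "cong2 L' (f p) (d p + f 0) \<longleftrightarrow> cong2 L' (f (p + (1, 0))) (d (p + (1, 0)) + f 0)" by (rule 1[OF s1])
    show "cong2 L' (f p) (d p + f 0) \<longleftrightarrow> cong2 L' (f (p + (0, 1))) (d (p + (0, 1)) + f 0)" by (rule 1[OF s2])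
  qed
  have iff: "d v \<in> L' \<longleftrightarrow> v \<in> L" for v
  proof -
    have "v \<in> L \<longleftrightarrow> cong2 L' (f (v + v)) (f 0)" unfolding f_cong cong2_double ..
    also have "\<dots> \<longleftrightarrow> cong2 L' (d (v + v) + f 0) (0 + f 0)" 
      unfolding add_0 using key[of "v + v"] sy tr by meson
    also have "\<dots> \<longleftrightarrow> d v \<in> L'" unfolding cong2_shift dl(1) cong2_double ..
    finally show ?thesis by simp
  qed
  have sur: "\<exists>v. w = d v" for w
  proof -
    obtain e where "d \<circ> e = id" using sym6_inv[OF d(1)] by blast
    then have "w = d (e w)" by (metis comp_apply id_apply)
    then show ?thesis by blast
  qed
  have "L' = d ` L"
  proof (intro equalityI subsetI)
    fix w assume w: "w \<in> L'"
    obtain v where v: "w = d v" using sur by blast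
    show "w \<in> d ` L" using w iff[of v] unfolding v by blast
  next
    fix w assume "w \<in> d ` L" then show "w \<in> L'" using iff by blast
  qed
  then show ?thesis using d(1) by blast
qed

end

end

section \<open>Labelled graphs and the lattices that model them\<close>

definition models :: "plane_drawing \<Rightarrow> (int \<times> int) set \<Rightarrow> bool" where
  "models G L \<longleftrightarrow> (\<exists>\<psi>. range \<psi> = verts G \<and> (\<forall>p q. \<psi> p = \<psi> q \<longleftrightarrow> cong2 L p q) \<and>
     (\<forall>p q. adj G (\<psi> p) (\<psi> q) \<longleftrightarrow> (\<exists>s\<in>S3. cong2 L q (s - p))))"

lemma modelsE:
  assumes "models G L"
  obtains \<psi> where "range \<psi> = verts G" "\<And>p q. \<psi> p = \<psi> q \<longleftrightarrow> cong2 L p q"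
    "\<And>p q. adj G (\<psi> p) (\<psi> q) \<longleftrightarrow> (\<exists>s\<in>S3. cong2 L q (s - p))"
  using assms unfolding models_def by blast

lemma graph_iso_sym: "graph_iso G H \<Longrightarrow> graph_iso H G"
proof -
  assume "graph_iso G H"
  then obtain \<phi> where p: "bij_betw \<phi> (verts G) (verts H)"
    "\<forall>u\<in>verts G. \<forall>v\<in>verts G. adj G u v \<longleftrightarrow> adj H (\<phi> u) (\<phi> v)" unfolding graph_iso_def by blast
  let ?i = "inv_into (verts G) \<phi>"
  have b: "bij_betw ?i (verts H) (verts G)" using bij_betw_inv_into[OF p(1)] .
  have "adj H u v \<longleftrightarrow> adj G (?i u) (?i v)" if "u \<in> verts H" "v \<in> verts H" for u v
  proof -
    have "?i u \<in> verts G" "?i v \<in> verts G" using bij_betwE[OF b] that by blast+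
    moreover have "\<phi> (?i u) = u" "\<phi> (?i v) = v" using bij_betw_inv_into_right[OF p(1)] that by blast+
    ultimately show ?thesis using p(2) by metis
  qed
  then show ?thesis unfolding graph_iso_def using b by blast
qed

lemma iso_label_map:
  assumes L: "lat L" "lat L'" and m: "models G L" "models H L'" and iso: "graph_iso G H"
  obtains f where "label_map L L' f"
proof -
  obtain \<psi> where a: "range \<psi> = verts G" "\<And>p q. \<psi> p = \<psi> q \<longleftrightarrow> cong2 L p q"
    "\<And>p q. adj G (\<psi> p) (\<psi> q) \<longleftrightarrow> (\<exists>s\<in>S3. cong2 L q (s - p))" by (rule modelsE[OF m(1)]) (rule that)
  obtain \<xi> where b: "range \<xi> = verts H" "\<And>p q. \<xi> p = \<xi> q \<longleftrightarrow> cong2 L' p q"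
    "\<And>p q. adj H (\<xi> p) (\<xi> q) \<longleftrightarrow> (\<exists>s\<in>S3. cong2 L' q (s - p))" by (rule modelsE[OF m(2)]) (rule that)
  obtain \<phi> where p: "bij_betw \<phi> (verts G) (verts H)"
    "\<forall>u\<in>verts G. \<forall>v\<in>verts G. adj G u v \<longleftrightarrow> adj H (\<phi> u) (\<phi> v)" using iso unfolding graph_iso_def by blast
  have aV: "\<psi> p \<in> verts G" for p using a(1) by blast
  have "\<exists>q. \<xi> q = \<phi> (\<psi> p)" for p using bij_betwE[OF p(1)] aV[of p] b(1) by (metis imageE)
  then obtain f where f: "\<And>p. \<xi> (f p) = \<phi> (\<psi> p)" by metis
  have "label_map L L' f"
  proof
    show "lat L" "lat L'" by fact+
    show "cong2 L' (f p) (f q) \<longleftrightarrow> cong2 L p q" for p q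
      unfolding b(2)[symmetric] a(2)[symmetric] f
      by (rule inj_on_eq_iff[OF bij_betw_imp_inj_on[OF p(1)] aV aV])
    fix s p assume s: "s \<in> S3"
    have "cong2 L (s - p) (s - p)" using cong2_refl[OF L(1)] .
    then have "adj G (\<psi> p) (\<psi> (s - p))" unfolding a(3) using s by blast
    then have "adj H (\<xi> (f p)) (\<xi> (f (s - p)))" unfolding f using p(2) aV by blast
    then show "\<exists>c\<in>S3. cong2 L' (f (s - p)) (c - f p)" unfolding b(3) .
  qed
  then show ?thesis using that by blast
qed

lemma sym6_lat:
  assumes d: "d \<in> sym6" and L: "lat L"
  shows "lat (d ` L)"
proof -
  obtain e where e: "e \<in> sym6" "d \<circ> e = id" using sym6_inv[OF d] by blast
  obtain k where k: "k > 0" "(k, 0) \<in> L" "(0, k) \<in> L" using L unfolding lat_def by blast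
  have kL: "(a * k, b * k) \<in> L" for a b
  proof -
    have "zmul a (k, 0) + zmul b (0, k) \<in> L" using lat_add[OF L] lat_zmul[OF L] k by blast
    then show ?thesis by (simp add: zmul_def)
  qed
  have "\<exists>a b. e (k, 0) = (a * k, b * k)" "\<exists>a b. e (0, k) = (a * k, b * k)"
  proof -
    obtain m1 m2 m3 m4 where "e = lm (m1, m2, m3, m4)" using e(1) unfolding sym6_def by auto
    then show "\<exists>a b. e (k, 0) = (a * k, b * k)" "\<exists>a b. e (0, k) = (a * k, b * k)"
      unfolding lm_def by auto
  qed
  then have "e (k, 0) \<in> L" "e (0, k) \<in> L" using kL by metis+
  then have "d (e (k, 0)) \<in> d ` L" "d (e (0, k)) \<in> d ` L" by blast+
  then have "(k, 0) \<in> d ` L" "(0, k) \<in> d ` L" using e(2) by (metis comp_apply id_apply)+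
  moreover have "d 0 = 0" using sym6_linear(2)[OF d, of 0 0] by simp
  then have "0 \<in> d ` L" using lat_0[OF L] by force
  moreover have "x - y \<in> d ` L" if "x \<in> d ` L" "y \<in> d ` L" for x y
  proof -
    obtain p q where pq: "p \<in> L" "q \<in> L" "x = d p" "y = d q" using \<open>x \<in> d ` L\<close> \<open>y \<in> d ` L\<close> by blast
    have "d (p - q) \<in> d ` L" using lat_diff[OF L pq(1,2)] by blast
    then show ?thesis unfolding pq(3,4) sym6_linear(2)[OF d] .
  qed
  ultimately show ?thesis unfolding lat_def using k(1) by blast
qed

lemma hnf_member: "(x, y) \<in> hnf A B D \<longleftrightarrow> (\<exists>j. y = j * D \<and> A dvd (x - j * B))"
proof
  assume "\<exists>j. y = j * D \<and> A dvd (x - j * B)"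
  then obtain j i where "y = j * D" "x - j * B = A * i" by (auto elim!: dvdE)
  then have "(x, y) = (i * A + j * B, j * D)" by (simp add: algebra_simps)
  then show "(x, y) \<in> hnf A B D" unfolding hnf_def by blast
qed (auto simp: hnf_def)

text \<open>A symmetry moves \<open>u\<close> to \<plusminus>(1,0), which forces
  \<open>A = 1\<close> and therefore \<open>B = 0\<close> in the normal form.\<close>

lemma unit_hnf:
  assumes L: "lat L" and u: "u \<in> unit6" "u \<in> L"
  obtains d D where "d \<in> sym6" "D > 0" "d ` L = hnf 1 0 D"
proof -
  have "\<exists>d\<in>sym6. d u = (1, 0) \<or> d u = (- 1, 0)"
    using u(1) unfolding unit6_def by (elim insertE emptyE; simp add: sym6_def mats_def lm_def)
  then obtain d where d: "d \<in> sym6" "d u = (1, 0) \<or> d u = (- 1, 0)" by blast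
  have dL: "lat (d ` L)" using sym6_lat[OF d(1) L] .
  have "d u \<in> d ` L" using u(2) by blast
  then have 1: "(1, 0) \<in> d ` L" using d(2) lat_uminus[OF dL, of "(- 1, 0)"] by auto
  obtain A B D where h: "A > 0" "D > 0" "0 \<le> B" "B < A" "d ` L = hnf A B D" by (rule lat_hnf[OF dL])
  have "A dvd 1" using 1 h(2) unfolding h(5) hnf_member by auto
  then have "A = 1" using h(1) by simp
  then have "B = 0" using h(3,4) by simp
  then show ?thesis using that d(1) h(2,5) \<open>A = 1\<close> by blast
qed

text \<open>The box of width \<open>2A\<close> and height \<open>2D\<close> is a fundamental domain
  for \<open>2L\<close>.\<close>

lemma models_card:
  assumes m: "models G (hnf A B D)" and AD: "A > 0" "D > 0"
  shows "card (verts G) = 4 * nat (A * D)"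
proof -
  obtain \<psi> where a: "range \<psi> = verts G" "\<And>p q. \<psi> p = \<psi> q \<longleftrightarrow> cong2 (hnf A B D) p q"
    by (rule modelsE[OF m]) (rule that)
  have cong: "cong2 (hnf A B D) (x, y) (x', y') \<longleftrightarrow> (\<exists>i j. x - x' = 2 * (i * A + j * B) \<and> y - y' = 2 * (j * D))" for x y x' y'
  proof -
    have "cong2 (hnf A B D) (x, y) (x', y') \<longleftrightarrow> (\<exists>i j. (x, y) - (x', y') = (i * A + j * B, j * D) + (i * A + j * B, j * D))"
      unfolding cong2_def hnf_def by blast
    then show ?thesis by simp
  qed
  let ?R = "{0..<2 * A} \<times> {0..<2 * D}"
  have inj: "inj_on \<psi> ?R"
  proof (rule inj_onI)
    fix p q assume pq: "p \<in> ?R" "q \<in> ?R" "\<psi> p = \<psi> q"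
    obtain x y where p: "p = (x, y)" by (cases p)
    obtain x' y' where q: "q = (x', y')" by (cases q)
    obtain i j where ij: "x - x' = 2 * (i * A + j * B)" "y - y' = 2 * (j * D)" using pq(3) unfolding a(2) p q cong by blast
    have b: "0 \<le> x" "x < 2 * A" "0 \<le> x'" "x' < 2 * A" "0 \<le> y" "y < 2 * D" "0 \<le> y'" "y' < 2 * D" using pq p q by auto
    have z: "u = v" if "u - v = 2 * (j * D)" "0 \<le> u" "u < 2 * D" "0 \<le> v" "v < 2 * D" for u v j D :: int
    proof -
      have "u mod (2 * D) = u" "v mod (2 * D) = v" using that by simp_all
      moreover have "u = v + j * (2 * D)" using that(1) by simp
      then have "u mod (2 * D) = v mod (2 * D)" by simp
      ultimately show ?thesis by linarith
    qed
    have y: "y = y'" using z[OF ij(2) b(5-8)] .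
    then have "j = 0" using ij(2) AD by simp
    then have "x - x' = 2 * (i * A)" using ij(1) by simp
    then have "x = x'" using z b(1-4) by blast
    then show "p = q" using y p q by simp
  qed
  have img: "\<psi> ` ?R = range \<psi>"
  proof (intro equalityI subsetI)
    fix w assume "w \<in> range \<psi>"
    then obtain x y where w: "w = \<psi> (x, y)" by auto
    define j where "j = y div (2 * D)"
    define i where "i = (x - 2 * j * B) div (2 * A)"
    let ?p = "((x - 2 * j * B) mod (2 * A), y mod (2 * D))"
    have "x - (x - 2 * j * B) mod (2 * A) = 2 * (i * A + j * B)"
      using minus_mod_eq_div_mult[of "x - 2 * j * B" "2 * A"] unfolding i_def[symmetric] by (simp add: algebra_simps)
    moreover have "y - y mod (2 * D) = 2 * (j * D)"
      using minus_mod_eq_div_mult[of y "2 * D"] unfolding j_def[symmetric] by simp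
    ultimately have "\<psi> (x, y) = \<psi> ?p" unfolding a(2) cong by blast
    moreover have "?p \<in> ?R" using AD by simp
    ultimately show "w \<in> \<psi> ` ?R" unfolding w by blast
  qed auto
  have "card (verts G) = card ?R" using card_image[OF inj] unfolding img a(1) .
  also have "\<dots> = 4 * nat (A * D)" using AD by (simp add: nat_mult_distrib)
  finally show ?thesis .
qed

lemma graph_iso_card: "graph_iso G H \<Longrightarrow> card (verts G) = card (verts H)"
  unfolding graph_iso_def using bij_betw_same_card by blast

text \<open>A linear symmetry permutes \<open>S3\<close> only up to a common translation by 2h,
  which is absorbed by shifting all labels by \<open>h\<close>.\<close>

lemma models_image:
  assumes d: "d \<in> sym6" and m: "models G L"
  shows "models G (d ` L)"
proof -
  obtain \<psi> where a: "range \<psi> = verts G" "\<And>p q. \<psi> p = \<psi> q \<longleftrightarrow> cong2 L p q"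
    "\<And>p q. adj G (\<psi> p) (\<psi> q) \<longleftrightarrow> (\<exists>s\<in>S3. cong2 L q (s - p))" by (rule modelsE[OF m]) (rule that)
  obtain e where e: "e \<in> sym6" "d \<circ> e = id" "e \<circ> d = id" using sym6_inv[OF d] by blast
  have de: "d (e p) = p" "e (d p) = p" for p using e(2,3) by (metis comp_apply id_apply)+
  have "\<exists>h. (\<lambda>s. e s + (h + h)) ` S3 = S3"
  proof -
    have "(\<lambda>s. e s + ((0, 0) + (0, 0))) ` S3 = S3 \<or> (\<lambda>s. e s + ((1, 0) + (1, 0))) ` S3 = S3 \<or>
        (\<lambda>s. e s + ((0, 1) + (0, 1))) ` S3 = S3"
    proof -
      obtain m where m: "m \<in> mats" "e = lm m" using e(1) unfolding sym6_def by blast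
      show ?thesis using m(1) unfolding m(2) mats_def S3_def
        by (elim insertE emptyE; simp add: lm_def insert_commute)
    qed
    then show ?thesis by blast
  qed
  then obtain h where h: "(\<lambda>s. e s + (h + h)) ` S3 = S3" by blast
  define \<xi> where "\<xi> p = \<psi> (e p + h)" for p
  have cg: "cong2 (d ` L) p q \<longleftrightarrow> cong2 L (e p) (e q)" for p q
  proof -
    have "p - q = d l + d l \<longleftrightarrow> e p - e q = l + l" for l
      using de sym6_linear(1)[OF d] sym6_linear(2)[OF e(1)] by metis
    then show ?thesis unfolding cong2_def by blast
  qed
  have "\<psi> p = \<xi> (d (p - h))" for p unfolding \<xi>_def de by simp
  then have "range \<psi> \<subseteq> range \<xi>" by (metis image_subsetI rangeI)
  moreover have "range \<xi> \<subseteq> range \<psi>" unfolding \<xi>_def by blast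
  ultimately have "range \<xi> = verts G" using a(1) by simp
  moreover have "\<xi> p = \<xi> q \<longleftrightarrow> cong2 (d ` L) p q" for p q
    unfolding \<xi>_def a(2) cg cong2_shift ..
  moreover have "adj G (\<xi> p) (\<xi> q) \<longleftrightarrow> (\<exists>s\<in>S3. cong2 (d ` L) q (s - p))" for p q
  proof -
    have "adj G (\<xi> p) (\<xi> q) \<longleftrightarrow> (\<exists>t\<in>(\<lambda>s. e s + (h + h)) ` S3. cong2 L (e q + h) (t - (e p + h)))"
      unfolding \<xi>_def a(3) h ..
    also have "\<dots> \<longleftrightarrow> (\<exists>s\<in>S3. cong2 L (e q + h) (e s + (h + h) - (e p + h)))" by blast
    also have "\<dots> \<longleftrightarrow> (\<exists>s\<in>S3. cong2 L (e q + h) (e (s - p) + h))"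
      unfolding sym6_linear(2)[OF e(1)] by (simp add: algebra_simps)
    finally show ?thesis unfolding cg cong2_shift .
  qed
  ultimately show ?thesis unfolding models_def by blast
qed

lemma models_iso:
  assumes m: "models G L" "models H L"
  shows "graph_iso G H"
proof -
  obtain \<psi> where a: "range \<psi> = verts G" "\<And>p q. \<psi> p = \<psi> q \<longleftrightarrow> cong2 L p q"
    "\<And>p q. adj G (\<psi> p) (\<psi> q) \<longleftrightarrow> (\<exists>s\<in>S3. cong2 L q (s - p))" by (rule modelsE[OF m(1)]) (rule that)
  obtain \<xi> where b: "range \<xi> = verts H" "\<And>p q. \<xi> p = \<xi> q \<longleftrightarrow> cong2 L p q"
    "\<And>p q. adj H (\<xi> p) (\<xi> q) \<longleftrightarrow> (\<exists>s\<in>S3. cong2 L q (s - p))" by (rule modelsE[OF m(2)]) (rule that)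
  define \<phi> where "\<phi> v = \<xi> (inv_into UNIV \<psi> v)" for v
  have \<phi>: "\<phi> (\<psi> p) = \<xi> p" for p
  proof -
    have "\<psi> (inv_into UNIV \<psi> (\<psi> p)) = \<psi> p" by (simp add: f_inv_into_f)
    then show ?thesis unfolding \<phi>_def a(2) b(2) .
  qed
  have "bij_betw \<phi> (verts G) (verts H)" unfolding bij_betw_def
  proof
    show "inj_on \<phi> (verts G)" unfolding a(1)[symmetric] by (rule inj_onI) (auto simp: \<phi> a(2) b(2))
    show "\<phi> ` verts G = verts H" unfolding a(1)[symmetric] b(1)[symmetric] image_image \<phi> ..
  qed
  moreover have "adj G u v \<longleftrightarrow> adj H (\<phi> u) (\<phi> v)" if "u \<in> verts G" "v \<in> verts G" for u v
  proof -
    have "u \<in> range \<psi>" "v \<in> range \<psi>" using that unfolding a(1) by simp_all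
    then obtain p q where "u = \<psi> p" "v = \<psi> q" by (elim rangeE)
    then show ?thesis by (simp add: \<phi> a(3) b(3))
  qed
  ultimately show ?thesis unfolding graph_iso_def by blast
qed

text \<open>If \<open>L'\<close> contains a unit vector, colours need not be constant. Then
  \<open>L\<close> contains one as well, and up to symmetry both lattices are determined by the
  number of vertices.\<close>

theorem graph_iso_iff:
  assumes L: "lat L" "lat L'" and m: "models G L" "models H L'"
  shows "graph_iso G H \<longleftrightarrow> (\<exists>d\<in>sym6. L' = d ` L)"
proof
  assume "\<exists>d\<in>sym6. L' = d ` L"
  then show "graph_iso G H" using models_iso models_image m by blast
next
  assume iso: "graph_iso G H"
  obtain f where f: "label_map L L' f" by (rule iso_label_map[OF L m iso])
  obtain g where g: "label_map L' L g" by (rule iso_label_map[OF L(2,1) m(2,1) graph_iso_sym[OF iso]])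
  show "\<exists>d\<in>sym6. L' = d ` L"
  proof (cases "\<exists>u\<in>unit6. u \<in> L'")
    case False
    then show ?thesis using label_map.label_linear[OF f] by blast
  next
    case True
    then obtain u' where u': "u' \<in> unit6" "u' \<in> L'" by blast
    obtain u where u: "u \<in> unit6" "u \<in> L" using label_map.unit_transfer[OF g u'] by blast
    obtain d D where d: "d \<in> sym6" "D > 0" "d ` L = hnf 1 0 D" by (rule unit_hnf[OF L(1) u])
    obtain d' D' where d': "d' \<in> sym6" "D' > 0" "d' ` L' = hnf 1 0 D'" by (rule unit_hnf[OF L(2) u'])
    have "4 * nat (1 * D) = card (verts G)" using models_card[of G 1 0 D] models_image[OF d(1) m(1)] d by simp
    also have "\<dots> = card (verts H)" using graph_iso_card[OF iso] .
    also have "\<dots> = 4 * nat (1 * D')" using models_card[of H 1 0 D'] models_image[OF d'(1) m(2)] d' by simp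
    finally have "D = D'" using d(2) d'(2) by simp
    then have eq: "d' ` L' = d ` L" using d(3) d'(3) by simp
    obtain e where e: "e \<in> sym6" "e \<circ> d' = id" using sym6_inv[OF d'(1)] by blast
    have "L' = e ` (d' ` L')" using sym6_image[OF e(2)] by simp
    also have "\<dots> = (e \<circ> d) ` L" unfolding eq by (simp add: image_comp)
    finally show ?thesis using sym6_comp[OF e(1) d(1)] by blast
  qed
qed

section \<open>Drawing the quotient of the honeycomb\<close>

definition cx :: "real \<times> real \<Rightarrow> real" where "cx z = cos (pi * fst z)"
definition cy :: "real \<times> real \<Rightarrow> real" where "cy z = cos (pi * snd z)"
definition cz :: "real \<times> real \<Rightarrow> real" where "cz z = sin (pi * fst z) * sin (pi * snd z)"
text \<open>The norm scaled by the square root of 2, so that \<open>den\<close> vanishes exactly in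
  the direction (1,1,0).\<close>

definition rad :: "real \<times> real \<Rightarrow> real" where "rad z = sqrt (2 * (cx z ^ 2 + cy z ^ 2 + cz z ^ 2))"
definition den :: "real \<times> real \<Rightarrow> real" where "den z = rad z - cx z - cy z"

text \<open>The torus map \<open>(cx, cy, cz)\<close> is the quotient by the half-turn onto the pillow surface
  \<open>Z\<^sup>2 = (1 - X\<^sup>2) (1 - Y\<^sup>2)\<close>; it is followed by radial projection to a sphere and by stereographic
  projection from the direction (1,1,0).\<close>
definition pil :: "real \<times> real \<Rightarrow> complex" where
  "pil z = Complex ((cx z - cy z) / den z) (cz z / den z)"

text \<open>The preimage of the pole: the points where \<open>cx\<close> and \<open>cy\<close> are
  both 1.\<close>

definition evens :: "(real \<times> real) set" where
  "evens = {z. \<exists>i j::int. z = (2 * of_int i, 2 * of_int j)}"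

lemma pillow: "cz z ^ 2 = (1 - cx z ^ 2) * (1 - cy z ^ 2)"
  unfolding cz_def cx_def cy_def by (simp add: power_mult_distrib sin_squared_eq)

lemma cxy_le: "\<bar>cx z\<bar> \<le> 1" "\<bar>cy z\<bar> \<le> 1"
  unfolding cx_def cy_def by simp_all

lemma cos_eq_1_iff: "cos (pi * t) = 1 \<longleftrightarrow> (\<exists>i::int. t = 2 * of_int i)"
proof -
  have "cos (pi * t) = 1 \<longleftrightarrow> (\<exists>n::int. pi * t = of_int n * 2 * pi)" by (rule cos_one_2pi_int)
  also have "\<dots> \<longleftrightarrow> (\<exists>i::int. t = 2 * of_int i)" by (intro ex_cong1) (auto simp: field_simps)
  finally show ?thesis .
qed

lemma evens_iff: "z \<in> evens \<longleftrightarrow> cx z = 1 \<and> cy z = 1"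
  unfolding cx_def cy_def cos_eq_1_iff evens_def by (cases z) auto

lemma rad_sq: "rad z ^ 2 = 2 * (cx z ^ 2 + cy z ^ 2 + cz z ^ 2)" "rad z \<ge> 0"
  unfolding rad_def by simp_all

lemma rad_ge: "rad z ^ 2 \<ge> 2"
proof -
  have "cx z ^ 2 + cy z ^ 2 + cz z ^ 2 = 1 + (cx z * cy z) ^ 2" unfolding pillow by (simp add: algebra_simps power_mult_distrib)
  then show ?thesis unfolding rad_sq by simp
qed

lemma den_pos: "z \<notin> evens \<Longrightarrow> den z > 0"
proof -
  assume z: "z \<notin> evens"
  let ?X = "cx z" and ?Y = "cy z"
  have b: "\<bar>?X\<bar> \<le> 1" "\<bar>?Y\<bar> \<le> 1" using cxy_le by blast+
  have rp: "rad z > 0" using rad_ge[of z] rad_sq(2)[of z] by (cases "rad z = 0") auto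
  show ?thesis
  proof (cases "?X + ?Y \<le> 0")
    case True then show ?thesis unfolding den_def using rp by simp
  next
    case False
    have "(?X + ?Y) ^ 2 < rad z ^ 2"
    proof -
      have e: "rad z ^ 2 - (?X + ?Y) ^ 2 = (1 - ?X ^ 2) * (1 - ?Y ^ 2) + (1 - ?X * ?Y) ^ 2"
        unfolding rad_sq pillow by (simp add: power2_eq_square algebra_simps)
      have n: "(1 - ?X ^ 2) * (1 - ?Y ^ 2) \<ge> 0" using b by (simp add: abs_square_le_1)
      have "1 - ?X * ?Y \<noteq> 0"
      proof
        assume a: "1 - ?X * ?Y = 0"
        have "?X > 0 \<or> ?Y > 0" using False by linarith
        then have pos: "?X > 0" "?Y > 0" using a by (auto simp: zero_less_mult_iff dest: sym intro: ccontr) (smt (verit) mult_nonneg_nonpos mult_nonpos_nonneg)+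
        have "?X * ?Y \<le> ?X * 1" using pos b by (intro mult_left_mono) auto
        then have "?X = 1" using a b by linarith
        moreover then have "?Y = 1" using a by simp
        ultimately show False using z evens_iff by blast
      qed
      then have "(1 - ?X * ?Y) ^ 2 > 0" by simp
      then show ?thesis using e n by linarith
    qed
    then have "?X + ?Y < rad z" using rad_sq(2)[of z] power_less_imp_less_base by blast
    then show ?thesis unfolding den_def by simp
  qed
qed

text \<open>The imaginary part of \<open>pil\<close> is the stereographic coordinate divided by the
  square root of 2, so this quadratic form is the squared distance from the origin in the projection
  plane.\<close>

lemma pil_q:
  assumes z: "z \<notin> evens"
  shows "Re (pil z) ^ 2 + 2 * Im (pil z) ^ 2 = (rad z + cx z + cy z) / den z"
proof -
  have d: "den z \<noteq> 0" using den_pos[OF z] by simp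
  have "(cx z - cy z) ^ 2 + 2 * cz z ^ 2 = (rad z + cx z + cy z) * den z"
  proof -
    have "(rad z + cx z + cy z) * den z = rad z ^ 2 - (cx z + cy z) ^ 2"
      unfolding den_def by (simp add: power2_eq_square algebra_simps)
    then show ?thesis unfolding rad_sq by (simp add: power2_eq_square algebra_simps)
  qed
  then have "((cx z - cy z) ^ 2 + 2 * cz z ^ 2) / den z ^ 2 = (rad z + cx z + cy z) / den z"
    using d by (simp add: power2_eq_square)
  then show ?thesis unfolding pil_def by (simp add: power_divide add_divide_distrib)
qed

lemma pil_coords:
  assumes z: "z \<notin> evens"
  defines "q \<equiv> Re (pil z) ^ 2 + 2 * Im (pil z) ^ 2"
  shows "4 * cx z = den z * ((q - 1) + 2 * Re (pil z))" "4 * cy z = den z * ((q - 1) - 2 * Re (pil z))"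
    "cz z = den z * Im (pil z)"
proof -
  have d: "den z \<noteq> 0" using den_pos[OF z] by simp
  have "den z * q = rad z + cx z + cy z" unfolding q_def pil_q[OF z] using d by simp
  then have "den z * (q - 1) = 2 * (cx z + cy z)" unfolding den_def by (simp add: algebra_simps)
  moreover have "den z * Re (pil z) = cx z - cy z" unfolding pil_def using d by simp
  ultimately show "4 * cx z = den z * ((q - 1) + 2 * Re (pil z))" "4 * cy z = den z * ((q - 1) - 2 * Re (pil z))"
    by (simp_all add: distrib_left right_diff_distrib)
  show "cz z = den z * Im (pil z)" unfolding pil_def using d by simp
qed

text \<open>Stretching enlarges the left side of the pillow equation but does not enlarge the right
  side. Equality leaves only X^2 = 1 or Y^2 = 1, where stretching leaves the square.\<close>

lemma pillow_ray:
  fixes X Y Z X' Y' Z' t :: real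
  assumes s: "Z ^ 2 = (1 - X ^ 2) * (1 - Y ^ 2)" "Z' ^ 2 = (1 - X' ^ 2) * (1 - Y' ^ 2)"
    and b: "\<bar>X'\<bar> \<le> 1" "\<bar>Y'\<bar> \<le> 1" and t: "X' = t * X" "Y' = t * Y" "Z' = t * Z" "t > 1"
  shows False
proof -
  have t1: "t ^ 2 > 1" using t(4) by (simp add: one_less_power)
  have le: "X ^ 2 \<le> X' ^ 2" "Y ^ 2 \<le> Y' ^ 2" unfolding t power_mult_distrib
    using t1 mult_right_mono[of 1 "t ^ 2" "X ^ 2"] mult_right_mono[of 1 "t ^ 2" "Y ^ 2"] by auto
  have b2: "X' ^ 2 \<le> 1" "Y' ^ 2 \<le> 1" using b by (simp_all add: abs_square_le_1)
  have "Z' ^ 2 \<le> Z ^ 2" unfolding s by (rule mult_mono) (use le b2 in auto)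
  then have "t ^ 2 * Z ^ 2 \<le> 1 * Z ^ 2" unfolding t power_mult_distrib by simp
  then have "Z ^ 2 = 0" using t1 by (metis mult_le_cancel_right not_le zero_le_power2 order_antisym_conv)
  then have "X ^ 2 = 1 \<or> Y ^ 2 = 1" using s(1) by auto
  then have "X' ^ 2 = t ^ 2 \<or> Y' ^ 2 = t ^ 2" unfolding t power_mult_distrib by auto
  then show False using b2 t1 by auto
qed

text \<open>Equal projections make the coordinates proportional; \<open>pillow_ray\<close> in both
  directions shows that the factor is 1.\<close>

lemma pil_eq_coords:
  assumes z: "z \<notin> evens" "w \<notin> evens" and eq: "pil z = pil w"
  shows "cx w = cx z \<and> cy w = cy z \<and> cz w = cz z"
proof -
  define t where "t = den w / den z"
  have d: "den z > 0" "den w > 0" using den_pos z by blast+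
  have dw: "den w = t * den z" unfolding t_def using d by simp
  have "4 * cx w = t * (4 * cx z)" "4 * cy w = t * (4 * cy z)" "cz w = t * cz z"
    unfolding pil_coords[OF z(1)] pil_coords[OF z(2)] unfolding eq dw by simp_all
  then have t: "cx w = t * cx z" "cy w = t * cy z" "cz w = t * cz z" by simp_all
  have tp: "t > 0" unfolding t_def using d by simp
  have "\<not> t > 1" using pillow_ray[OF pillow[of z] pillow[of w] cxy_le t] by blast
  moreover have "\<not> 1 / t > 1"
    using pillow_ray[OF pillow[of w] pillow[of z] cxy_le, of "1 / t"] t tp by auto
  ultimately have "t = 1" using tp by (simp add: field_simps)
  then show ?thesis using t by simp
qed

lemma cos_pi_eq: "cos (pi * s) = cos (pi * t) \<longleftrightarrow> (\<exists>k::int. s = t + 2 * of_int k \<or> s = - t + 2 * of_int k)"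
proof
  assume "cos (pi * s) = cos (pi * t)"
  then have "cos (pi * s) - cos (pi * t) = 0" by simp
  then have "sin ((pi * s + pi * t) / 2) = 0 \<or> sin ((pi * t - pi * s) / 2) = 0"
    unfolding cos_diff_cos by auto
  then obtain k :: int where "(pi * s + pi * t) / 2 = of_int k * pi \<or> (pi * t - pi * s) / 2 = of_int k * pi"
    unfolding sin_zero_iff_int2 by blast
  then have "s = - t + 2 * of_int k \<or> s = t + 2 * of_int (- k)"
  proof
    assume "(pi * s + pi * t) / 2 = of_int k * pi"
    then have "pi * (s + t - 2 * of_int k) = 0" by (simp add: algebra_simps)
    then show ?thesis by simp
  next
    assume "(pi * t - pi * s) / 2 = of_int k * pi"
    then have "pi * (t - s - 2 * of_int k) = 0" by (simp add: algebra_simps)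
    then show ?thesis by simp
  qed
  then show "\<exists>k::int. s = t + 2 * of_int k \<or> s = - t + 2 * of_int k" by blast
next
  assume "\<exists>k::int. s = t + 2 * of_int k \<or> s = - t + 2 * of_int k"
  then obtain k :: int where "s = t + 2 * of_int k \<or> s = - t + 2 * of_int k" by blast
  moreover have "cos (pi * (x + 2 * of_int k)) = cos (pi * x)" for x :: real
    using cos_add[of "pi * x" "of_int k * 2 * pi"] cos_one_2pi_int[of "of_int k * 2 * pi"]
      sin_zero_iff_int2[of "of_int k * 2 * pi"] by (auto simp: algebra_simps) (metis mult.commute mult.left_commute of_int_mult of_int_numeral)
  from this[of t] this[of "- t"] calculation show "cos (pi * s) = cos (pi * t)" by auto
qed

lemma sin_period: "sin (pi * (x + 2 * of_int k)) = sin (pi * x)"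
proof -
  have "cos (of_int k * 2 * pi) = (1::real)" using cos_one_2pi_int by blast
  moreover have "sin (of_int k * 2 * pi) = (0::real)" using sin_zero_iff_int2[of "of_int k * 2 * pi"]
    by (metis of_int_mult of_int_numeral)
  moreover have "pi * (x + 2 * of_int k) = pi * x + of_int k * 2 * pi" by (simp add: algebra_simps)
  ultimately show ?thesis by (simp add: sin_add)
qed

lemma pil_inv:
  assumes "w - z \<in> evens \<or> w + z \<in> evens"
  shows "cx w = cx z \<and> cy w = cy z \<and> cz w = cz z \<and> pil w = pil z"
proof -
  have "cx w = cx z \<and> cy w = cy z \<and> cz w = cz z"
    using assms
  proof
    assume "w - z \<in> evens"
    then obtain i j :: int where "w - z = (2 * of_int i, 2 * of_int j)" unfolding evens_def by blast
    then have w: "fst w = fst z + 2 * of_int i" "snd w = snd z + 2 * of_int j" by (auto simp: prod_eq_iff)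
    then show ?thesis unfolding cx_def cy_def cz_def cos_pi_eq unfolding w sin_period by blast
  next
    assume "w + z \<in> evens"
    then obtain i j :: int where "w + z = (2 * of_int i, 2 * of_int j)" unfolding evens_def by blast
    then have w: "fst w = - fst z + 2 * of_int i" "snd w = - snd z + 2 * of_int j" by (auto simp: prod_eq_iff)
    then show ?thesis unfolding cx_def cy_def cz_def cos_pi_eq unfolding w sin_period by auto
  qed
  then show ?thesis unfolding pil_def den_def rad_def by simp
qed

text \<open>\<open>cx\<close> and \<open>cy\<close> fix the two coordinates up to period and
  independent signs, and \<open>cz\<close> couples the signs. If they disagree, \<open>cz\<close>
  vanishes, so one coordinate is an integer and changing its sign is a shift by a period.\<close>

lemma pil_eq:
  assumes z: "z \<notin> evens" "w \<notin> evens"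
  shows "pil z = pil w \<longleftrightarrow> w - z \<in> evens \<or> w + z \<in> evens"
proof
  assume "pil z = pil w"
  then have c: "cx w = cx z" "cy w = cy z" "cz w = cz z" using pil_eq_coords[OF z] by blast+
  obtain k :: int where k: "fst w = fst z + 2 * of_int k \<or> fst w = - fst z + 2 * of_int k"
    using c(1) unfolding cx_def cos_pi_eq by blast
  obtain l :: int where l: "snd w = snd z + 2 * of_int l \<or> snd w = - snd z + 2 * of_int l"
    using c(2) unfolding cy_def cos_pi_eq by blast
  have ev: "p \<in> evens" if "fst p = 2 * of_int i" "snd p = 2 * of_int j" for p and i j :: int
    using that unfolding evens_def by (auto simp: prod_eq_iff)
  have int: "\<exists>i::int. t = of_int i" if "sin (pi * t) = 0" for t
    using that unfolding sin_zero_iff_int2 by auto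
  have mix: "w - z \<in> evens \<or> w + z \<in> evens"
    if kl: "fst w = a * fst z + 2 * of_int k" "snd w = - a * snd z + 2 * of_int l" "a = 1 \<or> a = - 1" for a :: real
  proof -
    have "cz w = - cz z" using kl(3) unfolding cz_def kl sin_period by auto
    then have "cz z = 0" using c(3) by simp
    then have "sin (pi * fst z) = 0 \<or> sin (pi * snd z) = 0" unfolding cz_def by simp
    then obtain i :: int where i: "fst z = of_int i \<or> snd z = of_int i" using int by blast
    show ?thesis using i kl
      by (elim disjE) (auto intro: ev[of _ "k" "l + i"] ev[of _ "k + i" l] ev[of _ "k - i" l] ev[of _ k "l - i"] ev[of _ "i + k" l])
  qed
  show "w - z \<in> evens \<or> w + z \<in> evens"
    using k l mix[of 1] mix[of "- 1"] ev[of "w - z" k l] ev[of "w + z" k l] by auto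
next
  assume "w - z \<in> evens \<or> w + z \<in> evens"
  then show "pil z = pil w" using pil_inv by metis
qed

lemma pil_cont: "continuous_on (- evens) pil"
proof -
  have d: "den z \<noteq> 0" if "z \<in> - evens" for z using den_pos that by fastforce
  have c: "continuous_on S cx" "continuous_on S cy" "continuous_on S cz" for S
    unfolding cx_def cy_def cz_def by (intro continuous_intros)+
  have "continuous_on S den" for S unfolding den_def rad_def by (intro continuous_intros c)
  then show ?thesis unfolding pil_def Complex_eq by (intro continuous_intros c) (use d in auto)
qed

text \<open>Along the ray the defect of the pillow equation changes sign by the time the ray reaches
  the boundary of the square \<open>|X|, |Y| \<le> 1\<close>.\<close>

lemma pillow_ray_exists:
  fixes x y z :: real
  assumes "x \<noteq> 0 \<or> y \<noteq> 0 \<or> z \<noteq> 0"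
  obtains t where "t > 0" "\<bar>t * x\<bar> \<le> 1" "\<bar>t * y\<bar> \<le> 1" "(t * z) ^ 2 = (1 - (t * x) ^ 2) * (1 - (t * y) ^ 2)"
proof (cases "x = 0 \<and> y = 0")
  case True
  then have "z \<noteq> 0" using assms by blast
  then show ?thesis using that[of "1 / \<bar>z\<bar>"] True by (simp add: power_divide)
next
  case False
  define m where "m = max \<bar>x\<bar> \<bar>y\<bar>"
  have m: "m > 0" unfolding m_def using False by auto
  define g where "g t = (1 - (t * x) ^ 2) * (1 - (t * y) ^ 2) - (t * z) ^ 2" for t
  have "continuous_on {0..1/m} g" unfolding g_def by (intro continuous_intros)
  moreover have "g (1 / m) \<le> 0"
  proof -
    have "m = \<bar>x\<bar> \<or> m = \<bar>y\<bar>" unfolding m_def by linarith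
    then have "(1 / m * x) ^ 2 = 1 \<or> (1 / m * y) ^ 2 = 1" using m by (auto simp: power_mult_distrib power_divide)
    then show ?thesis unfolding g_def by auto
  qed
  moreover have "0 \<le> g 0" unfolding g_def by simp
  ultimately obtain t where t: "0 \<le> t" "t \<le> 1 / m" "g t = 0" using IVT2'[of g "1 / m" 0 0] m by auto
  have "t \<noteq> 0" using t(3) unfolding g_def by auto
  then have tp: "t > 0" using t(1) by simp
  have "t * m \<le> 1" using t(2) m by (simp add: field_simps)
  moreover have "\<bar>x\<bar> \<le> m" "\<bar>y\<bar> \<le> m" unfolding m_def by auto
  then have "t * \<bar>x\<bar> \<le> t * m" "t * \<bar>y\<bar> \<le> t * m" using tp by simp_all
  moreover note this
  ultimately have "t * \<bar>x\<bar> \<le> 1" "t * \<bar>y\<bar> \<le> 1" by linarith+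
  then have "\<bar>t * x\<bar> \<le> 1" "\<bar>t * y\<bar> \<le> 1" using tp by (simp_all add: abs_mult)
  then show ?thesis using that[OF tp] t(3) unfolding g_def by simp
qed

lemma pil_surj:
  obtains z where "z \<notin> evens" "pil z = \<zeta>"
proof -
  define a b where "a = Re \<zeta>" and "b = Im \<zeta>"
  define q where "q = a ^ 2 + 2 * b ^ 2"
  have q0: "q \<ge> 0" unfolding q_def by simp
  \<comment> \<open>Inverse stereographic projection, up to a positive factor; the third coordinate
    is \<open>2 * b\<close>.\<close>
  define x y where "x = (q - 1) / 2 + a" and "y = (q - 1) / 2 - a"
  have nrm: "2 * (x ^ 2 + y ^ 2 + (2 * b) ^ 2) = (q + 1) ^ 2"
    unfolding x_def y_def q_def by (simp add: power2_eq_square algebra_simps) 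
  have "x \<noteq> 0 \<or> y \<noteq> 0 \<or> 2 * b \<noteq> 0"
  proof (rule ccontr)
    assume "\<not> ?thesis"
    then have "(q + 1) ^ 2 = 0" using nrm by simp
    then show False using q0 by simp
  qed
  then obtain t where t: "t > 0" "\<bar>t * x\<bar> \<le> 1" "\<bar>t * y\<bar> \<le> 1" "(t * (2 * b)) ^ 2 = (1 - (t * x) ^ 2) * (1 - (t * y) ^ 2)"
    using pillow_ray_exists by metis
  \<comment> \<open>Both arccosines give nonnegative sines, so the sign of the third coordinate is
    put into the first angle.\<close>
  define sg where "sg = (if b < 0 then - 1 else (1::real))"
  define z where "z = (sg * (arccos (t * x) / pi), arccos (t * y) / pi)"
  have X: "cx z = t * x" unfolding cx_def z_def sg_def using t(2) by (simp add: cos_arccos_abs)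
  have Y: "cy z = t * y" unfolding cy_def z_def using t(3) by (simp add: cos_arccos_abs)
  have Z: "cz z = t * (2 * b)"
  proof -
    have "cz z = sg * (sqrt (1 - (t * x) ^ 2) * sqrt (1 - (t * y) ^ 2))"
      unfolding cz_def z_def sg_def using t(2,3) by (simp add: sin_arccos_abs)
    also have "\<dots> = sg * sqrt ((t * (2 * b)) ^ 2)" unfolding t(4) real_sqrt_mult ..
    also have "\<dots> = t * (2 * b)" unfolding sg_def using t(1) by (simp add: abs_mult)
    finally show ?thesis .
  qed
  have "rad z ^ 2 = (t * (q + 1)) ^ 2"
    unfolding rad_sq X Y Z power_mult_distrib[of t] nrm[symmetric] by (simp add: algebra_simps)
  then have R: "rad z = t * (q + 1)" using rad_sq(2)[of z] t(1) q0 by (simp add: power2_eq_iff_nonneg)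
  have d: "den z = 2 * t" unfolding den_def R X Y x_def y_def by (simp add: algebra_simps)
  have "z \<notin> evens"
  proof
    assume "z \<in> evens"
    then have "cx z = 1" "cy z = 1" using evens_iff by blast+
    moreover from this have "cz z = 0" using pillow[of z] by simp
    ultimately have "den z = 0" unfolding den_def rad_def by simp
    then show False using d t(1) by simp
  qed
  moreover have "pil z = \<zeta>" unfolding pil_def d X Y Z x_def y_def using t(1)
    by (simp add: complex_eq_iff a_def b_def field_simps)
  ultimately show ?thesis using that by blast
qed

text \<open>The image of a compact set is closed although the pole has been removed, because \<open>pil\<close> tends to
  infinity there.\<close>
lemma pil_closed:
  assumes C: "compact C"
  shows "closed (pil ` (C - evens))"
proof -
  have c: "continuous_on S cx" "continuous_on S cy" "continuous_on S cz" for S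
    unfolding cx_def cy_def cz_def by (intro continuous_intros)+
  have r: "continuous_on S rad" for S unfolding rad_def by (intro continuous_intros c)
  have "compact (pil ` (C - evens) \<inter> {\<zeta>. Re \<zeta> ^ 2 + 2 * Im \<zeta> ^ 2 \<le> Q})" for Q
  proof -
    \<comment> \<open>The bound on the image, multiplied by \<open>den\<close>, is a closed
      condition; at a point of \<open>evens\<close> it would read 4 \<le> 0.\<close>
    let ?K = "C \<inter> {z. rad z + cx z + cy z \<le> Q * (rad z - cx z - cy z)}"
    have cl: "closed {z. rad z + cx z + cy z \<le> Q * (rad z - cx z - cy z)}"
      by (rule closed_Collect_le) (intro continuous_intros c r)+
    have K: "compact ?K" by (rule compact_Int_closed[OF C cl])
    have ev: "?K \<subseteq> - evens"
    proof
      fix z assume z: "z \<in> ?K"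
      show "z \<in> - evens"
      proof
        assume "z \<in> evens"
        then have e: "cx z = 1" "cy z = 1" using evens_iff by blast+
        moreover from this have "cz z = 0" using pillow[of z] by simp
        ultimately have "rad z = 2" unfolding rad_def by simp
        then show False using z e by simp
      qed
    qed
    have "pil ` (C - evens) \<inter> {\<zeta>. Re \<zeta> ^ 2 + 2 * Im \<zeta> ^ 2 \<le> Q} = pil ` ?K"
    proof -
      have "Re (pil z) ^ 2 + 2 * Im (pil z) ^ 2 \<le> Q \<longleftrightarrow> rad z + cx z + cy z \<le> Q * (rad z - cx z - cy z)" if "z \<notin> evens" for z
        unfolding pil_q[OF that] using den_pos[OF that] by (simp add: den_def[symmetric] divide_le_eq)
      then show ?thesis using ev by auto
    qed
    moreover have "compact (pil ` ?K)" by (rule compact_continuous_image[OF continuous_on_subset[OF pil_cont ev] K])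
    ultimately show ?thesis by simp
  qed
  note comp = this
  show ?thesis unfolding closed_sequential_limits
  proof (intro allI impI)
    fix f l assume f: "(\<forall>n. f n \<in> pil ` (C - evens)) \<and> f \<longlonglongrightarrow> l"
    have "Bseq f" using f convergent_imp_Bseq convergentI by blast
    then obtain K where K: "\<And>n. norm (f n) \<le> K" "K > 0" unfolding Bseq_def by blast
    have "Re (f n) ^ 2 + 2 * Im (f n) ^ 2 \<le> 3 * K ^ 2" for n
    proof -
      have "Re (f n) ^ 2 \<le> K ^ 2" "Im (f n) ^ 2 \<le> K ^ 2"
        using K(1)[of n] abs_Re_le_cmod[of "f n"] abs_Im_le_cmod[of "f n"] by (simp_all add: abs_le_square_iff[symmetric])
      then show ?thesis by simp
    qed
    then have "\<forall>n. f n \<in> pil ` (C - evens) \<inter> {\<zeta>. Re \<zeta> ^ 2 + 2 * Im \<zeta> ^ 2 \<le> 3 * K ^ 2}" using f by auto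
    then have "l \<in> pil ` (C - evens) \<inter> {\<zeta>. Re \<zeta> ^ 2 + 2 * Im \<zeta> ^ 2 \<le> 3 * K ^ 2}"
      using compact_imp_closed[OF comp] f unfolding closed_sequential_limits by blast
    then show "l \<in> pil ` (C - evens)" by blast
  qed
qed

section \<open>The honeycomb: edges and hexagonal cells\<close>

definition rl :: "int \<times> int \<Rightarrow> real \<times> real" where "rl p = (of_int (fst p), of_int (snd p))"

lemma rl_add: "rl (p + q) = rl p + rl q" "rl (p - q) = rl p - rl q" "rl 0 = 0" "rl (- p) = - rl p"
  by (simp_all add: rl_def zero_prod_def prod_eq_iff)

text \<open>The open Voronoi cell of \<open>rl p\<close> for the form x^2 + xy + y^2, whose shortest
  integer vectors are those of \<open>unit6\<close>.\<close>

definition ocell :: "int \<times> int \<Rightarrow> (real \<times> real) set" where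
  "ocell p = {z. \<bar>2 * (fst z - real_of_int (fst p)) + (snd z - real_of_int (snd p))\<bar> < 1 \<and> \<bar>(fst z - real_of_int (fst p)) + 2 * (snd z - real_of_int (snd p))\<bar> < 1 \<and>
     \<bar>(fst z - real_of_int (fst p)) - (snd z - real_of_int (snd p))\<bar> < 1}"

definition ccell :: "int \<times> int \<Rightarrow> (real \<times> real) set" where
  "ccell p = {z. \<bar>2 * (fst z - real_of_int (fst p)) + (snd z - real_of_int (snd p))\<bar> \<le> 1 \<and> \<bar>(fst z - real_of_int (fst p)) + 2 * (snd z - real_of_int (snd p))\<bar> \<le> 1 \<and>
     \<bar>(fst z - real_of_int (fst p)) - (snd z - real_of_int (snd p))\<bar> \<le> 1}"

text \<open>The edge of the honeycomb with the \<open>q\<close>-th vertex of the first kind and direction \<open>s\<close>; the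
  vertices of the first kind are the points \<open>rl q - (1/3, 1/3)\<close>.\<close>
definition gam :: "int \<times> int \<Rightarrow> int \<times> int \<Rightarrow> real \<Rightarrow> real \<times> real" where
  "gam q s t = (real_of_int (fst q) - 1/3 + t * (2/3 - real_of_int (fst s)), real_of_int (snd q) - 1/3 + t * (2/3 - real_of_int (snd s)))"

text \<open>A half-turn reverses an edge and keeps its direction label, so it exchanges the two
  kinds of vertices.\<close>

lemma gam_shift: "gam q s t + rl v = gam (q + v) s t" "rl v - gam q s t = gam (v + s - q) s (1 - t)"
  by (simp_all add: gam_def rl_def algebra_simps diff_divide_distrib)

lemma ocell_shift: "z \<in> ocell p \<Longrightarrow> z + rl v \<in> ocell (p + v)" "z \<in> ocell p \<Longrightarrow> rl v - z \<in> ocell (v - p)"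
proof -
  assume z: "z \<in> ocell p"
  then show "z + rl v \<in> ocell (p + v)" by (simp add: ocell_def rl_def)
  have "2 * (fst (rl v - z) - real_of_int (fst (v - p))) + (snd (rl v - z) - real_of_int (snd (v - p))) = - (2 * (fst z - real_of_int (fst p)) + (snd z - real_of_int (snd p)))"
    "(fst (rl v - z) - real_of_int (fst (v - p))) + 2 * (snd (rl v - z) - real_of_int (snd (v - p))) = - ((fst z - real_of_int (fst p)) + 2 * (snd z - real_of_int (snd p)))"
    "(fst (rl v - z) - real_of_int (fst (v - p))) - (snd (rl v - z) - real_of_int (snd (v - p))) = - ((fst z - real_of_int (fst p)) - (snd z - real_of_int (snd p)))"
    by (simp_all add: rl_def algebra_simps)
  then show "rl v - z \<in> ocell (v - p)" using z unfolding ocell_def by (simp only: mem_Collect_eq abs_minus_cancel)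
qed

lemma S3_cases': "s \<in> S3 \<Longrightarrow> s = (1, 0) \<or> s = (0, 1) \<or> s = (1, 1)"
  unfolding S3_def by blast

lemma tripod_lin:
  fixes A B c d c' d' t t' :: real
  assumes "c = 1 \<and> d = 0 \<or> c = 0 \<and> d = 1 \<or> c = 1 \<and> d = 1" "c' = 1 \<and> d' = 0 \<or> c' = 0 \<and> d' = 1 \<or> c' = 1 \<and> d' = 1"
    and "A = -1 \<or> A = 0 \<or> A = 1" "B = -1 \<or> B = 0 \<or> B = 1" "0 \<le> t" "t \<le> 1" "0 \<le> t'" "t' \<le> 1"
    and "3 * A = t' * (2 - 3 * c') - t * (2 - 3 * c)" "3 * B = t' * (2 - 3 * d') - t * (2 - 3 * d)"
  shows "A = 0 \<and> B = 0 \<and> c = c' \<and> d = d' \<and> t = t' \<or> A = 0 \<and> B = 0 \<and> t = 0 \<and> t' = 0 \<or> t = 1 \<and> t' = 1"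
  using assms(1,2)
  by (elim disjE conjE; use assms(3-10) in \<open>simp; smt (verit)\<close>)

text \<open>The labels differ by integers of absolute value at most 1, which leaves finitely many
  linear cases.\<close>

lemma gam_eq:
  assumes s: "s \<in> S3" "s' \<in> S3" and t: "0 \<le> t" "t \<le> 1" "0 \<le> t'" "t' \<le> 1" and eq: "gam q s t = gam q' s' t'"
  shows "q = q' \<and> s = s' \<and> t = t' \<or> q = q' \<and> t = 0 \<and> t' = 0 \<or> t = 1 \<and> t' = 1"
proof -
  define a b where "a = fst q - fst q'" and "b = snd q - snd q'"
  have e: "real_of_int a = t' * (2/3 - real_of_int (fst s')) - t * (2/3 - real_of_int (fst s))" "real_of_int b = t' * (2/3 - real_of_int (snd s')) - t * (2/3 - real_of_int (snd s))"
    using eq unfolding gam_def a_def b_def by simp_all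
  have "real_of_int a < 2 \<and> real_of_int a > -2 \<and> real_of_int b < 2 \<and> real_of_int b > -2"
    unfolding e by (rule S3_cases[OF s(1)]; rule S3_cases[OF s(2)]; use t in simp)
  then have "a < 2" "a > -2" "b < 2" "b > -2" by linarith+
  then have ab: "a = -1 \<or> a = 0 \<or> a = 1" "b = -1 \<or> b = 0 \<or> b = 1" by linarith+
  have q: "q = q' \<longleftrightarrow> a = 0 \<and> b = 0" unfolding a_def b_def by (auto simp: prod_eq_iff)
  have ss: "real_of_int (fst u) = 1 \<and> real_of_int (snd u) = 0 \<or> real_of_int (fst u) = 0 \<and> real_of_int (snd u) = 1 \<or>
      real_of_int (fst u) = 1 \<and> real_of_int (snd u) = 1" if "u \<in> S3" for u using S3_cases'[OF that] by auto
  have rab: "real_of_int a = - 1 \<or> real_of_int a = 0 \<or> real_of_int a = 1" "real_of_int b = - 1 \<or> real_of_int b = 0 \<or> real_of_int b = 1"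
    using ab by auto
  have "3 * real_of_int a = t' * (2 - 3 * real_of_int (fst s')) - t * (2 - 3 * real_of_int (fst s))"
    "3 * real_of_int b = t' * (2 - 3 * real_of_int (snd s')) - t * (2 - 3 * real_of_int (snd s))"
    unfolding e by (simp_all add: algebra_simps)
  from tripod_lin[OF ss[OF s(1)] ss[OF s(2)] rab t this]
  show ?thesis unfolding q by (auto simp: prod_eq_iff)
qed

lemma int_small: "\<bar>real_of_int k\<bar> < 1 \<Longrightarrow> k = 0" by linarith

lemma gam_ocell:
  assumes s: "s \<in> S3" and t: "0 \<le> t" "t \<le> 1"
  shows "gam q s t \<notin> ocell p"
proof
  assume z: "gam q s t \<in> ocell p"
  define a b where "a = fst q - fst p" and "b = snd q - snd p"
  \<comment> \<open>Along an edge one of the three forms is an integer, hence 0 inside an open cell;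
    another form then asks for a multiple of 3 strictly between \<open>t\<close> and
    \<open>2 + t\<close>.\<close>
  have no3: False if "real_of_int (3 * k) > t" "real_of_int (3 * k) < 2 + t" for k
  proof -
    have "3 * k > 0" "3 * k < 3" using that t by linarith+
    then show False by presburger
  qed
  have ab: "\<bar>2 * (a - 1/3 + t * (2/3 - real_of_int (fst s))) + (b - 1/3 + t * (2/3 - real_of_int (snd s)))\<bar> < 1"
    "\<bar>(a - 1/3 + t * (2/3 - real_of_int (fst s))) + 2 * (b - 1/3 + t * (2/3 - real_of_int (snd s)))\<bar> < 1"
    "\<bar>(a - 1/3 + t * (2/3 - real_of_int (fst s))) - (b - 1/3 + t * (2/3 - real_of_int (snd s)))\<bar> < 1"
    using z unfolding ocell_def gam_def a_def b_def by (simp_all add: algebra_simps)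
  show False using S3_cases'[OF s]
  proof (elim disjE)
    assume s: "s = (1, 1)"
    have "\<bar>real_of_int (a - b)\<bar> < 1" using ab(3) unfolding s by simp
    then have b: "b = a" using int_small by fastforce
    have "t < real_of_int (3 * a)" "real_of_int (3 * a) < 2 + t"
      using ab(1) unfolding s b by (simp_all add: abs_less_iff)
    then show False by (rule no3)
  next
    assume s: "s = (1, 0)"
    have "\<bar>real_of_int (2 * a + b - 1)\<bar> < 1" using ab(1) unfolding s by simp
    then have b: "b = 1 - 2 * a" using int_small by fastforce
    show False using ab(2) no3[of "1 - a - b"] unfolding s b by simp linarith
  next
    assume s: "s = (0, 1)"
    have "\<bar>real_of_int (a + 2 * b - 1)\<bar> < 1" using ab(2) unfolding s by simp
    then have a: "a = 1 - 2 * b" using int_small by fastforce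
    show False using ab(1) no3[of "1 - a - b"] unfolding s a by simp linarith
  qed
qed

lemma ocell_unique:
  assumes "z \<in> ocell p" "z \<in> ocell p'"
  shows "p = p'"
proof -
  define a b where "a = fst p - fst p'" and "b = snd p - snd p'"
  have lt2: "\<bar>v - u\<bar> < 2" if "\<bar>u\<bar> < 1" "\<bar>v\<bar> < 1" for u v :: real using that by linarith
  define u v where "u = fst z" and "v = snd z"
  define f where "f = (\<lambda>p :: int \<times> int. 2 * (u - real_of_int (fst p)) + (v - real_of_int (snd p)))"
  define g where "g = (\<lambda>p :: int \<times> int. (u - real_of_int (fst p)) + 2 * (v - real_of_int (snd p)))"
  define h where "h = (\<lambda>p :: int \<times> int. (u - real_of_int (fst p)) - (v - real_of_int (snd p)))"
  have "\<bar>f p\<bar> < 1" "\<bar>f p'\<bar> < 1" "\<bar>g p\<bar> < 1" "\<bar>g p'\<bar> < 1" "\<bar>h p\<bar> < 1" "\<bar>h p'\<bar> < 1"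
    using assms unfolding ocell_def f_def g_def h_def u_def v_def by blast+
  then have "\<bar>f p' - f p\<bar> < 2" "\<bar>g p' - g p\<bar> < 2" "\<bar>h p' - h p\<bar> < 2" using lt2 by blast+
  moreover have "f p' - f p = real_of_int (2 * a + b)" "g p' - g p = real_of_int (a + 2 * b)" "h p' - h p = real_of_int (a - b)"
    unfolding f_def g_def h_def a_def b_def by simp_all
  ultimately have "\<bar>real_of_int (2 * a + b)\<bar> < 2" "\<bar>real_of_int (a + 2 * b)\<bar> < 2" "\<bar>real_of_int (a - b)\<bar> < 2" by simp_all
  then have "\<bar>2 * a + b\<bar> < 2" "\<bar>a + 2 * b\<bar> < 2" "\<bar>a - b\<bar> < 2" by linarith+
  then have "a = 0" "b = 0" by presburger+
  then show ?thesis unfolding a_def b_def by (simp add: prod_eq_iff)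
qed

lemma ccell_cover: "\<exists>p. z \<in> ccell p"
proof -
  define i j where "i = \<lfloor>fst z\<rfloor>" and "j = \<lfloor>snd z\<rfloor>"
  define x y where "x = fst z - of_int i" and "y = snd z - of_int j"
  have xy: "0 \<le> x" "x < 1" "0 \<le> y" "y < 1" unfolding x_def y_def i_def j_def by linarith+
  have c: "z \<in> ccell (i + a, j + b) \<longleftrightarrow> \<bar>2 * (x - a) + (y - b)\<bar> \<le> 1 \<and> \<bar>(x - a) + 2 * (y - b)\<bar> \<le> 1 \<and> \<bar>(x - a) - (y - b)\<bar> \<le> 1" for a b :: int
    unfolding ccell_def x_def y_def by (simp add: algebra_simps)
  have "z \<in> ccell (i + 0, j + 0) \<or> z \<in> ccell (i + 1, j + 0) \<or> z \<in> ccell (i + 0, j + 1) \<or> z \<in> ccell (i + 1, j + 1)"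
    unfolding c using xy by (simp add: abs_le_iff) linarith
  then show ?thesis by blast
qed

text \<open>The six edges around the cell \<open>p\<close>, each given by its first-kind vertex and
  its direction.\<close>

definition bd :: "int \<times> int \<Rightarrow> ((int \<times> int) \<times> (int \<times> int)) set" where
  "bd p = {(p + (1, 0), (1, 0)), (p, (1, 0)), (p + (0, 1), (0, 1)), (p, (0, 1)), (p + (1, 0), (1, 1)), (p + (0, 1), (1, 1))}"

lemma bd_ccell:
  assumes "(q, s) \<in> bd p" "0 \<le> t" "t \<le> 1"
  shows "gam q s t \<in> ccell p"
  using assms unfolding bd_def ccell_def gam_def by (elim insertE emptyE; simp add: abs_le_iff; linarith)

lemma bd_S3: "(q, s) \<in> bd p \<Longrightarrow> s \<in> S3"
  unfolding bd_def S3_def by auto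

lemma ccell_boundary:
  assumes z: "z \<in> ccell p" "z \<notin> ocell p"
  shows "\<exists>q s t. (q, s) \<in> bd p \<and> 0 \<le> t \<and> t \<le> 1 \<and> z = gam q s t"
proof -
  define x y where "x = fst z - of_int (fst p)" and "y = snd z - of_int (snd p)"
  have c: "\<bar>2 * x + y\<bar> \<le> 1" "\<bar>x + 2 * y\<bar> \<le> 1" "\<bar>x - y\<bar> \<le> 1" using z(1) unfolding ccell_def x_def y_def by simp_all
  have zz: "z = (of_int (fst p) + x, of_int (snd p) + y)" unfolding x_def y_def by simp
  have "\<not> (\<bar>2 * x + y\<bar> < 1 \<and> \<bar>x + 2 * y\<bar> < 1 \<and> \<bar>x - y\<bar> < 1)" using z(2) unfolding ocell_def x_def y_def by simp
  then consider "2 * x + y = 1" | "2 * x + y = - 1" | "x + 2 * y = 1" | "x + 2 * y = - 1" | "x - y = 1" | "x - y = - 1"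
    using c by linarith
  then show ?thesis
  proof cases
    case 1
    show ?thesis by (rule exI[of _ "p + (1, 0)"], rule exI[of _ "(1, 0)"], rule exI[of _ "2 - 3 * x"])
      (use 1 c in \<open>simp add: bd_def zz gam_def field_simps; linarith\<close>)
  next
    case 2
    show ?thesis by (rule exI[of _ p], rule exI[of _ "(1, 0)"], rule exI[of _ "- 1 - 3 * x"])
      (use 2 c in \<open>simp add: bd_def zz gam_def field_simps; linarith\<close>)
  next
    case 3
    show ?thesis by (rule exI[of _ "p + (0, 1)"], rule exI[of _ "(0, 1)"], rule exI[of _ "2 - 3 * y"])
      (use 3 c in \<open>simp add: bd_def zz gam_def field_simps; linarith\<close>)
  next
    case 4
    show ?thesis by (rule exI[of _ p], rule exI[of _ "(0, 1)"], rule exI[of _ "- 1 - 3 * y"])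
      (use 4 c in \<open>simp add: bd_def zz gam_def field_simps; linarith\<close>)
  next
    case 5
    show ?thesis by (rule exI[of _ "p + (1, 0)"], rule exI[of _ "(1, 1)"], rule exI[of _ "2 - 3 * x"])
      (use 5 c in \<open>simp add: bd_def zz gam_def field_simps; linarith\<close>)
  next
    case 6
    show ?thesis by (rule exI[of _ "p + (0, 1)"], rule exI[of _ "(1, 1)"], rule exI[of _ "2 - 3 * y"])
      (use 6 c in \<open>simp add: bd_def zz gam_def field_simps; linarith\<close>)
  qed
qed

lemma rl_ocell: "rl p \<in> ocell p"
  by (simp add: ocell_def rl_def)

lemma open_ocell: "open (ocell p)"
  unfolding ocell_def by (intro open_Collect_conj open_Collect_less continuous_intros)

lemma convex_ocell: "convex (ocell p)"
proof -
  have "ocell p = {z. inner (2, 1) z < 1 + 2 * real_of_int (fst p) + real_of_int (snd p)} \<inter> {z. inner (2, 1) z > - 1 + 2 * real_of_int (fst p) + real_of_int (snd p)}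
    \<inter> ({z. inner (1, 2) z < 1 + real_of_int (fst p) + 2 * real_of_int (snd p)} \<inter> {z. inner (1, 2) z > - 1 + real_of_int (fst p) + 2 * real_of_int (snd p)})
    \<inter> ({z. inner (1, - 1) z < 1 + real_of_int (fst p) - real_of_int (snd p)} \<inter> {z. inner (1, - 1) z > - 1 + real_of_int (fst p) - real_of_int (snd p)})"
    unfolding ocell_def by (auto simp: inner_prod_def abs_less_iff algebra_simps)
  then show ?thesis by (simp add: convex_Int convex_halfspace_lt convex_halfspace_gt)
qed

lemma compact_ccell: "compact (ccell p)"
proof -
  have "closed (ccell p)" unfolding ccell_def by (intro closed_Collect_conj closed_Collect_le continuous_intros)
  moreover have "ccell p \<subseteq> {of_int (fst p) - 1..of_int (fst p) + 1} \<times> {of_int (snd p) - 1..of_int (snd p) + 1}"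
  proof
    fix z assume "z \<in> ccell p"
    then have c: "\<bar>2 * (fst z - real_of_int (fst p)) + (snd z - real_of_int (snd p))\<bar> \<le> 1"
      "\<bar>(fst z - real_of_int (fst p)) + 2 * (snd z - real_of_int (snd p))\<bar> \<le> 1" unfolding ccell_def by blast+
    have lin: "\<bar>x\<bar> \<le> 1 \<and> \<bar>y\<bar> \<le> 1" if "\<bar>2 * x + y\<bar> \<le> 1" "\<bar>x + 2 * y\<bar> \<le> 1" for x y :: real using that by linarith
    have "\<bar>fst z - real_of_int (fst p)\<bar> \<le> 1" "\<bar>snd z - real_of_int (snd p)\<bar> \<le> 1" using lin[OF c] by blast+
    then show "z \<in> {of_int (fst p) - 1..of_int (fst p) + 1} \<times> {of_int (snd p) - 1..of_int (snd p) + 1}"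
      by (cases z) (simp add: abs_le_iff)
  qed
  moreover have "bounded ({of_int (fst p) - 1..of_int (fst p) + 1 :: real} \<times> {of_int (snd p) - 1..of_int (snd p) + 1 :: real})"
    by (intro bounded_Times bounded_closed_interval)
  ultimately show ?thesis using compact_eq_bounded_closed bounded_subset by blast
qed

lemma ccell_contract:
  assumes "z \<in> ccell p" "0 \<le> t" "t < 1"
  shows "rl p + t *\<^sub>R (z - rl p) \<in> ocell p"
proof -
  have *: "\<bar>t * u\<bar> < 1" if "\<bar>u\<bar> \<le> 1" for u
  proof -
    have "\<bar>t\<bar> * \<bar>u\<bar> \<le> t * 1" using that assms(2) by (simp add: mult_left_le)
    then show ?thesis using assms(3) by (simp add: abs_mult)
  qed
  have "t * (2 * (fst z - real_of_int (fst p)) + (snd z - real_of_int (snd p))) = 2 * (t * (fst z - real_of_int (fst p))) + t * (snd z - real_of_int (snd p))"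
    "t * ((fst z - real_of_int (fst p)) + 2 * (snd z - real_of_int (snd p))) = t * (fst z - real_of_int (fst p)) + 2 * (t * (snd z - real_of_int (snd p)))"
    "t * ((fst z - real_of_int (fst p)) - (snd z - real_of_int (snd p))) = t * (fst z - real_of_int (fst p)) - t * (snd z - real_of_int (snd p))"
    by (simp_all add: algebra_simps)
  then show ?thesis using assms(1) * unfolding ocell_def ccell_def rl_def by simp (metis *)
qed

text \<open>With finitely many relatively closed pieces, the union of all others is relatively
  closed too, so no connected set meets two of them.\<close>

lemma components_closed_partition:
  assumes fin: "finite CC" and S: "S = \<Union>CC"
    and C: "\<And>C. C \<in> CC \<Longrightarrow> connected C \<and> C \<noteq> {} \<and> (\<exists>K. closed K \<and> C = K \<inter> S)"
    and dis: "\<And>C C'. C \<in> CC \<Longrightarrow> C' \<in> CC \<Longrightarrow> C \<noteq> C' \<Longrightarrow> C \<inter> C' = {}"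
  shows "components S = CC"
proof -
  have comp: "C \<in> components S" if CC: "C \<in> CC" for C
    unfolding in_components_maximal
  proof (intro conjI allI impI)
    show "C \<noteq> {}" "C \<subseteq> S" "connected C" using C[OF CC] CC S by blast+
    fix T assume T: "T \<noteq> {} \<and> C \<subseteq> T \<and> T \<subseteq> S \<and> connected T"
    obtain K where K: "\<And>C. C \<in> CC \<Longrightarrow> closed (K C) \<and> C = K C \<inter> S" using C by metis
    define N where "N = \<Union>(K ` (CC - {C}))"
    have "closed N" unfolding N_def using fin K by (intro closed_Union) auto
    have NS: "N \<inter> S = \<Union>(CC - {C})" unfolding N_def using K by blast
    have "T \<subseteq> K C \<union> N"
    proof
      fix x assume "x \<in> T"
      then have "x \<in> S" using T by blast
      then obtain C' where C': "C' \<in> CC" "x \<in> C'" unfolding S by blast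
      then have "x \<in> K C'" using K[OF C'(1)] by blast
      then show "x \<in> K C \<union> N" unfolding N_def using C'(1) by blast
    qed
    moreover have "K C \<inter> N \<inter> T = {}"
    proof -
      have "K C \<inter> N \<inter> S = (K C \<inter> S) \<inter> (N \<inter> S)" by blast
      also have "\<dots> = C \<inter> \<Union>(CC - {C})" using K[OF CC] NS by simp
      also have "\<dots> = {}" using dis CC by blast
      finally show ?thesis using T by blast
    qed
    ultimately have "K C \<inter> T = {} \<or> N \<inter> T = {}"
      using connected_closedD[of T "K C" N] T K[OF CC] \<open>closed N\<close> by blast
    moreover have "C \<subseteq> K C \<inter> T" "C \<noteq> {}" using K[OF CC] T C[OF CC] by blast+
    ultimately have "N \<inter> T = {}" by blast
    then show "T = C" using \<open>T \<subseteq> K C \<union> N\<close> T K[OF CC] by blast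
  qed
  show ?thesis
  proof
    show "CC \<subseteq> components S" using comp by blast
    show "components S \<subseteq> CC"
    proof
      fix X assume X: "X \<in> components S"
      then obtain x where x: "x \<in> X" "x \<in> S" using in_components_nonempty in_components_subset by blast
      then obtain C where "C \<in> CC" "x \<in> C" unfolding S by blast
      then show "X \<in> CC" using components_eq[OF X comp] x by blast
    qed
  qed
qed

lemma cong2_hnf_finite:
  fixes f :: "int \<times> int \<Rightarrow> 'a"
  assumes AD: "A > 0" "D > 0" and f: "\<And>p q. cong2 (hnf A B D) p q \<Longrightarrow> f p = f q"
  shows "finite (range f)"
proof -
  have "range f \<subseteq> f ` ({0..<2 * A} \<times> {0..<2 * D})"
  proof
    fix w assume "w \<in> range f"
    then obtain x y where w: "w = f (x, y)" by auto
    define j where "j = y div (2 * D)"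
    define i where "i = (x - 2 * j * B) div (2 * A)"
    let ?p = "((x - 2 * j * B) mod (2 * A), y mod (2 * D))"
    have "x - (x - 2 * j * B) mod (2 * A) = 2 * (i * A + j * B)"
      using minus_mod_eq_div_mult[of "x - 2 * j * B" "2 * A"] unfolding i_def[symmetric] by (simp add: algebra_simps)
    moreover have "y - y mod (2 * D) = 2 * (j * D)"
      using minus_mod_eq_div_mult[of y "2 * D"] unfolding j_def[symmetric] by simp
    ultimately have "(x, y) - ?p = (i * A + j * B, j * D) + (i * A + j * B, j * D)" by simp
    then have "cong2 (hnf A B D) (x, y) ?p" unfolding cong2_def hnf_def by blast
    then have "w = f ?p" using f w by simp
    moreover have "?p \<in> {0..<2 * A} \<times> {0..<2 * D}" using AD by simp
    ultimately show "w \<in> f ` ({0..<2 * A} \<times> {0..<2 * D})" by blast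
  qed
  then show ?thesis by (rule finite_subset) simp
qed

lemma hnf_lat: "A > 0 \<Longrightarrow> D > 0 \<Longrightarrow> lat (hnf A B D)"
proof -
  assume AD: "A > 0" "D > 0"
  have "x - y \<in> hnf A B D" if xy: "x \<in> hnf A B D" "y \<in> hnf A B D" for x y
  proof -
    obtain i j where "x = (i * A + j * B, j * D)" using xy(1) unfolding hnf_def by blast
    moreover obtain i' j' where "y = (i' * A + j' * B, j' * D)" using xy(2) unfolding hnf_def by blast
    ultimately have "x - y = ((i - i') * A + (j - j') * B, (j - j') * D)" by (simp add: algebra_simps)
    then show ?thesis unfolding hnf_def by blast
  qed
  moreover have "0 \<in> hnf A B D" 
  proof -
    have "(0 :: int \<times> int) = (0 * A + 0 * B, 0 * D)" by (simp add: zero_prod_def)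
    then show ?thesis unfolding hnf_def by blast
  qed
  moreover have "(A * D, 0) \<in> hnf A B D" "(0, A * D) \<in> hnf A B D"
  proof -
    have "(A * D, 0) = (D * A + 0 * B, 0 * D)" "(0, A * D) = (- B * A + A * B, A * D)" by simp_all
    then show "(A * D, 0) \<in> hnf A B D" "(0, A * D) \<in> hnf A B D" unfolding hnf_def by blast+
  qed
  ultimately show ?thesis unfolding lat_def using AD by (metis zero_less_mult_iff)
qed

section \<open>The drawing of the quotient graph\<close>

locale pillow_drawing =
  fixes A B D :: int
  assumes A: "A > 0" and D: "D > 0"
begin

definition L where "L = hnf A B D"
lemma L: "lat L" unfolding L_def using hnf_lat A D by blast

text \<open>Coordinates with respect to the basis \<open>(A, 0)\<close>, \<open>(B, D)\<close>; they
  turn doubled lattice vectors into \<open>evens\<close>.\<close>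

definition co :: "real \<times> real \<Rightarrow> real \<times> real" where
  "co z = ((fst z - of_int B * snd z / of_int D) / of_int A, snd z / of_int D)"

definition P where "P z = pil (co z)"
definition poles where "poles = {z. co z \<in> evens}"

lemma co_linear: "co (z + w) = co z + co w" "co (z - w) = co z - co w"
  unfolding co_def by (simp_all add: prod_eq_iff add_divide_distrib diff_divide_distrib ring_distribs)

lemma co_evens: "co z \<in> evens \<longleftrightarrow> (\<exists>l\<in>L. z = rl (l + l))"
proof -
  have AD: "real_of_int A \<noteq> 0" "real_of_int D \<noteq> 0" using A D by auto
  have "co z = (2 * of_int i, 2 * of_int j) \<longleftrightarrow> z = rl ((i * A + j * B, j * D) + (i * A + j * B, j * D))" for i j
  proof -
    have "co z = (2 * of_int i, 2 * of_int j) \<longleftrightarrow> snd z = 2 * of_int j * of_int D \<and> fst z - of_int B * snd z / of_int D = 2 * of_int i * of_int A"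
      unfolding co_def using AD by (auto simp: field_simps)
    also have "\<dots> \<longleftrightarrow> z = rl ((i * A + j * B, j * D) + (i * A + j * B, j * D))"
      unfolding rl_def using AD by (auto simp: prod_eq_iff algebra_simps)
    finally show ?thesis .
  qed
  then show ?thesis unfolding evens_def L_def hnf_def by blast
qed

lemma poles_iff: "z \<in> poles \<longleftrightarrow> (\<exists>l\<in>L. z = rl (l + l))"
  unfolding poles_def using co_evens by simp

lemma P_eq:
  assumes "z \<notin> poles" "w \<notin> poles"
  shows "P z = P w \<longleftrightarrow> (\<exists>l\<in>L. w = z + rl (l + l)) \<or> (\<exists>l\<in>L. w = rl (l + l) - z)"
proof -
  have "P z = P w \<longleftrightarrow> co w - co z \<in> evens \<or> co w + co z \<in> evens"
    unfolding P_def by (rule pil_eq) (use assms in \<open>simp_all add: poles_def\<close>)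
  also have "\<dots> \<longleftrightarrow> (\<exists>l\<in>L. w - z = rl (l + l)) \<or> (\<exists>l\<in>L. w + z = rl (l + l))"
    unfolding co_linear[symmetric] co_evens ..
  finally show ?thesis by (simp add: algebra_simps)
qed

lemma co_cont: "continuous_on S co"
  unfolding co_def by (intro continuous_intros) (use A D in auto)

lemma closed_evens: "closed evens"
proof -
  have c: "continuous_on UNIV cx" "continuous_on UNIV cy"
    unfolding cx_def cy_def by (intro continuous_intros)+
  have "closed ({z. cx z = 1} \<inter> {z. cy z = 1})" by (intro closed_Int closed_Collect_eq c continuous_on_const)
  moreover have "{z. cx z = 1} \<inter> {z. cy z = 1} = evens" using evens_iff by blast
  ultimately show ?thesis by simp
qed

lemma P_cont: "continuous_on (- poles) P"
proof -
  have "continuous_on (- poles) (pil \<circ> co)"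
    by (rule continuous_on_compose[OF co_cont continuous_on_subset[OF pil_cont]]) (auto simp: poles_def)
  then show ?thesis by (simp add: P_def comp_def)
qed

lemma open_poles: "open (- poles)"
proof -
  have "- poles = co -` (- evens)" unfolding poles_def by blast
  moreover have "open (co -` (- evens))" by (rule open_vimage[OF open_Compl[OF closed_evens] co_cont])
  ultimately show ?thesis by simp
qed

lemma P_surj: obtains z where "z \<notin> poles" "P z = w"
proof -
  obtain u where u: "u \<notin> evens" "pil u = w" using pil_surj by blast
  define z where "z = (fst u * of_int A + of_int B * snd u, snd u * of_int D)"
  have "co z = u" unfolding co_def z_def using A D by (simp add: field_simps)
  then show ?thesis using that[of z] u unfolding P_def poles_def by simp
qed

lemma P_closed: "compact C \<Longrightarrow> closed (P ` (C - poles))"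
proof -
  assume C: "compact C"
  have "P ` (C - poles) = pil ` (co ` C - evens)" unfolding P_def poles_def by auto
  then show ?thesis using pil_closed[OF compact_continuous_image[OF co_cont C]] by simp
qed

lemma gam_pole: "s \<in> S3 \<Longrightarrow> 0 \<le> t \<Longrightarrow> t \<le> 1 \<Longrightarrow> gam q s t \<notin> poles"
  using gam_ocell rl_ocell unfolding poles_iff by metis

lemma ocell_poles: "z \<in> ocell p \<Longrightarrow> z \<in> poles \<Longrightarrow> z = rl p"
  using ocell_unique rl_ocell unfolding poles_iff by metis

lemma P_gam_eq:
  assumes "s \<in> S3" "0 \<le> t" "t \<le> 1" "w \<notin> poles"
  shows "P (gam q s t) = P w \<longleftrightarrow> (\<exists>l\<in>L. w = gam (q + (l + l)) s t) \<or> (\<exists>l\<in>L. w = gam (l + l + s - q) s (1 - t))"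
  unfolding P_eq[OF gam_pole[OF assms(1-3)] assms(4)] gam_shift by blast

lemma cong2_add: "l \<in> L \<Longrightarrow> cong2 L (q + (l + l)) q"
  unfolding cong2_def by (intro bexI[of _ l]) simp_all

lemma E_meet:
  assumes s: "s \<in> S3" "s' \<in> S3" and t: "0 \<le> t" "t \<le> 1" "0 \<le> t'" "t' \<le> 1"
    and eq: "P (gam q s t) = P (gam q' s' t')"
  shows "s = s' \<and> (cong2 L q' q \<and> t' = t \<or> cong2 L q' (s - q) \<and> t' = 1 - t) \<or> (t = 0 \<or> t = 1) \<and> (t' = 0 \<or> t' = 1)"
proof -
  consider l where "l \<in> L" "gam q' s' t' = gam (q + (l + l)) s t" | l where "l \<in> L" "gam q' s' t' = gam (l + l + s - q) s (1 - t)"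
    using eq unfolding P_gam_eq[OF s(1) t(1,2) gam_pole[OF s(2) t(3,4)]] by blast
  then show ?thesis
  proof cases
    case 1
    have "q' = q + (l + l) \<Longrightarrow> cong2 L q' q" using cong2_add[OF 1(1)] by simp
    then show ?thesis using gam_eq[OF s(2,1) t(3,4,1,2) 1(2)] by auto
  next
    case 2
    define r where "r = l + l + s - q"
    have "r = (s - q) + (l + l)" unfolding r_def by simp
    then have "cong2 L r (s - q)" using cong2_add[OF 2(1)] by simp
    moreover have "0 \<le> 1 - t" "1 - t \<le> 1" using t by simp_all
    ultimately show ?thesis using gam_eq[OF s(2,1) t(3,4) _ _ 2(2)[folded r_def]] by auto
  qed
qed

text \<open>The direction (1,1) is an arbitrary choice: the edges of all directions start at the
  same point for \<open>t = 0\<close>.\<close>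

definition psi where "psi q = P (gam q (1, 1) 0)"

lemma gam_0: "gam q s 0 = gam q s' 0" by (simp add: gam_def)

lemma psi_gam: "P (gam q s 0) = psi q" unfolding psi_def using gam_0 by metis

lemma L0: "0 \<in> L" using lat_0[OF L] .

lemma P_gam_1: "s \<in> S3 \<Longrightarrow> 0 \<le> t \<Longrightarrow> t \<le> 1 \<Longrightarrow> P (gam q s t) = P (gam (s - q) s (1 - t))"
proof -
  assume s: "s \<in> S3" "0 \<le> t" "t \<le> 1"
  have "gam (s - q) s (1 - t) \<notin> poles" by (rule gam_pole[OF s(1)]) (use s in simp_all)
  moreover have "\<exists>l\<in>L. gam (s - q) s (1 - t) = gam (l + l + s - q) s (1 - t)" by (rule bexI[OF _ L0]) simp
  ultimately show ?thesis using P_gam_eq[OF s] by blast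
qed

lemma psi_gam1: "s \<in> S3 \<Longrightarrow> P (gam q s 1) = psi (s - q)"
  using P_gam_1[of s 1 q] psi_gam by simp

lemma P_gam_cong: "s \<in> S3 \<Longrightarrow> 0 \<le> t \<Longrightarrow> t \<le> 1 \<Longrightarrow> cong2 L q q' \<Longrightarrow> P (gam q s t) = P (gam q' s t)"
proof -
  assume s: "s \<in> S3" "0 \<le> t" "t \<le> 1" and "cong2 L q q'"
  then obtain l where l: "l \<in> L" "q - q' = l + l" unfolding cong2_def by blast
  have "q' = q + (- l + - l)" using l(2) by (simp add: algebra_simps)
  then have "gam q' s t = gam (q + (- l + - l)) s t" by simp
  then show ?thesis unfolding P_gam_eq[OF s gam_pole[OF s]] using lat_uminus[OF L l(1)] by blast
qed

lemma S3_11: "(1, 1) \<in> S3" by (simp add: S3_def)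

lemma psi_eq: "psi q = psi q' \<longleftrightarrow> cong2 L q q'"
proof
  assume "psi q = psi q'"
  then have eq: "P (gam q (1, 1) 0) = P (gam q' (1, 1) 0)" unfolding psi_def .
  have "gam q' (1, 1) 0 \<notin> poles" by (rule gam_pole[OF S3_11]) simp_all
  then have "(\<exists>l\<in>L. gam q' (1, 1) 0 = gam (q + (l + l)) (1, 1) 0) \<or> (\<exists>l\<in>L. gam q' (1, 1) 0 = gam (l + l + (1, 1) - q) (1, 1) (1 - 0))"
    using P_gam_eq[OF S3_11, of 0] eq by simp
  then show "cong2 L q q'"
  proof (elim disjE bexE)
    fix l assume l: "l \<in> L" and "gam q' (1, 1) 0 = gam (q + (l + l)) (1, 1) 0"
    then have "q' = q + (l + l)" using gam_eq[OF S3_11 S3_11, of 0 0] by auto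
    then show ?thesis using cong2_sym[OF L cong2_add[OF l]] by simp
  next
    fix l assume "gam q' (1, 1) 0 = gam (l + l + (1, 1) - q) (1, 1) (1 - 0)"
    then show ?thesis using gam_eq[OF S3_11 S3_11, of 0 1 q' "l + l + (1, 1) - q"] by simp
  qed
next
  assume "cong2 L q q'"
  then show "psi q = psi q'" unfolding psi_def using P_gam_cong[OF S3_11] by simp
qed

definition E where "E q s = (\<lambda>t. P (gam q s t)) ` {0..1}"

lemma E_ends: "s \<in> S3 \<Longrightarrow> psi q \<in> E q s \<and> psi (s - q) \<in> E q s"
  unfolding E_def using psi_gam[of q s] psi_gam1[of s q] by (metis atLeastAtMost_iff image_eqI order_refl zero_le_one)

lemma E_inter:
  assumes s: "s \<in> S3" "s' \<in> S3" and x: "x \<in> E q s" "x \<in> E q' s'" "x \<notin> range psi"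
  shows "s = s' \<and> (cong2 L q' q \<or> cong2 L q' (s - q))"
proof -
  obtain t t' where t: "0 \<le> t" "t \<le> 1" "0 \<le> t'" "t' \<le> 1" "x = P (gam q s t)" "x = P (gam q' s' t')"
    using x unfolding E_def by auto
  have "t \<noteq> 0" "t \<noteq> 1" using x(3) t(5) psi_gam[of q s] psi_gam1[OF s(1), of q] by auto
  then show ?thesis using E_meet[OF s t(1-4)] t(5,6) by metis
qed

lemma E_mid: assumes s: "s \<in> S3" shows "P (gam q s (1/2)) \<in> E q s" "P (gam q s (1/2)) \<notin> range psi"
proof -
  show "P (gam q s (1/2)) \<in> E q s" unfolding E_def by (intro imageI) simp
  show "P (gam q s (1/2)) \<notin> range psi"
  proof
    assume "P (gam q s (1/2)) \<in> range psi"
    then obtain q' where "P (gam q s (1/2)) = P (gam q' (1, 1) 0)" unfolding psi_def by blast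
    then show False using E_meet[OF s S3_11, of "1/2" 0 q q'] by simp
  qed
qed

lemma E_eq:
  assumes s: "s \<in> S3" "s' \<in> S3"
  shows "E q s = E q' s' \<longleftrightarrow> s = s' \<and> (cong2 L q' q \<or> cong2 L q' (s - q))"
proof
  assume "E q s = E q' s'"
  then show "s = s' \<and> (cong2 L q' q \<or> cong2 L q' (s - q))" using E_inter[OF s E_mid(1)[OF s(1)]] E_mid[OF s(1), of q] by metis
next
  assume a: "s = s' \<and> (cong2 L q' q \<or> cong2 L q' (s - q))"
  have 1: "E q s = E q' s" if "cong2 L q q'" for q q' unfolding E_def
  proof (rule image_cong[OF refl])
    fix t :: real assume "t \<in> {0..1}"
    then show "P (gam q s t) = P (gam q' s t)" by (intro P_gam_cong[OF s(1) _ _ that]) simp_all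
  qed
  have 2: "E q s = E (s - q) s"
  proof -
    have "E q s = (\<lambda>t. P (gam (s - q) s (1 - t))) ` {0..1}" unfolding E_def
    proof (rule image_cong[OF refl])
      fix t :: real assume "t \<in> {0..1}"
      then show "P (gam q s t) = P (gam (s - q) s (1 - t))" by (intro P_gam_1[OF s(1)]) simp_all
    qed
    also have "\<dots> = (\<lambda>t. P (gam (s - q) s t)) ` ((\<lambda>t. 1 - t) ` {0..1})" unfolding image_image ..
    also have "(\<lambda>t. 1 - t) ` {0..1::real} = {0..1}"
    proof (intro equalityI subsetI)
      fix x :: real assume "x \<in> {0..1}"
      then show "x \<in> (\<lambda>t. 1 - t) ` {0..1}" by (intro image_eqI[of _ _ "1 - x"]) auto
    qed auto
    finally show ?thesis unfolding E_def .
  qed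
  show "E q s = E q' s'" using a 1 2 cong2_sym[OF L] by metis
qed

lemma psi_E: "s \<in> S3 \<Longrightarrow> psi q' \<in> E q s \<longleftrightarrow> cong2 L q' q \<or> cong2 L q' (s - q)"
proof
  assume s: "s \<in> S3" and "psi q' \<in> E q s"
  then obtain t where t: "0 \<le> t" "t \<le> 1" "P (gam q s t) = P (gam q' s 0)" unfolding E_def using psi_gam by auto
  have "t = 0 \<or> t = 1" using E_meet[OF s s t(1,2) _ _ t(3)] by auto
  then have "psi q' = psi q \<or> psi q' = psi (s - q)" using t(3) psi_gam psi_gam1[OF s] by metis
  then show "cong2 L q' q \<or> cong2 L q' (s - q)" unfolding psi_eq .
next
  assume s: "s \<in> S3" and "cong2 L q' q \<or> cong2 L q' (s - q)"
  from this(2) have "psi q' = psi q \<or> psi q' = psi (s - q)" unfolding psi_eq .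
  then show "psi q' \<in> E q s" using E_ends[OF s, of q] by metis
qed

lemma E_joins: assumes s: "s \<in> S3" shows "joins (E q s) (psi q) (psi (s - q))"
proof -
  define g where "g t = P (gam q s t)" for t
  have gc: "continuous_on {0..1} (gam q s)" unfolding gam_def by (intro continuous_intros)
  have "continuous_on {0..1} (P \<circ> gam q s)"
  proof (rule continuous_on_compose[OF gc continuous_on_subset[OF P_cont]])
    show "gam q s ` {0..1} \<subseteq> - poles"
    proof
      fix z assume "z \<in> gam q s ` {0..1}"
      then obtain t where "0 \<le> t" "t \<le> 1" "z = gam q s t" by (metis atLeastAtMost_iff imageE)
      then show "z \<in> - poles" using gam_pole[OF s] by simp
    qed
  qed
  then have c: "continuous_on {0..1} g" by (simp add: g_def[abs_def] comp_def)
  \<comment> \<open>Congruence would make \<open>s\<close> even in both coordinates. Hence the two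
    ends of the arc are different points.\<close>
  have neq: "\<not> cong2 L q (s - q)"
  proof
    assume "cong2 L q (s - q)"
    then obtain l where "q - (s - q) = l + l" unfolding cong2_def by blast
    then have "s - 0 = (q - l) + (q - l)" by (simp add: algebra_simps)
    then have "even (fst s)" "even (snd s)" by (metis diff_zero dvd_triv_left fst_add mult_2 snd_add)+
    then show False using s unfolding S3_def by auto
  qed
  have "inj_on g {0..1}"
  proof (rule inj_onI)
    fix t t' assume t: "t \<in> {0..1}" "t' \<in> {0..1}" "g t = g t'"
    have e: "cong2 L q q \<and> t' = t \<or> cong2 L q (s - q) \<and> t' = 1 - t \<or> (t = 0 \<or> t = 1) \<and> (t' = 0 \<or> t' = 1)"
      using E_meet[OF s s, of t t' q q] t unfolding g_def by auto
    have "g 0 \<noteq> g 1" unfolding g_def psi_gam psi_gam1[OF s] psi_eq using neq .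
    then show "t = t'" using e neq t(3) by metis
  qed
  then have "arc g" unfolding arc_def path_def using c by simp
  moreover have "path_image g = E q s" unfolding path_image_def E_def g_def ..
  moreover have "pathstart g = psi q" "pathfinish g = psi (s - q)"
    unfolding pathstart_def pathfinish_def g_def psi_gam psi_gam1[OF s] by simp_all
  ultimately show ?thesis unfolding joins_def by blast
qed

definition Gr :: plane_drawing where
  "Gr = \<lparr>verts = range psi, edges = {E q s | q s. s \<in> S3}\<rparr>"

lemma Gr_simps: "verts Gr = range psi" "edges Gr = {E q s | q s. s \<in> S3}" unfolding Gr_def by simp_all

lemma E_verts: "s \<in> S3 \<Longrightarrow> E q s \<inter> verts Gr = {psi q, psi (s - q)}"
proof (intro equalityI subsetI)
  fix x assume s: "s \<in> S3" and x: "x \<in> E q s \<inter> verts Gr"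
  then obtain q' where q': "x = psi q'" unfolding Gr_simps by blast
  then have "psi q' = psi q \<or> psi q' = psi (s - q)" using x psi_E[OF s, of q' q] unfolding psi_eq by blast
  then show "x \<in> {psi q, psi (s - q)}" unfolding q' by blast
next
  fix x assume "s \<in> S3" "x \<in> {psi q, psi (s - q)}"
  then show "x \<in> E q s \<inter> verts Gr" unfolding Gr_simps using E_ends[of s q] by blast
qed

lemma finite_range: "(\<And>p q. cong2 L p q \<Longrightarrow> f p = f q) \<Longrightarrow> finite (range f)" for f :: "int \<times> int \<Rightarrow> 'b"
  unfolding L_def using cong2_hnf_finite[OF A D] by blast

lemma adj_Gr: "adj Gr (psi p) (psi q) \<longleftrightarrow> (\<exists>s\<in>S3. cong2 L q (s - p))"
proof
  assume "adj Gr (psi p) (psi q)"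
  then obtain r s where rs: "s \<in> S3" "E r s \<inter> verts Gr = {psi p, psi q}" unfolding adj_def Gr_simps(2) by auto
  then have "{psi r, psi (s - r)} = {psi p, psi q}" using E_verts by metis
  then have "psi r = psi p \<and> psi (s - r) = psi q \<or> psi r = psi q \<and> psi (s - r) = psi p" by (simp add: doubleton_eq_iff)
  then have "cong2 L q (s - p)"
  proof
    assume "psi r = psi p \<and> psi (s - r) = psi q"
    then have "cong2 L q (s - r)" "cong2 L (s - r) (s - p)" using cong2_flip[OF L] cong2_sym[OF L] unfolding psi_eq by blast+
    then show ?thesis using cong2_trans[OF L] by blast
  next
    assume "psi r = psi q \<and> psi (s - r) = psi p"
    then have "cong2 L q r" "cong2 L (s - (s - r)) (s - p)" using cong2_flip[OF L, of s "s - r" p] cong2_sym[OF L] unfolding psi_eq by blast+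
    then show ?thesis using cong2_trans[OF L] by simp
  qed
  then show "\<exists>s\<in>S3. cong2 L q (s - p)" using rs(1) by blast
next
  assume "\<exists>s\<in>S3. cong2 L q (s - p)"
  then obtain s where s: "s \<in> S3" "cong2 L q (s - p)" by blast
  then have "E p s \<inter> verts Gr = {psi p, psi q}" unfolding E_verts[OF s(1)] psi_eq[symmetric] by simp
  then show "adj Gr (psi p) (psi q)" unfolding adj_def Gr_simps(2) using s(1) by blast
qed

lemma Gr_models: "models Gr L"
  unfolding models_def using Gr_simps(1) psi_eq adj_Gr by (intro exI[of _ psi]) simp

lemma Gr_plane: "plane_graph Gr"
  unfolding plane_graph_def
proof (intro conjI ballI impI)
  show "finite (verts Gr)" unfolding Gr_simps by (rule finite_range) (simp add: psi_eq)
  have "finite (range (\<lambda>q. E q s))" if "s \<in> S3" for s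
    by (rule finite_range) (use E_eq[OF that that] cong2_sym[OF L] in blast)
  then have "finite (\<Union>s\<in>S3. range (\<lambda>q. E q s))" by (intro finite_UN_I) (auto simp: S3_def)
  moreover have "edges Gr = (\<Union>s\<in>S3. range (\<lambda>q. E q s))" unfolding Gr_simps by blast
  ultimately show "finite (edges Gr)" by simp
next
  fix e assume "e \<in> edges Gr"
  then obtain q s where "s \<in> S3" "e = E q s" unfolding Gr_simps by blast
  then show "\<exists>u v. joins e u v \<and> e \<inter> verts Gr = {u, v}" using E_joins E_verts by blast
next
  fix e f assume ef: "e \<in> edges Gr" "f \<in> edges Gr" "e \<noteq> f"
  obtain q s where e: "s \<in> S3" "e = E q s" using ef(1) unfolding Gr_simps by blast
  obtain q' s' where f: "s' \<in> S3" "f = E q' s'" using ef(2) unfolding Gr_simps by blast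
  show "e \<inter> f \<subseteq> verts Gr"
  proof
    fix x assume x: "x \<in> e \<inter> f"
    show "x \<in> verts Gr"
    proof (rule ccontr)
      assume "x \<notin> verts Gr"
      then have "s = s' \<and> (cong2 L q' q \<or> cong2 L q' (s - q))" using E_inter[OF e(1) f(1)] x e(2) f(2) unfolding Gr_simps by blast
      then show False using ef(3) e(2) f(2) E_eq[OF e(1) f(1)] by blast
    qed
  qed
  show "e \<inter> verts Gr \<noteq> f \<inter> verts Gr"
  proof
    assume "e \<inter> verts Gr = f \<inter> verts Gr"
    then have "{psi q, psi (s - q)} = {psi q', psi (s' - q')}" unfolding e(2) f(2) E_verts[OF e(1)] E_verts[OF f(1)] .
    then have c: "cong2 L q q' \<and> cong2 L (s - q) (s' - q') \<or> cong2 L q (s' - q') \<and> cong2 L (s - q) q'"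
      unfolding doubleton_eq_iff psi_eq by blast
    \<comment> \<open>Edges with the same ends have directions that agree modulo 2, hence equal
      directions; this excludes parallel edges.\<close>
    have par: "s = s'" if "s - s' = m + m" for m using S3_odd[OF e(1) f(1) that] .
    have "s = s'" using c
    proof
      assume "cong2 L q q' \<and> cong2 L (s - q) (s' - q')"
      then obtain l m where "q - q' = l + l" "(s - q) - (s' - q') = m + m" unfolding cong2_def by blast
      then have "s - s' = (l + m) + (l + m)" by (simp add: algebra_simps)
      then show ?thesis by (rule par)
    next
      assume "cong2 L q (s' - q') \<and> cong2 L (s - q) q'"
      then obtain l m where "q - (s' - q') = l + l" "(s - q) - q' = m + m" unfolding cong2_def by blast
      then have "s - s' = (l + m) + (l + m)" by (simp add: algebra_simps)
      then show ?thesis by (rule par)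
    qed
    moreover have "cong2 L q' q \<or> cong2 L q' (s - q)" using c cong2_sym[OF L] by blast
    ultimately show False using ef(3) e(2) f(2) E_eq[OF e(1) f(1)] by blast
  qed
qed

lemma Gr_connected: "connected_graph Gr"
proof -
  have st: "adj Gr (psi p) (psi (s - p))" if "s \<in> S3" for p s
    unfolding adj_Gr using that cong2_refl[OF L] by blast
  have two: "(adj Gr)\<^sup>*\<^sup>* (psi p) (psi (p + (t - s)))" if "s \<in> S3" "t \<in> S3" for p s t
  proof -
    have "p + (t - s) = t - (s - p)" by simp
    then show ?thesis using st[OF that(1), of p] st[OF that(2), of "s - p"]
      by (metis rtranclp.rtrancl_into_rtrancl r_into_rtranclp)
  qed
  have m: "(1, 1) \<in> S3" "(0, 1) \<in> S3" "(1, 0) \<in> S3" by (simp_all add: S3_def)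
  have s: "(adj Gr)\<^sup>*\<^sup>* (psi p) (psi (p + (1, 0)))" "(adj Gr)\<^sup>*\<^sup>* (psi p) (psi (p + (0, 1)))"
    "(adj Gr)\<^sup>*\<^sup>* (psi p) (psi (p + (- 1, 0)))" "(adj Gr)\<^sup>*\<^sup>* (psi p) (psi (p + (0, - 1)))" for p
    using two[OF m(2,1), of p] two[OF m(3,1), of p] two[OF m(1,2), of p] two[OF m(1,3), of p] by simp_all
  have all: "(adj Gr)\<^sup>*\<^sup>* (psi r) (psi (r + v))" for r v
  proof -
    have tr: "(adj Gr)\<^sup>*\<^sup>* a c" if "(adj Gr)\<^sup>*\<^sup>* a b" "(adj Gr)\<^sup>*\<^sup>* b c" for a b c using that by (rule rtranclp_trans)
    have 1: "(adj Gr)\<^sup>*\<^sup>* (psi r) (psi (r + (i, 0)))" for i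
    proof (induction i rule: int_induct[where k = 0])
      case base show ?case by (simp flip: zero_prod_def)
    next
      case (step1 i)
      have e: "r + (i + 1, 0) = (r + (i, 0)) + (1, 0)" by (simp add: prod_eq_iff)
      show ?case unfolding e by (rule tr[OF step1(2) s(1)])
    next
      case (step2 i)
      have e: "r + (i - 1, 0) = (r + (i, 0)) + (- 1, 0)" by (simp add: prod_eq_iff)
      show ?case unfolding e by (rule tr[OF step2(2) s(3)])
    qed
    have "(adj Gr)\<^sup>*\<^sup>* (psi r) (psi (r + (i, j)))" for i j
    proof (induction j rule: int_induct[where k = 0])
      case base show ?case using 1 .
    next
      case (step1 j)
      have e: "r + (i, j + 1) = (r + (i, j)) + (0, 1)" by (simp add: prod_eq_iff)
      show ?case unfolding e by (rule tr[OF step1(2) s(2)])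
    next
      case (step2 j)
      have e: "r + (i, j - 1) = (r + (i, j)) + (0, - 1)" by (simp add: prod_eq_iff)
      show ?case unfolding e by (rule tr[OF step2(2) s(4)])
    qed
    then show ?thesis by (cases v) simp
  qed
  show ?thesis unfolding connected_graph_def Gr_simps
  proof (intro ballI)
    fix u v assume "u \<in> range psi" "v \<in> range psi"
    then obtain p q where "u = psi p" "v = psi q" by blast
    then show "(adj Gr)\<^sup>*\<^sup>* u v" using all[of p "q - p"] by simp
  qed
qed

lemma Gr_degree: "v \<in> verts Gr \<Longrightarrow> vertex_degree Gr v = 3"
proof -
  assume "v \<in> verts Gr"
  then obtain q where v: "v = psi q" unfolding Gr_simps by blast
  have "{e \<in> edges Gr. v \<in> e} = E q ` S3"
  proof (intro equalityI subsetI)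
    fix e assume "e \<in> {e \<in> edges Gr. v \<in> e}"
    then obtain q' s where e: "s \<in> S3" "e = E q' s" "psi q \<in> E q' s" unfolding Gr_simps v by blast
    then have "E q' s = E q s" unfolding E_eq[OF e(1) e(1)] using psi_E[OF e(1)] by blast
    then show "e \<in> E q ` S3" using e by blast
  next
    fix e assume "e \<in> E q ` S3"
    then show "e \<in> {e \<in> edges Gr. v \<in> e}" unfolding Gr_simps v using E_ends by blast
  qed
  moreover have "inj_on (E q) S3" by (rule inj_onI) (use E_eq in blast)
  moreover have "card S3 = 3" unfolding S3_def by simp
  ultimately show ?thesis unfolding vertex_degree_def by (simp add: card_image)
qed

end

section \<open>The faces of the drawing are the images of the cells\<close>

context pillow_drawing begin

definition Fc where "Fc p = P ` (ocell p - poles)"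
definition K where "K p = P ` (ccell p - poles)"
definition W where "W = verts Gr \<union> \<Union> (edges Gr)"

lemma poles_shift:
  assumes z: "z \<notin> poles" and l: "l \<in> L"
  shows "z + rl (l + l) \<notin> poles" "rl (l + l) - z \<notin> poles"
proof -
  have *: "m - l \<in> L" "l - m \<in> L" if "m \<in> L" for m using L l that unfolding lat_def by blast+
  show "z + rl (l + l) \<notin> poles"
  proof
    assume "z + rl (l + l) \<in> poles"
    then obtain m where m: "m \<in> L" "z + rl (l + l) = rl (m + m)" unfolding poles_iff by blast
    have "z = rl (m + m) - rl (l + l)" using m(2) by (simp add: algebra_simps)
    also have "\<dots> = rl ((m - l) + (m - l))" unfolding rl_add(2)[symmetric] by (simp add: algebra_simps)
    finally show False using z *(1)[OF m(1)] unfolding poles_iff by blast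
  qed
  show "rl (l + l) - z \<notin> poles"
  proof
    assume "rl (l + l) - z \<in> poles"
    then obtain m where m: "m \<in> L" "rl (l + l) - z = rl (m + m)" unfolding poles_iff by blast
    have "z = rl (l + l) - rl (m + m)" using m(2) by (simp add: algebra_simps)
    also have "\<dots> = rl ((l - m) + (l - m))" unfolding rl_add(2)[symmetric] by (simp add: algebra_simps)
    finally show False using z *(2)[OF m(1)] unfolding poles_iff by blast
  qed
qed

lemma Fc_meet:
  assumes "w \<in> Fc p" "w \<in> Fc p'"
  shows "cong2 L p' p \<or> cong2 L p' (- p)"
proof -
  obtain z where z: "z \<in> ocell p" "z \<notin> poles" "w = P z" using assms(1) unfolding Fc_def by blast
  obtain z' where z': "z' \<in> ocell p'" "z' \<notin> poles" "w = P z'" using assms(2) unfolding Fc_def by blast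
  have "P z = P z'" using z(3) z'(3) by simp
  then consider l where "l \<in> L" "z' = z + rl (l + l)" | l where "l \<in> L" "z' = rl (l + l) - z"
    unfolding P_eq[OF z(2) z'(2)] by blast
  then show ?thesis
  proof cases
    case 1
    then have "p' = p + (l + l)" using ocell_unique[OF z'(1)] ocell_shift(1)[OF z(1), of "l + l"] by simp
    then show ?thesis using cong2_add[OF 1(1)] by simp
  next
    case 2
    then have "p' = - p + (l + l)" using ocell_unique[OF z'(1)] ocell_shift(2)[OF z(1), of "l + l"] by simp
    then show ?thesis using cong2_add[OF 2(1), of "- p"] by simp
  qed
qed

lemma Fc_shift:
  assumes l: "l \<in> L" shows "Fc p \<subseteq> Fc (p + (l + l))" "Fc p \<subseteq> Fc (l + l - p)"
proof -
  have 1: "P z = P (z + rl (l + l))" "P z = P (rl (l + l) - z)" if z: "z \<notin> poles" for z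
    using P_eq[OF z poles_shift(1)[OF z l]] P_eq[OF z poles_shift(2)[OF z l]] l by blast+
  show "Fc p \<subseteq> Fc (p + (l + l))"
  proof
    fix w assume "w \<in> Fc p"
    then obtain z where z: "z \<in> ocell p" "z \<notin> poles" "w = P z" unfolding Fc_def by blast
    have "z + rl (l + l) \<in> ocell (p + (l + l)) - poles" using ocell_shift(1)[OF z(1)] poles_shift(1)[OF z(2) l] by blast
    then show "w \<in> Fc (p + (l + l))" unfolding Fc_def z(3) 1(1)[OF z(2)] by (rule imageI)
  qed
  show "Fc p \<subseteq> Fc (l + l - p)"
  proof
    fix w assume "w \<in> Fc p"
    then obtain z where z: "z \<in> ocell p" "z \<notin> poles" "w = P z" unfolding Fc_def by blast
    have "rl (l + l) - z \<in> ocell (l + l - p) - poles" using ocell_shift(2)[OF z(1)] poles_shift(2)[OF z(2) l] by blast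
    then show "w \<in> Fc (l + l - p)" unfolding Fc_def z(3) 1(2)[OF z(2)] by (rule imageI)
  qed
qed

lemma Fc_cong: assumes "cong2 L p' p \<or> cong2 L p' (- p)" shows "Fc p = Fc p'"
  using assms
proof
  assume "cong2 L p' p"
  then obtain l where l: "l \<in> L" "p' - p = l + l" unfolding cong2_def by blast
  have e: "p' = p + (l + l)" "p = p' + (- l + - l)" using l(2) by (simp_all add: algebra_simps)
  have "Fc p \<subseteq> Fc p'" using Fc_shift(1)[OF l(1), of p] e(1) by simp
  moreover have "Fc p' \<subseteq> Fc (p' + (- l + - l))" by (rule Fc_shift(1)[OF lat_uminus[OF L l(1)]])
  ultimately show ?thesis unfolding e(2)[symmetric] by blast
next
  assume "cong2 L p' (- p)"
  then obtain l where l: "l \<in> L" "p' - (- p) = l + l" unfolding cong2_def by blast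
  have e: "p' = l + l - p" "p = l + l - p'" using l(2) by (simp_all add: algebra_simps)
  have "Fc p \<subseteq> Fc p'" using Fc_shift(2)[OF l(1), of p] unfolding e(1)[symmetric] .
  moreover have "Fc p' \<subseteq> Fc p" using Fc_shift(2)[OF l(1), of p'] unfolding e(2)[symmetric] .
  ultimately show ?thesis by blast
qed

lemma Fc_nonempty: "Fc p \<noteq> {}"
proof -
  \<comment> \<open>A point of the cell off its centre, which may be a pole.\<close>
  define z where "z = (real_of_int (fst p) + 1/4, real_of_int (snd p))"
  have "z \<in> ocell p" unfolding z_def ocell_def by simp
  moreover have "z \<noteq> rl p" unfolding z_def rl_def by simp
  ultimately show ?thesis unfolding Fc_def using ocell_poles by blast
qed

lemma Fc_connected: "connected (Fc p)"
proof -
  have "connected (ocell p - {rl p})"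
    by (rule connected_open_delete[OF open_ocell convex_connected[OF convex_ocell]]) simp
  moreover have "ocell p - poles = ocell p \<or> ocell p - poles = ocell p - {rl p}" using ocell_poles by blast
  ultimately have "connected (ocell p - poles)" using convex_connected[OF convex_ocell, of p] by metis
  then show ?thesis unfolding Fc_def
    by (intro connected_continuous_image continuous_on_subset[OF P_cont]) blast+
qed

lemma W_eq: "W = (\<Union>q. \<Union>s\<in>S3. E q s)"
proof (intro equalityI subsetI)
  fix x assume x: "x \<in> W"
  show "x \<in> (\<Union>q. \<Union>s\<in>S3. E q s)"
  proof (cases "x \<in> verts Gr")
    case True
    then obtain q where "x = psi q" unfolding Gr_simps by blast
    then show ?thesis using E_ends[OF S3_11, of q] S3_11 by blast
  next
    case False
    then have "x \<in> \<Union>(edges Gr)" using x unfolding W_def by blast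
    then show ?thesis unfolding Gr_simps by blast
  qed
next
  fix x assume "x \<in> (\<Union>q. \<Union>s\<in>S3. E q s)"
  then show "x \<in> W" unfolding W_def Gr_simps by blast
qed

lemma E_Fc: assumes s: "s \<in> S3" shows "E q s \<inter> Fc p = {}"
proof -
  have False if x: "x \<in> E q s" "x \<in> Fc p" for x
  proof -
    obtain t where t: "0 \<le> t" "t \<le> 1" "x = P (gam q s t)" using x(1) unfolding E_def by auto
    obtain z where z: "z \<in> ocell p" "z \<notin> poles" "x = P z" using x(2) unfolding Fc_def by blast
    have "P (gam q s t) = P z" using t z by simp
    then have "(\<exists>l\<in>L. z = gam (q + (l + l)) s t) \<or> (\<exists>l\<in>L. z = gam (l + l + s - q) s (1 - t))"
      unfolding P_gam_eq[OF s t(1,2) z(2)] .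
    moreover have "0 \<le> 1 - t" "1 - t \<le> 1" using t by simp_all
    ultimately show False using z(1) gam_ocell[OF s] t(1,2) by metis
  qed
  then show ?thesis by blast
qed

lemma ocell_ccell: "ocell p \<subseteq> ccell p" unfolding ocell_def ccell_def by (rule subsetI) simp

lemma K_split: "K p = Fc p \<union> (\<Union>(q, s)\<in>bd p. E q s)"
proof (intro equalityI subsetI)
  fix x assume "x \<in> K p"
  then obtain z where z: "z \<in> ccell p" "z \<notin> poles" "x = P z" unfolding K_def by blast
  show "x \<in> Fc p \<union> (\<Union>(q, s)\<in>bd p. E q s)"
  proof (cases "z \<in> ocell p")
    case True then show ?thesis unfolding Fc_def using z by blast
  next
    case False
    then obtain q s t where b: "(q, s) \<in> bd p" "0 \<le> t" "t \<le> 1" "z = gam q s t" using ccell_boundary[OF z(1)] by metis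
    have "x \<in> E q s" unfolding E_def z(3) b(4) by (rule imageI) (use b in simp)
    then show ?thesis using b(1) by blast
  qed
next
  fix x assume "x \<in> Fc p \<union> (\<Union>(q, s)\<in>bd p. E q s)"
  then show "x \<in> K p"
  proof
    assume "x \<in> Fc p" then show ?thesis unfolding Fc_def K_def using ocell_ccell by blast
  next
    assume "x \<in> (\<Union>(q, s)\<in>bd p. E q s)"
    then obtain q s where b: "(q, s) \<in> bd p" "x \<in> E q s" by blast
    then obtain t where t: "0 \<le> t" "t \<le> 1" "x = P (gam q s t)" unfolding E_def by auto
    then show ?thesis unfolding K_def t(3) using bd_ccell[OF b(1) t(1,2)] gam_pole[OF bd_S3[OF b(1)] t(1,2)] by blast
  qed
qed

lemma bd_W: "(\<Union>(q, s)\<in>bd p. E q s) \<subseteq> W"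
  unfolding W_eq using bd_S3 by blast

lemma Fc_W: "Fc p \<inter> W = {}" unfolding W_eq using E_Fc by blast

lemma closed_K: "closed (K p)" unfolding K_def by (rule P_closed[OF compact_ccell])

lemma finite_Fc: "finite (range Fc)"
  by (rule finite_range) (use Fc_cong in metis)

lemma compl_W: "- W = \<Union> (range Fc)"
proof (intro equalityI subsetI)
  fix x assume x: "x \<in> - W"
  obtain z where z: "z \<notin> poles" "P z = x" by (rule P_surj)
  obtain p where "z \<in> ccell p" using ccell_cover by blast
  then have "x \<in> K p" unfolding K_def using z by blast
  then have "x \<in> Fc p" unfolding K_split using x bd_W[of p] by blast
  then show "x \<in> \<Union> (range Fc)" by blast
next
  fix x assume "x \<in> \<Union> (range Fc)"
  then show "x \<in> - W" using Fc_W by blast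
qed

text \<open>The image of an open cell is the part of the closed set \<open>K p\<close> off the
  drawing, so the finitely many images are relatively closed.\<close>

lemma faces_Gr: "faces Gr = range Fc"
  unfolding faces_def W_def[symmetric]
proof (rule components_closed_partition[OF finite_Fc compl_W])
  fix C assume "C \<in> range Fc"
  then obtain p where p: "C = Fc p" by blast
  have "C = K p \<inter> - W" unfolding p K_split using bd_W[of p] Fc_W[of p] by blast
  then show "connected C \<and> C \<noteq> {} \<and> (\<exists>K. closed K \<and> C = K \<inter> - W)"
    using Fc_connected[of p] Fc_nonempty[of p] closed_K[of p] unfolding p by blast
next
  fix C C' assume "C \<in> range Fc" "C' \<in> range Fc" "C \<noteq> C'"
  then obtain p p' where p: "C = Fc p" "C' = Fc p'" by blast
  show "C \<inter> C' = {}"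
  proof (rule ccontr)
    assume "C \<inter> C' \<noteq> {}"
    then obtain w where "w \<in> Fc p" "w \<in> Fc p'" unfolding p by blast
    then have "Fc p = Fc p'" by (intro Fc_cong Fc_meet)
    then show False using \<open>C \<noteq> C'\<close> unfolding p by blast
  qed
qed

lemma Fc_eq: "Fc p = Fc p' \<longleftrightarrow> cong2 L p' p \<or> cong2 L p' (- p)"
proof
  assume "Fc p = Fc p'"
  then obtain w where "w \<in> Fc p" "w \<in> Fc p'" using Fc_nonempty[of p] by blast
  then show "cong2 L p' p \<or> cong2 L p' (- p)" by (rule Fc_meet)
qed (rule Fc_cong)

lemma closed_W: "closed W"
proof -
  have fin: "finite (verts Gr)" "finite (edges Gr)" using Gr_plane unfolding plane_graph_def by blast+
  have "closed e" if "e \<in> edges Gr" for e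
  proof -
    obtain q s where e: "s \<in> S3" "e = E q s" using \<open>e \<in> edges Gr\<close> unfolding Gr_simps by blast
    obtain g where g: "arc g" "path_image g = e" using E_joins[OF e(1), of q] unfolding joins_def e(2) by blast
    show ?thesis using compact_imp_closed[OF compact_path_image[OF arc_imp_path[OF g(1)]]] unfolding g(2) .
  qed
  then show ?thesis unfolding W_def using fin by (intro closed_Un closed_Union ballI) (auto intro: finite_imp_closed)
qed

lemma open_Fc: "open (Fc p)"
proof (rule open_components)
  show "open (- W)" using closed_W by blast
  show "Fc p \<in> components (- W)" using faces_Gr unfolding faces_def W_def[symmetric] by blast
qed

lemma closure_ocell: "ccell p \<subseteq> closure (ocell p)"
proof
  fix z assume z: "z \<in> ccell p"
  define h where "h t = rl p + t *\<^sub>R (z - rl p)" for t :: real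
  have h: "h ` {0..<1} \<subseteq> ocell p" unfolding h_def using ccell_contract[OF z] by (intro image_subsetI) simp
  have "continuous_on UNIV h" unfolding h_def by (intro continuous_intros)
  then have "h ` closure {0..<1} \<subseteq> closure (h ` {0..<1})" by (rule continuous_image_closure_subset) simp
  moreover have "closure (h ` {0..<1}) \<subseteq> closure (ocell p)" by (rule closure_mono[OF h])
  moreover have "z = h 1" unfolding h_def by simp
  moreover have "1 \<in> closure {0..<1 :: real}" by simp
  ultimately show "z \<in> closure (ocell p)" by blast
qed

lemma closure_Fc: "closure (Fc p) = K p"
proof
  show "closure (Fc p) \<subseteq> K p" by (rule closure_minimal[OF _ closed_K]) (use K_split in blast)
  show "K p \<subseteq> closure (Fc p)"
  proof
    fix x assume "x \<in> K p"
    then obtain z where z: "z \<in> ccell p" "z \<notin> poles" "x = P z" unfolding K_def by blast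
    define U where "U = - poles \<inter> P -` (- closure (Fc p))"
    have "open U" unfolding U_def by (rule continuous_open_preimage[OF P_cont open_poles]) (simp add: open_Compl)
    moreover have "U \<inter> ocell p = {}"
    proof -
      have "P w \<in> closure (Fc p)" if "w \<in> ocell p" "w \<notin> poles" for w
        using closure_subset[of "Fc p"] that unfolding Fc_def by blast
      then show ?thesis unfolding U_def by blast
    qed
    ultimately have "U \<inter> closure (ocell p) = {}" using open_Int_closure_eq_empty by blast
    then have "z \<notin> U" using z(1) closure_ocell by blast
    then show "x \<in> closure (Fc p)" unfolding U_def z(3) using z(2) by blast
  qed
qed

lemma frontier_Fc: "frontier (Fc p) = (\<Union>(q, s)\<in>bd p. E q s)"
  unfolding frontier_def closure_Fc interior_open[OF open_Fc] K_split using bd_W[of p] Fc_W[of p] by blast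

lemma frontier_edges: "{e \<in> edges Gr. e \<subseteq> frontier (Fc p)} = (\<lambda>(q, s). E q s) ` bd p"
proof (intro equalityI subsetI)
  fix e assume e: "e \<in> {e \<in> edges Gr. e \<subseteq> frontier (Fc p)}"
  then obtain q s where s: "s \<in> S3" "e = E q s" unfolding Gr_simps by blast
  have "P (gam q s (1/2)) \<in> frontier (Fc p)" using E_mid(1)[OF s(1), of q] e s(2) by blast
  then obtain q' s' where b: "(q', s') \<in> bd p" "P (gam q s (1/2)) \<in> E q' s'" unfolding frontier_Fc by blast
  then have "e = E q' s'" unfolding s(2) E_eq[OF s(1) bd_S3[OF b(1)]]
    using E_inter[OF s(1) bd_S3[OF b(1)] E_mid(1)[OF s(1)] b(2) E_mid(2)[OF s(1)]] by blast
  then show "e \<in> (\<lambda>(q, s). E q s) ` bd p" using b(1) by blast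
next
  fix e assume "e \<in> (\<lambda>(q, s). E q s) ` bd p"
  then obtain q s where b: "(q, s) \<in> bd p" "e = E q s" by auto
  then show "e \<in> {e \<in> edges Gr. e \<subseteq> frontier (Fc p)}" unfolding frontier_Fc Gr_simps using bd_S3 by blast
qed

text \<open>Every edge of a cell has a second cell beside it. Its face is different by
  \<open>Fc_other\<close>, so each edge counts as one side.\<close>

lemma other_cell: "(q, s) \<in> bd p \<Longrightarrow> \<exists>u. (q, s) \<in> bd (p + u) \<and> u \<in> {(1, 0), (- 1, 0), (0, 1), (0, - 1), (1, - 1), (- 1, 1)}"
proof -
  assume "(q, s) \<in> bd p"
  then consider "(q, s) = (p + (1, 0), (1, 0))" | "(q, s) = (p, (1, 0))" | "(q, s) = (p + (0, 1), (0, 1))"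
    | "(q, s) = (p, (0, 1))" | "(q, s) = (p + (1, 0), (1, 1))" | "(q, s) = (p + (0, 1), (1, 1))"
    unfolding bd_def by blast
  then show ?thesis
  proof cases
    case 1 then show ?thesis by (intro exI[of _ "(1, 0)"]) (simp add: bd_def)
  next
    case 2 then show ?thesis by (intro exI[of _ "(- 1, 0)"]) (simp add: bd_def prod_eq_iff)
  next
    case 3 then show ?thesis by (intro exI[of _ "(0, 1)"]) (simp add: bd_def)
  next
    case 4 then show ?thesis by (intro exI[of _ "(0, - 1)"]) (simp add: bd_def prod_eq_iff)
  next
    case 5 then show ?thesis by (intro exI[of _ "(1, - 1)"]) (simp add: bd_def prod_eq_iff)
  next
    case 6 then show ?thesis by (intro exI[of _ "(- 1, 1)"]) (simp add: bd_def prod_eq_iff)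
  qed
qed

lemma Fc_other: "u \<in> {(1, 0), (- 1, 0), (0, 1), (0, - 1), (1, - 1), (- 1, 1)} \<Longrightarrow> Fc (p + u) \<noteq> Fc p"
proof
  assume u: "u \<in> {(1, 0), (- 1, 0), (0, 1), (0, - 1), (1, - 1), (- 1, 1)}" and "Fc (p + u) = Fc p"
  then have "Fc p = Fc (p + u)" by simp
  then obtain l where "(p + u) - p = l + l \<or> (p + u) - (- p) = l + l" unfolding Fc_eq cong2_def by blast
  then have "even (fst u) \<and> even (snd u)"
  proof
    assume "(p + u) - p = l + l"
    then have "fst u = 2 * fst l" "snd u = 2 * snd l" by (simp_all add: prod_eq_iff)
    then show ?thesis by simp
  next
    assume "(p + u) - (- p) = l + l"
    then have "fst u = 2 * (fst l - fst p)" "snd u = 2 * (snd l - snd p)" by (simp_all add: prod_eq_iff)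
    then show ?thesis by simp
  qed
  then show False using u by auto
qed

text \<open>Opposite edges of a cell are exchanged by the half-turn about its centre, and this
  half-turn belongs to the group exactly if \<open>p \<in> L\<close>.\<close>

lemma E_pair:
  assumes "u + v \<in> S3"
  shows "E (p + u) (u + v) = E (p + v) (u + v) \<longleftrightarrow> p \<in> L"
proof -
  have "\<not> cong2 L (p + v) (p + u)"
  proof
    assume "cong2 L (p + v) (p + u)"
    then obtain l where "(p + v) - (p + u) = l + l" unfolding cong2_def by blast
    then have "u + v - 0 = (l + u) + (l + u)" by (simp add: algebra_simps)
    then have "fst (u + v) = 2 * (fst l + fst u)" "snd (u + v) = 2 * (snd l + snd u)" by (simp_all add: prod_eq_iff)
    then have "even (fst (u + v))" "even (snd (u + v))" by (metis dvd_triv_left)+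
    then show False using S3_cases'[OF assms] by (metis even_of_nat fst_conv odd_one snd_conv)
  qed
  moreover have "cong2 L (p + v) (u + v - (p + u)) \<longleftrightarrow> p \<in> L"
  proof -
    have "(p + v) - (u + v - (p + u)) = p + p" by simp
    moreover have "p + p = l + l \<longleftrightarrow> p = l" for l by (auto simp: prod_eq_iff)
    ultimately show ?thesis unfolding cong2_def by simp
  qed
  ultimately show ?thesis unfolding E_eq[OF assms assms] by blast
qed

lemma card_six:
  assumes "{a, a'} \<inter> {b, b', c, c'} = {}" "{b, b'} \<inter> {c, c'} = {}" "a = a' \<longleftrightarrow> Q" "b = b' \<longleftrightarrow> Q" "c = c' \<longleftrightarrow> Q"
  shows "card {a, a', b, b', c, c'} = (if Q then 3 else 6)"
  using assms by (auto simp: card_insert_if)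

lemma card_bd: "card ((\<lambda>(q, s). E q s) ` bd p) = (if p \<in> L then 3 else 6)"
proof -
  have S: "(1, 0) \<in> S3" "(0, 1) \<in> S3" by (simp_all add: S3_def)
  have ne: "E q s \<noteq> E q' s'" if "s \<in> S3" "s' \<in> S3" "s \<noteq> s'" for q q' s s' using that E_eq by blast
  have b: "(\<lambda>(q, s). E q s) ` bd p = {E (p + (1, 0)) (1, 0), E p (1, 0), E (p + (0, 1)) (0, 1), E p (0, 1), E (p + (1, 0)) (1, 1), E (p + (0, 1)) (1, 1)}"
    unfolding bd_def by simp
  have e: "E (p + (1, 0)) (1, 0) = E p (1, 0) \<longleftrightarrow> p \<in> L" "E (p + (0, 1)) (0, 1) = E p (0, 1) \<longleftrightarrow> p \<in> L"
    "E (p + (1, 0)) (1, 1) = E (p + (0, 1)) (1, 1) \<longleftrightarrow> p \<in> L"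
    using E_pair[of "(1, 0)" 0 p] E_pair[of "(0, 1)" 0 p] E_pair[of "(1, 0)" "(0, 1)" p] S S3_11 by simp_all
  show ?thesis unfolding b
  proof (rule card_six[OF _ _ e])
    show "{E (p + (1, 0)) (1, 0), E p (1, 0)} \<inter> {E (p + (0, 1)) (0, 1), E p (0, 1), E (p + (1, 0)) (1, 1), E (p + (0, 1)) (1, 1)} = {}"
      using ne[OF S] ne[OF S(1) S3_11] by simp
    show "{E (p + (0, 1)) (0, 1), E p (0, 1)} \<inter> {E (p + (1, 0)) (1, 1), E (p + (0, 1)) (1, 1)} = {}"
      using ne[OF S(2) S3_11] by simp
  qed
qed

lemma sides_Fc: "sides Gr (Fc p) = (if p \<in> L then 3 else 6)"
proof -
  have "\<exists>F'\<in>faces Gr. F' \<noteq> Fc p \<and> e \<subseteq> frontier F'" if e: "e \<in> (\<lambda>(q, s). E q s) ` bd p" for e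
  proof -
    obtain q s where b: "(q, s) \<in> bd p" "e = E q s" using e by auto
    obtain u where u: "(q, s) \<in> bd (p + u)" "u \<in> {(1, 0), (- 1, 0), (0, 1), (0, - 1), (1, - 1), (- 1, 1)}"
      using other_cell[OF b(1)] by blast
    have "e \<subseteq> frontier (Fc (p + u))" unfolding frontier_Fc b(2) using u(1) by blast
    then show ?thesis unfolding faces_Gr by (intro bexI[of _ "Fc (p + u)"] conjI Fc_other[OF u(2)]) simp_all
  qed
  then have "sides Gr (Fc p) = (\<Sum>e\<in>(\<lambda>(q, s). E q s) ` bd p. 1)"
    unfolding sides_def frontier_edges by (intro sum.cong) simp_all
  then show ?thesis using card_bd by simp
qed

lemma Gr_trihex: "trihex Gr"
  unfolding trihex_def faces_Gr using Gr_plane Gr_connected Gr_degree sides_Fc by auto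

end

lemma trihex_exists:
  assumes "A > 0" "D > 0"
  shows "\<exists>G. trihex G \<and> models G (hnf A B D)"
proof -
  interpret pillow_drawing A B D by unfold_locales fact+
  show ?thesis using Gr_trihex Gr_models unfolding L_def by blast
qed

section \<open>Counting roots of quadratic congruences\<close>

text \<open>For \<open>k = 1\<close> and the identity this is the divisor sum, the number of
  sublattices of index \<open>n\<close>. For \<open>k = 2\<close>, \<open>d\<close> stands for the
  largest integer that divides all vectors of an invariant lattice.\<close>

definition powsum :: "nat \<Rightarrow> (nat \<Rightarrow> nat) \<Rightarrow> nat \<Rightarrow> nat" where
  "powsum k h n = (\<Sum>d | d ^ k dvd n. h (n div d ^ k))"

lemma finite_power_dvd: "k > 0 \<Longrightarrow> n > 0 \<Longrightarrow> finite {d :: nat. d ^ k dvd n}"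
proof (rule finite_subset[of _ "{..n}"])
  assume "k > 0" "n > 0"
  show "{d. d ^ k dvd n} \<subseteq> {..n}"
  proof
    fix d assume "d \<in> {d. d ^ k dvd n}"
    then have "d dvd n" using \<open>k > 0\<close> by (metis dvd_power dvd_trans mem_Collect_eq)
    then show "d \<in> {..n}" using dvd_imp_le \<open>n > 0\<close> by simp
  qed
qed simp

text \<open>A number whose \<open>k\<close>-th power divides the product splits uniquely into its
  gcds with \<open>m\<close> and \<open>n\<close>.\<close>

lemma powsum_mult:
  assumes k: "k > 0" and c: "coprime m n" and pos: "m > 0" "n > 0"
    and h: "\<And>a b. coprime a b \<Longrightarrow> a > 0 \<Longrightarrow> b > 0 \<Longrightarrow> h (a * b) = h a * h b"
  shows "powsum k h (m * n) = powsum k h m * powsum k h n"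
proof -
  let ?A = "{d. d ^ k dvd m}" and ?B = "{d. d ^ k dvd n}" and ?C = "{d. d ^ k dvd m * n}"
  have dv: "d dvd x" if "d ^ k dvd x" for d x :: nat using k that by (metis dvd_power dvd_trans)
  have gc: "gcd (a * b) m = a" "gcd (a * b) n = b" if "a dvd m" "b dvd n" for a b
  proof -
    have "coprime b m" using c that(2) by (metis coprime_commute coprime_divisors dvd_refl)
    then have "gcd (a * b) m = gcd a m" by (simp add: gcd_mult_right_right_cancel gcd.commute mult.commute coprime_commute)
    then show "gcd (a * b) m = a" using that(1) by (simp add: gcd_nat.absorb1)
    have "coprime a n" using c that(1) by (metis coprime_divisors dvd_refl)
    then have "gcd (a * b) n = gcd b n" by (simp add: gcd_mult_right_left_cancel gcd.commute coprime_commute)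
    then show "gcd (a * b) n = b" using that(2) by (simp add: gcd_nat.absorb1)
  qed
  have "powsum k h (m * n) = (\<Sum>(a, b)\<in>?A \<times> ?B. h (m div a ^ k) * h (n div b ^ k))"
    unfolding powsum_def
  proof (rule sum.reindex_bij_witness[of _ "\<lambda>(a, b). a * b" "\<lambda>d. (gcd d m, gcd d n)"])
    fix d assume "d \<in> ?C"
    then have d: "d ^ k dvd m * n" by simp
    obtain a b where ab: "d = a * b" "a dvd m" "b dvd n" using division_decomp[OF dv[OF d]] by blast
    have e: "gcd d m * gcd d n = d" unfolding ab(1) using gc[OF ab(2,3)] by simp
    then show "(\<lambda>(a, b). a * b) (gcd d m, gcd d n) = d" by simp
    have "gcd d m ^ k dvd m * n" "gcd d n ^ k dvd m * n" using d by (meson dvd_power_same dvd_trans gcd_dvd1)+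
    moreover have "coprime (gcd d m ^ k) n" "coprime (gcd d n ^ k) m"
      using c by (metis coprime_commute coprime_divisors coprime_power_left_iff dvd_refl gcd_dvd2)+
    ultimately have ab: "gcd d m ^ k dvd m" "gcd d n ^ k dvd n" by (simp_all add: coprime_dvd_mult_left_iff coprime_dvd_mult_right_iff)
    then show "(gcd d m, gcd d n) \<in> ?A \<times> ?B" by simp
    have q: "m * n div d ^ k = (m div gcd d m ^ k) * (n div gcd d n ^ k)"
    proof -
      have "d ^ k = gcd d m ^ k * gcd d n ^ k" using e by (metis power_mult_distrib)
      then show ?thesis using ab by (metis div_mult_div_if_dvd)
    qed
    have "coprime (m div gcd d m ^ k) (n div gcd d n ^ k)" using c ab by (metis coprime_divisors dvd_div_eq_mult dvd_triv_left dvd_triv_right div_dvd_iff_mult div_dvd_div dvd_def dvd_mult_div_cancel dvd_trans)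
    moreover have "m div gcd d m ^ k > 0" "n div gcd d n ^ k > 0" using ab pos by (metis div_greater_zero_iff dvd_imp_le dvd_pos_nat)+
    ultimately show "(case (gcd d m, gcd d n) of (a, b) \<Rightarrow> h (m div a ^ k) * h (n div b ^ k)) = h (m * n div d ^ k)"
      unfolding q using h by simp
  next
    fix p assume "p \<in> ?A \<times> ?B"
    then obtain a b where p: "p = (a, b)" "a ^ k dvd m" "b ^ k dvd n" by auto
    have ab: "a dvd m" "b dvd n" using dv p by blast+
    show "(gcd (case p of (a, b) \<Rightarrow> a * b) m, gcd (case p of (a, b) \<Rightarrow> a * b) n) = p" unfolding p(1) prod.case gc[OF ab] ..
    show "(case p of (a, b) \<Rightarrow> a * b) \<in> ?C" using p by (simp add: power_mult_distrib mult_dvd_mono)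
  qed
  also have "\<dots> = powsum k h m * powsum k h n"
    unfolding powsum_def sum_product by (simp add: sum.cartesian_product)
  finally show ?thesis .
qed

lemma powsum_1_prime_power: "prime p \<Longrightarrow> powsum 1 (\<lambda>x. x) (p ^ e) = (\<Sum>j\<le>e. p ^ j)"
proof -
  assume p: "prime p"
  have "{d. d ^ 1 dvd p ^ e} = (\<lambda>i. p ^ i) ` {..e}" using divides_primepow_nat[OF p] by auto
  then have "powsum 1 (\<lambda>x. x) (p ^ e) = (\<Sum>d\<in>(\<lambda>i. p ^ i) ` {..e}. p ^ e div d)" unfolding powsum_def by simp
  also have "\<dots> = (\<Sum>i\<le>e. p ^ e div p ^ i)"
    by (rule sum.reindex[unfolded o_def]) (use prime_gt_1_nat[OF p] in \<open>simp add: inj_on_def\<close>)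
  also have "\<dots> = (\<Sum>i\<le>e. p ^ (e - i))"
    by (intro sum.cong refl) (metis atMost_iff p power_diff prime_gt_0_nat not_gr_zero)
  also have "\<dots> = (\<Sum>j\<le>e. p ^ j)" by (rule sum.nat_diff_reindex[of "\<lambda>j. p ^ j" "Suc e", unfolded lessThan_Suc_atMost diff_Suc_Suc])
  finally show ?thesis .
qed

lemma square_dvd_prime_power: "prime p \<Longrightarrow> {d :: nat. d ^ 2 dvd p ^ (e + 2)} = insert 1 ((*) p ` {d. d ^ 2 dvd p ^ e})"
proof (intro equalityI subsetI)
  fix d assume p: "prime p" and "d \<in> {d. d ^ 2 dvd p ^ (e + 2)}"
  then have d: "d ^ 2 dvd p ^ (e + 2)" by simp
  then have "d dvd p ^ (e + 2)" by (metis dvd_power dvd_trans zero_less_numeral)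
  then obtain i where i: "d = p ^ i" using divides_primepow_nat[OF p] by blast
  show "d \<in> insert 1 ((*) p ` {d. d ^ 2 dvd p ^ e})"
  proof (cases i)
    case (Suc j)
    have "p ^ 2 * (p ^ j) ^ 2 dvd p ^ 2 * p ^ e" using d unfolding i Suc by (simp add: power2_eq_square mult.assoc mult.left_commute)
    moreover have "p ^ 2 > 0" using prime_gt_0_nat[OF p] by simp
    ultimately have "(p ^ j) ^ 2 dvd p ^ e" using nat_mult_dvd_cancel1 by blast
    then show ?thesis unfolding i Suc by (intro insertI2 image_eqI[of _ _ "p ^ j"]) simp_all
  qed (use i in simp)
next
  fix d assume p: "prime p" and "d \<in> insert 1 ((*) p ` {d. d ^ 2 dvd p ^ e})"
  then have "d = 1 \<or> (\<exists>x. d = p * x \<and> x ^ 2 dvd p ^ e)" by blast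
  then have "d ^ 2 dvd p ^ 2 * p ^ e" by (elim disjE exE conjE) (simp_all add: power_mult_distrib)
  moreover have "p ^ 2 * p ^ e = p ^ (e + 2)" by (simp add: power2_eq_square mult.assoc)
  ultimately show "d \<in> {d. d ^ 2 dvd p ^ (e + 2)}" by simp
qed

text \<open>Either \<open>d = 1\<close>, or \<open>p\<close> divides \<open>d\<close> and cancels
  from the quotient.\<close>

lemma powsum_2_step:
  assumes p: "prime p"
  shows "powsum 2 h (p ^ (e + 2)) = h (p ^ (e + 2)) + powsum 2 h (p ^ e)"
proof -
  have pg: "p > 0" "p \<noteq> 1" using prime_gt_1_nat[OF p] by simp_all
  have fin: "finite {d. d ^ 2 dvd p ^ e}" by (rule finite_power_dvd) (use pg in simp_all)
  have "powsum 2 h (p ^ (e + 2)) = h (p ^ (e + 2)) + (\<Sum>d\<in>(*) p ` {d. d ^ 2 dvd p ^ e}. h (p ^ (e + 2) div d ^ 2))"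
  proof -
    have f: "finite ((*) p ` {d. d ^ 2 dvd p ^ e})" using fin by simp
    have n: "1 \<notin> (*) p ` {d. d ^ 2 dvd p ^ e}"
    proof
      assume "1 \<in> (*) p ` {d. d ^ 2 dvd p ^ e}"
      then obtain d where "1 = p * d" by blast
      then show False using pg(2) by (metis nat_mult_eq_1_iff)
    qed
    show ?thesis unfolding powsum_def square_dvd_prime_power[OF p] sum.insert[OF f n] by simp
  qed
  also have "(\<Sum>d\<in>(*) p ` {d. d ^ 2 dvd p ^ e}. h (p ^ (e + 2) div d ^ 2)) = (\<Sum>d | d ^ 2 dvd p ^ e. h (p ^ (e + 2) div (p * d) ^ 2))"
    by (rule sum.reindex[unfolded o_def]) (use pg in \<open>simp add: inj_on_def\<close>)
  also have "\<dots> = powsum 2 h (p ^ e)" unfolding powsum_def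
  proof (rule sum.cong[OF refl])
    fix d
    have "p ^ (e + 2) div (p * d) ^ 2 = (p ^ 2 * p ^ e) div (p ^ 2 * d ^ 2)" by (simp add: power_mult_distrib) (simp add: power2_eq_square mult.assoc)
    then show "h (p ^ (e + 2) div (p * d) ^ 2) = h (p ^ e div d ^ 2)" using pg by simp
  qed
  finally show ?thesis .
qed

lemma powsum_2_0: "powsum 2 h 1 = h 1"
  unfolding powsum_def by simp

lemma powsum_2_1: assumes p: "prime p" shows "powsum 2 h p = h p"
proof -
  have "{d. d ^ 2 dvd p} = {1}"
  proof (intro equalityI subsetI)
    fix d assume "d \<in> {d. d ^ 2 dvd p}"
    then have d: "d ^ 2 dvd p" by simp
    then have "d dvd p" by (metis dvd_power dvd_trans zero_less_numeral)
    then have "d = 1 \<or> d = p" using p prime_nat_iff by blast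
    moreover have "d \<noteq> p"
    proof
      assume "d = p"
      then have "p * p dvd p * 1" using d by (simp add: power2_eq_square)
      then have "p dvd 1" using nat_mult_dvd_cancel1[OF prime_gt_0_nat[OF p]] by blast
      then show False using p by auto
    qed
    ultimately show "d \<in> {1}" by simp
  qed simp
  then show ?thesis unfolding powsum_def by simp
qed

definition nroots :: "int \<Rightarrow> int \<Rightarrow> nat \<Rightarrow> nat" where
  "nroots b c m = card {r. r < m \<and> int m dvd int r * int r + b * int r + c}"

lemma quadratic_mod:
  fixes x y m b c :: int
  assumes "m dvd x - y"
  shows "m dvd x * x + b * x + c \<longleftrightarrow> m dvd y * y + b * y + c"
proof -
  have "x * x + b * x + c = (x - y) * (x + y + b) + (y * y + b * y + c)" by (simp add: algebra_simps)
  then show ?thesis using assms by (metis dvd_add_right_iff dvd_mult2)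
qed

lemma cong_int_dvd: "[x = y] (mod m) \<longleftrightarrow> int m dvd int x - int y" for x y m :: nat
  by (simp add: cong_iff_dvd_diff flip: cong_int_iff)

text \<open>Chinese remainder theorem: a root modulo the product is a pair of roots modulo the
  factors.\<close>

lemma nroots_mult:
  assumes c: "coprime m n" and pos: "m > 0" "n > 0"
  shows "nroots b c' (m * n) = nroots b c' m * nroots b c' n"
proof -
  define R where "R m = {r. r < m \<and> int m dvd int r * int r + b * int r + c'}" for m
  have md: "int k dvd int (x mod k) * int (x mod k) + b * int (x mod k) + c' \<longleftrightarrow> int k dvd int x * int x + b * int x + c'" for x k
  proof (rule quadratic_mod)
    have "[x mod k = x] (mod k)" by simp
    then show "int k dvd int (x mod k) - int x" unfolding cong_int_dvd .
  qed
  have ci: "coprime (int m) (int n)" using c by simp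
  have both: "int (m * n) dvd z \<longleftrightarrow> int m dvd z \<and> int n dvd z" for z
    using ci by (metis divides_mult dvd_mult_left dvd_mult_right of_nat_mult)
  have "bij_betw (\<lambda>r. (r mod m, r mod n)) (R (m * n)) (R m \<times> R n)"
  proof (rule bij_betw_imageI)
    show "inj_on (\<lambda>r. (r mod m, r mod n)) (R (m * n))"
    proof (rule inj_onI)
      fix x y assume xy: "x \<in> R (m * n)" "y \<in> R (m * n)" "(x mod m, x mod n) = (y mod m, y mod n)"
      then have "[x = y] (mod m)" "[x = y] (mod n)" by (simp_all add: cong_def)
      then have "[x = y] (mod m * n)" using c by (rule coprime_cong_mult_nat)
      then show "x = y" using xy(1,2) unfolding R_def cong_def by simp
    qed
    show "(\<lambda>r. (r mod m, r mod n)) ` R (m * n) = R m \<times> R n"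
    proof (intro equalityI subsetI)
      fix w assume "w \<in> (\<lambda>r. (r mod m, r mod n)) ` R (m * n)"
      then obtain x where x: "x \<in> R (m * n)" "w = (x mod m, x mod n)" by blast
      have "int m dvd int x * int x + b * int x + c'" "int n dvd int x * int x + b * int x + c'"
        using x(1) unfolding R_def mem_Collect_eq both by blast+
      then show "w \<in> R m \<times> R n" unfolding x(2) R_def using pos md by simp
    next
      fix w assume "w \<in> R m \<times> R n"
      then obtain u v where w: "w = (u, v)" "u \<in> R m" "v \<in> R n" by blast
      obtain x where x: "x < m * n" "[x = u] (mod m)" "[x = v] (mod n)"
        using binary_chinese_remainder_unique_nat[OF c, of u v] pos by auto
      have e: "x mod m = u" "x mod n = v" using x w unfolding R_def cong_def by simp_all
      have "x \<in> R (m * n)" unfolding R_def mem_Collect_eq both using x(1) md[of m x] md[of n x] w(2,3) unfolding e R_def by blast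
      then show "w \<in> (\<lambda>r. (r mod m, r mod n)) ` R (m * n)" unfolding w(1) using e by force
    qed
  qed
  then have "card (R (m * n)) = card (R m \<times> R n)" by (rule bij_betw_same_card)
  then have "card (R (m * n)) = card (R m) * card (R n)" unfolding card_cartesian_product .
  then show ?thesis unfolding nroots_def R_def .
qed

lemma nroots_1: "nroots b c 1 = 1"
proof -
  have "{r. r < 1 \<and> int 1 dvd int r * int r + b * int r + c} = {0}" by auto
  then show ?thesis unfolding nroots_def by simp
qed

text \<open>\<open>p\<close> never divides both \<open>r - w\<close> and \<open>r - w'\<close>, so
  the whole prime power goes into one of the two factors.\<close>

lemma nroots_two:
  fixes b c w w' :: int
  assumes p: "prime p" and e: "e > 0" and fac: "\<And>r. int p ^ e dvd r * r + b * r + c - (r - w) * (r - w')" and nd: "\<not> int p dvd w - w'"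
  shows "nroots b c (p ^ e) = 2"
proof -
  let ?m = "int (p ^ e)"
  have mp: "?m > 0" using p by (simp add: prime_gt_0_nat)
  have ip: "prime (int p)" using p by simp
  have iff: "?m dvd r * r + b * r + c \<longleftrightarrow> ?m dvd r - w \<or> ?m dvd r - w'" for r
  proof -
    have "?m dvd r * r + b * r + c \<longleftrightarrow> ?m dvd (r - w) * (r - w')"
      using fac[of r] by (metis dvd_diff_right_iff dvd_add_right_iff diff_add_cancel of_nat_power)
    also have "\<dots> \<longleftrightarrow> ?m dvd r - w \<or> ?m dvd r - w'"
    proof
      assume d: "?m dvd (r - w) * (r - w')"
      have "\<not> int p dvd r - w \<or> \<not> int p dvd r - w'"
      proof (rule ccontr)
        assume "\<not> (\<not> int p dvd r - w \<or> \<not> int p dvd r - w')"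
        then have "int p dvd (r - w') - (r - w)" using dvd_diff[of "int p" "r - w'" "r - w"] by blast
        then show False using nd by simp
      qed
      then have "coprime ?m (r - w) \<or> coprime ?m (r - w')"
        using ip by (metis of_nat_power coprime_power_left_iff prime_imp_coprime)
      then show "?m dvd r - w \<or> ?m dvd r - w'" using d by (metis coprime_dvd_mult_left_iff coprime_dvd_mult_right_iff)
    qed auto
    finally show ?thesis .
  qed
  have "{r. r < p ^ e \<and> ?m dvd int r * int r + b * int r + c} = {nat (w mod ?m), nat (w' mod ?m)}"
  proof (intro equalityI subsetI)
    fix r assume r: "r \<in> {r. r < p ^ e \<and> ?m dvd int r * int r + b * int r + c}"
    then have "int r mod ?m = int r" by simp
    moreover have "?m dvd int r - w \<or> ?m dvd int r - w'" using r unfolding mem_Collect_eq iff by blast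
    then have "int r mod ?m = w mod ?m \<or> int r mod ?m = w' mod ?m" unfolding mod_eq_dvd_iff .
    ultimately have "int r = w mod ?m \<or> int r = w' mod ?m" by simp
    then show "r \<in> {nat (w mod ?m), nat (w' mod ?m)}" by auto
  next
    have a: "nat (v mod ?m) \<in> {r. r < p ^ e \<and> ?m dvd int r * int r + b * int r + c}" if v: "v = w \<or> v = w'" for v
    proof -
      have n: "int (nat (v mod ?m)) = v mod ?m" using mp by simp
      have "?m dvd v mod ?m - v" by (simp add: mod_eq_dvd_iff[symmetric])
      then have "?m dvd int (nat (v mod ?m)) - w \<or> ?m dvd int (nat (v mod ?m)) - w'" unfolding n using v by blast
      moreover have "nat (v mod ?m) < p ^ e" using mp by (metis n of_nat_less_iff pos_mod_bound)
      ultimately show ?thesis unfolding mem_Collect_eq iff by blast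
    qed
    fix r assume "r \<in> {nat (w mod ?m), nat (w' mod ?m)}"
    then show "r \<in> {r. r < p ^ e \<and> ?m dvd int r * int r + b * int r + c}" using a by blast
  qed
  moreover have "nat (w mod ?m) \<noteq> nat (w' mod ?m)"
  proof
    assume "nat (w mod ?m) = nat (w' mod ?m)"
    then have "w mod ?m = w' mod ?m" using mp by (metis nat_eq_iff2 pos_mod_sign)
    then have "?m dvd w - w'" by (simp add: mod_eq_dvd_iff)
    moreover have "int p dvd ?m" using e by simp
    ultimately show False using nd dvd_trans by blast
  qed
  ultimately show ?thesis unfolding nroots_def by simp
qed

lemma nat_two_cases:
  fixes e :: nat obtains "e = 0" | "e = 1" | f where "e = f + 2"
proof (cases "e < 2")
  case True then show ?thesis using that by linarith
next
  case False then show ?thesis using that(3)[of "e - 2"] by simp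
qed

lemma nat_three_cases:
  fixes e :: nat obtains "e = 0" | "e = 1" | "e = 2" | f where "e = f + 3"
proof (cases "e < 3")
  case True then show ?thesis using that by linarith
next
  case False then show ?thesis using that(4)[of "e - 3"] by simp
qed

text \<open>The exponents are \<open>e\<close>, \<open>e - 2\<close> and so on; each contributes 2,
  except a final exponent 0, which contributes 1.\<close>

lemma powsum_two:
  assumes p: "prime p" and "h 1 = 1" and "\<And>e. e > 0 \<Longrightarrow> h (p ^ e) = 2"
  shows "powsum 2 h (p ^ e) = e + 1"
proof (induction e rule: less_induct)
  case (less e)
  consider "e = 0" | "e = 1" | f where "e = f + 2" by (rule nat_two_cases)
  then show ?case
  proof cases
    case 1 then show ?thesis using powsum_2_0 assms by simp
  next
    case 2 then show ?thesis using powsum_2_1[OF p] assms(3)[of 1] by simp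
  next
    case 3 then show ?thesis using powsum_2_step[OF p] less[of f] assms(3)[of e] by simp
  qed
qed

lemma powsum_parity:
  assumes p: "prime p" and "h 1 = 1" and "\<And>e. e > 0 \<Longrightarrow> h (p ^ e) = 0"
  shows "powsum 2 h (p ^ e) = (if even e then 1 else 0)"
proof (induction e rule: less_induct)
  case (less e)
  consider "e = 0" | "e = 1" | f where "e = f + 2" by (rule nat_two_cases)
  then show ?case
  proof cases
    case 1 then show ?thesis using powsum_2_0 assms by simp
  next
    case 2 then show ?thesis using powsum_2_1[OF p] assms(3)[of 1] by simp
  next
    case 3 then show ?thesis using powsum_2_step[OF p] less[of f] assms(3)[of e] by simp
  qed
qed

lemma reflection_odd_prime:
  assumes p: "prime p" "p > 2"
  shows "powsum 2 (nroots 0 (-1)) (p ^ e) = e + 1"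
proof (rule powsum_two[where h = "nroots 0 (-1)", OF p(1) nroots_1])
  fix e :: nat assume e: "e > 0"
  show "nroots 0 (-1) (p ^ e) = 2"
  proof (rule nroots_two[OF p(1) e, of _ _ 1 "-1"])
    show "int p ^ e dvd r * r + 0 * r + - 1 - (r - 1) * (r - - 1)" for r by (simp add: algebra_simps)
    show "\<not> int p dvd 1 - - 1"
    proof
      assume "int p dvd 1 - - 1"
      then have "int p \<le> 2" by (intro zdvd_imp_le) simp_all
      then show False using p(2) by simp
    qed
  qed
qed

text \<open>\<open>w\<close> is the power of a primitive root with exponent one third of the group
  order. As \<open>p - 1\<close> does not divide this exponent, \<open>w - 1\<close> is prime to
  \<open>p\<close> and cancels from \<open>w ^ 3 - 1\<close>.\<close>

lemma cube_root_of_unity: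
  assumes p: "prime p" "p mod 3 = 1" and e: "e > 0"
  shows "\<exists>w. int p ^ e dvd w * w + w + 1"
proof -
  have p2: "p \<noteq> 2" using p(2) by auto
  then have "odd p" using p(1) prime_odd_nat prime_ge_2_nat[OF p(1)] by (metis le_neq_implies_less)
  obtain g where g: "\<forall>k>0. residue_primroot (p ^ k) g"
    using residue_primroot_odd_prime_power_exists[OF p(1) \<open>odd p\<close>] by blast
  define t where "t = p ^ (e - 1) * ((p - 1) div 3)"
  have d3: "3 * ((p - 1) div 3) = p - 1" using p(2) by presburger
  have oe: "ord (p ^ e) g = 3 * t"
  proof -
    have "ord (p ^ e) g = totient (p ^ e)" using g e unfolding residue_primroot_def by blast
    also have "\<dots> = p ^ (e - 1) * (p - 1)" by (rule totient_prime_power[OF p(1) e])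
    also have "\<dots> = 3 * t" unfolding t_def using d3 by (metis mult.left_commute)
    finally show ?thesis .
  qed
  have o1: "ord p g = p - 1"
    using g[rule_format, of 1] totient_prime[OF p(1)] unfolding residue_primroot_def by simp
  have "[g ^ (3 * t) = 1] (mod p ^ e)" unfolding ord_divides oe by simp
  then have 1: "int (p ^ e) dvd int (g ^ (3 * t)) - int 1" unfolding cong_int_dvd .
  define w where "w = int g ^ t"
  have "int (g ^ (3 * t)) - int 1 = (w - 1) * (w * w + w + 1)"
    unfolding w_def by (simp add: mult.commute[of 3] power_mult power3_eq_cube algebra_simps)
  then have d: "int p ^ e dvd (w - 1) * (w * w + w + 1)" using 1 by simp
  have "\<not> int p dvd w - 1"
  proof
    assume "int p dvd w - 1"
    then have "[g ^ t = 1] (mod p)" unfolding cong_int_dvd w_def by simp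
    then have "p - 1 dvd t" unfolding ord_divides o1 .
    then obtain k where k: "t = (p - 1) * k" by blast
    define u where "u = (p - 1) div 3"
    have u: "p - 1 = 3 * u" unfolding u_def using d3 by simp
    have tu: "t = p ^ (e - 1) * u" unfolding t_def u_def ..
    have "u > 0" using u prime_gt_1_nat[OF p(1)] by (cases u) auto
    moreover have "p ^ (e - 1) * u = (3 * k) * u" using k unfolding tu u by (simp only: mult_ac)
    ultimately have "p ^ (e - 1) = 3 * k" by simp
    then have "3 dvd p ^ (e - 1)" by simp
    then have "3 dvd p" using prime_dvd_power[of 3 p] by simp
    then show False using p(2) by presburger
  qed
  then have "coprime (int p ^ e) (w - 1)" using p(1) by (simp add: prime_imp_coprime)
  then have "int p ^ e dvd w * w + w + 1" using d by (simp add: coprime_dvd_mult_right_iff)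
  then show ?thesis by blast
qed

lemma rotation_split_prime:
  assumes p: "prime p" "p mod 3 = 1"
  shows "powsum 2 (nroots 1 1) (p ^ e) = e + 1"
proof (rule powsum_two[where h = "nroots 1 1", OF p(1) nroots_1])
  fix e :: nat assume e: "e > 0"
  obtain w where w: "int p ^ e dvd w * w + w + 1" using cube_root_of_unity[OF p e] by blast
  have ip: "prime (int p)" using p by simp
  show "nroots 1 1 (p ^ e) = 2"
  proof (rule nroots_two[OF p(1) e, of _ _ w "- 1 - w"])
    show "int p ^ e dvd r * r + 1 * r + 1 - (r - w) * (r - (- 1 - w))" for r
      using w by (simp add: algebra_simps)
    \<comment> \<open>The square of \<open>2 * w + 1\<close> is
      \<open>4 * (w * w + w + 1) - 3\<close>, so the two roots agree modulo \<open>p\<close> only if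
      \<open>p\<close> divides 3.\<close>
    show "\<not> int p dvd w - (- 1 - w)"
    proof
      assume "int p dvd w - (- 1 - w)"
      then have "int p dvd (w - (- 1 - w)) * (w - (- 1 - w))" by simp
      moreover have "int p dvd 4 * (w * w + w + 1)" using w e by (meson dvd_mult dvd_power dvd_trans)
      ultimately have "int p dvd 4 * (w * w + w + 1) - (w - (- 1 - w)) * (w - (- 1 - w))" by (rule dvd_diff[rotated])
      then have "int p dvd 3" by (simp add: algebra_simps)
      then have "p dvd 3" by presburger
      then have "p = 3" by (intro primes_dvd_imp_eq p(1)) simp_all
      then show False using p(2) by simp
    qed
  qed
qed

lemma nroots_0I: "(\<And>r. \<not> int m dvd r * r + b * r + c) \<Longrightarrow> nroots b c m = 0"
  unfolding nroots_def by simp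

text \<open>A root satisfies \<open>r ^ 3 = 1\<close>. As \<open>p - 1\<close> is 1 modulo 3,
  Fermat's theorem gives \<open>r = 1\<close>, and then \<open>p\<close> divides 3.\<close>

lemma rotation_inert_prime:
  assumes p: "prime p" "p mod 3 = 2"
  shows "powsum 2 (nroots 1 1) (p ^ e) = (if even e then 1 else 0)"
proof (rule powsum_parity[where h = "nroots 1 1", OF p(1) nroots_1])
  fix e :: nat assume e: "e > 0"
  show "nroots 1 1 (p ^ e) = 0"
  proof (rule nroots_0I)
    fix r show "\<not> int (p ^ e) dvd r * r + 1 * r + 1"
    proof
      assume "int (p ^ e) dvd r * r + 1 * r + 1"
      moreover have "int p dvd int (p ^ e)" using e by simp
      ultimately have d: "int p dvd r * r + r + 1" using dvd_trans by fastforce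
      have ip: "prime (int p)" using p by simp
      define k where "k = p div 3"
      have pk: "p = 3 * k + 2" unfolding k_def using p(2) by presburger
      have r0: "\<not> int p dvd r"
      proof
        assume "int p dvd r"
        then have "int p dvd (r * r + r + 1) - r * (r + 1)" using d by (intro dvd_diff) simp_all
        then have "int p dvd 1" by (simp add: algebra_simps)
        then show False using p(1) by auto
      qed
      have "[r ^ (p - 1) = 1] (mod int p)"
      proof -
        define x where "x = nat (r mod int p)"
        have x: "int x = r mod int p" unfolding x_def using p(1) by (simp add: prime_gt_0_nat)
        have "\<not> int p dvd int x" unfolding x using r0 by (simp add: dvd_mod_iff)
        then have "\<not> p dvd x" by simp
        then have "[x ^ (p - 1) = 1] (mod p)" using fermat_theorem[OF p(1)] by blast
        then have "[int x ^ (p - 1) = 1] (mod int p)" by (metis cong_int_iff of_nat_1 of_nat_power)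
        moreover have "[int x = r] (mod int p)" unfolding x by (simp add: cong_def)
        then have "[int x ^ (p - 1) = r ^ (p - 1)] (mod int p)" by (rule cong_pow)
        ultimately show ?thesis using cong_sym cong_trans by blast
      qed
      moreover have "[r ^ 3 = 1] (mod int p)"
      proof -
        have "r ^ 3 - 1 = (r - 1) * (r * r + r + 1)" by (simp add: power3_eq_cube algebra_simps)
        then show ?thesis using d by (simp add: cong_iff_dvd_diff)
      qed
      then have "[(r ^ 3) ^ k * r = 1 ^ k * r] (mod int p)" by (intro cong_mult cong_pow cong_refl)
      moreover have "r ^ (p - 1) = (r ^ 3) ^ k * r" unfolding pk by (simp add: power_mult)
      ultimately have "[r = 1] (mod int p)" by (metis cong_sym cong_trans mult_1 power_one)
      then have "int p dvd r - 1" by (simp add: cong_iff_dvd_diff)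
      then have "int p dvd (r * r + r + 1) - (r - 1) * (r + 2)" using d by (intro dvd_diff) simp_all
      then have "int p dvd 3" by (simp add: algebra_simps)
      then have "p dvd 3" by presburger
      then have "p = 3" by (intro primes_dvd_imp_eq p(1)) simp_all
      then show False using p(2) by auto
    qed
  qed
qed

text \<open>The polynomial has one root modulo 3 and none modulo 9, since at
  \<open>r = 3 * q + 1\<close> its value is 3 modulo 9.\<close>

lemma rotation_3: "powsum 2 (nroots 1 1) (3 ^ e) = 1"
proof -
  have p: "prime (3 :: nat)" by simp
  have n1: "nroots 1 1 3 = 1"
  proof -
    have "{r :: nat. r < 3 \<and> int 3 dvd int r * int r + 1 * int r + 1} = {1}"
    proof (intro equalityI subsetI)
      fix r assume r: "r \<in> {r :: nat. r < 3 \<and> int 3 dvd int r * int r + 1 * int r + 1}"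
      then have "r = 0 \<or> r = 1 \<or> r = 2" by auto
      then show "r \<in> {1}" using r by auto
    qed simp
    then show ?thesis unfolding nroots_def by simp
  qed
  have n2: "nroots 1 1 (3 ^ (e + 2)) = 0" for e
  proof (rule nroots_0I)
    fix r :: int show "\<not> int (3 ^ (e + 2)) dvd r * r + 1 * r + 1"
    proof
      assume "int (3 ^ (e + 2)) dvd r * r + 1 * r + 1"
      moreover have "9 dvd int (3 ^ (e + 2))" by (simp add: power_add)
      ultimately have d: "9 dvd r * r + r + 1" using dvd_trans by fastforce
      define q s where "q = r div 3" and "s = r mod 3"
      have r: "r = 3 * q + s" "s = 0 \<or> s = 1 \<or> s = 2" unfolding q_def s_def by presburger+
      have "r * r + r + 1 = 3 * (3 * q * q + 2 * q * s + q) + (s * s + s + 1)" unfolding r(1) by (simp add: algebra_simps)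
      then have "s = 1" using d r(2) by (elim disjE) (simp_all, presburger+)
      then have "r * r + r + 1 = 9 * (q * q + q) + 3" unfolding r(1) by (simp add: algebra_simps)
      then show False using d by presburger
    qed
  qed
  show ?thesis
  proof (induction e rule: less_induct)
    case (less e)
    consider "e = 0" | "e = 1" | f where "e = f + 2" by (rule nat_two_cases)
    then show ?case
    proof cases
      case 1 then show ?thesis using powsum_2_0[of "nroots 1 1"] nroots_1 by simp
    next
      case 2 then show ?thesis using powsum_2_1[OF p] n1 by simp
    next
      case 3 then show ?thesis using powsum_2_step[OF p] less[of f] n2[of f] by simp
    qed
  qed
qed

text \<open>The square roots of 1 number 1, 1, 2 modulo 1, 2, 4 and 4 modulo each higher power of 2;
  for positive \<open>a\<close>, summing over every second exponent gives
  \<open>2 * a - 1\<close>.\<close>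

lemma reflection_2: "powsum 2 (nroots 0 (-1)) (2 ^ a) = (if a = 0 then 1 else 2 * a - 1)"
proof -
  have p: "prime (2 :: nat)" by simp
  have small: "{r :: nat. r < 2 \<and> int 2 dvd int r * int r + 0 * int r + - 1} = {1}"
    "{r :: nat. r < 4 \<and> int 4 dvd int r * int r + 0 * int r + - 1} = {1, 3}"
  proof -
    show "{r :: nat. r < 2 \<and> int 2 dvd int r * int r + 0 * int r + - 1} = {1}"
    proof (intro equalityI subsetI)
      fix r assume r: "r \<in> {r :: nat. r < 2 \<and> int 2 dvd int r * int r + 0 * int r + - 1}"
      then have "r = 0 \<or> r = 1" by auto
      then show "r \<in> {1}" using r by auto
    qed simp
    show "{r :: nat. r < 4 \<and> int 4 dvd int r * int r + 0 * int r + - 1} = {1, 3}"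
    proof (intro equalityI subsetI)
      fix r assume r: "r \<in> {r :: nat. r < 4 \<and> int 4 dvd int r * int r + 0 * int r + - 1}"
      then have "r = 0 \<or> r = 1 \<or> r = 2 \<or> r = 3" by auto
      then show "r \<in> {1, 3}" using r by auto
    qed auto
  qed
  have n1: "nroots 0 (-1) 2 = 1" "nroots 0 (-1) 4 = 2" unfolding nroots_def small by simp_all
  have n4: "nroots 0 (-1) (2 ^ (e + 3)) = 4" for e
  proof -
    \<comment> \<open>Half of the modulus; the four roots are \<plusminus>1 and \<open>M\<close>
      \<plusminus> 1.\<close>
    define M :: int where "M = 2 ^ (e + 2)"
    have M4: "M \<ge> 4" "4 dvd M" unfolding M_def by (simp_all add: power_add)
    have "{r. r < 2 ^ (e + 3) \<and> int (2 ^ (e + 3)) dvd int r * int r + 0 * int r + - 1} = nat ` {1, M - 1, M + 1, 2 * M - 1}"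
    proof (intro equalityI subsetI)
      fix r assume r: "r \<in> {r. r < 2 ^ (e + 3) \<and> int (2 ^ (e + 3)) dvd int r * int r + 0 * int r + - 1}"
      have M2: "int (2 ^ (e + 3)) = 2 * M" unfolding M_def by (simp add: power_add)
      have rl: "int r < 2 * M" using r unfolding M2[symmetric] by simp
      have d: "2 * M dvd int r * int r - 1" using r unfolding M2 by simp
      have "even (2 * M)" by simp
      then have "even (int r * int r - 1)" using d dvd_trans by blast
      then have "odd (int r)" by simp
      then obtain k where k: "int r = 2 * k + 1" by (elim oddE)
      have "int r * int r - 1 = 4 * (k * (k + 1))" unfolding k by (simp add: algebra_simps)
      moreover define M' :: int where "M' = 2 ^ (e + 1)"
      have MM: "M = 2 * M'" unfolding M_def M'_def by (simp add: power_add)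
      ultimately have "4 * M' dvd 4 * (k * (k + 1))" using d by simp
      then have dk: "M' dvd k * (k + 1)" by simp
      have "coprime k (k + 1)" by simp
      have "M' dvd k \<or> M' dvd k + 1"
      proof (cases "even k")
        case True
        then have "odd (k + 1)" by simp
        then have "coprime M' (k + 1)" unfolding M'_def by (simp add: coprime_power_left_iff prime_imp_coprime)
        then show ?thesis using dk by (simp add: coprime_dvd_mult_left_iff)
      next
        case False
        then have "coprime M' k" unfolding M'_def by (simp add: coprime_power_left_iff prime_imp_coprime)
        then show ?thesis using dk by (simp add: coprime_dvd_mult_right_iff)
      qed
      moreover have kb: "0 \<le> k" "k < 2 * M'" using k rl MM by linarith+
      moreover have mp: "M' > 0" unfolding M'_def by simp
      ultimately have "k = 0 \<or> k = M' \<or> k = M' - 1 \<or> k = 2 * M' - 1"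
      proof -
        have m: "x = 0 \<or> x = M' \<or> x = 2 * M'" if "M' dvd x" "0 \<le> x" "x \<le> 2 * M'" for x
        proof -
          obtain j where j: "x = M' * j" using \<open>M' dvd x\<close> by blast
          have "0 \<le> j" using that(2) mp unfolding j by (simp add: zero_le_mult_iff)
          moreover have "j \<le> 2" using that(3) mp unfolding j by (simp add: mult.commute[of M'])
          ultimately have "j = 0 \<or> j = 1 \<or> j = 2" by auto
          then show ?thesis unfolding j by auto
        qed
        show ?thesis using \<open>M' dvd k \<or> M' dvd k + 1\<close> m[of k] m[of "k + 1"] kb by auto
      qed
      then have "int r = 1 \<or> int r = M + 1 \<or> int r = M - 1 \<or> int r = 2 * M - 1" unfolding k MM by auto
      then show "r \<in> nat ` {1, M - 1, M + 1, 2 * M - 1}" by (auto simp flip: nat_int)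
    next
      fix r assume "r \<in> nat ` {1, M - 1, M + 1, 2 * M - 1}"
      then obtain v where v: "v \<in> {1, M - 1, M + 1, 2 * M - 1}" "r = nat v" by blast
      have M2: "int (2 ^ (e + 3)) = 2 * M" unfolding M_def by (simp add: power_add)
      have rv: "int r = v" "v < 2 * M" using v M4 by auto
      obtain j where j: "M = 2 * j" using M4(2) by (metis dvd_def dvd_trans even_numeral)
      have "2 * M dvd v * v - 1"
      proof -
        have "1 * 1 - 1 = 2 * M * 0" "(M - 1) * (M - 1) - 1 = 2 * M * (j - 1)" "(M + 1) * (M + 1) - 1 = 2 * M * (j + 1)"
          "(2 * M - 1) * (2 * M - 1) - 1 = 2 * M * (2 * M - 2)" unfolding j by (simp_all add: algebra_simps)
        then show ?thesis using v(1) by (auto intro: dvdI)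
      qed
      moreover have "r < 2 ^ (e + 3)" using rv M2 by linarith
      ultimately show "r \<in> {r. r < 2 ^ (e + 3) \<and> int (2 ^ (e + 3)) dvd int r * int r + 0 * int r + - 1}"
        unfolding M2 using rv by simp
    qed
    moreover have "card (nat ` {1, M - 1, M + 1, 2 * M - 1}) = card {1, M - 1, M + 1, 2 * M - 1}"
      by (rule card_image) (use M4(1) in \<open>auto simp: inj_on_def\<close>)
    moreover have "card {1, M - 1, M + 1, 2 * M - 1} = 4" using M4(1) by (simp add: card_insert_if)
    ultimately show ?thesis unfolding nroots_def by simp
  qed
  show ?thesis
  proof (induction a rule: less_induct)
    case (less a)
    consider "a = 0" | "a = 1" | "a = 2" | f where "a = f + 3" by (rule nat_three_cases)
    then show ?case
    proof cases
      case 1 then show ?thesis using powsum_2_0[of "nroots 0 (-1)"] nroots_1 by simp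
    next
      case 2 then show ?thesis using powsum_2_1[OF p] n1 by simp
    next
      case 3 then show ?thesis using powsum_2_step[OF p, of "nroots 0 (-1)" 0] powsum_2_0[of "nroots 0 (-1)"] nroots_1 n1 by simp
    next
      case 4
      have e: "2 ^ a = (2 :: nat) ^ ((f + 1) + 2)" "(2 :: nat) ^ ((f + 1) + 2) = 2 ^ (f + 3)" unfolding 4 by (simp_all add: power_add)
      have "powsum 2 (nroots 0 (-1)) (2 ^ a) = 4 + powsum 2 (nroots 0 (-1)) (2 ^ (f + 1))"
        unfolding e(1) powsum_2_step[OF p] unfolding e(2) n4 ..
      then show ?thesis using less[of "f + 1"] 4 by simp
    qed
  qed
qed

section \<open>Counting lattices up to symmetry\<close>

lemma burnside_image:
  fixes S :: "('a \<Rightarrow> 'a) set" and X :: "'a set set"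
  assumes fin: "finite S" "finite X"
    and comp: "\<And>d e. d \<in> S \<Longrightarrow> e \<in> S \<Longrightarrow> d \<circ> e \<in> S"
    and inv: "\<And>d. d \<in> S \<Longrightarrow> \<exists>e\<in>S. e \<circ> d = id \<and> d \<circ> e = id" and id: "id \<in> S"
    and X: "\<And>d L. d \<in> S \<Longrightarrow> L \<in> X \<Longrightarrow> d ` L \<in> X"
  shows "card (X // {(L, L'). L \<in> X \<and> L' \<in> X \<and> (\<exists>d\<in>S. L' = d ` L)}) * card S = (\<Sum>d\<in>S. card {L \<in> X. d ` L = L})"
    and "equiv X {(L, L'). L \<in> X \<and> L' \<in> X \<and> (\<exists>d\<in>S. L' = d ` L)}"
proof -
  define R where "R = {(L, L'). L \<in> X \<and> L' \<in> X \<and> (\<exists>d\<in>S. L' = d ` L)}"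
  have im: "e ` (d ` L) = (e \<circ> d) ` L" for e d :: "'a \<Rightarrow> 'a" and L by (rule image_comp)
  have eq: "equiv X R"
  proof (rule equivI)
    show "R \<subseteq> X \<times> X" unfolding R_def by blast
    show "refl_on X R" unfolding R_def refl_on_def using id by (auto intro!: bexI[of _ id])
    show "sym R"
    proof (rule symI)
      fix L L' assume "(L, L') \<in> R"
      then obtain d where d: "L \<in> X" "L' \<in> X" "d \<in> S" "L' = d ` L" unfolding R_def by blast
      obtain e where e: "e \<in> S" "e \<circ> d = id" using inv[OF d(3)] by blast
      have "e ` L' = L" unfolding d(4) im e(2) by simp
      then show "(L', L) \<in> R" unfolding R_def using d(1,2) e(1) by blast
    qed
    show "trans R"
    proof (rule transI)
      fix L L' L'' assume "(L, L') \<in> R" "(L', L'') \<in> R"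
      then obtain d e where d: "L \<in> X" "L'' \<in> X" "d \<in> S" "e \<in> S" "L'' = e ` (d ` L)" unfolding R_def by blast
      then show "(L, L'') \<in> R" unfolding R_def im using comp by blast
    qed
  qed
  then show "equiv X {(L, L'). L \<in> X \<and> L' \<in> X \<and> (\<exists>d\<in>S. L' = d ` L)}" unfolding R_def .
  have orbit: "(\<Sum>L\<in>C. card {d \<in> S. d ` L = L}) = card S" if C: "C \<in> X // R" for C
  proof -
    obtain L0 where L0: "L0 \<in> X" "C = R `` {L0}" using C by (rule quotientE)
    have C_iff: "L \<in> C \<longleftrightarrow> (\<exists>d\<in>S. L = d ` L0)" for L
      unfolding L0(2) R_def using L0(1) X by blast
    \<comment> \<open>Composition with an element that carries \<open>L0\<close> to \<open>L\<close>
      turns the stabiliser of \<open>L\<close> into the set of elements carrying \<open>L0\<close>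
      to \<open>L\<close>. These sets partition \<open>S\<close> as \<open>L\<close> runs through
      the orbit.\<close>
    have same: "card {d \<in> S. d ` L = L} = card {d \<in> S. d ` L0 = L}" if LC: "L \<in> C" for L
    proof -
      obtain e where e: "e \<in> S" "L = e ` L0" using C_iff LC by blast
      obtain f where f: "f \<in> S" "f \<circ> e = id" "e \<circ> f = id" using inv[OF e(1)] by blast
      have "f ` L = L0" unfolding e(2) im f(2) by simp
      have "bij_betw (\<lambda>d. d \<circ> e) {d \<in> S. d ` L = L} {d \<in> S. d ` L0 = L}"
      proof (rule bij_betw_byWitness[of _ "\<lambda>d. d \<circ> f"])
        show "\<forall>d\<in>{d \<in> S. d ` L = L}. (d \<circ> e) \<circ> f = d" using f(3) by (simp add: comp_assoc)
        show "\<forall>d\<in>{d \<in> S. d ` L0 = L}. (d \<circ> f) \<circ> e = d" using f(2) by (simp add: comp_assoc)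
        show "(\<lambda>d. d \<circ> e) ` {d \<in> S. d ` L = L} \<subseteq> {d \<in> S. d ` L0 = L}"
        proof (rule image_subsetI)
          fix d assume "d \<in> {d \<in> S. d ` L = L}"
          then show "d \<circ> e \<in> {d \<in> S. d ` L0 = L}" using comp e unfolding mem_Collect_eq im[symmetric] by simp
        qed
        show "(\<lambda>d. d \<circ> f) ` {d \<in> S. d ` L0 = L} \<subseteq> {d \<in> S. d ` L = L}"
        proof (rule image_subsetI)
          fix d assume "d \<in> {d \<in> S. d ` L0 = L}"
          then show "d \<circ> f \<in> {d \<in> S. d ` L = L}" using comp f(1) \<open>f ` L = L0\<close> unfolding mem_Collect_eq im[symmetric] by simp
        qed
      qed
      then show ?thesis by (rule bij_betw_same_card)
    qed
    have finC: "finite C" using fin(2) L0 unfolding R_def by (rule_tac finite_subset[of _ X]) blast+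
    have "(\<Sum>L\<in>C. card {d \<in> S. d ` L = L}) = (\<Sum>L\<in>C. \<Sum>d\<in>{d \<in> S. d ` L0 = L}. 1)" using same by simp
    also have "\<dots> = (\<Sum>d\<in>S. 1)"
      by (rule sum.group[OF fin(1) finC]) (use C_iff in blast)
    finally show ?thesis by simp
  qed
  have "(\<Sum>d\<in>S. card {L \<in> X. d ` L = L}) = (\<Sum>d\<in>S. \<Sum>L\<in>X. if d ` L = L then 1 else 0)"
    using fin(2) by (simp add: sum.If_cases Int_def conj_commute)
  also have "\<dots> = (\<Sum>L\<in>X. \<Sum>d\<in>S. if d ` L = L then 1 else 0)" by (rule sum.swap)
  also have "\<dots> = (\<Sum>L\<in>X. card {d \<in> S. d ` L = L})" using fin(1) by (simp add: sum.If_cases Int_def conj_commute)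
  also have "\<dots> = (\<Sum>L\<in>\<Union>(X // R). card {d \<in> S. d ` L = L})" unfolding Union_quotient[OF eq] ..
  also have "\<dots> = (\<Sum>C\<in>X // R. \<Sum>L\<in>C. card {d \<in> S. d ` L = L})"
  proof (rule sum.Union_disjoint[unfolded o_def])
    show "\<forall>C\<in>X // R. finite C" using fin(2) Union_quotient[OF eq] by (metis Union_upper finite_subset)
    show "\<forall>C\<in>X // R. \<forall>C'\<in>X // R. C \<noteq> C' \<longrightarrow> C \<inter> C' = {}" using quotient_disj[OF eq] by blast
  qed
  also have "\<dots> = (\<Sum>C\<in>X // R. card S)" using orbit by (intro sum.cong) simp_all
  finally show "card (X // {(L, L'). L \<in> X \<and> L' \<in> X \<and> (\<exists>d\<in>S. L' = d ` L)}) * card S = (\<Sum>d\<in>S. card {L \<in> X. d ` L = L})"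
    unfolding R_def by simp
qed

section \<open>Lattices of index n and those fixed by a symmetry\<close>

definition Om :: "nat \<Rightarrow> (int \<times> int) set set" where
  "Om n = {hnf A B D | A B D. A > 0 \<and> D > 0 \<and> 0 \<le> B \<and> B < A \<and> A * D = int n}"

lemma OmE:
  assumes "L \<in> Om n"
  obtains A B D where "L = hnf A B D" "A > 0" "D > 0" "0 \<le> B" "B < A" "A * D = int n"
  using assms unfolding Om_def by blast

lemma OmI: "A > 0 \<Longrightarrow> D > 0 \<Longrightarrow> 0 \<le> B \<Longrightarrow> B < A \<Longrightarrow> A * D = int n \<Longrightarrow> hnf A B D \<in> Om n"
  unfolding Om_def by blast

lemma hnf_mem_iff: "D > 0 \<Longrightarrow> (x, y) \<in> hnf A B D \<longleftrightarrow> D dvd y \<and> A dvd x - (y div D) * B"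
  unfolding hnf_member by (auto simp: mult.commute)

lemma hnf_inj:
  assumes "hnf A B D = hnf A' B' D'" and p: "A > 0" "D > 0" "A' > 0" "D' > 0" and "0 \<le> B" "B < A" "0 \<le> B'" "B' < A'"
  shows "A = A' \<and> B = B' \<and> D = D'"
proof -
  have m: "(A, 0) \<in> hnf A B D" "(B, D) \<in> hnf A B D" for A B D :: int
    unfolding hnf_member by (intro exI[of _ 0], simp) (intro exI[of _ 1], simp)
  have h: "(A, 0) \<in> hnf A' B' D'" "(B, D) \<in> hnf A' B' D'" unfolding assms(1)[symmetric] by (rule m)+
  have h': "(A', 0) \<in> hnf A B D" "(B', D') \<in> hnf A B D" unfolding assms(1) by (rule m)+
  have 1: "A' dvd A" "A dvd A'" "D' dvd D" "D dvd D'"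
    using h h' unfolding hnf_mem_iff[OF p(2)] hnf_mem_iff[OF p(4)] by simp_all
  have "A = A'" "D = D'" using 1 p by (metis zdvd_antisym_nonneg less_imp_le)+
  moreover have "A' dvd B - (D div D') * B'" using h(2) unfolding hnf_mem_iff[OF p(4)] by blast
  ultimately have "A dvd B - B'" using p by simp
  then have "B mod A = B' mod A" by (simp add: mod_eq_dvd_iff)
  then have "B = B'" using assms \<open>A = A'\<close> by simp
  then show ?thesis using \<open>A = A'\<close> \<open>D = D'\<close> by blast
qed

text \<open>For each divisor \<open>d\<close> in the place of \<open>D\<close> there are
  \<open>n div d\<close> choices of \<open>B\<close>.\<close>

lemma card_Om:
  assumes n: "n > 0"
  shows "card (Om n) = powsum 1 (\<lambda>x. x) n" and "finite (Om n)"
proof -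
  define f where "f = (\<lambda>(d, r). hnf (int (n div d)) (int r) (int d))"
  let ?S = "Sigma {d. d ^ 1 dvd n} (\<lambda>d. {..<n div d})"
  have pos: "d > 0 \<and> n div d > 0 \<and> n div d * d = n" if "d dvd n" for d
    using that n by (metis dvd_div_mult_self dvd_pos_nat nat_0_less_mult_iff)
  have img: "f ` ?S = Om n"
  proof (intro equalityI subsetI)
    fix L assume "L \<in> f ` ?S"
    then obtain d r where dr: "d dvd n" "r < n div d" "L = hnf (int (n div d)) (int r) (int d)" unfolding f_def by auto
    have "int (n div d) * int d = int n" using pos[OF dr(1)] by (metis of_nat_mult)
    then show "L \<in> Om n" unfolding dr(3) using pos[OF dr(1)] dr(2) by (intro OmI) simp_all
  next
    fix L assume "L \<in> Om n"
    then obtain A B D where L: "L = hnf A B D" "A > 0" "D > 0" "0 \<le> B" "B < A" "A * D = int n" by (rule OmE)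
    have e: "nat A * nat D = n" using L by (metis nat_int nat_mult_distrib less_imp_le)
    then have q: "n div nat D = nat A" using L(3) by (metis nonzero_mult_div_cancel_right nat_0_iff not_le)
    have "(nat D, nat B) \<in> ?S" using e q L by (auto simp: nat_less_iff)
    moreover have "L = f (nat D, nat B)" unfolding f_def using q L by simp
    ultimately show "L \<in> f ` ?S" by blast
  qed
  have inj: "inj_on f ?S"
  proof (rule inj_onI)
    fix x y assume x: "x \<in> ?S" and y: "y \<in> ?S" and e: "f x = f y"
    obtain d r where dr: "x = (d, r)" "d dvd n" "r < n div d" using x by auto
    obtain d' r' where dr': "y = (d', r')" "d' dvd n" "r' < n div d'" using y by auto
    have "int (n div d) = int (n div d') \<and> int r = int r' \<and> int d = int d'"
      by (rule hnf_inj) (use e dr dr' pos[OF dr(2)] pos[OF dr'(2)] in \<open>simp_all add: f_def\<close>)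
    then show "x = y" unfolding dr(1) dr'(1) by simp
  qed
  have fin: "finite {d. d ^ 1 dvd n}" by (rule finite_power_dvd) (use n in simp_all)
  show "finite (Om n)" unfolding img[symmetric] using fin by (intro finite_imageI finite_SigmaI) simp_all
  have "card (Om n) = card ?S" unfolding img[symmetric] by (rule card_image[OF inj])
  also have "\<dots> = (\<Sum>d | d ^ 1 dvd n. card {..<n div d})" using fin by (intro card_SigmaI) simp_all
  finally show "card (Om n) = powsum 1 (\<lambda>x. x) n" unfolding powsum_def by simp
qed

text \<open>By \<open>Q'\<close> such a lattice is \<open>D\<close> times one whose normal form ends
  in 1. It is therefore described by \<open>D\<close> and a root \<open>k\<close> modulo
  \<open>j\<close>, where \<open>n\<close> is \<open>j\<close> times the square of
  \<open>D\<close>.\<close>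

lemma card_fixed:
  assumes n: "n > 0"
    and Q: "\<And>j k D. j > 0 \<Longrightarrow> D > 0 \<Longrightarrow> Q (hnf (j * D) (k * D) D) \<longleftrightarrow> j dvd k * k + b * k + c"
    and Q': "\<And>A B D. A > 0 \<Longrightarrow> D > 0 \<Longrightarrow> Q (hnf A B D) \<Longrightarrow> D dvd A \<and> D dvd B"
  shows "card {L \<in> Om n. Q L} = powsum 2 (nroots b c) n"
proof -
  define f where "f = (\<lambda>(d, r). hnf (int (n div d ^ 2) * int d) (int r * int d) (int d))"
  let ?S = "Sigma {d. d ^ 2 dvd n} (\<lambda>d. {r. r < n div d ^ 2 \<and> int (n div d ^ 2) dvd int r * int r + b * int r + c})"
  have pos: "d > 0 \<and> n div d ^ 2 > 0 \<and> n div d ^ 2 * d ^ 2 = n" if "d ^ 2 dvd n" for d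
  proof -
    have "n div d ^ 2 * d ^ 2 = n" using that by simp
    then show ?thesis using n by (cases "d = 0"; cases "n div d ^ 2 = 0") auto
  qed
  have img: "f ` ?S = {L \<in> Om n. Q L}"
  proof (intro equalityI subsetI)
    fix L assume "L \<in> f ` ?S"
    then obtain d r where dr: "d ^ 2 dvd n" "r < n div d ^ 2" "int (n div d ^ 2) dvd int r * int r + b * int r + c"
      "L = hnf (int (n div d ^ 2) * int d) (int r * int d) (int d)" unfolding f_def by auto
    have p: "int d > 0" "int (n div d ^ 2) > 0" using pos[OF dr(1)] by simp_all
    have "int (n div d ^ 2) * int d * int d = int (n div d ^ 2 * d ^ 2)" by (simp only: of_nat_mult of_nat_power power2_eq_square mult.assoc)
    also have "\<dots> = int n" using pos[OF dr(1)] by simp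
    finally have e: "int (n div d ^ 2) * int d * int d = int n" .
    have lt: "int r * int d < int (n div d ^ 2) * int d" using dr(2) p(1) by (intro mult_strict_right_mono) simp_all
    have "L \<in> Om n" unfolding dr(4) by (rule OmI[OF mult_pos_pos[OF p(2,1)] p(1) _ lt e]) simp
    then show "L \<in> {L \<in> Om n. Q L}" using dr(3) Q[OF p(2,1)] unfolding dr(4) by blast
  next
    fix L assume "L \<in> {L \<in> Om n. Q L}"
    then have "L \<in> Om n" and QL: "Q L" by blast+
    from this(1) obtain A B D where L: "L = hnf A B D" "A > 0" "D > 0" "0 \<le> B" "B < A" "A * D = int n" by (rule OmE)
    have "D dvd A" "D dvd B" using Q'[OF L(2,3)] QL L(1) by blast+
    then obtain j k where jk: "A = j * D" "B = k * D" by (metis dvd_def mult.commute)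
    have j: "j > 0" "0 \<le> k" "k < j" using L jk by (simp_all add: zero_less_mult_iff zero_le_mult_iff)
    have d: "j dvd k * k + b * k + c" using Q[OF j(1) L(3)] QL unfolding L(1) jk by blast
    have "int (nat j * nat D ^ 2) = int n" using L(3,6) j unfolding jk by (simp add: power2_eq_square mult.assoc)
    then have e: "nat j * nat D ^ 2 = n" by (rule of_nat_eq_iff[THEN iffD1])
    then have "n div nat D ^ 2 = nat j" using L(3) by (metis nonzero_mult_div_cancel_right nat_0_iff not_le power_not_zero)
    then have q: "int (n div nat D ^ 2) = j" using j by simp
    have "(nat D, nat k) \<in> ?S"
    proof (rule SigmaI)
      show "nat D \<in> {d. d ^ 2 dvd n}" using e by auto
      have "nat k < n div nat D ^ 2" using q j by linarith
      then show "nat k \<in> {r. r < n div nat D ^ 2 \<and> int (n div nat D ^ 2) dvd int r * int r + b * int r + c}"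
        unfolding mem_Collect_eq q using d j by simp
    qed
    moreover have "L = f (nat D, nat k)" unfolding f_def prod.case q using L j jk by simp
    ultimately show "L \<in> f ` ?S" by blast
  qed
  have inj: "inj_on f ?S"
  proof (rule inj_onI)
    fix x y assume x: "x \<in> ?S" and y: "y \<in> ?S" and e: "f x = f y"
    obtain d r where dr: "x = (d, r)" "d ^ 2 dvd n" "r < n div d ^ 2" using x by auto
    obtain d' r' where dr': "y = (d', r')" "d' ^ 2 dvd n" "r' < n div d' ^ 2" using y by auto
    have p: "int d > 0" "int (n div d ^ 2) > 0" "int d' > 0" "int (n div d' ^ 2) > 0" using pos[OF dr(2)] pos[OF dr'(2)] by simp_all
    have lt: "int r * int d < int (n div d ^ 2) * int d" "int r' * int d' < int (n div d' ^ 2) * int d'"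
      using dr(3) dr'(3) p by (simp_all only: mult_strict_right_mono of_nat_less_iff)
    have h: "hnf (int (n div d ^ 2) * int d) (int r * int d) (int d) = hnf (int (n div d' ^ 2) * int d') (int r' * int d') (int d')"
      using e unfolding dr(1) dr'(1) f_def by simp
    have "int (n div d ^ 2) * int d = int (n div d' ^ 2) * int d' \<and> int r * int d = int r' * int d' \<and> int d = int d'"
      by (rule hnf_inj[OF h mult_pos_pos[OF p(2,1)] p(1) mult_pos_pos[OF p(4,3)] p(3) _ lt(1) _ lt(2)]) simp_all
    then have dd: "d = d'" and "int r * int d = int r' * int d'" by (simp, blast)
    from this(2) have rr: "int r * int d' = int r' * int d'" unfolding dd .
    have "int r = int r'" using rr p(3) by (metis less_irrefl mult_right_cancel)
    then show "x = y" unfolding dr(1) dr'(1) using dd by simp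
  qed
  have fin: "finite {d. d ^ 2 dvd n}" by (rule finite_power_dvd) (use n in simp_all)
  have "card {L \<in> Om n. Q L} = card ?S" unfolding img[symmetric] by (rule card_image[OF inj])
  also have "\<dots> = (\<Sum>d | d ^ 2 dvd n. nroots b c (n div d ^ 2))" unfolding nroots_def using fin by (intro card_SigmaI) simp_all
  finally show ?thesis unfolding powsum_def .
qed

lemma lm_hnf:
  assumes "D > 0"
  shows "lm m ` hnf A B D \<subseteq> hnf A B D \<longleftrightarrow> lm m (A, 0) \<in> hnf A B D \<and> lm m (B, D) \<in> hnf A B D"
proof
  have m: "(A, 0) \<in> hnf A B D" "(B, D) \<in> hnf A B D"
    unfolding hnf_member by (intro exI[of _ 0], simp) (intro exI[of _ 1], simp)
  assume "lm m ` hnf A B D \<subseteq> hnf A B D"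
  then show "lm m (A, 0) \<in> hnf A B D \<and> lm m (B, D) \<in> hnf A B D" using m by blast
next
  assume a: "lm m (A, 0) \<in> hnf A B D \<and> lm m (B, D) \<in> hnf A B D"
  obtain i j where ij: "lm m (A, 0) = (i * A + j * B, j * D)" using a unfolding hnf_def by blast
  obtain k l where kl: "lm m (B, D) = (k * A + l * B, l * D)" using a unfolding hnf_def by blast
  show "lm m ` hnf A B D \<subseteq> hnf A B D"
  proof (rule image_subsetI)
    fix z assume "z \<in> hnf A B D"
    then obtain u v where z: "z = (u * A + v * B, v * D)" unfolding hnf_def by blast
    have "lm m z = zmul u (lm m (A, 0)) + zmul v (lm m (B, D))"
      unfolding z lm_def zmul_def by (cases m) (simp add: algebra_simps)
    also have "\<dots> = ((u * i + v * k) * A + (u * j + v * l) * B, (u * j + v * l) * D)"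
      unfolding ij kl zmul_def by (simp add: algebra_simps)
    finally show "lm m z \<in> hnf A B D" unfolding hnf_def by blast
  qed
qed

text \<open>The rotation has finite order, so mapping \<open>L\<close> into itself already means
  mapping it onto itself. With \<open>A = j * D\<close> and \<open>B = k * D\<close>, the image of
  the basis vector \<open>(B, D)\<close> yields the quadratic congruence.\<close>

lemma card_fixed_rotation:
  assumes n: "n > 0"
  shows "card {L \<in> Om n. lm (- 1, - 1, 1, 0) ` L = L} = powsum 2 (nroots 1 1) n"
proof (rule card_fixed[OF n])
  let ?m = "(- 1, - 1, 1, 0) :: int \<times> int \<times> int \<times> int"
  have 3: "lm ?m ` lm ?m ` lm ?m ` L = L" for L
    unfolding image_comp lm_comp mm_def by (simp add: lm_id)
  have eq: "lm ?m ` L = L \<longleftrightarrow> lm ?m ` L \<subseteq> L" for L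
  proof
    assume a: "lm ?m ` L \<subseteq> L"
    then have "lm ?m ` lm ?m ` L \<subseteq> L" by blast
    then have "lm ?m ` lm ?m ` lm ?m ` L \<subseteq> lm ?m ` L" by (rule image_mono)
    then show "lm ?m ` L = L" using a unfolding 3 by blast
  qed simp
  have v: "lm ?m (A, 0) = (- A, A)" "lm ?m (B, D) = (- B - D, B)" for A B D by (simp_all add: lm_def)
  show "D dvd A \<and> D dvd B" if D: "A > 0" "D > 0" and "lm ?m ` hnf A B D = hnf A B D" for A B D
    using that(3) unfolding eq lm_hnf[OF D(2)] v hnf_mem_iff[OF D(2)] by blast
  show "lm ?m ` hnf (j * D) (k * D) D = hnf (j * D) (k * D) D \<longleftrightarrow> j dvd k * k + 1 * k + 1" if D: "j > 0" "D > 0" for j k D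
  proof -
    have e: "- (j * D) - j * D div D * (k * D) = (- 1 - k) * (j * D)" "- (k * D) - D - k * D div D * (k * D) = - ((k * k + 1 * k + 1) * D)"
      using D by (simp_all add: algebra_simps)
    show ?thesis unfolding eq lm_hnf[OF D(2)] v hnf_mem_iff[OF D(2)] e dvd_minus_iff using D(2) by simp
  qed
qed

lemma card_fixed_reflection:
  assumes n: "n > 0"
  shows "card {L \<in> Om n. lm (0, 1, 1, 0) ` L = L} = powsum 2 (nroots 0 (- 1)) n"
proof (rule card_fixed[OF n])
  let ?m = "(0, 1, 1, 0) :: int \<times> int \<times> int \<times> int"
  have 2: "lm ?m ` lm ?m ` L = L" for L
    unfolding image_comp lm_comp mm_def by (simp add: lm_id)
  have eq: "lm ?m ` L = L \<longleftrightarrow> lm ?m ` L \<subseteq> L" for L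
  proof
    assume a: "lm ?m ` L \<subseteq> L"
    then have "lm ?m ` lm ?m ` L \<subseteq> lm ?m ` L" by (rule image_mono)
    then show "lm ?m ` L = L" using a unfolding 2 by blast
  qed simp
  have v: "lm ?m (A, 0) = (0, A)" "lm ?m (B, D) = (D, B)" for A B D by (simp_all add: lm_def)
  show "D dvd A \<and> D dvd B" if D: "A > 0" "D > 0" and "lm ?m ` hnf A B D = hnf A B D" for A B D
    using that(3) unfolding eq lm_hnf[OF D(2)] v hnf_mem_iff[OF D(2)] by blast
  show "lm ?m ` hnf (j * D) (k * D) D = hnf (j * D) (k * D) D \<longleftrightarrow> j dvd k * k + 0 * k + - 1" if D: "j > 0" "D > 0" for j k D
  proof -
    have e: "0 - j * D div D * (k * D) = (- k) * (j * D)" "D - k * D div D * (k * D) = - ((k * k + 0 * k + - 1) * D)"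
      using D by (simp_all add: algebra_simps)
    show ?thesis unfolding eq lm_hnf[OF D(2)] v hnf_mem_iff[OF D(2)] e dvd_minus_iff using D(2) by simp
  qed
qed

lemma orbit_count:
  assumes n: "n > 0" and cl: "\<And>d L. d \<in> sym6 \<Longrightarrow> L \<in> Om n \<Longrightarrow> d ` L \<in> Om n"
  shows "6 * card (Om n // {(L, L'). L \<in> Om n \<and> L' \<in> Om n \<and> (\<exists>d\<in>sym6. L' = d ` L)}) =
    powsum 1 (\<lambda>x. x) n + 2 * powsum 2 (nroots 1 1) n + 3 * powsum 2 (nroots 0 (- 1)) n"
proof -
  define F where "F m = card {L \<in> Om n. lm m ` L = L}" for m
  have inj: "inj_on lm mats"
  proof (rule inj_onI)
    fix m m' assume "lm m = lm m'"
    then have "lm m (1, 0) = lm m' (1, 0)" "lm m (0, 1) = lm m' (0, 1)" by simp_all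
    then show "m = m'" unfolding lm_def by (cases m; cases m') simp
  qed
  have sub: "F s \<le> F t" if st: "s \<in> mats" "t \<in> mats" "mm t (- 1, - 1, 1, 0) = mm (- 1, - 1, 1, 0) s" for s t
  proof -
    let ?r = "lm (- 1, - 1, 1, 0)"
    have r: "?r \<in> sym6" unfolding sym6_def by (rule imageI) (simp add: mats_def)
    have c: "lm t ` ?r ` L = ?r ` lm s ` L" for L unfolding image_comp lm_comp st(3) ..
    have "inj ?r"
    proof (rule injI)
      fix x y assume "?r x = ?r y"
      then show "x = y" unfolding lm_def by (cases x; cases y) simp
    qed
    then have "inj_on ((`) ?r) {L \<in> Om n. lm s ` L = L}" by (meson inj_image_eq_iff inj_onI)
    moreover have "(`) ?r ` {L \<in> Om n. lm s ` L = L} \<subseteq> {L \<in> Om n. lm t ` L = L}"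
    proof (rule image_subsetI)
      fix L assume "L \<in> {L \<in> Om n. lm s ` L = L}"
      then show "?r ` L \<in> {L \<in> Om n. lm t ` L = L}" using cl[OF r] c[of L] by simp
    qed
    moreover have "finite {L \<in> Om n. lm t ` L = L}" using card_Om(2)[OF n] by simp
    ultimately show ?thesis unfolding F_def by (rule card_inj_on_le)
  qed
  \<comment> \<open>Conjugation by the rotation permutes the three reflections cyclically, so the
    chain of inequalities closes up to equalities.\<close>
  have "F (0, 1, 1, 0) \<le> F (1, 0, - 1, - 1)" "F (1, 0, - 1, - 1) \<le> F (- 1, - 1, 0, 1)" "F (- 1, - 1, 0, 1) \<le> F (0, 1, 1, 0)"
    by (rule sub; simp add: mats_def mm_def)+
  then have refl: "F (1, 0, - 1, - 1) = F (0, 1, 1, 0)" "F (- 1, - 1, 0, 1) = F (0, 1, 1, 0)" by simp_all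
  have rot: "F (0, 1, - 1, - 1) = F (- 1, - 1, 1, 0)"
  proof -
    have i: "lm (0, 1, - 1, - 1) ` lm (- 1, - 1, 1, 0) ` L = L" "lm (- 1, - 1, 1, 0) ` lm (0, 1, - 1, - 1) ` L = L" for L
      unfolding image_comp lm_comp mm_def by (simp_all add: lm_id)
    have "lm (0, 1, - 1, - 1) ` L = L \<longleftrightarrow> lm (- 1, - 1, 1, 0) ` L = L" for L using i[of L] by metis
    then show ?thesis unfolding F_def by simp
  qed
  have id: "F (1, 0, 0, 1) = card (Om n)" unfolding F_def lm_id by simp
  have "(\<Sum>d\<in>sym6. card {L \<in> Om n. d ` L = L}) = (\<Sum>m\<in>mats. F m)"
    unfolding sym6_def F_def by (rule sum.reindex[OF inj, unfolded o_def])
  also have "\<dots> = F (1, 0, 0, 1) + F (0, 1, 1, 0) + F (- 1, - 1, 1, 0) + F (0, 1, - 1, - 1) + F (1, 0, - 1, - 1) + F (- 1, - 1, 0, 1)"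
    unfolding mats_def by simp
  also have "\<dots> = card (Om n) + 2 * F (- 1, - 1, 1, 0) + 3 * F (0, 1, 1, 0)" unfolding refl rot id by simp
  finally have s: "(\<Sum>d\<in>sym6. card {L \<in> Om n. d ` L = L}) =
    powsum 1 (\<lambda>x. x) n + 2 * powsum 2 (nroots 1 1) n + 3 * powsum 2 (nroots 0 (- 1)) n"
    unfolding F_def card_fixed_rotation[OF n] card_fixed_reflection[OF n] card_Om(1)[OF n] .
  have c6: "card sym6 = 6" unfolding sym6_def card_image[OF inj] by (simp add: mats_def)
  have fin6: "finite sym6" unfolding sym6_def mats_def by simp
  show ?thesis
    using burnside_image(1)[OF fin6 card_Om(2)[OF n] sym6_comp sym6_inv sym6_id cl] unfolding s c6 by (simp add: mult.commute)
qed

lemma card_quotient_transfer: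
  assumes R: "equiv X R" and S: "equiv Y S" and m: "\<And>x. x \<in> X \<Longrightarrow> m x \<in> Y"
    and iff: "\<And>x x'. x \<in> X \<Longrightarrow> x' \<in> X \<Longrightarrow> (x, x') \<in> R \<longleftrightarrow> (m x, m x') \<in> S"
    and onto: "\<And>y. y \<in> Y \<Longrightarrow> \<exists>x\<in>X. (m x, y) \<in> S"
  shows "card (X // R) = card (Y // S)"
proof -
  define h where "h C = S `` {m (SOME x. x \<in> X \<and> C = R `` {x})}" for C
  have hx: "h (R `` {x}) = S `` {m x}" if x: "x \<in> X" for x
  proof -
    define x' where "x' = (SOME x'. x' \<in> X \<and> R `` {x} = R `` {x'})"
    have x': "x' \<in> X" "R `` {x} = R `` {x'}" using someI[of "\<lambda>x'. x' \<in> X \<and> R `` {x} = R `` {x'}" x] x unfolding x'_def by blast+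
    then have "(x, x') \<in> R" using eq_equiv_class[OF x'(2) R] by blast
    then have "(m x, m x') \<in> S" using iff[OF x x'(1)] by blast
    then have "S `` {m x} = S `` {m x'}" by (rule equiv_class_eq[OF S])
    then show ?thesis unfolding h_def x'_def[symmetric] by simp
  qed
  have "bij_betw h (X // R) (Y // S)"
  proof (rule bij_betw_imageI)
    show "inj_on h (X // R)"
    proof (rule inj_onI)
      fix C C' assume "C \<in> X // R" "C' \<in> X // R" and e: "h C = h C'"
      then obtain x x' where x: "x \<in> X" "C = R `` {x}" "x' \<in> X" "C' = R `` {x'}" by (metis quotientE)
      have "S `` {m x} = S `` {m x'}" using e unfolding x(2,4) hx[OF x(1)] hx[OF x(3)] .
      then have "(m x, m x') \<in> S" using eq_equiv_class[OF _ S m[OF x(3)]] by blast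
      then have "(x, x') \<in> R" using iff[OF x(1,3)] by blast
      then show "C = C'" unfolding x(2,4) by (rule equiv_class_eq[OF R])
    qed
    show "h ` (X // R) = Y // S"
    proof (intro equalityI subsetI)
      fix W assume "W \<in> h ` (X // R)"
      then obtain C where "C \<in> X // R" "W = h C" by blast
      then obtain x where "x \<in> X" "W = h (R `` {x})" by (metis quotientE)
      then show "W \<in> Y // S" using hx m by (metis quotientI)
    next
      fix W assume "W \<in> Y // S"
      then obtain y where y: "y \<in> Y" "W = S `` {y}" by (rule quotientE)
      obtain x where x: "x \<in> X" "(m x, y) \<in> S" using onto[OF y(1)] by blast
      have "S `` {m x} = S `` {y}" by (rule equiv_class_eq[OF S x(2)])
      then have "W = h (R `` {x})" unfolding y(2) hx[OF x(1)] by simp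
      then show "W \<in> h ` (X // R)" using quotientI[OF x(1)] by blast
    qed
  qed
  then show ?thesis by (rule bij_betw_same_card)
qed

lemma trihex_models:
  assumes "trihex G" "verts G \<noteq> {}"
  shows "\<exists>L. lat L \<and> models G L"
proof -
  obtain L \<psi> where m: "lat L" "range \<psi> = verts G" "\<forall>p q. \<psi> p = \<psi> q \<longleftrightarrow> (\<exists>l\<in>L. p - q = l + l)"
    "\<forall>p q. adj G (\<psi> p) (\<psi> q) \<longleftrightarrow> (\<exists>s\<in>{(1, 0), (0, 1), (1, 1)}. \<psi> q = \<psi> (s - p))"
    using trihex_lattice[OF assms] by (elim exE conjE) (rule that)
  have e: "\<psi> p = \<psi> q \<longleftrightarrow> cong2 L p q" for p q unfolding cong2_def by (rule m(3)[rule_format])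
  have a: "adj G (\<psi> p) (\<psi> q) \<longleftrightarrow> (\<exists>s\<in>S3. cong2 L q (s - p))" for p q
    unfolding m(4)[rule_format] S3_def e ..
  have "models G L" unfolding models_def by (rule exI[of _ \<psi>], intro conjI allI m(2) e a)
  then show ?thesis using m(1) by blast
qed

lemma models_Om:
  assumes "lat L" "models G L" "card (verts G) = 4 * n"
  shows "L \<in> Om n"
proof -
  obtain A B D where h: "A > 0" "D > 0" "0 \<le> B" "B < A" "L = hnf A B D" by (rule lat_hnf[OF assms(1)])
  have "card (verts G) = 4 * nat (A * D)" by (rule models_card[OF _ h(1,2)]) (use assms(2) h(5) in simp)
  then have "nat (A * D) = n" using assms(3) by simp
  moreover have "A * D > 0" using h(1,2) by simp
  ultimately have "A * D = int n" by linarith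
  then show ?thesis unfolding h(5) using h(1-4) by (intro OmI)
qed

lemma Om_realised:
  assumes "L \<in> Om n"
  shows "\<exists>G. trihex G \<and> models G L \<and> card (verts G) = 4 * n \<and> lat L"
proof -
  obtain A B D where L: "L = hnf A B D" "A > 0" "D > 0" "0 \<le> B" "B < A" "A * D = int n" using assms by (rule OmE)
  obtain G where G: "trihex G" "models G (hnf A B D)" using trihex_exists[OF L(2,3)] by blast
  have "card (verts G) = 4 * n" using models_card[OF G(2) L(2,3)] L(6) by simp
  then show ?thesis using G hnf_lat[OF L(2,3)] unfolding L(1) by blast
qed

text \<open>The index of the image is read off from the number of vertices: a trihex that realises
  \<open>L\<close> is also modelled by the image lattice.\<close>

lemma Om_closed:
  assumes "d \<in> sym6" "L \<in> Om n"
  shows "d ` L \<in> Om n"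
proof -
  obtain G where G: "models G L" "card (verts G) = 4 * n" "lat L" using Om_realised[OF assms(2)] by blast
  show ?thesis by (rule models_Om[OF sym6_lat[OF assms(1) G(3)] models_image[OF assms(1) G(1)] G(2)])
qed

lemma trihex_gamma_count:
  assumes n: "n > 0"
  shows "6 * trihex_gamma (4 * n) =
    powsum 1 (\<lambda>x. x) n + 2 * powsum 2 (nroots 1 1) n + 3 * powsum 2 (nroots 0 (- 1)) n"
proof -
  let ?X = "trihexes (4 * n)"
  let ?R = "{(G, H). G \<in> ?X \<and> H \<in> ?X \<and> graph_iso G H}"
  let ?S = "{(L, L'). L \<in> Om n \<and> L' \<in> Om n \<and> (\<exists>d\<in>sym6. L' = d ` L)}"
  have fin6: "finite sym6" unfolding sym6_def mats_def by simp
  have S: "equiv (Om n) ?S"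
    by (rule burnside_image(2)[OF fin6 card_Om(2)[OF n] sym6_comp sym6_inv sym6_id Om_closed])
  \<comment> \<open>Any lattice that models \<open>G\<close> will do, since by
    \<open>graph_iso_iff\<close> two of them differ by a symmetry.\<close>
  define m where "m G = (SOME L. lat L \<and> models G L)" for G
  have mG: "lat (m G)" "models G (m G)" "m G \<in> Om n" if "G \<in> ?X" for G
  proof -
    have G: "trihex G" "card (verts G) = 4 * n" using that unfolding trihexes_def by blast+
    then have "verts G \<noteq> {}" using n by auto
    then have "\<exists>L. lat L \<and> models G L" using trihex_models[OF G(1)] by blast
    then have "lat (m G) \<and> models G (m G)" unfolding m_def by (rule someI_ex)
    then show "lat (m G)" "models G (m G)" "m G \<in> Om n" using models_Om[OF _ _ G(2)] by blast+
  qed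
  have iff: "(G, H) \<in> ?R \<longleftrightarrow> (m G, m H) \<in> ?S" if "G \<in> ?X" "H \<in> ?X" for G H
    using graph_iso_iff[OF mG(1)[OF that(1)] mG(1)[OF that(2)] mG(2)[OF that(1)] mG(2)[OF that(2)]] mG(3) that by blast
  have R: "equiv ?X ?R"
  proof (rule equivI)
    show "?R \<subseteq> ?X \<times> ?X" by blast
    show "refl_on ?X ?R"
    proof (rule refl_onI)
      fix G assume G: "G \<in> ?X"
      have "(m G, m G) \<in> ?S" using equiv_class_self[OF S mG(3)[OF G]] by blast
      then show "(G, G) \<in> ?R" unfolding iff[OF G G] .
    qed
    show "sym ?R"
    proof (rule symI)
      fix G H assume a: "(G, H) \<in> ?R"
      then have X: "G \<in> ?X" "H \<in> ?X" by blast+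
      have "(m H, m G) \<in> ?S" using a iff[OF X] S unfolding equiv_def by (meson symE)
      then show "(H, G) \<in> ?R" unfolding iff[OF X(2,1)] .
    qed
    show "trans ?R"
    proof (rule transI)
      fix G H K assume a: "(G, H) \<in> ?R" "(H, K) \<in> ?R"
      then have X: "G \<in> ?X" "H \<in> ?X" "K \<in> ?X" by blast+
      have "(m G, m K) \<in> ?S" using a iff[OF X(1,2)] iff[OF X(2,3)] S unfolding equiv_def by (meson transE)
      then show "(G, K) \<in> ?R" unfolding iff[OF X(1,3)] .
    qed
  qed
  have "card (?X // ?R) = card (Om n // ?S)"
  proof (rule card_quotient_transfer[OF R S mG(3) iff])
    fix L assume L: "L \<in> Om n"
    obtain G where G: "trihex G" "models G L" "card (verts G) = 4 * n" "lat L" using Om_realised[OF L] by blast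
    have X: "G \<in> ?X" using G unfolding trihexes_def by blast
    have "graph_iso G G" using R X unfolding equiv_def refl_on_def by blast
    then have "\<exists>d\<in>sym6. L = d ` m G" using graph_iso_iff[OF mG(1)[OF X] G(4) mG(2)[OF X] G(2)] by blast
    then show "\<exists>G\<in>?X. (m G, L) \<in> ?S" using X L mG(3)[OF X] by blast
  qed
  then show ?thesis unfolding trihex_gamma_def using orbit_count[OF n Om_closed] by simp
qed

section \<open>Multiplicativity and the closed formulas\<close>

definition coprime_mult :: "(nat \<Rightarrow> nat) \<Rightarrow> bool" where
  "coprime_mult F \<longleftrightarrow> F 1 = 1 \<and> (\<forall>m n. coprime m n \<longrightarrow> m > 0 \<longrightarrow> n > 0 \<longrightarrow> F (m * n) = F m * F n)"

lemma coprime_mult_prod: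
  assumes F: "coprime_mult F" and "finite I" and "\<And>i. i \<in> I \<Longrightarrow> f i > 0"
    and "\<And>i j. i \<in> I \<Longrightarrow> j \<in> I \<Longrightarrow> i \<noteq> j \<Longrightarrow> coprime (f i) (f j)"
  shows "F (\<Prod>i\<in>I. f i) = (\<Prod>i\<in>I. F (f i))"
  using assms(2-4)
proof (induction I rule: finite_induct)
  case empty then show ?case using F unfolding coprime_mult_def by simp
next
  case (insert i I)
  have "coprime (f i) (\<Prod>i\<in>I. f i)" by (rule prod_coprime_right) (use insert in auto)
  moreover have "f i > 0" "(\<Prod>i\<in>I. f i) > 0" using insert.prems(1) by (auto intro: prod_pos)
  ultimately have "F (f i * (\<Prod>i\<in>I. f i)) = F (f i) * F (\<Prod>i\<in>I. f i)" using F unfolding coprime_mult_def by blast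
  then show ?case using insert by simp
qed

lemma powsum_coprime_mult:
  assumes "k > 0" "coprime_mult h" shows "coprime_mult (powsum k h)"
proof -
  have "{d :: nat. d ^ k dvd 1} = {1}" using assms(1) by (auto simp: power_eq_1_iff)
  then have "powsum k h 1 = 1" unfolding powsum_def using assms(2) by (simp add: coprime_mult_def)
  then show ?thesis unfolding coprime_mult_def using powsum_mult[OF assms(1)] assms(2)[unfolded coprime_mult_def] by blast
qed

lemma coprime_mult_id: "coprime_mult (\<lambda>x. x)" unfolding coprime_mult_def by simp

lemma coprime_mult_nroots: "coprime_mult (nroots b c)"
  unfolding coprime_mult_def using nroots_1 nroots_mult by simp

lemma coprime_mult_factor:
  fixes p q k l :: "nat \<Rightarrow> nat"
  assumes F: "coprime_mult F"
    and p: "inj_on p {1..x}" "\<forall>i\<in>{1..x}. prime (p i) \<and> p i mod 3 = 1"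
    and q: "inj_on q {1..y}" "\<forall>j\<in>{1..y}. prime (q j) \<and> q j > 2 \<and> q j mod 3 = 2"
  shows "F (2 ^ a * 3 ^ b * (\<Prod>i = 1..x. p i ^ k i) * (\<Prod>j = 1..y. q j ^ l j)) =
    F (2 ^ a) * F (3 ^ b) * (\<Prod>i = 1..x. F (p i ^ k i)) * (\<Prod>j = 1..y. F (q j ^ l j))"
proof -
  have cp: "coprime (r ^ m) (s ^ n)" if "prime r" "prime s" "r \<noteq> s" for r s m n :: nat
    using primes_coprime[OF that] by simp
  have P: "prime (p i)" "p i \<noteq> 2" "p i \<noteq> 3" if "i \<in> {1..x}" for i using p(2)[rule_format, OF that] by auto
  have Q: "prime (q j)" "q j \<noteq> 2" "q j \<noteq> 3" if "j \<in> {1..y}" for j using q(2)[rule_format, OF that] by auto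
  have PQ: "p i \<noteq> q j" if "i \<in> {1..x}" "j \<in> {1..y}" for i j using p(2)[rule_format, OF that(1)] q(2)[rule_format, OF that(2)] by auto
  have pos: "(\<Prod>i = 1..x. p i ^ k i) > 0" "(\<Prod>j = 1..y. q j ^ l j) > 0" "(2 :: nat) ^ a > 0" "(3 :: nat) ^ b > 0"
    using P(1) Q(1) by (auto intro!: prod_pos simp: prime_gt_0_nat)
  have pr3: "prime (3 :: nat)" by simp
  have c1: "coprime ((2 :: nat) ^ a) (3 ^ b)" by (rule cp) simp_all
  have c2: "coprime (2 ^ a * 3 ^ b) (\<Prod>i = 1..x. p i ^ k i)"
  proof (rule prod_coprime_right)
    fix i assume i: "i \<in> {1..x}"
    show "coprime (2 ^ a * 3 ^ b) (p i ^ k i)" unfolding coprime_mult_left_iff using cp[OF two_is_prime_nat P(1)[OF i] P(2)[OF i, symmetric]] cp[OF pr3 P(1)[OF i] P(3)[OF i, symmetric]] by blast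
  qed
  have c3: "coprime (2 ^ a * 3 ^ b * (\<Prod>i = 1..x. p i ^ k i)) (\<Prod>j = 1..y. q j ^ l j)"
  proof (rule prod_coprime_right)
    fix j assume j: "j \<in> {1..y}"
    have "coprime (\<Prod>i = 1..x. p i ^ k i) (q j ^ l j)"
      by (rule prod_coprime_left) (use cp P(1) Q(1) PQ j in blast)
    moreover have "coprime (2 ^ a * 3 ^ b) (q j ^ l j)" unfolding coprime_mult_left_iff using cp[OF two_is_prime_nat Q(1)[OF j] Q(2)[OF j, symmetric]] cp[OF pr3 Q(1)[OF j] Q(3)[OF j, symmetric]] by blast
    ultimately show "coprime (2 ^ a * 3 ^ b * (\<Prod>i = 1..x. p i ^ k i)) (q j ^ l j)" unfolding coprime_mult_left_iff by blast
  qed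
  have m: "F (u * v) = F u * F v" if "coprime u v" "u > 0" "v > 0" for u v
    using F that unfolding coprime_mult_def by blast
  have fp: "F (\<Prod>i = 1..x. p i ^ k i) = (\<Prod>i = 1..x. F (p i ^ k i))"
  proof (rule coprime_mult_prod[OF F])
    show "p i ^ k i > 0" if "i \<in> {1..x}" for i using P(1)[OF that] by (simp add: prime_gt_0_nat)
    show "coprime (p i ^ k i) (p j ^ k j)" if "i \<in> {1..x}" "j \<in> {1..x}" "i \<noteq> j" for i j
      by (rule cp[OF P(1)[OF that(1)] P(1)[OF that(2)]]) (use p(1) that in \<open>simp add: inj_on_eq_iff\<close>)
  qed simp
  have fq: "F (\<Prod>j = 1..y. q j ^ l j) = (\<Prod>j = 1..y. F (q j ^ l j))"
  proof (rule coprime_mult_prod[OF F])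
    show "q i ^ l i > 0" if "i \<in> {1..y}" for i using Q(1)[OF that] by (simp add: prime_gt_0_nat)
    show "coprime (q i ^ l i) (q j ^ l j)" if "i \<in> {1..y}" "j \<in> {1..y}" "i \<noteq> j" for i j
      by (rule cp[OF Q(1)[OF that(1)] Q(1)[OF that(2)]]) (use q(1) that in \<open>simp add: inj_on_eq_iff\<close>)
  qed simp
  show ?thesis
    unfolding m[OF c3 mult_pos_pos[OF mult_pos_pos[OF pos(3,4)] pos(1)] pos(2)] m[OF c2 mult_pos_pos[OF pos(3,4)] pos(1)] m[OF c1 pos(3,4)] fp fq ..
qed

lemma divisor_sum_prime_power:
  assumes "prime r" shows "real (powsum 1 (\<lambda>x. x) (r ^ e)) = (real r ^ (e + 1) - 1) / (real r - 1)"
proof -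
  have "real r \<noteq> 1" using prime_gt_1_nat[OF assms] by simp
  then have "(\<Sum>j<e + 1. real r ^ j) = (real r ^ (e + 1) - 1) / (real r - 1)" by (rule geometric_sum)
  then show ?thesis unfolding powsum_1_prime_power[OF assms] by (simp add: lessThan_Suc_atMost)
qed

lemma prod_parity:
  fixes l :: "nat \<Rightarrow> nat"
  shows "finite J \<Longrightarrow> (\<Prod>j\<in>J. if even (l j) then 1 else 0) = (if \<forall>j\<in>J. even (l j) then 1 else (0 :: nat))"
  by (induction J rule: finite_induct) auto

lemma count_factor:
  fixes p q k l :: "nat \<Rightarrow> nat"
  assumes n: "n = 2 ^ a * 3 ^ b * (\<Prod>i = 1..x. p i ^ k i) * (\<Prod>j = 1..y. q j ^ l j)"
    and p: "inj_on p {1..x}" "\<forall>i\<in>{1..x}. prime (p i) \<and> p i mod 3 = 1"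
    and q: "inj_on q {1..y}" "\<forall>j\<in>{1..y}. prime (q j) \<and> q j > 2 \<and> q j mod 3 = 2"
  shows "real (powsum 1 (\<lambda>x. x) n) = (2 ^ (a + 1) - 1) * ((3 ^ (b + 1) - 1) / 2)
      * (\<Prod>i = 1..x. (real (p i) ^ (k i + 1) - 1) / (real (p i) - 1))
      * (\<Prod>j = 1..y. (real (q j) ^ (l j + 1) - 1) / (real (q j) - 1))"
    and "real (powsum 2 (nroots 1 1) n) = (if even a \<and> (\<forall>j\<in>{1..y}. even (l j)) then 1 else 0) * (\<Prod>i = 1..x. real (k i) + 1)"
    and "real (powsum 2 (nroots 0 (- 1)) n) = (if a = 0 then 1 else 2 * real a - 1) * (real b + 1)
      * (\<Prod>i = 1..x. real (k i) + 1) * (\<Prod>j = 1..y. real (l j) + 1)"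
proof -
  have p2: "prime (p i)" "p i mod 3 = 1" "p i > 2" if "i \<in> {1..x}" for i
  proof -
    show "prime (p i)" "p i mod 3 = 1" using p(2)[rule_format, OF that] by blast+
    then show "p i > 2" using prime_ge_2_nat[of "p i"] by (cases "p i = 2") auto
  qed
  have q2: "prime (q j)" "q j mod 3 = 2" "q j > 2" if "j \<in> {1..y}" for j using q(2)[rule_format, OF that] by blast+
  have pr: "prime (2 :: nat)" "prime (3 :: nat)" by simp_all
  have s: "powsum 1 (\<lambda>x. x) n = powsum 1 (\<lambda>x. x) (2 ^ a) * powsum 1 (\<lambda>x. x) (3 ^ b)
      * (\<Prod>i = 1..x. powsum 1 (\<lambda>x. x) (p i ^ k i)) * (\<Prod>j = 1..y. powsum 1 (\<lambda>x. x) (q j ^ l j))"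
    unfolding n by (rule coprime_mult_factor[OF powsum_coprime_mult[OF _ coprime_mult_id] p q]) simp
  have "real (powsum 1 (\<lambda>x. x) n) = real (powsum 1 (\<lambda>x. x) (2 ^ a)) * real (powsum 1 (\<lambda>x. x) (3 ^ b))
      * (\<Prod>i = 1..x. real (powsum 1 (\<lambda>x. x) (p i ^ k i))) * (\<Prod>j = 1..y. real (powsum 1 (\<lambda>x. x) (q j ^ l j)))"
    unfolding s by simp
  also have "(\<Prod>i = 1..x. real (powsum 1 (\<lambda>x. x) (p i ^ k i))) = (\<Prod>i = 1..x. (real (p i) ^ (k i + 1) - 1) / (real (p i) - 1))"
    by (rule prod.cong[OF refl]) (rule divisor_sum_prime_power[OF p2(1)])
  also have "(\<Prod>j = 1..y. real (powsum 1 (\<lambda>x. x) (q j ^ l j))) = (\<Prod>j = 1..y. (real (q j) ^ (l j + 1) - 1) / (real (q j) - 1))"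
    by (rule prod.cong[OF refl]) (rule divisor_sum_prime_power[OF q2(1)])
  finally show "real (powsum 1 (\<lambda>x. x) n) = (2 ^ (a + 1) - 1) * ((3 ^ (b + 1) - 1) / 2)
      * (\<Prod>i = 1..x. (real (p i) ^ (k i + 1) - 1) / (real (p i) - 1))
      * (\<Prod>j = 1..y. (real (q j) ^ (l j + 1) - 1) / (real (q j) - 1))"
    unfolding divisor_sum_prime_power[OF pr(1)] divisor_sum_prime_power[OF pr(2)] by simp
  have "powsum 2 (nroots 1 1) n = powsum 2 (nroots 1 1) (2 ^ a) * powsum 2 (nroots 1 1) (3 ^ b)
      * (\<Prod>i = 1..x. powsum 2 (nroots 1 1) (p i ^ k i)) * (\<Prod>j = 1..y. powsum 2 (nroots 1 1) (q j ^ l j))"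
    unfolding n by (rule coprime_mult_factor[OF powsum_coprime_mult[OF _ coprime_mult_nroots] p q]) simp
  also have "(\<Prod>i = 1..x. powsum 2 (nroots 1 1) (p i ^ k i)) = (\<Prod>i = 1..x. k i + 1)"
    by (rule prod.cong[OF refl]) (rule rotation_split_prime[OF p2(1,2)])
  also have "(\<Prod>j = 1..y. powsum 2 (nroots 1 1) (q j ^ l j)) = (\<Prod>j\<in>{1..y}. if even (l j) then 1 else 0)"
    by (rule prod.cong[OF refl]) (rule rotation_inert_prime[OF q2(1,2)])
  also have "powsum 2 (nroots 1 1) (2 ^ a) = (if even a then 1 else 0)" by (rule rotation_inert_prime) simp_all
  finally have r: "powsum 2 (nroots 1 1) n = (if even a then 1 else 0) * (\<Prod>i = 1..x. k i + 1) * (if \<forall>j\<in>{1..y}. even (l j) then 1 else 0)"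
    unfolding rotation_3 prod_parity[OF finite_atLeastAtMost] by simp
  show "real (powsum 2 (nroots 1 1) n) = (if even a \<and> (\<forall>j\<in>{1..y}. even (l j)) then 1 else 0) * (\<Prod>i = 1..x. real (k i) + 1)"
    unfolding r by (simp add: add.commute)
  have "powsum 2 (nroots 0 (- 1)) n = powsum 2 (nroots 0 (- 1)) (2 ^ a) * powsum 2 (nroots 0 (- 1)) (3 ^ b)
      * (\<Prod>i = 1..x. powsum 2 (nroots 0 (- 1)) (p i ^ k i)) * (\<Prod>j = 1..y. powsum 2 (nroots 0 (- 1)) (q j ^ l j))"
    unfolding n by (rule coprime_mult_factor[OF powsum_coprime_mult[OF _ coprime_mult_nroots] p q]) simp
  also have "(\<Prod>i = 1..x. powsum 2 (nroots 0 (- 1)) (p i ^ k i)) = (\<Prod>i = 1..x. k i + 1)"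
    by (rule prod.cong[OF refl]) (rule reflection_odd_prime[OF p2(1,3)])
  also have "(\<Prod>j = 1..y. powsum 2 (nroots 0 (- 1)) (q j ^ l j)) = (\<Prod>j = 1..y. l j + 1)"
    by (rule prod.cong[OF refl]) (rule reflection_odd_prime[OF q2(1,3)])
  also have "powsum 2 (nroots 0 (- 1)) (3 ^ b) = b + 1" by (rule reflection_odd_prime) simp_all
  finally have m: "powsum 2 (nroots 0 (- 1)) n = (if a = 0 then 1 else 2 * a - 1) * (b + 1) * (\<Prod>i = 1..x. k i + 1) * (\<Prod>j = 1..y. l j + 1)"
    unfolding reflection_2 .
  have a: "real (if a = 0 then 1 else 2 * a - 1) = (if a = 0 then 1 else 2 * real a - 1)" by (simp add: of_nat_diff)
  show "real (powsum 2 (nroots 0 (- 1)) n) = (if a = 0 then 1 else 2 * real a - 1) * (real b + 1)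
      * (\<Prod>i = 1..x. real (k i) + 1) * (\<Prod>j = 1..y. real (l j) + 1)"
    unfolding m of_nat_mult a by (simp add: add.commute)
qed

theorem theorem19:
  fixes V a b x y :: nat and p q k l :: "nat \<Rightarrow> nat"
  assumes "V > 0" and "4 dvd V"
    and "V div 4 = 2 ^ a * 3 ^ b * (\<Prod>i = 1..x. p i ^ k i) * (\<Prod>j = 1..y. q j ^ l j)"
    and "inj_on p {1..x}" and "\<And>i. i \<in> {1..x} \<Longrightarrow> prime (p i) \<and> p i mod 3 = 1"
    and "inj_on q {1..y}" and "\<And>j. j \<in> {1..y} \<Longrightarrow> prime (q j) \<and> q j > 2 \<and> q j mod 3 = 2"
  shows "(a = 0 \<and> (\<forall>j \<in> {1..y}. even (l j)) \<longrightarrow>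
      real (trihex_gamma V) =
        (3 ^ (b + 1) - 1) / 12
          * (\<Prod>i = 1..x. (real (p i) ^ (k i + 1) - 1) / (real (p i) - 1))
          * (\<Prod>j = 1..y. (real (q j) ^ (l j + 1) - 1) / (real (q j) - 1))
        + 1 / 3 * (\<Prod>i = 1..x. (real (k i) + 1))
        + (real b + 1) / 2 * (\<Prod>i = 1..x. (real (k i) + 1)) * (\<Prod>j = 1..y. (real (l j) + 1)))
    \<and> (a > 0 \<and> even a \<and> (\<forall>j \<in> {1..y}. even (l j)) \<longrightarrow>
      real (trihex_gamma V) =
        (2 ^ (a + 1) - 1) * (3 ^ (b + 1) - 1) / 12
          * (\<Prod>i = 1..x. (real (p i) ^ (k i + 1) - 1) / (real (p i) - 1))
          * (\<Prod>j = 1..y. (real (q j) ^ (l j + 1) - 1) / (real (q j) - 1))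
        + 1 / 3 * (\<Prod>i = 1..x. (real (k i) + 1))
        + (2 * real a - 1) * (real b + 1) / 2
          * (\<Prod>i = 1..x. (real (k i) + 1)) * (\<Prod>j = 1..y. (real (l j) + 1)))
    \<and> (a = 0 \<and> (\<exists>j \<in> {1..y}. odd (l j)) \<longrightarrow>
      real (trihex_gamma V) =
        (3 ^ (b + 1) - 1) / 12
          * (\<Prod>i = 1..x. (real (p i) ^ (k i + 1) - 1) / (real (p i) - 1))
          * (\<Prod>j = 1..y. (real (q j) ^ (l j + 1) - 1) / (real (q j) - 1))
        + (real b + 1) / 2 * (\<Prod>i = 1..x. (real (k i) + 1)) * (\<Prod>j = 1..y. (real (l j) + 1)))
    \<and> (a > 0 \<and> (odd a \<or> (\<exists>j \<in> {1..y}. odd (l j))) \<longrightarrow>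
      real (trihex_gamma V) =
        (2 ^ (a + 1) - 1) * (3 ^ (b + 1) - 1) / 12
          * (\<Prod>i = 1..x. (real (p i) ^ (k i + 1) - 1) / (real (p i) - 1))
          * (\<Prod>j = 1..y. (real (q j) ^ (l j + 1) - 1) / (real (q j) - 1))
        + (2 * real a - 1) * (real b + 1) / 2
          * (\<Prod>i = 1..x. (real (k i) + 1)) * (\<Prod>j = 1..y. (real (l j) + 1)))"
proof -
  define n where "n = V div 4"
  have V: "V = 4 * n" and n: "n > 0" using assms(1,2) unfolding n_def by auto
  define SP where "SP = (\<Prod>i = 1..x. (real (p i) ^ (k i + 1) - 1) / (real (p i) - 1))"
  define SQ where "SQ = (\<Prod>j = 1..y. (real (q j) ^ (l j + 1) - 1) / (real (q j) - 1))"
  define KP where "KP = (\<Prod>i = 1..x. (real (k i) + 1))"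
  define LQ where "LQ = (\<Prod>j = 1..y. (real (l j) + 1))"
  have "\<forall>i\<in>{1..x}. prime (p i) \<and> p i mod 3 = 1" "\<forall>j\<in>{1..y}. prime (q j) \<and> q j > 2 \<and> q j mod 3 = 2"
    using assms(5,7) by blast+
  note c = count_factor[OF assms(3)[folded n_def] assms(4) this(1) assms(6) this(2)]
  have "6 * real (trihex_gamma V) =
    real (powsum 1 (\<lambda>x. x) n) + 2 * real (powsum 2 (nroots 1 1) n) + 3 * real (powsum 2 (nroots 0 (- 1)) n)"
    using arg_cong[OF trihex_gamma_count[OF n], of real] unfolding V by simp
  \<comment> \<open>The divisor sum of \<open>3 ^ b\<close> brings a denominator 2, which together
    with the group order 6 gives 12. The rotation term survives only if \<open>a\<close> and all
    \<open>l j\<close> are even.\<close>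
  then have g: "6 * real (trihex_gamma V) = (2 ^ (a + 1) - 1) * ((3 ^ (b + 1) - 1) / 2) * SP * SQ
      + 2 * ((if even a \<and> (\<forall>j\<in>{1..y}. even (l j)) then 1 else 0) * KP)
      + 3 * ((if a = 0 then 1 else 2 * real a - 1) * (real b + 1) * KP * LQ)"
    unfolding c SP_def SQ_def KP_def LQ_def .
  show ?thesis
    unfolding SP_def[symmetric] SQ_def[symmetric] KP_def[symmetric] LQ_def[symmetric]
  proof (intro conjI impI)
    assume "a = 0 \<and> (\<forall>j\<in>{1..y}. even (l j))"
    then show "real (trihex_gamma V) = (3 ^ (b + 1) - 1) / 12 * SP * SQ + 1 / 3 * KP + (real b + 1) / 2 * KP * LQ"
      using g by (simp add: field_simps)
  next
    assume "a > 0 \<and> even a \<and> (\<forall>j\<in>{1..y}. even (l j))"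
    then show "real (trihex_gamma V) = (2 ^ (a + 1) - 1) * (3 ^ (b + 1) - 1) / 12 * SP * SQ
        + 1 / 3 * KP + (2 * real a - 1) * (real b + 1) / 2 * KP * LQ"
      using g by (simp add: field_simps)
  next
    assume h: "a = 0 \<and> (\<exists>j\<in>{1..y}. odd (l j))"
    then have e: "(even a \<and> (\<forall>j\<in>{1..y}. even (l j))) = False" by blast
    show "real (trihex_gamma V) = (3 ^ (b + 1) - 1) / 12 * SP * SQ + (real b + 1) / 2 * KP * LQ"
      using g h unfolding e by (simp add: field_simps)
  next
    assume h: "a > 0 \<and> (odd a \<or> (\<exists>j\<in>{1..y}. odd (l j)))"
    then have e: "(even a \<and> (\<forall>j\<in>{1..y}. even (l j))) = False" by blast
    show "real (trihex_gamma V) = (2 ^ (a + 1) - 1) * (3 ^ (b + 1) - 1) / 12 * SP * SQ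
        + (2 * real a - 1) * (real b + 1) / 2 * KP * LQ"
      using g h unfolding e by (simp add: field_simps)
  qed
qed

end
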